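(* Let $R=\mathbf k[y_0,y_1,y_2]$, $S=\mathbf k[\partial_0,\partial_1,\partial_2]$, and let $n\ge5$ be odd. (i) The map $F\mapsto F^\perp$ gives a bijection between (nonzero homogeneous) polynomials $F\in S$ of degree $n-3$, up to scalars, and (Artinian graded Gorenstein) ideals $I$ of codimension three in $R$, with socle in degree $n-3$, generated by the Pfaffians of a skew-symmetric matrix of forms of positive degrees in $R$. (ii) This correspondence restricts to a one-to-one correspondence between non-degenerate polynomials $F\in S$ of degree $n-3$, up to scalars, and (Artinian graded Gorenstein) ideals $I$ of codimension three in $R$ generated in degree $\frac{n-1}2$ by the $n$ Pfaffians of an $n\times n$ skew-symmetric matrix of linear forms in $R$.
   Context: $\mathbf k$ is an algebraically closed field of characteristic zero. $R$ acts on $S$ by differentiation: $y^\alpha(\partial^\beta)=\alpha!\binom\beta\alpha\partial^{\beta-\alpha}$ if $\beta\ge\alpha$ and $0$ otherwise, for multi-indices $\alpha,\beta$ (with $\alpha!=\prod\alpha_i!$, $\binom\beta\alpha=\prod\binom{\beta_i}{\alpha_i}$, and $\beta\geq\alpha$ meaning $\beta_i\ge\alpha_i$ for all $i$). For $F\in S$ homogeneous, $F^\perp\subset R$ is the homogeneous ideal of elements $D$ with $D(F)=0$. An ideal $I\subset R$ is called Artinian graded Gorenstein, with socle in degree $k$, if $R/I$ is an Artinian graded Gorenstein ring with (one-dimensional) socle in degree $k$. The Pfaffians of a skew-symmetric matrix of odd order $\nu$ are the $\nu$ Pfaffians of the $(\nu-1)\times(\nu-1)$ matrices obtained by deleting the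 $i$-th row and the $i$-th column, $i=1,\dots,\nu$; in (i) the matrix has odd order and homogeneous entries. A homogeneous $F\in S$ of even degree $k$ is non-degenerate if the elements $\{y^\alpha(F)\}_{|\alpha|=k/2}$ are linearly independent in $S_{k/2}$. *)

theory Defs
  imports
    "HOL-Algebra.Algebraic_Closure_Type"
    "HOL-Library.Poly_Mapping"
    "HOL-Library.Numeral_Type"
    "HOL-Library.Extended_Nat"
    "HOL-Combinatorics.Permutations"
    "Jordan_Normal_Form.Determinant"
begin

section \<open>Polynomials in three variables\<close>

text \<open>
  The variables are indexed by the three-element type \<^typ>\<open>3\<close>, whose elements are 0, 1 and 2.
  The same type serves for the ring \<open>R\<close> in the variables \<open>y\<^sub>i\<close> and for the polynomials \<open>S\<close> in
  the \<open>\<partial>\<^sub>i\<close> on which it acts.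
\<close>

type_synonym monomial3 = "3 \<Rightarrow>\<^sub>0 nat"
type_synonym 'k poly3 = "monomial3 \<Rightarrow>\<^sub>0 'k"

abbreviation ring3 :: "'k::field poly3 ring" where
  "ring3 \<equiv> ring_of_type_algebra"

definition const3 :: "'k::field \<Rightarrow> 'k poly3" where
  "const3 c = Poly_Mapping.single 0 c"

definition var3 :: "3 \<Rightarrow> 'k::field poly3" where
  "var3 i = Poly_Mapping.single (Poly_Mapping.single i 1) 1"

definition mdeg :: "monomial3 \<Rightarrow> nat" where
  "mdeg \<alpha> = (\<Sum>i\<in>UNIV. Poly_Mapping.lookup \<alpha> i)"

text \<open>As usual, the zero polynomial is homogeneous of every degree.\<close>

definition homogeneous :: "nat \<Rightarrow> 'k::field poly3 \<Rightarrow> bool" where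
  "homogeneous d F \<longleftrightarrow> (\<forall>\<alpha>\<in>Poly_Mapping.keys F. mdeg \<alpha> = d)"

section \<open>The action by differentiation\<close>

text \<open>The built-in order on \<^typ>\<open>monomial3\<close> is lexicographic, hence the componentwise order here.\<close>

definition mdvd :: "monomial3 \<Rightarrow> monomial3 \<Rightarrow> bool" where
  "mdvd \<alpha> \<beta> \<longleftrightarrow> (\<forall>i. Poly_Mapping.lookup \<alpha> i \<le> Poly_Mapping.lookup \<beta> i)"

definition mfact :: "monomial3 \<Rightarrow> nat" where
  "mfact \<alpha> = (\<Prod>i\<in>UNIV. fact (Poly_Mapping.lookup \<alpha> i))"

definition mbinom :: "monomial3 \<Rightarrow> monomial3 \<Rightarrow> nat" where
  "mbinom \<beta> \<alpha> = (\<Prod>i\<in>UNIV. Poly_Mapping.lookup \<beta> i choose Poly_Mapping.lookup \<alpha> i)"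

definition monomial_act :: "monomial3 \<Rightarrow> monomial3 \<Rightarrow> 'k::field poly3" where
  "monomial_act \<alpha> \<beta> =
     (if mdvd \<alpha> \<beta> then Poly_Mapping.single (\<beta> - \<alpha>) (of_nat (mfact \<alpha> * mbinom \<beta> \<alpha>)) else 0)"

definition act :: "'k::field poly3 \<Rightarrow> 'k poly3 \<Rightarrow> 'k poly3" where
  "act D F = (\<Sum>\<alpha>\<in>Poly_Mapping.keys D. \<Sum>\<beta>\<in>Poly_Mapping.keys F.
     const3 (Poly_Mapping.lookup D \<alpha> * Poly_Mapping.lookup F \<beta>) * monomial_act \<alpha> \<beta>)"

definition perp :: "'k::field poly3 \<Rightarrow> 'k poly3 set" where
  "perp F = {D. act D F = 0}"

text \<open>
  Linear independence is that of the family indexed by \<open>\<alpha>\<close>, not merely of its set of values.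
\<close>

definition nondegenerate :: "nat \<Rightarrow> 'k::field poly3 \<Rightarrow> bool" where
  "nondegenerate k F \<longleftrightarrow> even k \<and> homogeneous k F \<and>
     (\<forall>c :: monomial3 \<Rightarrow> 'k.
        (\<Sum>\<alpha> | mdeg \<alpha> = k div 2. const3 (c \<alpha>) * act (Poly_Mapping.single \<alpha> 1) F) = 0 \<longrightarrow>
        (\<forall>\<alpha>. mdeg \<alpha> = k div 2 \<longrightarrow> c \<alpha> = 0))"

text \<open>The index set of this sum is finite, so the sum is a genuine one.\<close>

lemma finite_mdeg: "finite {\<alpha>. mdeg \<alpha> = d}"
proof -
  have "Poly_Mapping.lookup ` {\<alpha>. mdeg \<alpha> = d} \<subseteq> Pi\<^sub>E UNIV (\<lambda>_. {..d})"
    by (auto simp: mdeg_def intro: member_le_sum)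
  then have "finite (Poly_Mapping.lookup ` {\<alpha>. mdeg \<alpha> = d})"
    by (rule finite_subset) (auto intro: finite_PiE)
  then show ?thesis
    by (rule finite_imageD) (auto simp: inj_on_def poly_mapping_eqI)
qed

section \<open>Polynomials up to scalars\<close>

definition forms :: "nat \<Rightarrow> 'k::field poly3 set" where
  "forms d = {F. F \<noteq> 0 \<and> homogeneous d F}"

definition nondegenerate_forms :: "nat \<Rightarrow> 'k::field poly3 set" where
  "nondegenerate_forms d = {F \<in> forms d. nondegenerate d F}"

definition proportional :: "('k::field poly3 \<times> 'k poly3) set" where
  "proportional = {(F, G). \<exists>c. c \<noteq> 0 \<and> G = const3 c * F}"

text \<open>
  The map on classes up to scalars induced by \<^const>\<open>perp\<close>. It is meaningful because \<^const>\<open>perp\<close>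
  is constant on each class; that fact is part of the main statement.
\<close>

definition perp_class :: "'k::field poly3 set \<Rightarrow> 'k poly3 set" where
  "perp_class C = the_elem (perp ` C)"

section \<open>Codimension\<close>

definition prime_height :: "('a, 'b) ring_scheme \<Rightarrow> 'a set \<Rightarrow> enat" where
  "prime_height A P = Sup {enat l | l. \<exists>C :: nat \<Rightarrow> 'a set.
     (\<forall>i\<le>l. primeideal (C i) A) \<and> (\<forall>i<l. C i \<subset> C (Suc i)) \<and> C l = P}"

definition codimension :: "('a, 'b) ring_scheme \<Rightarrow> 'a set \<Rightarrow> enat" where
  "codimension A I = Inf {prime_height A P | P. primeideal P A \<and> I \<subseteq> P}"

section \<open>Artinian graded Gorenstein ideals\<close>

definition artinian_ring :: "('a, 'b) ring_scheme \<Rightarrow> bool" where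
  "artinian_ring A \<longleftrightarrow> ring A \<and> wf {(J, K). ideal J A \<and> ideal K A \<and> J \<subset> K}"

definition homogeneous_ideal :: "'k::field poly3 set \<Rightarrow> bool" where
  "homogeneous_ideal I \<longleftrightarrow> ideal I ring3 \<and> I = Idl\<^bsub>ring3\<^esub> {D \<in> I. \<exists>d. homogeneous d D}"

text \<open>
  For homogeneous \<open>I\<close> with Artinian quotient, the image of the ideal of the variables is the unique
  maximal ideal of \<open>R/I\<close>. The socle is its annihilator.
\<close>

definition socle :: "'k::field poly3 set \<Rightarrow> 'k poly3 set set" where
  "socle I = {x \<in> carrier (ring3 Quot I).
     \<forall>D \<in> Idl\<^bsub>ring3\<^esub> (range var3). (I +>\<^bsub>ring3\<^esub> D) \<otimes>\<^bsub>ring3 Quot I\<^esub> x = \<zero>\<^bsub>ring3 Quot I\<^esub>}"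

text \<open>
  An Artinian graded algebra is Gorenstein iff its socle is one-dimensional over the field. The
  socle has degree \<open>k\<close> if it is spanned by the class of a form of degree \<open>k\<close>.
\<close>

definition artinian_graded_gorenstein :: "nat \<Rightarrow> 'k::field poly3 set \<Rightarrow> bool" where
  "artinian_graded_gorenstein k I \<longleftrightarrow> homogeneous_ideal I \<and> artinian_ring (ring3 Quot I) \<and>
     (\<exists>s. homogeneous k s \<and> s \<notin> I \<and> socle I = {I +>\<^bsub>ring3\<^esub> (const3 c * s) | c. True})"

section \<open>Pfaffians\<close>

text \<open>
  The sum runs over the perfect matchings of \<open>{..<2m}\<close>. Each is represented by the unique
  permutation \<open>\<sigma>\<close> listing its pairs \<open>\<sigma>(2i) < \<sigma>(2i+1)\<close> in order of increasing first entry.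
\<close>

definition matching_perms :: "nat \<Rightarrow> (nat \<Rightarrow> nat) set" where
  "matching_perms m = {\<sigma>. \<sigma> permutes {..<2 * m} \<and>
     (\<forall>i<m. \<sigma> (2 * i) < \<sigma> (2 * i + 1)) \<and> (\<forall>j<m. \<forall>i<j. \<sigma> (2 * i) < \<sigma> (2 * j))}"

definition pfaffian :: "'a::comm_ring_1 mat \<Rightarrow> 'a" where
  "pfaffian A = (\<Sum>\<sigma>\<in>matching_perms (dim_row A div 2).
     of_int (sign \<sigma>) * (\<Prod>i<dim_row A div 2. A $$ (\<sigma> (2 * i), \<sigma> (2 * i + 1))))"

definition skew_symmetric :: "nat \<Rightarrow> 'a::comm_ring_1 mat \<Rightarrow> bool" where
  "skew_symmetric n M \<longleftrightarrow> M \<in> carrier_mat n n \<and> transpose_mat M = - M"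

definition sub_pfaffian :: "'a::comm_ring_1 mat \<Rightarrow> nat \<Rightarrow> 'a" where
  "sub_pfaffian M i = pfaffian (mat_delete M i i)"

definition pfaffian_ideal :: "'k::field poly3 mat \<Rightarrow> 'k poly3 set" where
  "pfaffian_ideal M = Idl\<^bsub>ring3\<^esub> (sub_pfaffian M ` {..<dim_row M})"

definition pfaffian_gorenstein_ideals :: "nat \<Rightarrow> 'k::field poly3 set set" where
  "pfaffian_gorenstein_ideals k = {I. artinian_graded_gorenstein k I \<and> codimension ring3 I = 3 \<and>
     (\<exists>\<nu> M. odd \<nu> \<and> skew_symmetric \<nu> M \<and>
        (\<forall>i<\<nu>. \<forall>j<\<nu>. \<exists>d>0. homogeneous d (M $$ (i, j))) \<and> I = pfaffian_ideal M)}"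

definition linear_pfaffian_gorenstein_ideals :: "nat \<Rightarrow> 'k::field poly3 set set" where
  "linear_pfaffian_gorenstein_ideals n = {I. (\<exists>k. artinian_graded_gorenstein k I) \<and>
     codimension ring3 I = 3 \<and>
     (\<exists>M. skew_symmetric n M \<and> (\<forall>i<n. \<forall>j<n. homogeneous 1 (M $$ (i, j))) \<and>
        (\<forall>i<n. homogeneous ((n - 1) div 2) (sub_pfaffian M i)) \<and> I = pfaffian_ideal M)}"

end

(*
  The pairing <F, D> = (D F)(0) identifies forms of degree k with graded functionals on R concentrated
  in degree k. The ideal of D with <F, ED> = 0 for all E is Artinian Gorenstein with socle in degree k,
  and conversely such an ideal is recovered from the functional reading off the socle coefficient.

  For the Pfaffian presentation, take minimal generators f of I and lift the Koszul complex along the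
  minimal free resolution; self-duality gives a skew-symmetric matrix A with kernel R f whose image is
  the syzygy module of f. Then adj A = c f f^T, and exactness forces c to divide a power of every
  generator, so c is a nonzero constant; since the determinant of a skew-symmetric matrix is the square of
  its Pfaffian up to sign, the Pfaffians of A are the f_i up to scalars, and comparing degrees gives
  (n - 1)(k + 3) = 2 sum deg f_i. Nondegeneracy of F means that I has no forms of degree k/2; with the
  degree identity this forces all generators into degree k/2 + 1 and all entries of A to be linear.
  Conversely the Pfaffians of a linear A generate its kernel and A is exact there, which determines the
  socle degree.
*)
theory Submission
  imports Defs "HOL-Library.Function_Algebras"
begin

section \<open>Polynomials in three variables\<close>

text \<open>The one-dimensional socle has to become a statement about the last syzygies. Elements
  are therefore chased through the Koszul complex of the variables, written with dot and cross
  products; this is a computation of Tor_3 by hand and shows that the kernel of the syzygy matrix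
  \<open>Phi\<close> is generated by one vector \<open>g\<close>, of degree k + 3. Duality then
  comes from alternating lifts of the Koszul syzygies of \<open>f\<close>, which yield a matrix
  \<open>T\<close> with T g = (N - n + 1) f, where N counts the syzygies. The scalar must be shown
  nonzero before N = n is known; N = n follows afterwards from two traces modulo the maximal ideal.
  Characteristic zero enters through this scalar, the traces, the factorials in the pairing and the
  number of permutations listing a matching. Algebraic closedness enters through square roots, which
  turn proportional squares into proportional Pfaffians. Cramer's rule is applied to A + e_i e_i^T,
  whose determinant is the i-th diagonal entry of the adjugate when det A = 0. It shows both that c
  divides powers of the generators and that the complex of a linear \<open>A\<close> is
  exact.\<close>

lemma three_distinct: "(0::3) \<noteq> 1" "(0::3) \<noteq> 2" "(1::3) \<noteq> 2"
  by simp_all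

lemma UNIV_three: "(UNIV :: 3 set) = {0, 1, 2}"
proof -
  have "card {0, 1, 2::3} = 3"
    using three_distinct by (simp only: card_insert_if finite.intros insert_iff empty_iff) simp
  moreover have "card (UNIV :: 3 set) = 3" by simp
  ultimately show ?thesis
    by (intro card_subset_eq[symmetric, OF finite subset_UNIV]) (simp only:)
qed

lemma sum_three: "(\<Sum>i\<in>UNIV. f i) = f 0 + f 1 + f (2 :: 3)"
  unfolding UNIV_three using three_distinct by (subst sum.insert; simp add: add.assoc)

lemma all_three: "(\<forall>i. P i) \<longleftrightarrow> P 0 \<and> P 1 \<and> P (2 :: 3)"
proof -
  have "(\<forall>i. P i) \<longleftrightarrow> (\<forall>i\<in>UNIV. P i)" by simp
  then show ?thesis unfolding UNIV_three by simp
qed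

abbreviation c0 :: "'k::field poly3 \<Rightarrow> 'k" where
  "c0 p \<equiv> Poly_Mapping.lookup p 0"

lemma mdeg_add: "mdeg (\<alpha> + \<beta>) = mdeg \<alpha> + mdeg \<beta>"
  by (simp add: mdeg_def lookup_add sum.distrib)

lemma mdeg_zero [simp]: "mdeg 0 = 0"
  by (simp add: mdeg_def)

lemma mdeg_eq_0_iff [simp]: "mdeg \<alpha> = 0 \<longleftrightarrow> \<alpha> = 0"
  by (auto simp: mdeg_def intro: poly_mapping_eqI)

lemma mdeg_single [simp]: "mdeg (Poly_Mapping.single i n) = n"
  by (simp add: mdeg_def lookup_single when_def)

lemma poly3_sum_single:
  "p = (\<Sum>\<alpha>\<in>Poly_Mapping.keys p. Poly_Mapping.single \<alpha> (Poly_Mapping.lookup p \<alpha>))"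
  by (rule poly_mapping_eqI)
    (auto simp: lookup_sum lookup_single when_def sum.delta' in_keys_iff if_distrib cong: if_cong)

lemma poly3_induct [case_names zero add]:
  assumes "P 0" "\<And>\<alpha> c p. c \<noteq> 0 \<Longrightarrow> P p \<Longrightarrow> P (Poly_Mapping.single \<alpha> c + p)"
  shows "P (p :: 'k::field poly3)"
proof -
  have "P (\<Sum>\<alpha>\<in>A. Poly_Mapping.single \<alpha> (Poly_Mapping.lookup p \<alpha>))"
    if "finite A" "A \<subseteq> Poly_Mapping.keys p" for A
    using that by (induction A) (auto simp: assms in_keys_iff)
  from this[of "Poly_Mapping.keys p"] show ?thesis
    using poly3_sum_single[of p] by simp
qed

lemma lookup_single_mult:
  "Poly_Mapping.lookup (Poly_Mapping.single \<beta> c * p) \<gamma> =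
    (if mdvd \<beta> \<gamma> then c * Poly_Mapping.lookup p (\<gamma> - \<beta>) else (0 :: 'k::field))"
proof -
  have "Poly_Mapping.lookup (Poly_Mapping.single \<beta> c * p) \<gamma> =
      (\<Sum>l. (c when \<beta> = l) * (\<Sum>q. Poly_Mapping.lookup p q when \<gamma> = l + q))"
    by (simp add: lookup_mult lookup_single)
  also have "\<dots> = (\<Sum>l. (c * (\<Sum>q. Poly_Mapping.lookup p q when \<gamma> = \<beta> + q)) when \<beta> = l)"
    by (rule arg_cong[where f = Sum_any]) (auto simp: fun_eq_iff when_def)
  also have "\<dots> = c * (\<Sum>q. Poly_Mapping.lookup p q when \<gamma> = \<beta> + q)"
    by simp
  also have "(\<Sum>q. Poly_Mapping.lookup p q when \<gamma> = \<beta> + q) =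
      (if mdvd \<beta> \<gamma> then Poly_Mapping.lookup p (\<gamma> - \<beta>) else 0)"
  proof (cases "mdvd \<beta> \<gamma>")
    case True
    then have "\<gamma> = \<beta> + q \<longleftrightarrow> q = \<gamma> - \<beta>" for q
      by (auto simp: poly_mapping_eq_iff fun_eq_iff lookup_add lookup_minus mdvd_def)
    then show ?thesis using True by simp
  next
    case False
    then have "\<gamma> \<noteq> \<beta> + q" for q by (auto simp: mdvd_def lookup_add)
    then show ?thesis using False by simp
  qed
  finally show ?thesis by simp
qed

lemma mdvd_zero [simp]: "mdvd 0 \<alpha>" by (simp add: mdvd_def)

lemma mdvd_zero_iff [simp]: "mdvd \<alpha> 0 \<longleftrightarrow> \<alpha> = 0"
  by (auto simp: mdvd_def intro: poly_mapping_eqI)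

lemma lookup_const3_mult [simp]: "Poly_Mapping.lookup (const3 c * p) \<gamma> = c * Poly_Mapping.lookup p \<gamma>"
  by (simp add: const3_def lookup_single_mult)

lemma c0_const3 [simp]: "c0 (const3 c) = c"
  by (simp add: const3_def)

lemma c0_var3 [simp]: "c0 (var3 i) = 0"
  by (auto simp: var3_def lookup_single when_def poly_mapping_eq_iff fun_eq_iff)

lemma c0_mult [simp]: "c0 (p * q) = c0 p * c0 (q :: 'k::field poly3)"
  by (induction p rule: poly3_induct)
    (auto simp: distrib_right lookup_add lookup_single_mult lookup_single when_def)


lemma const3_add: "const3 (a + b) = const3 a + const3 b" by (simp add: const3_def single_add)
lemma const3_diff: "const3 (a - b) = const3 a - const3 b" by (simp add: const3_def single_diff)
lemma const3_uminus: "const3 (- a) = - const3 a" by (simp add: const3_def single_uminus)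
lemma const3_mult: "const3 (a * b) = const3 a * const3 b" by (simp add: const3_def mult_single)
lemma const3_0 [simp]: "const3 0 = 0" by (simp add: const3_def)
lemma const3_1 [simp]: "const3 1 = 1" by (simp add: const3_def)
lemma const3_eq_0_iff [simp]: "const3 c = 0 \<longleftrightarrow> c = 0"
  by (metis c0_const3 const3_0 lookup_zero)

lemma single_eq_const3_mult: "Poly_Mapping.single \<alpha> c = const3 c * Poly_Mapping.single \<alpha> 1"
  by (simp add: const3_def mult_single)

lemma var3_nonzero [simp]: "var3 i \<noteq> (0 :: 'k::field poly3)"
  by (metis keys_single keys_zero var3_def insert_not_empty zero_neq_one)


text \<open>\<open>mfilter P p\<close> keeps the terms of \<open>p\<close> whose monomial satisfies \<open>P\<close>. Homogeneous components and
  the substitutions \<open>y\<^sub>i = 0\<close> are both of this form.\<close>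

definition mfilter :: "(monomial3 \<Rightarrow> bool) \<Rightarrow> 'k::field poly3 \<Rightarrow> 'k poly3" where
  "mfilter P p = Poly_Mapping.mapp (\<lambda>\<alpha> c. if P \<alpha> then c else 0) p"

lemma lookup_mfilter [simp]:
  "Poly_Mapping.lookup (mfilter P p) \<alpha> = (if P \<alpha> then Poly_Mapping.lookup p \<alpha> else 0)"
  by (auto simp: mfilter_def lookup_mapp in_keys_iff when_def)

lemma keys_mfilter: "Poly_Mapping.keys (mfilter P p) = {\<alpha> \<in> Poly_Mapping.keys p. P \<alpha>}"
  by (auto simp: in_keys_iff split: if_splits)

lemma mfilter_0 [simp]: "mfilter P 0 = 0"
  by (rule poly_mapping_eqI) simp

lemma mfilter_add: "mfilter P (p + q) = mfilter P p + mfilter P q"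
  by (rule poly_mapping_eqI) (simp add: lookup_add)

lemma mfilter_diff: "mfilter P (p - q) = mfilter P p - mfilter P q"
  by (rule poly_mapping_eqI) (simp add: lookup_minus)


lemma mfilter_sum: "mfilter P (\<Sum>i\<in>A. f i) = (\<Sum>i\<in>A. mfilter P (f i))"
  by (rule poly_mapping_eqI) (simp add: lookup_sum)

lemma mfilter_single:
  "mfilter P (Poly_Mapping.single \<alpha> c) = (if P \<alpha> then Poly_Mapping.single \<alpha> c else 0)"
  by (rule poly_mapping_eqI) (auto simp: lookup_single when_def)

lemma mfilter_split: "p = mfilter P p + mfilter (\<lambda>\<alpha>. \<not> P \<alpha>) p"
  by (rule poly_mapping_eqI) (simp add: lookup_add)

text \<open>Moves a condition on the product to one factor. For homogeneous \<open>q\<close> a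
  degree condition becomes a shifted degree condition; if no term can survive, \<open>P'\<close> is
  constantly false.\<close>

lemma mfilter_mult:
  assumes "\<And>\<alpha> \<beta>. \<beta> \<in> Poly_Mapping.keys q \<Longrightarrow> P (\<alpha> + \<beta>) \<longleftrightarrow> P' \<alpha>"
  shows "mfilter P (p * q) = mfilter P' p * q"
proof -
  have *: "mfilter P (Poly_Mapping.single \<alpha> c * (\<Sum>\<beta>\<in>A. Poly_Mapping.single \<beta> (Poly_Mapping.lookup q \<beta>)))
      = mfilter P' (Poly_Mapping.single \<alpha> c) * (\<Sum>\<beta>\<in>A. Poly_Mapping.single \<beta> (Poly_Mapping.lookup q \<beta>))"
    if "A \<subseteq> Poly_Mapping.keys q" for \<alpha> c A
    using that
  proof (induction A rule: infinite_finite_induct)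
    case (insert \<beta> A)
    then show ?case using assms[of \<beta> \<alpha>]
      by (auto simp: distrib_left mfilter_add mult_single mfilter_single)
  qed auto
  have **: "mfilter P (Poly_Mapping.single \<alpha> c * q) = mfilter P' (Poly_Mapping.single \<alpha> c) * q" for \<alpha> c
    using *[of "Poly_Mapping.keys q" \<alpha> c] poly3_sum_single[of q] by simp
  show ?thesis
    by (induction p rule: poly3_induct) (auto simp: mfilter_add distrib_right **)
qed

lemma mfilter_False [simp]: "mfilter (\<lambda>_. False) p = 0"
  by (rule poly_mapping_eqI) simp

text \<open>The hypothesis says that the surviving exponents form a submonoid whose complement
  absorbs addition. Dropping the other terms is then a substitution of zeros for variables, hence
  multiplicative.\<close>

lemma mfilter_hom:
  assumes "\<And>\<alpha> \<beta>. P (\<alpha> + \<beta>) \<longleftrightarrow> P \<alpha> \<and> P \<beta>"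
  shows "mfilter P (p * q) = mfilter P p * mfilter P q"
proof -
  have "mfilter P (p * q) = mfilter P (p * mfilter P q) + mfilter P (p * mfilter (\<lambda>\<alpha>. \<not> P \<alpha>) q)"
    by (metis mfilter_split mfilter_add distrib_left)
  also have "mfilter P (p * mfilter P q) = mfilter P p * mfilter P q"
    by (rule mfilter_mult) (auto simp: keys_mfilter assms)
  also have "mfilter P (p * mfilter (\<lambda>\<alpha>. \<not> P \<alpha>) q) = mfilter (\<lambda>_. False) p * mfilter (\<lambda>\<alpha>. \<not> P \<alpha>) q"
    by (rule mfilter_mult) (auto simp: keys_mfilter assms)
  finally show ?thesis by simp
qed

text \<open>Turns divisibility by a variable into vanishing under a ring homomorphism. All
  coprimality arguments for variables rest on this criterion instead of unique
  factorization.\<close>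

lemma var3_dvd_iff:
  "var3 i dvd p \<longleftrightarrow> mfilter (\<lambda>\<alpha>. Poly_Mapping.lookup \<alpha> i = 0) p = (0 :: 'k::field poly3)"
proof
  assume "var3 i dvd p"
  then show "mfilter (\<lambda>\<alpha>. Poly_Mapping.lookup \<alpha> i = 0) p = 0"
    by (auto simp: dvd_def mfilter_hom lookup_add var3_def mfilter_single)
next
  assume *: "mfilter (\<lambda>\<alpha>. Poly_Mapping.lookup \<alpha> i = 0) p = 0"
  have "var3 i dvd Poly_Mapping.single \<alpha> (Poly_Mapping.lookup p \<alpha>)" if "\<alpha> \<in> Poly_Mapping.keys p" for \<alpha>
  proof -
    have "Poly_Mapping.lookup \<alpha> i \<noteq> 0"
      using that * by (metis (mono_tags, lifting) in_keys_iff lookup_mfilter lookup_zero)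
    then have "Poly_Mapping.single i 1 + (\<alpha> - Poly_Mapping.single i 1) = \<alpha>"
      by (auto simp: poly_mapping_eq_iff fun_eq_iff lookup_add lookup_minus lookup_single when_def)
    then have "Poly_Mapping.single \<alpha> (Poly_Mapping.lookup p \<alpha>) =
        var3 i * Poly_Mapping.single (\<alpha> - Poly_Mapping.single i 1) (Poly_Mapping.lookup p \<alpha>)"
      by (simp add: var3_def mult_single)
    then show ?thesis by simp
  qed
  then show "var3 i dvd p"
    by (subst poly3_sum_single) (rule dvd_sum)
qed

lemma mfilter_var3_mult:
  assumes "i \<noteq> j"
  shows "mfilter (\<lambda>\<alpha>. Poly_Mapping.lookup \<alpha> i = 0) (var3 j * p) =
    var3 j * mfilter (\<lambda>\<alpha>. Poly_Mapping.lookup \<alpha> i = 0) (p :: 'k::field poly3)"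
  using assms by (subst mfilter_hom) (auto simp: lookup_add var3_def mfilter_single lookup_single)

lemma var3_rem:
  obtains q where "p = mfilter (\<lambda>\<alpha>. Poly_Mapping.lookup \<alpha> i = 0) p + var3 i * (q :: 'k::field poly3)"
proof -
  let ?P = "\<lambda>\<alpha> :: monomial3. Poly_Mapping.lookup \<alpha> i = 0"
  have "var3 i dvd mfilter (\<lambda>\<alpha>. \<not> ?P \<alpha>) p"
    unfolding var3_dvd_iff by (rule poly_mapping_eqI) simp
  with mfilter_split[of p ?P] show ?thesis using that by (auto simp: dvd_def)
qed

lemma var3_dvd_var3_mult:
  assumes "i \<noteq> j" "var3 i dvd var3 j * (p :: 'k::field poly3)"
  shows "var3 i dvd p"
  using assms by (simp add: var3_dvd_iff mfilter_var3_mult)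

text \<open>Distinct variables have coprime powers: factors of \<open>var3 i\<close> are split off
  one at a time, and then the factors \<open>var3 j\<close> are cancelled one at a time.\<close>

lemma var3_power_dvd_var3_mult:
  assumes "i \<noteq> j" "var3 i ^ m dvd var3 j ^ l * (p :: 'k::field poly3)"
  shows "var3 i ^ m dvd p"
proof -
  have 1: "var3 i ^ m dvd q" if "var3 i ^ m dvd var3 j * q" for m and q :: "'k poly3"
    using that
  proof (induction m arbitrary: q)
    case (Suc m)
    have "var3 i dvd var3 j * q" using Suc.prems by (auto intro: dvd_mult_left)
    with assms(1) have "var3 i dvd q" by (rule var3_dvd_var3_mult)
    then obtain r where r: "q = var3 i * r" by (auto simp: dvd_def)
    have "var3 i * var3 i ^ m dvd var3 i * (var3 j * r)"
      using Suc.prems by (simp only: r power_Suc mult.left_commute)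
    then have "var3 i ^ m dvd var3 j * r" by (simp only: dvd_mult_cancel_left) simp
    then have "var3 i ^ m dvd r" by (rule Suc.IH)
    then show ?case unfolding r power_Suc by (rule mult_dvd_mono[OF dvd_refl])
  qed simp
  show ?thesis using assms(2)
  proof (induction l)
    case (Suc l)
    have "var3 i ^ m dvd var3 j * (var3 j ^ l * p)" using Suc.prems by (simp only: power_Suc mult.assoc)
    then show ?case by (rule Suc.IH[OF 1])
  qed simp
qed

text \<open>The maximal ideal at the origin is generated by the variables: each variable is set to
  zero in turn, and the three remainders are collected.\<close>

lemma c0_eq_0_iff:
  "c0 p = 0 \<longleftrightarrow> (\<exists>q. p = (\<Sum>a\<in>UNIV. var3 a * (q a :: 'k::field poly3)))"
proof
  assume "c0 p = 0"
  define p0 where "p0 = mfilter (\<lambda>\<alpha>. Poly_Mapping.lookup \<alpha> 0 = 0) p"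
  define p1 where "p1 = mfilter (\<lambda>\<alpha>. Poly_Mapping.lookup \<alpha> 1 = 0) p0"
  obtain q0 where q0: "p = p0 + var3 0 * q0" by (rule var3_rem[of p 0, folded p0_def])
  obtain q1 where q1: "p0 = p1 + var3 1 * q1" by (rule var3_rem[of p0 1, folded p1_def])
  have "mfilter (\<lambda>\<alpha>. Poly_Mapping.lookup \<alpha> 2 = 0) p1 = 0"
  proof (rule poly_mapping_eqI)
    fix \<alpha> :: monomial3
    have "\<alpha> = 0" if "Poly_Mapping.lookup \<alpha> 0 = 0" "Poly_Mapping.lookup \<alpha> 1 = 0" "Poly_Mapping.lookup \<alpha> 2 = 0"
      using that all_three[of "\<lambda>i. Poly_Mapping.lookup \<alpha> i = 0"] by (auto intro: poly_mapping_eqI)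
    then show "Poly_Mapping.lookup (mfilter (\<lambda>\<alpha>. Poly_Mapping.lookup \<alpha> 2 = 0) p1) \<alpha> = Poly_Mapping.lookup 0 \<alpha>"
      using \<open>c0 p = 0\<close> by (auto simp: p0_def p1_def)
  qed
  then obtain q2 where q2: "p1 = var3 2 * q2" by (auto simp: var3_dvd_iff[symmetric] dvd_def)
  define q where "q a = (if a = 0 then q0 else if a = 1 then q1 else q2)" for a :: 3
  have "q 0 = q0" "q 1 = q1" "q 2 = q2" by (simp_all add: q_def)
  then have "p = (\<Sum>a\<in>UNIV. var3 a * q a)"
    unfolding sum_three by (simp add: q0 q1 q2 add_ac)
  then show "\<exists>q. p = (\<Sum>a\<in>UNIV. var3 a * q a)" by (rule exI[where x = q])
next
  assume "\<exists>q. p = (\<Sum>a\<in>UNIV. var3 a * q a)"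
  then obtain q where "p = (\<Sum>a\<in>UNIV. var3 a * q a)" by (rule exE)
  then have "c0 p = (\<Sum>a\<in>UNIV. c0 (var3 a * q a))" by (simp only: lookup_sum)
  then show "c0 p = 0" by (simp only: c0_mult c0_var3 mult_zero_left sum.neutral_const)
qed

subsection \<open>Exactness of the Koszul complex\<close>

text \<open>Exactness at the place where the Koszul map is the cross product with the variables:
  coprimality of two variables yields the factor in one coordinate, and cancellation transports it
  to the others.\<close>

lemma koszul_parallel:
  fixes v :: "3 \<Rightarrow> 'k::field poly3"
  assumes "\<And>a b. var3 b * v a = var3 a * v b"
  obtains u where "\<And>a. v a = var3 a * u"
proof -
  have "var3 0 dvd var3 1 * v 0" using assms[of 1 0] by simp
  then have "var3 0 dvd v 0" by (rule var3_dvd_var3_mult[rotated]) simp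
  then obtain u where u: "v 0 = var3 0 * u" by (auto simp: dvd_def)
  have "var3 0 * v a = var3 0 * (var3 a * u)" for a
    using assms[of 0 a] u by (simp add: mult.left_commute)
  then have "v a = var3 a * u" for a by simp
  then show ?thesis using that by blast
qed

text \<open>The middle Koszul differential when the second exterior power of R^3 is identified with
  R^3; the neighbouring differentials are multiplication by and dot product with the vector of
  variables.\<close>

definition cross :: "(3 \<Rightarrow> 'a::comm_ring) \<Rightarrow> (3 \<Rightarrow> 'a) \<Rightarrow> 3 \<Rightarrow> 'a" where
  "cross u v a = (if a = 0 then u 1 * v 2 - u 2 * v 1 else if a = 1 then u 2 * v 0 - u 0 * v 2
     else u 0 * v 1 - u 1 * v 0)"

text \<open>Modulo the last variable the relation involves two coprime variables only, so it is a
  multiple \<open>t\<close> of the evident one. The quotients \<open>q0\<close> and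
  \<open>q1\<close> left over by this reduction supply the other two coordinates of
  \<open>w\<close>.\<close>

lemma koszul_orthogonal:
  fixes x :: "3 \<Rightarrow> 'k::field poly3"
  assumes "(\<Sum>a\<in>UNIV. var3 a * x a) = 0"
  obtains w where "\<And>a. x a = cross var3 w a"
proof -
  let ?r = "mfilter (\<lambda>\<alpha>. Poly_Mapping.lookup \<alpha> 2 = 0)"
  obtain q0 where q0: "x 0 = ?r (x 0) + var3 2 * q0" by (rule var3_rem[of "x 0" 2])
  obtain q1 where q1: "x 1 = ?r (x 1) + var3 2 * q1" by (rule var3_rem[of "x 1" 2])
  have "?r (\<Sum>a\<in>UNIV. var3 a * x a) = var3 0 * ?r (x 0) + var3 1 * ?r (x 1) + ?r (var3 2 * x 2)"
    by (simp add: sum_three mfilter_add mfilter_var3_mult)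
  moreover have "?r (var3 2 * x 2) = 0" by (simp add: var3_dvd_iff[symmetric])
  ultimately have r: "var3 0 * ?r (x 0) + var3 1 * ?r (x 1) = 0" using assms by simp
  then have "var3 0 * ?r (x 0) = var3 1 * (- ?r (x 1))" by (simp add: eq_neg_iff_add_eq_0)
  then have "var3 1 dvd var3 0 * ?r (x 0)" by simp
  then have "var3 1 dvd ?r (x 0)" by (rule var3_dvd_var3_mult[rotated]) simp
  then obtain t where t: "?r (x 0) = var3 1 * t" by (auto simp: dvd_def)
  have "var3 1 * (?r (x 1) + var3 0 * t) = 0"
    using r unfolding t by (simp add: algebra_simps)
  then have r1: "?r (x 1) = - var3 0 * t" by (simp add: eq_neg_iff_add_eq_0)
  have x0: "x 0 = var3 1 * t + var3 2 * q0" using q0 unfolding t .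
  have x1: "x 1 = - var3 0 * t + var3 2 * q1" using q1 unfolding r1 .
  have "var3 2 * (var3 0 * q0 + var3 1 * q1 + x 2) = 0"
    using assms unfolding sum_three x0 x1 by (simp add: algebra_simps)
  then have "var3 0 * q0 + var3 1 * q1 + x 2 = 0" by simp
  moreover have "x 2 = (var3 0 * q0 + var3 1 * q1 + x 2) - var3 0 * q0 - var3 1 * q1" by simp
  ultimately have x2: "x 2 = - var3 0 * q0 - var3 1 * q1" by simp
  have "\<forall>a. x a = cross var3 (\<lambda>a. if a = 0 then q1 else if a = 1 then - q0 else t) a"
    unfolding all_three x0 x1 x2 by (simp add: cross_def algebra_simps)
  then show ?thesis using that by blast
qed

subsection \<open>Grading\<close>

text \<open>Degrees are integers, so that a homogeneous polynomial of negative degree is zero and degree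
  shifts need no case distinctions.\<close>

definition homz :: "int \<Rightarrow> 'k::field poly3 \<Rightarrow> bool" where
  "homz d p \<longleftrightarrow> (\<forall>\<alpha>\<in>Poly_Mapping.keys p. int (mdeg \<alpha>) = d)"

definition hc :: "int \<Rightarrow> 'k::field poly3 \<Rightarrow> 'k poly3" where
  "hc d p = mfilter (\<lambda>\<alpha>. int (mdeg \<alpha>) = d) p"

lemma homogeneous_iff_homz: "homogeneous n p \<longleftrightarrow> homz (int n) p"
  by (simp add: homogeneous_def homz_def)

lemma homz_iff_lookup: "homz d p \<longleftrightarrow> (\<forall>\<alpha>. Poly_Mapping.lookup p \<alpha> \<noteq> 0 \<longrightarrow> int (mdeg \<alpha>) = d)"
  by (auto simp: homz_def in_keys_iff)

lemma homz_0 [simp]: "homz d 0" by (simp add: homz_def)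

lemma homz_add: "homz d p \<Longrightarrow> homz d q \<Longrightarrow> homz d (p + q)"
  unfolding homz_iff_lookup lookup_add by (metis add_0)

lemma homz_uminus [simp]: "homz d (- p) = homz d p"
  by (simp add: homz_def)

lemma homz_diff: "homz d p \<Longrightarrow> homz d q \<Longrightarrow> homz d (p - q)"
  using homz_add[of d p "- q"] by simp

lemma homz_sum: "(\<And>i. i \<in> A \<Longrightarrow> homz d (f i)) \<Longrightarrow> homz d (\<Sum>i\<in>A. f i)"
  by (induction A rule: infinite_finite_induct) (auto intro: homz_add)

lemma homz_single: "homz (int (mdeg \<alpha>)) (Poly_Mapping.single \<alpha> c)"
  by (simp add: homz_def)

lemma homz_const3 [simp]: "homz 0 (const3 c)"
  using homz_single[of 0 c] by (simp add: const3_def)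

lemma homz_1 [simp]: "homz 0 1" using homz_const3[of 1] by simp

lemma homz_var3 [simp]: "homz 1 (var3 i)"
  by (simp add: homz_def var3_def)

lemma homz_mult: "homz d p \<Longrightarrow> homz e q \<Longrightarrow> homz (d + e) (p * q)"
  unfolding homz_def using keys_mult[of p q] by (fastforce simp: mdeg_add)

lemma homz_const3_mult [simp]: "homz d p \<Longrightarrow> homz d (const3 c * p)"
  using homz_mult[of 0 "const3 c" d p] by simp

lemma homz_power: "homz d p \<Longrightarrow> homz (int n * d) (p ^ n)"
proof (induction n)
  case (Suc n)
  then show ?case using homz_mult[of d p "int n * d" "p ^ n"] by (simp add: algebra_simps)
qed simp

lemma homz_prod:
  "finite A \<Longrightarrow> (\<And>i. i \<in> A \<Longrightarrow> homz (d i) (f i)) \<Longrightarrow> homz (\<Sum>i\<in>A. d i) (\<Prod>i\<in>A. f i)"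
  by (induction A rule: finite_induct) (auto intro: homz_mult)

lemma homz_neg: "homz d p \<Longrightarrow> d < 0 \<Longrightarrow> p = 0"
  by (rule ccontr) (auto simp: homz_def keys_eq_empty dest!: ex_in_conv[THEN iffD2])


lemma c0_homz: "homz d p \<Longrightarrow> d \<noteq> 0 \<Longrightarrow> c0 p = 0"
  by (auto simp: homz_iff_lookup)

lemma homz_0_const3: "homz 0 p \<Longrightarrow> p = const3 (c0 p)"
  by (rule poly_mapping_eqI) (auto simp: homz_iff_lookup const3_def lookup_single when_def)

lemma lookup_hc [simp]:
  "Poly_Mapping.lookup (hc d p) \<alpha> = (if int (mdeg \<alpha>) = d then Poly_Mapping.lookup p \<alpha> else 0)"
  by (simp add: hc_def)

lemma homz_hc [simp]: "homz d (hc d p)"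
  by (auto simp: homz_iff_lookup)

lemma hc_homz: "homz d p \<Longrightarrow> hc e p = (if e = d then p else 0)"
  by (rule poly_mapping_eqI) (auto simp: homz_iff_lookup)

lemma hc_self: "homz d p \<Longrightarrow> hc d p = p"
  by (simp add: hc_homz)

lemma hc_0 [simp]: "hc d 0 = 0" by (simp add: hc_def)
lemma hc_add: "hc d (p + q) = hc d p + hc d q" by (simp add: hc_def mfilter_add)
lemma hc_diff: "hc d (p - q) = hc d p - hc d q" by (simp add: hc_def mfilter_diff)

lemma hc_sum: "hc d (\<Sum>i\<in>A. f i) = (\<Sum>i\<in>A. hc d (f i))" by (simp add: hc_def mfilter_sum)

lemma hc_mult: "homz e q \<Longrightarrow> hc d (p * q) = hc (d - e) p * q"
  unfolding hc_def by (rule mfilter_mult) (auto simp: homz_def mdeg_add)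

lemma hc_mult': "homz e q \<Longrightarrow> hc d (q * p) = q * hc (d - e) p"
  using hc_mult[of e q d p] by (simp add: mult.commute)

lemma hc_const3_mult: "hc d (const3 c * p) = const3 c * hc d p"
  using hc_mult'[of 0 "const3 c"] by simp

lemma c0_hc: "c0 (hc d p) = (if d = 0 then c0 p else 0)"
  by simp

lemma hc_decomp:
  obtains D where "\<And>d. d > D \<Longrightarrow> hc (int d) p = 0" "p = (\<Sum>d\<le>D. hc (int d) p)"
proof -
  define D where "D = (\<Sum>\<alpha>\<in>Poly_Mapping.keys p. mdeg \<alpha>)"
  have D: "mdeg \<alpha> \<le> D" if "Poly_Mapping.lookup p \<alpha> \<noteq> 0" for \<alpha>
    unfolding D_def using that by (intro member_le_sum) (auto simp: in_keys_iff)
  show ?thesis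
  proof (rule that)
    show "hc (int d) p = 0" if "d > D" for d
      by (rule poly_mapping_eqI) (use D that in fastforce)
    show "p = (\<Sum>d\<le>D. hc (int d) p)"
      by (rule poly_mapping_eqI) (use D in \<open>auto simp: lookup_sum sum.delta\<close>)
  qed
qed

lemma homz_cancel:
  assumes "homz d (p * q)" "homz e q" "q \<noteq> 0"
  shows "homz (d - e) p"
proof -
  have "hc f p = 0" if "f \<noteq> d - e" for f
  proof -
    have "hc f p * q = hc (f + e) (p * q)" using hc_mult[OF assms(2), of "f + e" p] by simp
    also have "\<dots> = 0" using assms(1) that by (subst hc_homz) auto
    finally show ?thesis using assms(3) by simp
  qed
  then show ?thesis unfolding homz_iff_lookup
    by (metis lookup_hc lookup_zero)
qed

subsection \<open>The action by differentiation\<close>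

text \<open>The value at the origin of D applied to F, with the factorials written out; it is the
  case \<gamma> = 0 of \<open>lookup_act\<close>.\<close>

definition phi :: "'k::field poly3 \<Rightarrow> 'k poly3 \<Rightarrow> 'k" where
  "phi F D = (\<Sum>\<beta>\<in>Poly_Mapping.keys F.
     Poly_Mapping.lookup D \<beta> * Poly_Mapping.lookup F \<beta> * of_nat (mfact \<beta>))"

lemma phi_0 [simp]: "phi F 0 = 0" by (simp add: phi_def)
lemma phi_add: "phi F (D + E) = phi F D + phi F E"
  by (simp add: phi_def lookup_add algebra_simps sum.distrib)
lemma phi_uminus: "phi F (- D) = - phi F D"
  by (simp add: phi_def sum_negf)
lemma phi_diff: "phi F (D - E) = phi F D - phi F E"
  using phi_add[of F D "- E"] by (simp add: phi_uminus)
lemma phi_const3_mult: "phi F (const3 c * D) = c * phi F D"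
  by (simp add: phi_def sum_distrib_left mult.assoc)
lemma phi_sum: "phi F (\<Sum>i\<in>A. f i) = (\<Sum>i\<in>A. phi F (f i))"
  by (induction A rule: infinite_finite_induct) (auto simp: phi_add)

lemma mfact_nonzero [simp]: "mfact \<alpha> \<noteq> 0"
  by (simp add: mfact_def)

lemma mfact_mbinom:
  assumes "mdvd \<alpha> \<beta>"
  shows "mfact \<alpha> * mbinom \<beta> \<alpha> * mfact (\<beta> - \<alpha>) = mfact \<beta>"
proof -
  have "fact a * (b choose a) * fact (b - a) = (fact b :: nat)" if "a \<le> b" for a b
    using binomial_fact_lemma[OF that] by (simp add: algebra_simps)
  then show ?thesis unfolding mfact_def mbinom_def prod.distrib[symmetric]
    by (intro prod.cong) (use assms in \<open>auto simp: mdvd_def lookup_minus\<close>)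
qed

lemma monomial_minus_eq_iff:
  "mdvd \<alpha> \<beta> \<and> \<beta> - \<alpha> = \<gamma> \<longleftrightarrow> \<beta> = \<alpha> + (\<gamma> :: monomial3)"
  by (auto simp: poly_mapping_eq_iff fun_eq_iff lookup_add lookup_minus mdvd_def)
    (metis add_diff_inverse_nat not_le)+

text \<open>Taylor coefficients are values at the origin of further derivatives. This reduces the
  whole action to the scalar pairing \<open>phi\<close>.\<close>

lemma lookup_act:
  "Poly_Mapping.lookup (act D F) \<gamma> * of_nat (mfact \<gamma>) =
    phi F (Poly_Mapping.single \<gamma> 1 * (D :: 'k::field_char_0 poly3))"
proof -
  have mon: "Poly_Mapping.lookup (monomial_act \<alpha> \<beta>) \<gamma> * of_nat (mfact \<gamma>) =
      (if \<beta> = \<alpha> + \<gamma> then of_nat (mfact \<beta>) else (0 :: 'k))" for \<alpha> \<beta>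
  proof (cases "\<beta> = \<alpha> + \<gamma>")
    case True
    then have "mdvd \<alpha> \<beta>" "\<beta> - \<alpha> = \<gamma>" using monomial_minus_eq_iff by blast+
    then show ?thesis using True mfact_mbinom[of \<alpha> \<beta>]
      by (simp add: monomial_act_def of_nat_mult[symmetric] del: of_nat_mult)
  next
    case False
    then show ?thesis using monomial_minus_eq_iff[of \<alpha> \<beta> \<gamma>]
      by (auto simp: monomial_act_def lookup_single when_def)
  qed
  have lk: "Poly_Mapping.lookup (Poly_Mapping.single \<gamma> 1 * D) \<beta> =
      (\<Sum>\<alpha>\<in>Poly_Mapping.keys D. if \<beta> = \<alpha> + \<gamma> then Poly_Mapping.lookup D \<alpha> else 0)" for \<beta>
  proof (cases "mdvd \<gamma> \<beta>")
    case True
    then have "\<beta> = \<alpha> + \<gamma> \<longleftrightarrow> \<alpha> = \<beta> - \<gamma>" for \<alpha>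
      using monomial_minus_eq_iff[of \<gamma> \<beta> \<alpha>] by (auto simp: add.commute)
    then have "(\<Sum>\<alpha>\<in>Poly_Mapping.keys D. if \<beta> = \<alpha> + \<gamma> then Poly_Mapping.lookup D \<alpha> else 0) =
        (\<Sum>\<alpha>\<in>Poly_Mapping.keys D. if \<alpha> = \<beta> - \<gamma> then Poly_Mapping.lookup D \<alpha> else 0)"
      by simp
    also have "\<dots> = Poly_Mapping.lookup D (\<beta> - \<gamma>)"
      by (simp add: in_keys_iff)
    finally show ?thesis using True by (simp add: lookup_single_mult)
  next
    case False
    then have "\<beta> \<noteq> \<alpha> + \<gamma>" for \<alpha> by (auto simp: mdvd_def lookup_add)
    then show ?thesis using False by (simp add: lookup_single_mult)
  qed
  have "Poly_Mapping.lookup (act D F) \<gamma> * of_nat (mfact \<gamma>) =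
      (\<Sum>\<alpha>\<in>Poly_Mapping.keys D. \<Sum>\<beta>\<in>Poly_Mapping.keys F.
        Poly_Mapping.lookup D \<alpha> * Poly_Mapping.lookup F \<beta> *
          (Poly_Mapping.lookup (monomial_act \<alpha> \<beta>) \<gamma> * of_nat (mfact \<gamma>)))"
    by (simp add: act_def lookup_sum sum_distrib_right mult.assoc)
  also have "\<dots> = (\<Sum>\<beta>\<in>Poly_Mapping.keys F. \<Sum>\<alpha>\<in>Poly_Mapping.keys D.
        (if \<beta> = \<alpha> + \<gamma> then Poly_Mapping.lookup D \<alpha> else 0) * Poly_Mapping.lookup F \<beta> * of_nat (mfact \<beta>))"
    unfolding mon by (subst sum.swap) (intro sum.cong, auto)
  also have "\<dots> = phi F (Poly_Mapping.single \<gamma> 1 * D)"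
    by (simp add: phi_def lk sum_distrib_right)
  finally show ?thesis .
qed

lemma mult_single_1_zero_imp:
  assumes "\<And>\<gamma>. phi F (Poly_Mapping.single \<gamma> 1 * D) = 0"
  shows "phi F (E * D) = 0"
proof (induction E rule: poly3_induct)
  case (add \<alpha> c p)
  have "phi F (Poly_Mapping.single \<alpha> c * D) = 0"
    using assms[of \<alpha>] by (subst single_eq_const3_mult) (simp add: mult.assoc phi_const3_mult)
  then show ?case using add by (simp add: distrib_right phi_add)
qed simp

text \<open>All Taylor coefficients of D F vanish iff all monomial multiples of D pair to zero with
  F, the factorials being invertible. Hence \<open>perp F\<close> is the largest ideal inside the
  kernel of a linear functional.\<close>

lemma perp_eq: "perp F = {D. \<forall>E. phi F (E * D) = (0 :: 'k::field_char_0)}"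
proof -
  have "act D F = 0 \<longleftrightarrow> (\<forall>E. phi F (E * D) = 0)" for D
  proof
    assume "act D F = 0"
    then have "phi F (Poly_Mapping.single \<gamma> 1 * D) = 0" for \<gamma>
      using lookup_act[of D F \<gamma>] by simp
    then show "\<forall>E. phi F (E * D) = 0" using mult_single_1_zero_imp by blast
  next
    assume "\<forall>E. phi F (E * D) = 0"
    then have "Poly_Mapping.lookup (act D F) \<gamma> * of_nat (mfact \<gamma>) = 0" for \<gamma>
      by (simp add: lookup_act)
    then show "act D F = 0" by (auto intro: poly_mapping_eqI)
  qed
  then show ?thesis by (simp add: perp_def)
qed

lemma phi_hc: "homz k F \<Longrightarrow> phi F (hc k D) = phi F D"
  by (auto simp: phi_def homz_def intro!: sum.cong)

lemma phi_homz_0: "homz k F \<Longrightarrow> homz e D \<Longrightarrow> e \<noteq> k \<Longrightarrow> phi F D = 0"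
  using phi_hc[of k F D] hc_homz[of e D k] by simp

lemma phi_nonzero:
  fixes F :: "'k::field_char_0 poly3"
  assumes "homz k F" "F \<noteq> 0"
  obtains s where "homz k s" "phi F s = 1"
proof -
  from assms obtain \<alpha> where \<alpha>: "\<alpha> \<in> Poly_Mapping.keys F" by (metis keys_eq_empty ex_in_conv)
  let ?c = "Poly_Mapping.lookup F \<alpha> * of_nat (mfact \<alpha>)"
  have "phi F (Poly_Mapping.single \<alpha> 1) = ?c"
    using \<alpha> by (simp add: phi_def lookup_single when_def if_distrib[of "\<lambda>x. x * _"] cong: if_cong)
  moreover have "?c \<noteq> 0" using \<alpha> by (simp add: in_keys_iff)
  ultimately have "phi F (const3 (1 / ?c) * Poly_Mapping.single \<alpha> 1) = 1"
    by (simp add: phi_const3_mult)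
  moreover have "homz k (const3 (1 / ?c) * Poly_Mapping.single \<alpha> 1)"
    using assms(1) \<alpha> homz_single[of \<alpha> "1 :: 'k"] by (intro homz_const3_mult) (auto simp: homz_def[of k F])
  ultimately show ?thesis using that by blast
qed

text \<open>Since y^\<alpha> pairs to \<alpha>! with its dual monomial, the coefficient of F at
  \<alpha> has to be the value of the functional at y^\<alpha> divided by \<alpha>!; the hypothesis
  \<open>deg\<close> kills all other monomials.\<close>

lemma phi_represent:
  fixes f :: "'k::field_char_0 poly3 \<Rightarrow> 'k"
  assumes add: "\<And>p q. f (p + q) = f p + f q" and scale: "\<And>c p. f (const3 c * p) = c * f p"
    and deg: "\<And>p. f (hc (int k) p) = f p"
  obtains F where "homz (int k) F" "\<And>D. phi F D = f D"
proof -
  define F where "F = (\<Sum>\<alpha> | mdeg \<alpha> = k. Poly_Mapping.single \<alpha> (f (Poly_Mapping.single \<alpha> 1) / of_nat (mfact \<alpha>)))"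
  have f0: "f 0 = 0" using add[of 0 0] by simp
  have lF: "Poly_Mapping.lookup F \<alpha> = (if mdeg \<alpha> = k then f (Poly_Mapping.single \<alpha> 1) / of_nat (mfact \<alpha>) else 0)" for \<alpha>
    by (simp add: F_def lookup_sum lookup_single when_def finite_mdeg)
  have hF: "homz (int k) F" by (auto simp: homz_iff_lookup lF split: if_splits)
  have single: "phi F (Poly_Mapping.single \<alpha> 1) = f (Poly_Mapping.single \<alpha> 1)" for \<alpha>
  proof (cases "mdeg \<alpha> = k")
    case True
    have "phi F (Poly_Mapping.single \<alpha> 1) = Poly_Mapping.lookup F \<alpha> * of_nat (mfact \<alpha>)"
      by (simp add: phi_def lookup_single when_def in_keys_iff if_distrib[of "\<lambda>x. x * _"] cong: if_cong)
    then show ?thesis using True by (simp add: lF)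
  next
    case False
    then have "hc (int k) (Poly_Mapping.single \<alpha> (1 :: 'k)) = 0"
      by (simp add: hc_homz[OF homz_single])
    then have "f (Poly_Mapping.single \<alpha> 1) = 0" using deg[of "Poly_Mapping.single \<alpha> 1"] f0 by simp
    moreover have "phi F (Poly_Mapping.single \<alpha> 1) = 0"
      using phi_homz_0[OF hF homz_single[of \<alpha> 1]] False by simp
    ultimately show ?thesis by simp
  qed
  have "phi F D = f D" for D
  proof (induction D rule: poly3_induct)
    case (add \<alpha> c p)
    have "phi F (Poly_Mapping.single \<alpha> c) = f (Poly_Mapping.single \<alpha> c)"
      using single[of \<alpha>] by (subst (1 2) single_eq_const3_mult) (simp add: phi_const3_mult scale)
    then show ?case using add by (simp add: phi_add assms(1))
  qed (simp add: f0)
  with hF that show ?thesis by blast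
qed

section \<open>Ideals\<close>

lemma ring3_simps [simp]:
  "carrier (ring3 :: 'k::field poly3 ring) = UNIV" "x \<oplus>\<^bsub>ring3\<^esub> y = x + y" "x \<otimes>\<^bsub>ring3\<^esub> y = x * y"
  "\<zero>\<^bsub>ring3\<^esub> = (0 :: 'k poly3)" "\<one>\<^bsub>ring3\<^esub> = (1 :: 'k poly3)"
  by (simp_all add: ring_of_type_algebra_def)

lemma cring_ring3: "cring (ring3 :: 'k::field poly3 ring)"
  by (rule cring_from_type_algebra)

lemma ring_ring3: "ring (ring3 :: 'k::field poly3 ring)"
  by (rule ring_from_type_algebra)

lemma a_inv_ring3 [simp]: "\<ominus>\<^bsub>ring3\<^esub> x = - (x :: 'k::field poly3)"
proof -
  interpret ring "ring3 :: 'k poly3 ring" by (rule ring_ring3)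
  show ?thesis using minus_equality[of "- x" x] by simp
qed

lemma ideal_ring3_iff:
  "ideal I (ring3 :: 'k::field poly3 ring) \<longleftrightarrow>
    0 \<in> I \<and> (\<forall>x\<in>I. \<forall>y\<in>I. x + y \<in> I) \<and> (\<forall>r. \<forall>x\<in>I. r * x \<in> I)"
proof
  assume "ideal I (ring3 :: 'k poly3 ring)"
  then interpret ideal I "ring3 :: 'k poly3 ring" .
  show "0 \<in> I \<and> (\<forall>x\<in>I. \<forall>y\<in>I. x + y \<in> I) \<and> (\<forall>r. \<forall>x\<in>I. r * x \<in> I)"
    using additive_subgroup.zero_closed[OF additive_subgroup_axioms]
      additive_subgroup.a_closed[OF additive_subgroup_axioms] I_l_closed by auto
next
  assume *: "0 \<in> I \<and> (\<forall>x\<in>I. \<forall>y\<in>I. x + y \<in> I) \<and> (\<forall>r. \<forall>x\<in>I. r * x \<in> I)"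
  interpret ring "ring3 :: 'k poly3 ring" by (rule ring_ring3)
  show "ideal I (ring3 :: 'k poly3 ring)"
  proof (rule idealI[OF ring_ring3])
    have neg: "- x \<in> I" if "x \<in> I" for x using * that by (metis mult_minus1)
    show "subgroup I (add_monoid (ring3 :: 'k poly3 ring))"
      by (rule add.subgroupI) (use * neg in \<open>auto simp: a_inv_def[symmetric]\<close>)
      show "x \<otimes>\<^bsub>ring3\<^esub> a \<in> I" "a \<otimes>\<^bsub>ring3\<^esub> x \<in> I" if "a \<in> I" for a x
      using that * by (metis ring3_simps(3) mult.commute)+
  qed
qed

context
  fixes I :: "'k::field poly3 set"
  assumes I: "ideal I (ring3 :: 'k poly3 ring)"
begin

lemma ideal3_0: "0 \<in> I" using I by (simp add: ideal_ring3_iff)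
lemma ideal3_add: "x \<in> I \<Longrightarrow> y \<in> I \<Longrightarrow> x + y \<in> I" using I by (simp add: ideal_ring3_iff)
lemma ideal3_mult: "x \<in> I \<Longrightarrow> r * x \<in> I" using I by (simp add: ideal_ring3_iff)
lemma ideal3_mult': "x \<in> I \<Longrightarrow> x * r \<in> I" using ideal3_mult[of x r] by (simp add: mult.commute)
lemma ideal3_uminus: "x \<in> I \<Longrightarrow> - x \<in> I" using ideal3_mult[of x "- 1"] by simp
lemma ideal3_diff: "x \<in> I \<Longrightarrow> y \<in> I \<Longrightarrow> x - y \<in> I" using ideal3_add[of x "- y"] ideal3_uminus[of y] by simp
lemma ideal3_sum: "(\<And>i. i \<in> A \<Longrightarrow> f i \<in> I) \<Longrightarrow> (\<Sum>i\<in>A. f i) \<in> I"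
  by (induction A rule: infinite_finite_induct) (auto simp: ideal3_0 ideal3_add)

end

lemma genideal_mono: "S \<subseteq> Idl\<^bsub>ring3\<^esub> (S :: 'k::field poly3 set)"
  using ring.genideal_self[OF ring_ring3, of S] by simp

lemma genideal_ideal: "ideal (Idl\<^bsub>ring3\<^esub> (S :: 'k::field poly3 set)) ring3"
  using ring.genideal_ideal[OF ring_ring3, of S] by simp

lemma genideal_min: "ideal I ring3 \<Longrightarrow> S \<subseteq> I \<Longrightarrow> Idl\<^bsub>ring3\<^esub> (S :: 'k::field poly3 set) \<subseteq> I"
  by (rule ring.genideal_minimal[OF ring_ring3])

lemma genideal_family:
  "Idl\<^bsub>ring3\<^esub> (f ` {..<n}) = {\<Sum>i<n. r i * f i | r. True}" for f :: "nat \<Rightarrow> 'k::field poly3"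
proof
  let ?J = "{\<Sum>i<n. r i * f i | r. True}"
  have "ideal ?J ring3" unfolding ideal_ring3_iff
  proof (intro conjI ballI allI)
    show "0 \<in> ?J" by (rule CollectI, rule exI[of _ "\<lambda>_. 0"]) simp
  next
    fix x y assume "x \<in> ?J" "y \<in> ?J"
    then obtain r s where "x = (\<Sum>i<n. r i * f i)" "y = (\<Sum>i<n. s i * f i)" by blast
    then have "x + y = (\<Sum>i<n. (r i + s i) * f i)" by (simp add: distrib_right sum.distrib)
    then show "x + y \<in> ?J" by (auto intro!: exI[where x = "\<lambda>i. r i + s i"])
  next
    fix t x assume "x \<in> ?J"
    then obtain r where "x = (\<Sum>i<n. r i * f i)" by blast
    then have "t * x = (\<Sum>i<n. (t * r i) * f i)" by (simp add: sum_distrib_left mult.assoc)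
    then show "t * x \<in> ?J" by (auto intro!: exI[where x = "\<lambda>i. t * r i"])
  qed
  moreover have "f j \<in> ?J" if "j < n" for j
  proof -
    have "(\<Sum>i<n. (if i = j then 1 else 0) * f i) = f j"
      using that by (simp add: if_distrib[of "\<lambda>x. x * _"] cong: if_cong)
    then show ?thesis by (auto intro!: exI[where x = "\<lambda>i. if i = j then 1 else 0"])
  qed
  then have "f ` {..<n} \<subseteq> ?J" by blast
  ultimately show "Idl\<^bsub>ring3\<^esub> (f ` {..<n}) \<subseteq> ?J" by (rule genideal_min)
next
  show "{\<Sum>i<n. r i * f i | r. True} \<subseteq> Idl\<^bsub>ring3\<^esub> (f ` {..<n})"
    using genideal_mono[of "f ` {..<n}"]
    by (auto intro!: ideal3_sum[OF genideal_ideal] ideal3_mult[OF genideal_ideal])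
qed

lemma homogeneous_ideal_iff:
  "homogeneous_ideal I \<longleftrightarrow> ideal I ring3 \<and> (\<forall>D\<in>I. \<forall>d. hc d D \<in> (I :: 'k::field poly3 set))"
proof
  assume *: "homogeneous_ideal I"
  then have I: "ideal I ring3" by (simp add: homogeneous_ideal_def)
  let ?S = "{D \<in> I. \<exists>d. homogeneous d D}"
  \<comment> \<open>The elements with all components in \<open>I\<close> form an ideal that contains
    the homogeneous members of \<open>I\<close>, hence everything they generate.\<close>
  define J where "J = {D. \<forall>d. hc d D \<in> I}"
  have "ideal J ring3" unfolding ideal_ring3_iff
  proof (intro conjI ballI allI)
    show "0 \<in> J" using ideal3_0[OF I] by (simp add: J_def)
  next
    fix x y assume "x \<in> J" "y \<in> J"
    then show "x + y \<in> J" by (simp add: J_def hc_add ideal3_add[OF I])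
  next
    fix r x assume x: "x \<in> J"
    have "hc d (r * x) \<in> I" for d
    proof (induction r rule: poly3_induct)
      case (add \<alpha> c p)
      have "hc d (Poly_Mapping.single \<alpha> c * x) = Poly_Mapping.single \<alpha> c * hc (d - int (mdeg \<alpha>)) x"
        by (rule hc_mult'[OF homz_single])
      then show ?case using x add
        by (simp add: J_def distrib_right hc_add ideal3_add[OF I] ideal3_mult[OF I])
    qed (simp add: ideal3_0[OF I])
    then show "r * x \<in> J" by (simp add: J_def)
  qed
  moreover have "?S \<subseteq> J"
    by (auto simp: J_def homogeneous_iff_homz hc_homz ideal3_0[OF I])
  ultimately have "Idl\<^bsub>ring3\<^esub> ?S \<subseteq> J" by (rule genideal_min)
  then have "I \<subseteq> J" using * by (simp add: homogeneous_ideal_def)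
  then show "ideal I ring3 \<and> (\<forall>D\<in>I. \<forall>d. hc d D \<in> I)" using I by (auto simp: J_def)
next
  assume *: "ideal I ring3 \<and> (\<forall>D\<in>I. \<forall>d. hc d D \<in> I)"
  then have I: "ideal I ring3" by simp
  let ?S = "{D \<in> I. \<exists>d. homogeneous d D}"
  have "I \<subseteq> Idl\<^bsub>ring3\<^esub> ?S"
  proof
    fix D assume D: "D \<in> I"
    obtain N where N: "D = (\<Sum>d\<le>N. hc (int d) D)" by (rule hc_decomp)
    have "hc (int d) D \<in> Idl\<^bsub>ring3\<^esub> ?S" for d
    proof -
      have "hc (int d) D \<in> ?S" using * D homz_hc[of "int d" D] by (auto simp: homogeneous_iff_homz simp del: homz_hc)
      then show ?thesis by (rule subsetD[OF genideal_mono])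
    qed
    then have "(\<Sum>d\<le>N. hc (int d) D) \<in> Idl\<^bsub>ring3\<^esub> ?S"
      by (intro ideal3_sum[OF genideal_ideal])
    then show "D \<in> Idl\<^bsub>ring3\<^esub> ?S" using N by simp
  qed
  moreover have "Idl\<^bsub>ring3\<^esub> ?S \<subseteq> I" by (rule genideal_min[OF I]) auto
  ultimately show "homogeneous_ideal I" using I by (simp add: homogeneous_ideal_def)
qed

section \<open>Graded submodules of free modules\<close>

text \<open>The monomial vectors only bound the dimension; the spanning set is a maximal independent
  subset of \<open>S\<close> itself, so that generators of a submodule can be chosen inside
  it.\<close>

lemma bounded_degree_finite_span:
  fixes S :: "(nat \<Rightarrow> 'k::field poly3) set"
  assumes "\<And>z i. z \<in> S \<Longrightarrow> i \<ge> m \<Longrightarrow> z i = 0"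
    and "\<And>z i \<alpha>. z \<in> S \<Longrightarrow> i < m \<Longrightarrow> \<alpha> \<in> Poly_Mapping.keys (z i) \<Longrightarrow> mdeg \<alpha> \<le> E"
  shows "\<exists>B. finite B \<and> B \<subseteq> S \<and> (\<forall>z\<in>S. \<exists>c. \<forall>i. z i = (\<Sum>b\<in>B. const3 (c b) * b i))"
proof -
  interpret vs: vector_space "\<lambda>(c::'k) (v :: nat \<Rightarrow> 'k poly3) i. const3 c * v i"
    by unfold_locales (auto simp: fun_eq_iff const3_add const3_mult algebra_simps)
  have sum_apply: "(\<Sum>x\<in>A. f x) i = (\<Sum>x\<in>A. f x i)" for A and f :: "'z \<Rightarrow> nat \<Rightarrow> 'k poly3" and i
    by (induction A rule: infinite_finite_induct) auto
  define u where "u = (\<lambda>(j :: nat, \<alpha> :: monomial3) (i :: nat). if i = j then Poly_Mapping.single \<alpha> (1 :: 'k) else 0)"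
  define T where "T = u ` ({..<m} \<times> (\<Union>e\<le>E. {\<alpha>. mdeg \<alpha> = e}))"
  have fT: "finite T" by (simp add: T_def finite_mdeg)
  have ST: "S \<subseteq> vs.span T"
  proof
    fix z assume z: "z \<in> S"
    define w where "w = (\<Sum>j<m. \<Sum>\<alpha>\<in>Poly_Mapping.keys (z j). (\<lambda>i. const3 (Poly_Mapping.lookup (z j) \<alpha>) * u (j, \<alpha>) i))"
    have "w \<in> vs.span T" unfolding w_def
      by (intro vs.span_sum vs.span_scale vs.span_base) (use assms(2)[OF z] in \<open>auto simp: T_def\<close>)
    moreover have "w = z"
    proof
      fix i
      have "w i = (\<Sum>j<m. \<Sum>\<alpha>\<in>Poly_Mapping.keys (z j). if i = j then Poly_Mapping.single \<alpha> (Poly_Mapping.lookup (z j) \<alpha>) else 0)"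
        unfolding w_def sum_apply by (intro sum.cong refl) (auto simp: u_def single_eq_const3_mult[symmetric])
      also have "\<dots> = (\<Sum>j<m. if i = j then z j else 0)"
        by (intro sum.cong refl) (auto simp: poly3_sum_single[symmetric])
      also have "\<dots> = z i" using assms(1)[OF z, of i] by auto
      finally show "w i = z i" .
    qed
    ultimately show "z \<in> vs.span T" by simp
  qed
  obtain B where B: "B \<subseteq> S" "vs.independent B" "S \<subseteq> vs.span B"
    by (rule vs.maximal_independent_subset[of S])
  have fB: "finite B"
    using vs.independent_span_bound[OF fT B(2)] B(1) ST by blast
  show ?thesis
  proof (intro exI[of _ B] conjI ballI fB B(1))
    fix z assume "z \<in> S"
    then have "z \<in> range (\<lambda>u. \<Sum>v\<in>B. (\<lambda>i. const3 (u v) * v i))"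
      using B(3) vs.span_finite[OF fB] by auto
    then obtain c where "z = (\<Sum>v\<in>B. (\<lambda>i. const3 (c v) * v i))" by blast
    then show "\<exists>c. \<forall>i. z i = (\<Sum>b\<in>B. const3 (c b) * b i)" by (auto simp: sum_apply)
  qed
qed

text \<open>A homogeneous vector of degree \<open>e\<close> in the graded free module with generators of degrees \<open>\<delta> i\<close>.\<close>

definition vhom :: "(nat \<Rightarrow> int) \<Rightarrow> int \<Rightarrow> (nat \<Rightarrow> 'k::field poly3) \<Rightarrow> bool" where
  "vhom \<delta> e z \<longleftrightarrow> (\<forall>i. homz (e - \<delta> i) (z i))"

definition vcomp :: "(nat \<Rightarrow> int) \<Rightarrow> int \<Rightarrow> (nat \<Rightarrow> 'k::field poly3) \<Rightarrow> nat \<Rightarrow> 'k poly3" where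
  "vcomp \<delta> e z i = hc (e - \<delta> i) (z i)"

lemma vhom_vcomp [simp]: "vhom \<delta> e (vcomp \<delta> e z)"
  by (simp add: vhom_def vcomp_def)

lemma sum_hc_superset:
  assumes "finite T" "\<And>\<alpha>. \<alpha> \<in> Poly_Mapping.keys p \<Longrightarrow> int (mdeg \<alpha>) + \<epsilon> \<in> T"
  shows "p = (\<Sum>t\<in>T. hc (t - \<epsilon>) p)"
proof (rule poly_mapping_eqI)
  fix \<alpha>
  have "Poly_Mapping.lookup (\<Sum>t\<in>T. hc (t - \<epsilon>) p) \<alpha> =
      (\<Sum>t\<in>T. if t = int (mdeg \<alpha>) + \<epsilon> then Poly_Mapping.lookup p \<alpha> else 0)"
    unfolding lookup_sum by (intro sum.cong) auto
  then show "Poly_Mapping.lookup p \<alpha> = Poly_Mapping.lookup (\<Sum>t\<in>T. hc (t - \<epsilon>) p) \<alpha>"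
    using assms(2)[of \<alpha>] assms(1) by (auto simp: in_keys_iff)
qed

lemma vcomp_decomp:
  obtains T where "finite T" "\<And>i. i < m \<Longrightarrow> z i = (\<Sum>t\<in>T. vcomp \<delta> t z i)"
proof
  let ?T = "\<Union>i<m. (\<lambda>\<alpha>. int (mdeg \<alpha>) + \<delta> i) ` Poly_Mapping.keys (z i)"
  show "finite ?T" by simp
  show "z i = (\<Sum>t\<in>?T. vcomp \<delta> t z i)" if "i < m" for i
    unfolding vcomp_def by (rule sum_hc_superset) (use that in auto)
qed

lemma c0_eq_0_homz:
  assumes "c0 p = 0" "homz d p"
  obtains q where "p = (\<Sum>a\<in>UNIV. var3 a * q a)" "\<And>a. homz (d - 1) (q a)"
proof -
  obtain q where q: "p = (\<Sum>a\<in>UNIV. var3 a * q a)" using assms(1) unfolding c0_eq_0_iff by (rule exE)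
  have "p = hc d p" using assms(2) by (simp add: hc_self)
  also have "\<dots> = (\<Sum>a\<in>UNIV. var3 a * hc (d - 1) (q a))"
    by (subst q) (simp only: hc_sum hc_mult'[OF homz_var3])
  finally show ?thesis using that[of "\<lambda>a. hc (d - 1) (q a)"] by simp
qed

text \<open>Graded Nakayama. By \<open>step\<close>, a homogeneous vector of degree above
  \<open>E\<close> is a combination of variables times elements of \<open>W\<close>, so degrees at
  most \<open>E\<close> generate \<open>W\<close>, and these span a finite-dimensional space. The
  degree bound takes the place of a Noetherian argument.\<close>

lemma finite_graded_generators:
  fixes W :: "(nat \<Rightarrow> 'k::field poly3) set"
  assumes W0: "\<And>z i. z \<in> W \<Longrightarrow> i \<ge> m \<Longrightarrow> z i = 0"
    and Wadd: "\<And>z z'. z \<in> W \<Longrightarrow> z' \<in> W \<Longrightarrow> (\<lambda>i. z i + z' i) \<in> W"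
    and Wsc: "\<And>z r. z \<in> W \<Longrightarrow> (\<lambda>i. r * z i) \<in> W"
    and Wc: "\<And>z e. z \<in> W \<Longrightarrow> vcomp \<delta> e z \<in> W"
    and step: "\<And>z e. z \<in> W \<Longrightarrow> vhom \<delta> e z \<Longrightarrow> e > E \<Longrightarrow>
      \<exists>\<zeta>. (\<forall>a. \<zeta> a \<in> W) \<and> (\<forall>i. z i = (\<Sum>a\<in>UNIV. var3 a * \<zeta> a i))"
  shows "\<exists>(N :: nat) z e. (\<forall>j<N. z j \<in> W \<and> vhom \<delta> (e j) (z j)) \<and>
    (\<forall>w\<in>W. \<exists>x. \<forall>i. w i = (\<Sum>j<N. x j * z j i))"
proof -
  define S where "S = {z \<in> W. \<exists>e\<le>E. vhom \<delta> e z}"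
  define E' where "E' = (\<Sum>i<m. nat (E - \<delta> i))"
  have deg: "mdeg \<alpha> \<le> E'" if "z \<in> S" "i < m" "\<alpha> \<in> Poly_Mapping.keys (z i)" for z i \<alpha>
  proof -
    from that obtain e where "e \<le> E" "homz (e - \<delta> i) (z i)" by (auto simp: S_def vhom_def)
    then have "int (mdeg \<alpha>) = e - \<delta> i" using that(3) by (auto simp: homz_def)
    then have "mdeg \<alpha> \<le> nat (E - \<delta> i)" using \<open>e \<le> E\<close> by linarith
    also have "\<dots> \<le> E'" unfolding E'_def using that(2) by (intro member_le_sum) auto
    finally show ?thesis .
  qed
  have S0: "z i = 0" if "z \<in> S" "i \<ge> m" for z i using that W0 by (simp add: S_def)
  have "\<exists>B. finite B \<and> B \<subseteq> S \<and> (\<forall>z\<in>S. \<exists>c. \<forall>i. z i = (\<Sum>b\<in>B. const3 (c b) * b i))"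
    using S0 deg by (rule bounded_degree_finite_span[of S m E'])
  then obtain B where B: "finite B" "B \<subseteq> S" "\<And>z. z \<in> S \<Longrightarrow> \<exists>c. \<forall>i. z i = (\<Sum>b\<in>B. const3 (c b) * b i)"
    by (elim exE conjE) (rule that, assumption, assumption, erule bspec)
  obtain h where h: "bij_betw h {..<card B} B" using ex_bij_betw_nat_finite[OF B(1)] by (auto simp: atLeast0LessThan)
  have "\<forall>b\<in>B. \<exists>e. vhom \<delta> e b" using B(2) by (auto simp: S_def)
  then obtain \<epsilon> where \<epsilon>: "\<And>b. b \<in> B \<Longrightarrow> vhom \<delta> (\<epsilon> b) b" by metis
  define gen where "gen w \<longleftrightarrow> (\<exists>x. \<forall>i. w i = (\<Sum>b\<in>B. x b * b i))" for w :: "nat \<Rightarrow> 'k poly3"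
  have gen_add: "gen (\<lambda>i. w i + w' i)" if "gen w" "gen w'" for w w'
  proof -
    from that obtain x x' where "\<And>i. w i = (\<Sum>b\<in>B. x b * b i)" "\<And>i. w' i = (\<Sum>b\<in>B. x' b * b i)"
      unfolding gen_def by blast
    then show ?thesis unfolding gen_def
      by (intro exI[of _ "\<lambda>b. x b + x' b"]) (simp add: distrib_right sum.distrib)
  qed
  have gen_sc: "gen (\<lambda>i. r * w i)" if "gen w" for r w
  proof -
    from that obtain x where "\<And>i. w i = (\<Sum>b\<in>B. x b * b i)" unfolding gen_def by blast
    then show ?thesis unfolding gen_def
      by (intro exI[of _ "\<lambda>b. r * x b"]) (simp add: sum_distrib_left mult.assoc)
  qed
  have gen0: "gen (\<lambda>i. 0)" unfolding gen_def by (intro exI[of _ "\<lambda>_. 0"]) simp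
  have gen_sum: "gen (\<lambda>i. \<Sum>t\<in>T. w t i)" if "\<And>t. t \<in> T \<Longrightarrow> gen (w t)" for T and w :: "'z \<Rightarrow> nat \<Rightarrow> 'k poly3"
    using that
  proof (induction T rule: infinite_finite_induct)
    case (insert t T)
    have "gen (\<lambda>i. w t i + (\<Sum>t\<in>T. w t i))" using insert by (intro gen_add) simp_all
    then show ?case using insert(1,2) by simp
  qed (simp_all add: gen0)
  have hom: "gen w" if "w \<in> W" "vhom \<delta> e w" "e \<le> E + int t" for w e t
    using that
  proof (induction t arbitrary: w e)
    case 0
    then have "w \<in> S" by (auto simp: S_def)
    from B(3)[OF this] obtain c where "\<forall>i. w i = (\<Sum>b\<in>B. const3 (c b) * b i)" by blast
    then show ?case unfolding gen_def by (intro exI[of _ "\<lambda>b. const3 (c b)"])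
  next
    case (Suc t)
    show ?case
    proof (cases "e \<le> E + int t")
      case True
      then show ?thesis using Suc by blast
    next
      case False
      then have "e > E" by linarith
      from step[OF Suc.prems(1,2) this] obtain \<zeta> where
        \<zeta>: "\<And>a. \<zeta> a \<in> W" "\<And>i. w i = (\<Sum>a\<in>UNIV. var3 a * \<zeta> a i)" by blast
      \<comment> \<open>The vectors \<open>\<zeta> a\<close> need not be homogeneous; their
        components of degree e - 1 give the same sum and fall under the induction
        hypothesis.\<close>
      have "w i = (\<Sum>a\<in>UNIV. var3 a * vcomp \<delta> (e - 1) (\<zeta> a) i)" for i
      proof -
        have "w i = hc (e - \<delta> i) (w i)" using Suc.prems(2) by (simp add: vhom_def hc_self)
        also have "\<dots> = (\<Sum>a\<in>UNIV. var3 a * hc (e - \<delta> i - 1) (\<zeta> a i))"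
          by (simp only: \<zeta>(2) hc_sum hc_mult'[OF homz_var3])
        also have "e - \<delta> i - 1 = e - 1 - \<delta> i" by simp
        finally show ?thesis by (simp add: vcomp_def)
      qed
      then have weq: "w = (\<lambda>i. \<Sum>a\<in>UNIV. var3 a * vcomp \<delta> (e - 1) (\<zeta> a) i)" by (rule ext)
      have "gen (vcomp \<delta> (e - 1) (\<zeta> a))" for a
        using Suc.prems(3) by (intro Suc.IH[OF Wc[OF \<zeta>(1)] vhom_vcomp]) simp
      then have "gen (\<lambda>i. var3 a * vcomp \<delta> (e - 1) (\<zeta> a) i)" for a by (rule gen_sc)
      then show ?thesis unfolding weq by (rule gen_sum[of UNIV "\<lambda>a i. var3 a * vcomp \<delta> (e - 1) (\<zeta> a) i"])
    qed
  qed
  have gen: "gen w" if w: "w \<in> W" for w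
  proof -
    obtain T where T: "finite T" "\<And>i. i < m \<Longrightarrow> w i = (\<Sum>t\<in>T. vcomp \<delta> t w i)"
      using vcomp_decomp[where m = m and z = w and \<delta> = \<delta>] by blast
    have "w i = (\<Sum>t\<in>T. vcomp \<delta> t w i)" for i
      using T(2)[of i] W0[OF w, of i] by (cases "i < m") (auto simp: vcomp_def)
    then have "w = (\<lambda>i. \<Sum>t\<in>T. vcomp \<delta> t w i)" by (rule ext)
    moreover have "gen (vcomp \<delta> t w)" for t
      using hom[OF Wc[OF w] vhom_vcomp, of t "nat (t - E)"] by simp
    ultimately show ?thesis using gen_sum[of T "\<lambda>t. vcomp \<delta> t w"] by simp
  qed
  show ?thesis
  proof (rule exI[of _ "card B"], rule exI[of _ h], rule exI[of _ "\<lambda>j. \<epsilon> (h j)"], intro conjI allI impI ballI)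
    show "h j \<in> W" "vhom \<delta> (\<epsilon> (h j)) (h j)" if "j < card B" for j
      using h B(2) \<epsilon> that by (auto simp: bij_betw_def S_def)
    show "\<exists>x. \<forall>i. w i = (\<Sum>j<card B. x j * h j i)" if "w \<in> W" for w
    proof -
      from gen[OF that] obtain x where "\<forall>i. w i = (\<Sum>b\<in>B. x b * b i)" unfolding gen_def by blast
      then have "\<forall>i. w i = (\<Sum>j<card B. x (h j) * h j i)"
        using sum.reindex_bij_betw[OF h, of "\<lambda>b. x b * b _"] by simp
      then show ?thesis by (intro exI[of _ "\<lambda>j. x (h j)"])
    qed
  qed
qed

text \<open>Minimality of the generators means that no relation between them has a unit coefficient.\<close>

lemma minimal_graded_generators:
  fixes W :: "(nat \<Rightarrow> 'k::field poly3) set"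
  assumes W0: "\<And>z i. z \<in> W \<Longrightarrow> i \<ge> m \<Longrightarrow> z i = 0"
    and Wadd: "\<And>z z'. z \<in> W \<Longrightarrow> z' \<in> W \<Longrightarrow> (\<lambda>i. z i + z' i) \<in> W"
    and Wsc: "\<And>z r. z \<in> W \<Longrightarrow> (\<lambda>i. r * z i) \<in> W"
    and Wc: "\<And>z e. z \<in> W \<Longrightarrow> vcomp \<delta> e z \<in> W"
    and step: "\<And>z e. z \<in> W \<Longrightarrow> vhom \<delta> e z \<Longrightarrow> e > E \<Longrightarrow>
      \<exists>\<zeta>. (\<forall>a. \<zeta> a \<in> W) \<and> (\<forall>i. z i = (\<Sum>a\<in>UNIV. var3 a * \<zeta> a i))"
  shows "\<exists>(N :: nat) z e. (\<forall>j<N. z j \<in> W \<and> vhom \<delta> (e j) (z j)) \<and>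
    (\<forall>w\<in>W. \<exists>x. \<forall>i. w i = (\<Sum>j<N. x j * z j i)) \<and>
    (\<forall>x. (\<forall>i. (\<Sum>j<N. x j * z j i) = 0) \<longrightarrow> (\<forall>j<N. c0 (x j) = 0))"
proof -
  have "\<exists>(N :: nat) z e. (\<forall>j<N. z j \<in> W \<and> vhom \<delta> (e j) (z j)) \<and>
    (\<forall>w\<in>W. \<exists>x. \<forall>i. w i = (\<Sum>j<N. x j * z j i))"
    using W0 Wadd Wsc Wc step by (rule finite_graded_generators[where m = m and E = E])
  then obtain N0 :: nat and z e where zW: "\<forall>j<N0. z j \<in> W \<and> vhom \<delta> (e j) (z j)"
    and zgen: "\<forall>w\<in>W. \<exists>x. \<forall>i. w i = (\<Sum>j<N0. x j * z j i)"
    by (elim exE conjE) (rule that)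
  have z: "z j \<in> W" "vhom \<delta> (e j) (z j)" if "j < N0" for j using zW that by simp_all
  define P where "P J \<longleftrightarrow> J \<subseteq> {..<N0} \<and> (\<forall>w\<in>W. \<exists>x. \<forall>i. w i = (\<Sum>j\<in>J. x j * z j i))" for J
  have "P {..<N0}" unfolding P_def using zgen by (intro conjI subset_refl)
  then obtain J where J: "P J" "\<And>J'. P J' \<Longrightarrow> card J \<le> card J'"
    using ex_has_least_nat[of P "{..<N0}" card] by metis
  have Jgen: "\<forall>w\<in>W. \<exists>x. \<forall>i. w i = (\<Sum>j\<in>J. x j * z j i)" using J(1) unfolding P_def by (rule conjunct2)
  have fJ: "finite J" using J(1) by (auto simp: P_def intro: finite_subset)
  have rel: "c0 (x j0) = 0" if x: "\<forall>i. (\<Sum>j\<in>J. x j * z j i) = 0" and j0: "j0 \<in> J" for x j0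
  proof (rule ccontr)
    assume c: "c0 (x j0) \<noteq> 0"
    \<comment> \<open>The component of the relation in the degree of generator \<open>j0\<close> has
      the invertible constant \<open>c0 (x j0)\<close> as its coefficient there. It expresses
      \<open>z j0\<close> by the other generators, against the choice of \<open>J\<close> with least
      cardinality.\<close>
    define x' where "x' j = hc (e j0 - e j) (x j)" for j
    have zh: "homz (e j - \<delta> i) (z j i)" if "j \<in> J" for i j
      using z(2)[of j] that J(1) by (auto simp: P_def vhom_def)
    have x'0: "(\<Sum>j\<in>J. x' j * z j i) = 0" for i
    proof -
      have "(\<Sum>j\<in>J. x' j * z j i) = (\<Sum>j\<in>J. hc (e j0 - \<delta> i) (x j * z j i))"
        by (intro sum.cong refl) (simp add: x'_def hc_mult[OF zh])
      also have "\<dots> = 0" by (simp add: hc_sum[symmetric] x)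
      finally show ?thesis .
    qed
    have x'j0: "x' j0 = const3 (c0 (x j0))"
      using homz_0_const3[OF homz_hc[of 0 "x j0"]] by (simp add: x'_def)
    let ?b = "const3 (1 / c0 (x j0)) :: 'k poly3"
    have zj0: "z j0 i = (\<Sum>j\<in>J - {j0}. - ?b * x' j * z j i)" for i
    proof -
      have "x' j0 * z j0 i = - (\<Sum>j\<in>J - {j0}. x' j * z j i)"
        using x'0[of i] sum.remove[OF fJ j0, of "\<lambda>j. x' j * z j i"] by (simp add: eq_neg_iff_add_eq_0)
      then have "?b * (x' j0 * z j0 i) = ?b * (- (\<Sum>j\<in>J - {j0}. x' j * z j i))" by simp
      moreover have "?b * x' j0 = 1" using c by (simp add: x'j0 const3_mult[symmetric])
      then have "?b * (x' j0 * z j0 i) = z j0 i" by (simp only: mult.assoc[symmetric] mult_1_left)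
      ultimately show ?thesis by (simp add: sum_distrib_left sum_negf mult.assoc)
    qed
    have "P (J - {j0})" unfolding P_def
    proof (intro conjI ballI)
      show "J - {j0} \<subseteq> {..<N0}" using J(1) by (auto simp: P_def)
      fix w assume "w \<in> W"
      with Jgen have "\<exists>x. \<forall>i. w i = (\<Sum>j\<in>J. x j * z j i)" by (rule bspec)
      then obtain t where t0: "\<forall>i. w i = (\<Sum>j\<in>J. t j * z j i)" by (rule exE)
      then have t: "w i = (\<Sum>j\<in>J. t j * z j i)" for i by (rule spec)
      have "w i = (\<Sum>j\<in>J - {j0}. (t j0 * (- ?b * x' j) + t j) * z j i)" for i
      proof -
        have "w i = t j0 * z j0 i + (\<Sum>j\<in>J - {j0}. t j * z j i)"
          unfolding t by (rule sum.remove[OF fJ j0])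
        then show ?thesis
          by (simp only: zj0 sum_distrib_left sum.distrib[symmetric] distrib_right mult.assoc)
      qed
      then show "\<exists>x. \<forall>i. w i = (\<Sum>j\<in>J - {j0}. x j * z j i)"
        by (intro exI[of _ "\<lambda>j. t j0 * (- ?b * x' j) + t j"] allI)
    qed
    then have "card J \<le> card (J - {j0})" by (rule J(2))
    then show False using fJ j0 by (meson card_Diff1_less not_le)
  qed
  obtain h where h: "bij_betw h {..<card J} J" using ex_bij_betw_nat_finite[OF fJ] by (auto simp: atLeast0LessThan)
  have hJ: "h j \<in> J" "h j < N0" if "j < card J" for j
    using h that J(1) by (auto simp: bij_betw_def P_def)
  show ?thesis
  proof (rule exI[of _ "card J"], rule exI[of _ "\<lambda>j. z (h j)"], rule exI[of _ "\<lambda>j. e (h j)"],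
      intro conjI allI impI ballI)
    show "z (h j) \<in> W" "vhom \<delta> (e (h j)) (z (h j))" if "j < card J" for j
      using z hJ[OF that] by auto
    show "\<exists>x. \<forall>i. w i = (\<Sum>j<card J. x j * z (h j) i)" if "w \<in> W" for w
    proof -
      from Jgen that have "\<exists>x. \<forall>i. w i = (\<Sum>j\<in>J. x j * z j i)" by (rule bspec)
      then obtain x where "\<forall>i. w i = (\<Sum>j\<in>J. x j * z j i)" by (rule exE)
      then have "\<forall>i. w i = (\<Sum>j<card J. x (h j) * z (h j) i)"
        using sum.reindex_bij_betw[OF h, of "\<lambda>b. x b * z b _"] by simp
      then show ?thesis by (intro exI[of _ "\<lambda>j. x (h j)"])
    qed
    show "c0 (x j) = 0" if x: "\<forall>i. (\<Sum>j<card J. x j * z (h j) i) = 0" and j: "j < card J" for x j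
    proof -
      let ?g = "the_inv_into {..<card J} h"
      have g: "?g (h j) = j" if "j < card J" for j
        using h that by (intro the_inv_into_f_f) (auto simp: bij_betw_def)
      have "(\<Sum>b\<in>J. x (?g b) * z b i) = 0" for i
      proof -
        have "(\<Sum>b\<in>J. x (?g b) * z b i) = (\<Sum>j<card J. x (?g (h j)) * z (h j) i)"
          by (rule sum.reindex_bij_betw[OF h, symmetric])
        also have "\<dots> = (\<Sum>j<card J. x j * z (h j) i)" by (intro sum.cong) (auto simp: g)
        finally show ?thesis using x by simp
      qed
      then have "c0 (x (?g (h j))) = 0" using rel[of "\<lambda>b. x (?g b)" "h j"] hJ(1)[OF j] by blast
      then show ?thesis by (simp add: g j)
    qed
  qed
qed

section \<open>Koszul arguments\<close>

lemma cross_orthogonal: "(\<Sum>a\<in>UNIV. (u a :: 'a::comm_ring_1) * cross u v a) = 0"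
  using three_distinct by (simp add: sum_three cross_def algebra_simps)


lemma cross_diff: "cross u (\<lambda>a. v a - w a) a = cross u v a - cross u w a"
  by (simp add: cross_def algebra_simps)

lemma cross_sum: "cross u (\<lambda>a. \<Sum>i\<in>A. c i * v i a) a = (\<Sum>i\<in>A. c i * cross u (v i) a)"
  for c :: "'i \<Rightarrow> 'a::comm_ring_1"
  by (simp add: cross_def sum_distrib_left sum_subtractf algebra_simps)

lemma cross_scale: "cross u (\<lambda>a. c * v a) a = c * cross u v a" for c :: "'a::comm_ring_1"
  by (simp add: cross_def algebra_simps)

lemma cross_self: "cross u (\<lambda>a. u a * c) a = 0" for c :: "'a::comm_ring_1"
  by (simp add: cross_def algebra_simps)

lemma cross_eq_0:
  fixes v :: "3 \<Rightarrow> 'k::field poly3"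
  assumes "\<And>a. cross var3 v a = 0"
  obtains u where "\<And>a. v a = var3 a * u"
proof (rule koszul_parallel)
  have "\<forall>a b. var3 b * v a = var3 a * v b"
    unfolding all_three using assms[of 0] assms[of 1] assms[of 2] three_distinct
    by (simp add: cross_def)
  then show "var3 b * v a = var3 a * v b" for a b by blast
qed (use that in blast)

lemma homz_cross:
  assumes "\<And>a. homz d (v a)"
  shows "homz (d + 1) (cross var3 v a)"
proof -
  have "homz (d + 1) (var3 b * v c)" for b c
    using homz_mult[OF homz_var3[of b] assms[of c]] by (simp add: add.commute)
  then show ?thesis by (auto simp: cross_def intro: homz_diff)
qed

lemma hc_cross: "hc d (cross var3 v a) = cross var3 (\<lambda>a. hc (d - 1) (v a)) a"
  by (simp add: cross_def hc_diff hc_mult'[OF homz_var3])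

text \<open>Depth: the cokernel of a matrix whose kernel is cyclic has no socle.\<close>

lemma image_saturated:
  fixes A :: "nat \<Rightarrow> nat \<Rightarrow> 'k::field poly3"
  assumes ker: "\<And>x. (\<And>i. i < p \<Longrightarrow> (\<Sum>j<q. A i j * x j) = 0) \<Longrightarrow> \<exists>r. \<forall>j<q. x j = r * g j"
    and Xg: "\<And>i. i < p \<Longrightarrow> (\<Sum>j<q. A i j * g j) = 0"
    and w: "\<And>a i. i < p \<Longrightarrow> var3 a * z i = (\<Sum>j<q. A i j * w a j)"
  shows "\<exists>u. \<forall>i<p. z i = (\<Sum>j<q. A i j * u j)"
proof -
  \<comment> \<open>The matrix maps the cross product of the variables with \<open>w\<close> to the
    cross product of the variables with their own multiple \<open>var3 a * z i\<close>, which is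
    zero. So these vectors lie in the kernel and are multiples of \<open>g\<close>.\<close>
  have "(\<Sum>j<q. A i j * cross var3 (\<lambda>a. w a j) c) = 0" if "i < p" for i c
  proof -
    have "(\<Sum>j<q. A i j * cross var3 (\<lambda>a. w a j) c) = cross var3 (\<lambda>a. \<Sum>j<q. A i j * w a j) c"
      by (simp add: cross_sum)
    also have "(\<lambda>a. \<Sum>j<q. A i j * w a j) = (\<lambda>a. var3 a * z i)" using w[OF that] by simp
    finally show ?thesis by (simp add: cross_self)
  qed
  then have "\<forall>c. \<exists>r. \<forall>j<q. cross var3 (\<lambda>a. w a j) c = r * g j"
    by (intro allI ker)
  then obtain r0 where r0: "\<And>c j. j < q \<Longrightarrow> cross var3 (\<lambda>a. w a j) c = r0 c * g j" by metis
  obtain r where r: "\<And>c j. j < q \<Longrightarrow> cross var3 (\<lambda>a. w a j) c = r c * g j"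
    and rc: "(\<Sum>c\<in>UNIV. var3 c * r c) = 0"
  proof (cases "\<exists>j<q. g j \<noteq> 0")
    case True
    then obtain j where j: "j < q" "g j \<noteq> 0" by blast
    have "(\<Sum>c\<in>UNIV. var3 c * r0 c) * g j = (\<Sum>c\<in>UNIV. var3 c * cross var3 (\<lambda>a. w a j) c)"
      using r0[OF j(1)] by (simp add: sum_distrib_right mult.assoc)
    then have "(\<Sum>c\<in>UNIV. var3 c * r0 c) = 0" using j(2) by (simp add: cross_orthogonal)
    then show ?thesis using r0 that by blast
  next
    case False
    then show ?thesis using r0 that[of "\<lambda>_. 0"] by auto
  qed
  \<comment> \<open>The multipliers \<open>r\<close> are themselves a cross product with the
    variables. Subtracting \<open>g j * t a\<close>, which the matrix kills, makes \<open>w\<close>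
    parallel to the variables; the quotient \<open>u\<close> is the preimage of
    \<open>z\<close>.\<close>
  obtain t where t: "\<And>a. r a = cross var3 t a" using koszul_orthogonal[OF rc] by blast
  have "\<exists>u. \<forall>a. w a j - g j * t a = var3 a * u" if "j < q" for j
  proof -
    have "cross var3 (\<lambda>a. w a j - g j * t a) c = 0" for c
      by (simp add: cross_diff cross_scale r[OF that] t)
    from cross_eq_0[OF this] show ?thesis by blast
  qed
  then obtain u where u: "\<And>a j. j < q \<Longrightarrow> w a j - g j * t a = var3 a * u j" by metis
  have "z i = (\<Sum>j<q. A i j * u j)" if "i < p" for i
  proof -
    have "var3 0 * z i = (\<Sum>j<q. A i j * (var3 0 * u j + g j * t 0))"
      unfolding w[OF that] by (intro sum.cong refl) (use u[of _ 0] in \<open>auto simp: algebra_simps\<close>)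
    also have "\<dots> = var3 0 * (\<Sum>j<q. A i j * u j) + (\<Sum>j<q. A i j * g j) * t 0"
      by (simp add: distrib_left sum.distrib sum_distrib_left sum_distrib_right mult_ac)
    finally show ?thesis using Xg[OF that] by simp
  qed
  then show ?thesis by blast
qed

text \<open>Multiples by monomials with some exponent \<open>K\<close> satisfy \<open>P\<close> by
  \<open>pow\<close>. From there \<open>sat\<close> removes one variable at a time, by induction on
  the total distance \<open>t\<close> of the exponents from \<open>K\<close>.\<close>

lemma saturated_power:
  fixes K :: nat
  assumes sat: "\<And>z. (\<And>a. P (\<lambda>i. var3 a * z i)) \<Longrightarrow> P z"
    and mult: "\<And>r z. P z \<Longrightarrow> P (\<lambda>i. r * (z i :: 'k::field poly3))"
    and pow: "\<And>a. P (\<lambda>i. var3 a ^ K * z i)"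
  shows "P z"
proof -
  have "P (\<lambda>i. var3 0 ^ b * var3 1 ^ c * var3 2 ^ d * z i)"
    if "b \<le> K" "c \<le> K" "d \<le> K" "3 * K \<le> b + c + d + t" for b c d t
    using that
  proof (induction t arbitrary: b c d)
    case 0
    then have "b = K" by linarith
    have "P (\<lambda>i. var3 1 ^ c * var3 2 ^ d * (var3 0 ^ K * z i))" by (rule mult[OF pow])
    then show ?case using \<open>b = K\<close> by (simp add: mult_ac)
  next
    case (Suc t)
    show ?case
    proof (cases "b = K \<or> c = K \<or> d = K")
      case True
      have "P (\<lambda>i. var3 1 ^ c * var3 2 ^ d * (var3 0 ^ K * z i))"
        "P (\<lambda>i. var3 0 ^ b * var3 2 ^ d * (var3 1 ^ K * z i))"
        "P (\<lambda>i. var3 0 ^ b * var3 1 ^ c * (var3 2 ^ K * z i))" by (rule mult[OF pow])+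
      then show ?thesis using True by (auto simp: mult_ac)
    next
      case False
      show ?thesis
      proof (rule sat)
        have "P (\<lambda>i. var3 0 ^ Suc b * var3 1 ^ c * var3 2 ^ d * z i)"
          "P (\<lambda>i. var3 0 ^ b * var3 1 ^ Suc c * var3 2 ^ d * z i)"
          "P (\<lambda>i. var3 0 ^ b * var3 1 ^ c * var3 2 ^ Suc d * z i)"
          by (rule Suc.IH; use False Suc.prems in linarith)+
        then have "\<forall>a. P (\<lambda>i. var3 a * (var3 0 ^ b * var3 1 ^ c * var3 2 ^ d * z i))"
          unfolding all_three by (simp add: mult_ac)
        then show "P (\<lambda>i. var3 a * (var3 0 ^ b * var3 1 ^ c * var3 2 ^ d * z i))" for a by blast
      qed
    qed
  qed
  from this[of 0 0 0 "3 * K"] show ?thesis by simp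
qed

text \<open>Depth two: the generators have no common factor.\<close>

lemma proportional_multiple:
  fixes f x :: "nat \<Rightarrow> 'k::field poly3"
  assumes pr: "\<And>i j. i < n \<Longrightarrow> j < n \<Longrightarrow> f i * x j = f j * x i"
    and pow: "\<And>a. \<exists>r. var3 a ^ K = (\<Sum>i<n. r i * f i)"
  shows "\<exists>r. \<forall>j<n. x j = r * f j"
proof -
  \<comment> \<open>Substituting the expansion of the power in terms of \<open>f\<close> and using
    \<open>pr\<close> to exchange indices pulls out the factor \<open>f j\<close>.\<close>
  have "\<exists>\<rho>. \<forall>j<n. var3 a ^ K * x j = \<rho> * f j" for a
  proof -
    obtain r where r: "var3 a ^ K = (\<Sum>i<n. r i * f i)" using pow by blast
    have "var3 a ^ K * x j = (\<Sum>i<n. r i * x i) * f j" if "j < n" for j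
    proof -
      have "var3 a ^ K * x j = (\<Sum>i<n. r i * (f i * x j))"
        by (simp add: r sum_distrib_right mult.assoc)
      also have "\<dots> = (\<Sum>i<n. r i * (f j * x i))" using pr that by simp
      finally show ?thesis by (simp add: sum_distrib_left sum_distrib_right mult_ac)
    qed
    then show ?thesis by blast
  qed
  then obtain \<rho> where \<rho>: "\<And>a j. j < n \<Longrightarrow> var3 a ^ K * x j = \<rho> a * f j" by metis
  show ?thesis
  proof (cases "\<exists>j<n. f j \<noteq> 0")
    case True
    then obtain j where j: "j < n" "f j \<noteq> 0" by blast
    \<comment> \<open>Two different variables give two multipliers for the same vector; coprimality
      of the powers divides the power out of \<open>\<rho> 0\<close>.\<close>
    have "var3 1 ^ K * (\<rho> 0 * f j) = var3 0 ^ K * (\<rho> 1 * f j)"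
      using \<rho>[OF j(1), of 0] \<rho>[OF j(1), of 1] by (metis mult.left_commute)
    then have "(var3 1 ^ K * \<rho> 0) * f j = (var3 0 ^ K * \<rho> 1) * f j" by (simp only: mult.assoc)
    then have "var3 1 ^ K * \<rho> 0 = var3 0 ^ K * \<rho> 1" using j(2) by simp
    then have "var3 0 ^ K dvd var3 1 ^ K * \<rho> 0" by simp
    then have "var3 0 ^ K dvd \<rho> 0" by (rule var3_power_dvd_var3_mult[OF three_distinct(1)])
    then obtain r where r: "\<rho> 0 = var3 0 ^ K * r" by (auto simp: dvd_def)
    have "x j = r * f j" if "j < n" for j
    proof -
      have "var3 0 ^ K * x j = var3 0 ^ K * (r * f j)" using \<rho>[OF that, of 0] by (simp add: r mult.assoc)
      then show ?thesis by simp
    qed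
    then show ?thesis by blast
  next
    case False
    then have "var3 0 ^ K * x j = 0" if "j < n" for j using \<rho>[OF that, of 0] that by simp
    then have "x j = 0" if "j < n" for j using that by fastforce
    then show ?thesis by (intro exI[of _ 0]) simp
  qed
qed

section \<open>The free resolution of a graded Artinian Gorenstein ideal\<close>

text \<open>Elementwise form of the Gorenstein property, in which \<open>high_degree\<close>
  expresses the Artinian condition. The passage from and to
  \<open>artinian_graded_gorenstein\<close> is made by \<open>gorenstein_ideal_of_agg\<close> and
  \<open>agg\<close>.\<close>

locale gorenstein_ideal =
  fixes I :: "'k::field_char_0 poly3 set" and k :: nat and s0 :: "'k poly3"
  assumes I: "ideal I ring3" and hcI: "D \<in> I \<Longrightarrow> hc d D \<in> I"
    and s0_hom: "homz (int k) s0" and s0_notin: "s0 \<notin> I" and var_s0: "var3 a * s0 \<in> I"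
    and socle_span: "(\<And>a. var3 a * r \<in> I) \<Longrightarrow> \<exists>c. r - const3 c * s0 \<in> I"
    and high_degree: "homz d p \<Longrightarrow> d > int k \<Longrightarrow> p \<in> I"
begin

lemmas I_0 = ideal3_0[OF I] and I_add = ideal3_add[OF I] and I_mult = ideal3_mult[OF I]
  and I_mult' = ideal3_mult'[OF I] and I_diff = ideal3_diff[OF I] and I_sum = ideal3_sum[OF I]
  and I_uminus = ideal3_uminus[OF I]

lemma var3_power_in: "var3 a ^ Suc k \<in> I"
  using homz_power[OF homz_var3[of a], of "Suc k"] by (rule high_degree) simp

text \<open>Among the monomials that do not multiply \<open>r\<close> into \<open>I\<close>, take
  one of largest degree. Its product with \<open>r\<close> is killed by every variable modulo
  \<open>I\<close>, so it is a nonzero multiple of the socle generator.\<close>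

lemma socle_essential:
  assumes "r \<notin> I"
  shows "\<exists>E. E * r - s0 \<in> I"
proof -
  let ?m = "\<lambda>\<alpha>. Poly_Mapping.single \<alpha> (1 :: 'k)"
  define T where "T = {\<alpha>. ?m \<alpha> * r \<notin> I}"
  have bound: "mdeg \<alpha> < Suc k" if "\<alpha> \<in> T" for \<alpha>
  proof (rule ccontr)
    assume "\<not> mdeg \<alpha> < Suc k"
    then have "?m \<alpha> \<in> I" using homz_single[of \<alpha> "1 :: 'k"] by (intro high_degree) auto
    then show False using that by (simp add: T_def I_mult')
  qed
  have "0 \<in> T" using assms by (simp add: T_def)
  then obtain \<alpha> where \<alpha>: "\<alpha> \<in> T" "\<And>\<beta>. \<beta> \<in> T \<Longrightarrow> mdeg \<beta> \<le> mdeg \<alpha>"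
    using ex_has_greatest_nat[of "\<lambda>\<alpha>. \<alpha> \<in> T" 0 mdeg "Suc k"] bound by (auto simp: less_imp_le)
  have "var3 a * (?m \<alpha> * r) \<in> I" for a
  proof -
    have "Poly_Mapping.single a 1 + \<alpha> \<notin> T" using \<alpha>(2)[of "Poly_Mapping.single a 1 + \<alpha>"] by (auto simp: mdeg_add)
    then have "?m (Poly_Mapping.single a 1 + \<alpha>) * r \<in> I" by (simp add: T_def)
    moreover have "?m (Poly_Mapping.single a 1 + \<alpha>) = var3 a * ?m \<alpha>" by (simp add: var3_def mult_single)
    ultimately show ?thesis by (simp add: mult.assoc)
  qed
  from socle_span[OF this] obtain c where c: "?m \<alpha> * r - const3 c * s0 \<in> I" by (rule exE)
  have "c \<noteq> 0" using c \<alpha>(1) by (auto simp: T_def)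
  have "const3 (1 / c) * (?m \<alpha> * r - const3 c * s0) = const3 (1 / c) * ?m \<alpha> * r - const3 (1 / c * c) * s0"
    by (simp only: right_diff_distrib mult.assoc const3_mult)
  then have "const3 (1 / c) * ?m \<alpha> * r - s0 \<in> I"
    using I_mult[OF c, of "const3 (1 / c)"] \<open>c \<noteq> 0\<close> by simp
  then show ?thesis by (rule exI[of _ "const3 (1 / c) * ?m \<alpha>"])
qed

lemma ideal_minimal_generators:
  "\<exists>(n :: nat) f d. (\<forall>i<n. f i \<in> I \<and> homz (d i) (f i)) \<and> (\<forall>p\<in>I. \<exists>r. p = (\<Sum>i<n. r i * f i)) \<and>
    (\<forall>r. (\<Sum>i<n. r i * f i) = 0 \<longrightarrow> (\<forall>i<n. c0 (r i) = 0))"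
proof -
  \<comment> \<open>The ideal is treated as a submodule of the free module of rank one, supported in
    coordinate 0.\<close>
  define W where "W = {z :: nat \<Rightarrow> 'k poly3. z 0 \<in> I \<and> (\<forall>i\<ge>1. z i = 0)}"
  define \<delta> where "\<delta> = (\<lambda>_ :: nat. 0 :: int)"
  have "\<exists>(N :: nat) z e. (\<forall>j<N. z j \<in> W \<and> vhom \<delta> (e j) (z j)) \<and>
    (\<forall>w\<in>W. \<exists>x. \<forall>i. w i = (\<Sum>j<N. x j * z j i)) \<and>
    (\<forall>x. (\<forall>i. (\<Sum>j<N. x j * z j i) = 0) \<longrightarrow> (\<forall>j<N. c0 (x j) = 0))"
  \<comment> \<open>The bound k + 1 lies one above the socle degree: the quotients
    \<open>q a\<close> then have degree e - 1 > k and belong to the ideal by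
    \<open>high_degree\<close>.\<close>
  proof (rule minimal_graded_generators[of W 1 \<delta> "int k + 1"])
    show "z i = 0" if "z \<in> W" "i \<ge> 1" for z i using that by (simp add: W_def)
    show "(\<lambda>i. z i + z' i) \<in> W" if "z \<in> W" "z' \<in> W" for z z' using that by (simp add: W_def I_add)
    show "(\<lambda>i. r * z i) \<in> W" if "z \<in> W" for z r using that by (simp add: W_def I_mult)
    show "vcomp \<delta> e z \<in> W" if "z \<in> W" for z e using that by (simp add: W_def vcomp_def hcI)
    fix z e assume z: "z \<in> W" "vhom \<delta> e z" "int k + 1 < e"
    then have h: "homz e (z 0)" by (simp add: vhom_def \<delta>_def)
    then have "c0 (z 0) = 0" using z(3) by (intro c0_homz) auto
    from c0_eq_0_homz[OF this h] obtain q where q: "z 0 = (\<Sum>a\<in>UNIV. var3 a * q a)" "\<And>a. homz (e - 1) (q a)"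
      by metis
    have "q a \<in> I" for a using q(2) by (rule high_degree) (use z(3) in simp)
    moreover have "z i = (\<Sum>a\<in>UNIV. var3 a * (if i = 0 then q a else 0))" for i
      using z(1) q(1) by (cases "i = 0") (auto simp: W_def)
    ultimately show "\<exists>\<zeta>. (\<forall>a. \<zeta> a \<in> W) \<and> (\<forall>i. z i = (\<Sum>a\<in>UNIV. var3 a * \<zeta> a i))"
      by (intro exI[of _ "\<lambda>a i. if i = 0 then q a else 0"] conjI allI) (simp_all add: W_def)
  qed
  then obtain N :: nat and z e where 1: "\<forall>j<N. z j \<in> W \<and> vhom \<delta> (e j) (z j)"
    and 2: "\<forall>w\<in>W. \<exists>x. \<forall>i. w i = (\<Sum>j<N. x j * z j i)"
    and 3: "\<forall>x. (\<forall>i. (\<Sum>j<N. x j * z j i) = 0) \<longrightarrow> (\<forall>j<N. c0 (x j) = 0)"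
    by (elim exE conjE) (rule that)
  show ?thesis
  proof (rule exI[of _ N], rule exI[of _ "\<lambda>j. z j 0"], rule exI[of _ e], intro conjI allI impI ballI)
    show "z i 0 \<in> I" "homz (e i) (z i 0)" if "i < N" for i
      using 1 that by (auto simp: W_def vhom_def \<delta>_def)
    show "\<exists>r. p = (\<Sum>i<N. r i * z i 0)" if "p \<in> I" for p
    proof -
      have "(\<lambda>i. if i = 0 then p else 0) \<in> W" using that by (simp add: W_def)
      with 2 have "\<exists>x. \<forall>i. (\<lambda>i. if i = 0 then p else 0) i = (\<Sum>j<N. x j * z j i)" by (rule bspec)
      then obtain x where x: "\<forall>i. (\<lambda>i. if i = 0 then p else 0) i = (\<Sum>j<N. x j * z j i)" by (rule exE)
      have "p = (\<Sum>j<N. x j * z j 0)" using spec[OF x, of 0] by simp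
      then show ?thesis by (rule exI[of _ x])
    qed
    fix r i assume r: "(\<Sum>i<N. r i * z i 0) = 0" "i < N"
    have "(\<Sum>j<N. r j * z j i) = 0" for i
    proof (cases "i = 0")
      case False
      then have "z j i = 0" if "j < N" for j using 1 that by (auto simp: W_def)
      then show ?thesis by simp
    qed (simp add: r)
    then show "c0 (r i) = 0" using 3 r(2) by simp
  qed
qed

text \<open>If \<open>f\<close> generates \<open>I\<close>, \<open>Phi\<close> generates the syzygies of \<open>f\<close> and \<open>g\<close> generates the syzygies of
  \<open>Phi\<close>, then the degree of \<open>g\<close> is read off by lifting the socle through the Koszul complex.\<close>

lemma socle_degree:
  fixes f g :: "nat \<Rightarrow> 'k poly3" and Phi :: "nat \<Rightarrow> nat \<Rightarrow> 'k poly3" and n N :: nat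
  assumes fI: "\<And>i. i < n \<Longrightarrow> f i \<in> I" and fd: "\<And>i. i < n \<Longrightarrow> homz (d i) (f i)"
    and gen: "\<And>p. p \<in> I \<Longrightarrow> \<exists>r. p = (\<Sum>i<n. r i * f i)"
    and Ph: "\<And>i j. i < n \<Longrightarrow> j < N \<Longrightarrow> homz (e j - d i) (Phi i j)"
    and Pf: "\<And>j. j < N \<Longrightarrow> (\<Sum>i<n. f i * Phi i j) = 0"
    and syz: "\<And>z. (\<Sum>i<n. f i * z i) = 0 \<Longrightarrow> \<exists>x. \<forall>i<n. z i = (\<Sum>j<N. Phi i j * x j)"
    and ker: "\<And>x. (\<forall>i<n. (\<Sum>j<N. Phi i j * x j) = 0) \<Longrightarrow> \<exists>r. \<forall>j<N. x j = r * g j"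
    and Pg: "\<And>i. i < n \<Longrightarrow> (\<Sum>j<N. Phi i j * g j) = 0"
    and gd: "\<And>j. j < N \<Longrightarrow> homz (\<gamma> - e j) (g j)"
  shows "(\<exists>j<N. g j \<noteq> 0) \<and> \<gamma> = int k + 3"
proof -
  have "\<exists>v. (\<forall>i<n. homz (int k + 1 - d i) (v i)) \<and> var3 a * s0 = (\<Sum>i<n. f i * v i)" for a
  proof -
    obtain r where r: "var3 a * s0 = (\<Sum>i<n. r i * f i)" using gen[OF var_s0[of a]] by (rule exE)
    have "homz (1 + int k) (var3 a * s0)" by (intro homz_mult homz_var3 s0_hom)
    then have "var3 a * s0 = hc (int k + 1) (var3 a * s0)" by (simp add: hc_self add.commute)
    also have "\<dots> = (\<Sum>i<n. hc (int k + 1 - d i) (r i) * f i)"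
      unfolding r hc_sum by (intro sum.cong refl) (simp add: hc_mult[OF fd])
    finally show ?thesis
      by (intro exI[of _ "\<lambda>i. hc (int k + 1 - d i) (r i)"]) (simp add: mult.commute)
  qed
  then have "\<forall>a. \<exists>v. (\<forall>i<n. homz (int k + 1 - d i) (v i)) \<and> var3 a * s0 = (\<Sum>i<n. f i * v i)" by (rule allI)
  from choice[OF this] obtain v where v: "\<And>a i. i < n \<Longrightarrow> homz (int k + 1 - d i) (v a i)"
    "\<And>a. var3 a * s0 = (\<Sum>i<n. f i * v a i)" by auto
  \<comment> \<open>Since \<open>f\<close> pairs with \<open>v\<close> to a multiple of the vector
    of variables, it pairs to zero with the cross product of the variables with \<open>v\<close>;
    this syzygy lifts through \<open>Phi\<close>.\<close>
  have "\<exists>x. (\<forall>j<N. homz (int k + 2 - e j) (x j)) \<and>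
      (\<forall>i<n. cross var3 (\<lambda>a. v a i) c = (\<Sum>j<N. Phi i j * x j))" for c
  proof -
    have "(\<Sum>i<n. f i * cross var3 (\<lambda>a. v a i) c) = cross var3 (\<lambda>a. var3 a * s0) c"
      unfolding v(2) cross_sum ..
    then have "(\<Sum>i<n. f i * cross var3 (\<lambda>a. v a i) c) = 0" by (simp add: cross_self)
    from syz[OF this] obtain x where x: "\<And>i. i < n \<Longrightarrow> cross var3 (\<lambda>a. v a i) c = (\<Sum>j<N. Phi i j * x j)" by auto
    have "cross var3 (\<lambda>a. v a i) c = (\<Sum>j<N. Phi i j * hc (int k + 2 - e j) (x j))" if i: "i < n" for i
    proof -
      have "homz (int k + 1 - d i + 1) (cross var3 (\<lambda>a. v a i) c)" by (rule homz_cross) (rule v(1)[OF i])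
      then have "cross var3 (\<lambda>a. v a i) c = hc (int k + 2 - d i) (\<Sum>j<N. Phi i j * x j)"
        using x[OF i] by (simp add: hc_self algebra_simps)
      also have "\<dots> = (\<Sum>j<N. Phi i j * hc (int k + 2 - e j) (x j))"
        unfolding hc_sum by (intro sum.cong refl, subst hc_mult'[OF Ph[OF i]]) (simp_all add: algebra_simps)
      finally show ?thesis .
    qed
    then show ?thesis by (intro exI[of _ "\<lambda>j. hc (int k + 2 - e j) (x j)"]) simp
  qed
  then have "\<forall>c. \<exists>x. (\<forall>j<N. homz (int k + 2 - e j) (x j)) \<and>
      (\<forall>i<n. cross var3 (\<lambda>a. v a i) c = (\<Sum>j<N. Phi i j * x j))" by (rule allI)
  from choice[OF this] obtain x where x: "\<And>c j. j < N \<Longrightarrow> homz (int k + 2 - e j) (x c j)"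
      "\<And>c i. i < n \<Longrightarrow> cross var3 (\<lambda>a. v a i) c = (\<Sum>j<N. Phi i j * x c j)" by auto
  have "(\<Sum>j<N. Phi i j * (\<Sum>c\<in>UNIV. var3 c * x c j)) = 0" if i: "i < n" for i
  proof -
    have "(\<Sum>j<N. Phi i j * (\<Sum>c\<in>UNIV. var3 c * x c j)) = (\<Sum>c\<in>UNIV. var3 c * (\<Sum>j<N. Phi i j * x c j))"
      unfolding sum_distrib_left by (subst sum.swap) (simp add: mult.left_commute)
    then show ?thesis by (simp add: x(2)[OF i, symmetric] cross_orthogonal)
  qed
  then obtain q where q: "\<And>j. j < N \<Longrightarrow> (\<Sum>c\<in>UNIV. var3 c * x c j) = q * g j"
    using ker[of "\<lambda>j. \<Sum>c\<in>UNIV. var3 c * x c j"] by auto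
  \<comment> \<open>With a multiplier in the maximal ideal the lifting can be undone: subtracting
    \<open>p c * g j\<close> makes \<open>x\<close> a cross product, then \<open>v\<close> differs
    from a syzygy by a multiple of the variables, and cancelling one variable puts the socle
    generator into \<open>I\<close>.\<close>
  have no: False if c0q: "c0 q' = 0" and q': "\<And>j. j < N \<Longrightarrow> (\<Sum>c\<in>UNIV. var3 c * x c j) = q' * g j" for q'
  proof -
    obtain p where p: "q' = (\<Sum>a\<in>UNIV. var3 a * p a)" using c0q unfolding c0_eq_0_iff by (rule exE)
    have "\<exists>w. \<forall>c. x c j - p c * g j = cross var3 w c" if j: "j < N" for j
    proof -
      have "(\<Sum>c\<in>UNIV. var3 c * (x c j - p c * g j)) = 0"
        by (simp add: right_diff_distrib sum_subtractf q'[OF j] p sum_distrib_right mult.assoc)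
      from koszul_orthogonal[OF this] show ?thesis by metis
    qed
    then obtain w where w: "\<And>c j. j < N \<Longrightarrow> x c j - p c * g j = cross var3 (w j) c" by metis
    define y where "y a i = (\<Sum>j<N. Phi i j * w j a)" for a i
    have "\<exists>t. \<forall>a. v a i - y a i = var3 a * t" if i: "i < n" for i
    proof -
      have "cross var3 (\<lambda>a. v a i) c = cross var3 (\<lambda>a. y a i) c" for c
      proof -
        have "cross var3 (\<lambda>a. v a i) c = (\<Sum>j<N. Phi i j * (cross var3 (w j) c + p c * g j))"
          unfolding x(2)[OF i] by (intro sum.cong refl) (use w in \<open>auto simp: algebra_simps\<close>)
        also have "\<dots> = cross var3 (\<lambda>a. y a i) c + p c * (\<Sum>j<N. Phi i j * g j)"
          by (simp add: y_def cross_sum distrib_left sum.distrib sum_distrib_left mult.left_commute)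
        finally show ?thesis using Pg[OF i] by simp
      qed
      then have "cross var3 (\<lambda>a. v a i - y a i) c = 0" for c by (simp add: cross_diff)
      from cross_eq_0[OF this] show ?thesis by metis
    qed
    then obtain t where t: "\<And>i a. i < n \<Longrightarrow> v a i - y a i = var3 a * t i" by metis
    have "(\<Sum>i<n. f i * y 0 i) = (\<Sum>j<N. (\<Sum>i<n. f i * Phi i j) * w j 0)"
      unfolding y_def sum_distrib_left sum_distrib_right by (subst sum.swap) (simp add: mult.assoc)
    then have fy: "(\<Sum>i<n. f i * y 0 i) = 0" by (simp add: Pf)
    have "var3 0 * s0 = (\<Sum>i<n. f i * (y 0 i + var3 0 * t i))"
      unfolding v(2) by (intro sum.cong refl) (use t[of _ 0] in \<open>auto simp: algebra_simps\<close>)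
    also have "\<dots> = var3 0 * (\<Sum>i<n. t i * f i)"
      by (simp add: distrib_left sum.distrib fy sum_distrib_left mult_ac)
    finally have "s0 = (\<Sum>i<n. t i * f i)" by simp
    then show False using s0_notin fI by (auto intro: I_sum I_mult)
  qed
  have g0: "\<exists>j<N. g j \<noteq> 0"
  proof (rule ccontr)
    assume "\<not> (\<exists>j<N. g j \<noteq> 0)"
    then show False using q by (intro no[of 0]) auto
  qed
  then obtain j where j: "j < N" "g j \<noteq> 0" by blast
  \<comment> \<open>The multiplier \<open>q\<close> is homogeneous of degree k + 3 - \<gamma> and
    has a nonzero constant term, which pins down \<gamma>.\<close>
  have "homz (1 + (int k + 2 - e j)) (q * g j)"
    unfolding q[OF j(1), symmetric] by (intro homz_sum homz_mult homz_var3 x(1)[OF j(1)])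
  from homz_cancel[OF this gd[OF j(1)] j(2)] have "homz (int k + 3 - \<gamma>) q" by (simp add: algebra_simps)
  moreover have "c0 q \<noteq> 0" using no q by blast
  ultimately have "int k + 3 - \<gamma> = 0" using c0_homz by blast
  then show ?thesis using g0 by simp
qed

end

locale gorenstein_generators = gorenstein_ideal I k s0
  for I :: "'k::field_char_0 poly3 set" and k s0 +
  fixes n :: nat and f :: "nat \<Rightarrow> 'k poly3" and d :: "nat \<Rightarrow> int"
  assumes f_in: "i < n \<Longrightarrow> f i \<in> I" and f_hom: "i < n \<Longrightarrow> homz (d i) (f i)"
    and f_gen: "p \<in> I \<Longrightarrow> \<exists>r. p = (\<Sum>i<n. r i * f i)"
    and f_min: "(\<Sum>i<n. r i * f i) = 0 \<Longrightarrow> i < n \<Longrightarrow> c0 (r i) = 0"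
begin

lemma f_nonzero: "i < n \<Longrightarrow> f i \<noteq> 0"
proof
  assume i: "i < n" "f i = 0"
  have "(\<Sum>j<n. (if j = i then 1 else 0) * f j) = 0" using i(2) by (intro sum.neutral) auto
  from f_min[OF this i(1)] show False by simp
qed

lemma n_pos: "n > 0"
proof (rule ccontr)
  assume "\<not> n > 0"
  then have "var3 0 ^ Suc k = (0 :: 'k poly3)" using f_gen[OF var3_power_in[of 0]] by auto
  then show False by simp
qed

text \<open>Syzygies of degree above k + 2 are not minimal. By \<open>f_min\<close> their entries
  split along the variables; pairing the parts with \<open>f\<close> gives a Koszul cycle
  \<open>u\<close>, so a cross product with some \<open>h\<close> of degree above k. Then
  \<open>h\<close> lies in the ideal, and its expansion in \<open>f\<close> corrects the parts to
  syzygies.\<close>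

lemma syzygy_minimal_generators:
  "\<exists>(N :: nat) Phi e. (\<forall>j<N. (\<Sum>i<n. f i * Phi i j) = 0 \<and> (\<forall>i. homz (e j - d i) (Phi i j))) \<and>
    (\<forall>z. (\<Sum>i<n. f i * z i) = 0 \<longrightarrow> (\<exists>x. \<forall>i<n. z i = (\<Sum>j<N. Phi i j * x j))) \<and>
    (\<forall>x. (\<forall>i<n. (\<Sum>j<N. Phi i j * x j) = 0) \<longrightarrow> (\<forall>j<N. c0 (x j) = 0))"
proof -
  define W where "W = {z :: nat \<Rightarrow> 'k poly3. (\<Sum>i<n. f i * z i) = 0 \<and> (\<forall>i\<ge>n. z i = 0)}"
  have "\<exists>(N :: nat) z e. (\<forall>j<N. z j \<in> W \<and> vhom d (e j) (z j)) \<and>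
    (\<forall>w\<in>W. \<exists>x. \<forall>i. w i = (\<Sum>j<N. x j * z j i)) \<and>
    (\<forall>x. (\<forall>i. (\<Sum>j<N. x j * z j i) = 0) \<longrightarrow> (\<forall>j<N. c0 (x j) = 0))"
  proof (rule minimal_graded_generators[of W n d "int k + 2"])
    show "z i = 0" if "z \<in> W" "i \<ge> n" for z i using that by (simp add: W_def)
    show "(\<lambda>i. z i + z' i) \<in> W" if "z \<in> W" "z' \<in> W" for z z'
      using that by (simp add: W_def distrib_left sum.distrib)
    show "(\<lambda>i. r * z i) \<in> W" if "z \<in> W" for z r
      using that by (simp add: W_def mult.left_commute[of _ r] sum_distrib_left[symmetric])
    show "vcomp d e z \<in> W" if z: "z \<in> W" for z e
    proof -
      have "(\<Sum>i<n. f i * vcomp d e z i) = hc e (\<Sum>i<n. f i * z i)"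
        unfolding hc_sum vcomp_def by (intro sum.cong refl) (simp add: hc_mult'[OF f_hom])
      then show ?thesis using z by (simp add: W_def vcomp_def)
    qed
    fix z e assume z: "z \<in> W" "vhom d e z" "int k + 2 < e"
    have zf: "(\<Sum>i<n. f i * z i) = 0" using z(1) by (simp add: W_def)
    have "\<exists>q. z i = (\<Sum>a\<in>UNIV. var3 a * q a) \<and> (\<forall>a. homz (e - d i - 1) (q a))" if i: "i < n" for i
    proof -
      have "c0 (z i) = 0" using zf i by (intro f_min) (simp add: mult.commute)
      moreover have "homz (e - d i) (z i)" using z(2) by (simp add: vhom_def)
      ultimately show ?thesis using c0_eq_0_homz by metis
    qed
    then obtain q where q: "\<And>i. i < n \<Longrightarrow> z i = (\<Sum>a\<in>UNIV. var3 a * q i a)"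
      "\<And>i a. i < n \<Longrightarrow> homz (e - d i - 1) (q i a)" by metis
    define u where "u a = (\<Sum>i<n. f i * q i a)" for a
    have uh: "homz (e - 1) (u a)" for a
      unfolding u_def
    proof (rule homz_sum)
      show "homz (e - 1) (f i * q i a)" if "i \<in> {..<n}" for i
        using homz_mult[OF f_hom q(2), of i i a] that by (simp add: algebra_simps)
    qed
    have "(\<Sum>a\<in>UNIV. var3 a * u a) = (\<Sum>i<n. f i * z i)"
      unfolding u_def sum_distrib_left by (subst sum.swap) (simp add: q(1) sum_distrib_left mult.left_commute)
    then have "(\<Sum>a\<in>UNIV. var3 a * u a) = 0" using zf by simp
    from koszul_orthogonal[OF this] obtain h0 where h0: "\<And>a. u a = cross var3 h0 a" by metis
    define h where "h a = hc (e - 2) (h0 a)" for a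
    have h: "u a = cross var3 h a" for a
    proof -
      have "u a = hc (e - 1) (u a)" using uh by (simp add: hc_self)
      also have "\<dots> = cross var3 h a" unfolding h0 hc_cross h_def by simp
      finally show ?thesis .
    qed
    have "h a \<in> I" for a using z(3) by (intro high_degree[of "e - 2"]) (auto simp: h_def)
    then have "\<forall>a. \<exists>r. h a = (\<Sum>i<n. r i * f i)" using f_gen by blast
    from choice[OF this] obtain v where v: "\<And>a. h a = (\<Sum>i<n. v a i * f i)" by auto
    define \<zeta> where "\<zeta> a i = (if i < n then q i a - cross var3 (\<lambda>b. v b i) a else 0)" for a i
    have "\<zeta> a \<in> W" for a
    proof -
      have "(\<Sum>i<n. f i * \<zeta> a i) = u a - (\<Sum>i<n. f i * cross var3 (\<lambda>b. v b i) a)"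
        by (simp add: \<zeta>_def u_def right_diff_distrib sum_subtractf)
      also have "(\<Sum>i<n. f i * cross var3 (\<lambda>b. v b i) a) = cross var3 (\<lambda>b. \<Sum>i<n. f i * v b i) a"
        by (rule cross_sum[symmetric])
      also have "(\<lambda>b. \<Sum>i<n. f i * v b i) = h" by (rule ext) (simp add: v mult.commute)
      finally show ?thesis by (simp add: W_def h \<zeta>_def)
    qed
    moreover have "z i = (\<Sum>a\<in>UNIV. var3 a * \<zeta> a i)" for i
    proof (cases "i < n")
      case True
      have "(\<Sum>a\<in>UNIV. var3 a * \<zeta> a i) = z i - (\<Sum>a\<in>UNIV. var3 a * cross var3 (\<lambda>b. v b i) a)"
        using True by (simp add: \<zeta>_def right_diff_distrib sum_subtractf q(1))
      then show ?thesis by (simp add: cross_orthogonal)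
    next
      case False
      then show ?thesis using z(1) by (simp add: W_def \<zeta>_def)
    qed
    ultimately show "\<exists>\<zeta>. (\<forall>a. \<zeta> a \<in> W) \<and> (\<forall>i. z i = (\<Sum>a\<in>UNIV. var3 a * \<zeta> a i))"
      by (intro exI[of _ \<zeta>] conjI allI)
  qed
  then obtain N :: nat and z e where 1: "\<forall>j<N. z j \<in> W \<and> vhom d (e j) (z j)"
    and 2: "\<forall>w\<in>W. \<exists>x. \<forall>i. w i = (\<Sum>j<N. x j * z j i)"
    and 3: "\<forall>x. (\<forall>i. (\<Sum>j<N. x j * z j i) = 0) \<longrightarrow> (\<forall>j<N. c0 (x j) = 0)"
    by (elim exE conjE) (rule that)
  show ?thesis
  proof (rule exI[of _ N], rule exI[of _ "\<lambda>i j. z j i"], rule exI[of _ e], intro conjI allI impI)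
    show "(\<Sum>i<n. f i * z j i) = 0" if "j < N" for j using 1 that by (simp add: W_def)
    show "homz (e j - d i) (z j i)" if "j < N" for i j using 1 that by (simp add: vhom_def)
    show "\<exists>x. \<forall>i<n. w i = (\<Sum>j<N. z j i * x j)" if w: "(\<Sum>i<n. f i * w i) = 0" for w
    proof -
      define w' where "w' i = (if i < n then w i else 0)" for i
      have "w' \<in> W" using w by (simp add: W_def w'_def)
      with 2 have "\<exists>x. \<forall>i. w' i = (\<Sum>j<N. x j * z j i)" by (rule bspec)
      then obtain x where x: "\<forall>i. w' i = (\<Sum>j<N. x j * z j i)" by (rule exE)
      have "w i = (\<Sum>j<N. z j i * x j)" if "i < n" for i
        using spec[OF x, of i] that by (simp add: w'_def mult.commute)
      then show ?thesis by (intro exI[of _ x]) simp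
    qed
    fix x j assume x: "\<forall>i<n. (\<Sum>j<N. z j i * x j) = 0" "j < N"
    have "(\<Sum>j<N. x j * z j i) = 0" for i
    proof (cases "i < n")
      case True
      then show ?thesis using x(1) by (simp add: mult.commute)
    next
      case False
      then have "z j i = 0" if "j < N" for j using 1 that by (auto simp: W_def)
      then show ?thesis by simp
    qed
    then show "c0 (x j) = 0" using 3 x(2) by simp
  qed
qed

end

section \<open>The last syzygy module and the socle\<close>

locale gorenstein_resolution = gorenstein_generators I k s0 n f d
  for I :: "'k::field_char_0 poly3 set" and k s0 n f d +
  fixes N :: nat and Phi :: "nat \<Rightarrow> nat \<Rightarrow> 'k poly3" and e :: "nat \<Rightarrow> int"
  assumes Phi_syz: "j < N \<Longrightarrow> (\<Sum>i<n. f i * Phi i j) = 0"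
    and Phi_hom: "j < N \<Longrightarrow> homz (e j - d i) (Phi i j)"
    and Phi_gen: "(\<Sum>i<n. f i * z i) = 0 \<Longrightarrow> \<exists>x. \<forall>i<n. z i = (\<Sum>j<N. Phi i j * x j)"
    and Phi_min: "(\<forall>i<n. (\<Sum>j<N. Phi i j * x j) = 0) \<Longrightarrow> j < N \<Longrightarrow> c0 (x j) = 0"
begin

definition kr :: "(nat \<Rightarrow> 'k poly3) \<Rightarrow> bool" where
  "kr x \<longleftrightarrow> (\<forall>i<n. (\<Sum>j<N. Phi i j * x j) = 0)"

text \<open>\<open>lift x s\<close>: the syzygy \<open>x\<close> of \<open>Phi\<close> corresponds to \<open>s\<close> under the connecting maps of the Koszul
  complex; modulo \<open>I\<close>, such an \<open>s\<close> lies in the socle.\<close>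

definition lift :: "(nat \<Rightarrow> 'k poly3) \<Rightarrow> 'k poly3 \<Rightarrow> bool" where
  "lift x s \<longleftrightarrow> (\<exists>Y v. (\<forall>j<N. x j = (\<Sum>a\<in>UNIV. var3 a * Y a j)) \<and>
     (\<forall>a. \<forall>i<n. (\<Sum>j<N. Phi i j * Y a j) = cross var3 (\<lambda>b. v b i) a) \<and>
     (\<forall>a. (\<Sum>i<n. f i * v a i) = var3 a * s))"

text \<open>Minimality puts the entries of \<open>x\<close> in the maximal ideal. Each further stage
  of the chase is an application of Koszul exactness: first to vectors orthogonal to the variables,
  then to vectors parallel to them.\<close>

lemma lift_exists:
  assumes "kr x"
  shows "\<exists>s. lift x s"
proof -
  have "\<exists>q. x j = (\<Sum>a\<in>UNIV. var3 a * q a)" if "j < N" for j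
    using Phi_min[OF assms[unfolded kr_def] that] unfolding c0_eq_0_iff .
  then obtain q where q: "\<And>j. j < N \<Longrightarrow> x j = (\<Sum>a\<in>UNIV. var3 a * q j a)" by metis
  define \<zeta> where "\<zeta> i a = (\<Sum>j<N. Phi i j * q j a)" for i a
  have "\<exists>w. \<forall>a. \<zeta> i a = cross var3 w a" if i: "i < n" for i
  proof -
    have "(\<Sum>a\<in>UNIV. var3 a * \<zeta> i a) = (\<Sum>j<N. Phi i j * x j)"
      unfolding \<zeta>_def sum_distrib_left by (subst sum.swap) (simp add: q sum_distrib_left mult.left_commute)
    then have "(\<Sum>a\<in>UNIV. var3 a * \<zeta> i a) = 0" using assms i by (simp add: kr_def)
    from koszul_orthogonal[OF this] show ?thesis by metis
  qed
  then obtain w where w: "\<And>i a. i < n \<Longrightarrow> \<zeta> i a = cross var3 (w i) a" by metis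
  have "cross var3 (\<lambda>b. \<Sum>i<n. f i * w i b) a = 0" for a
  proof -
    have "cross var3 (\<lambda>b. \<Sum>i<n. f i * w i b) a = (\<Sum>i<n. f i * \<zeta> i a)"
      by (simp add: cross_sum w)
    also have "\<dots> = (\<Sum>j<N. (\<Sum>i<n. f i * Phi i j) * q j a)"
      unfolding \<zeta>_def sum_distrib_left sum_distrib_right by (subst sum.swap) (simp add: mult.assoc)
    finally show ?thesis by (simp add: Phi_syz)
  qed
  from cross_eq_0[OF this] obtain s where s: "\<And>a. (\<Sum>i<n. f i * w i a) = var3 a * s" by metis
  show ?thesis unfolding lift_def
    by (rule exI[of _ s], rule exI[of _ "\<lambda>a j. q j a"], rule exI[of _ "\<lambda>a i. w i a"])
      (simp add: q s w[symmetric] \<zeta>_def)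
qed

lemma lift_socle:
  assumes "lift x s"
  shows "\<exists>c. s - const3 c * s0 \<in> I"
proof (rule socle_span)
  fix a
  from assms obtain v where "\<And>a. (\<Sum>i<n. f i * v a i) = var3 a * s" unfolding lift_def by blast
  from this[of a, symmetric] show "var3 a * s \<in> I" by (auto intro!: I_sum I_mult' f_in)
qed

lemma lift_linear:
  assumes "lift x s" "lift x' s'"
  shows "lift (\<lambda>j. x j - c * x' j) (s - c * s')"
proof -
  from assms(1) obtain Y v where 1: "\<And>j. j < N \<Longrightarrow> x j = (\<Sum>a\<in>UNIV. var3 a * Y a j)"
    "\<And>a i. i < n \<Longrightarrow> (\<Sum>j<N. Phi i j * Y a j) = cross var3 (\<lambda>b. v b i) a"
    "\<And>a. (\<Sum>i<n. f i * v a i) = var3 a * s" unfolding lift_def by blast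
  from assms(2) obtain Y' v' where 2: "\<And>j. j < N \<Longrightarrow> x' j = (\<Sum>a\<in>UNIV. var3 a * Y' a j)"
    "\<And>a i. i < n \<Longrightarrow> (\<Sum>j<N. Phi i j * Y' a j) = cross var3 (\<lambda>b. v' b i) a"
    "\<And>a. (\<Sum>i<n. f i * v' a i) = var3 a * s'" unfolding lift_def by blast
  have a: "x j - c * x' j = (\<Sum>a\<in>UNIV. var3 a * (Y a j - c * Y' a j))" if "j < N" for j
    unfolding 1(1)[OF that] 2(1)[OF that]
    by (simp add: right_diff_distrib sum_subtractf sum_distrib_left mult.left_commute)
  have b: "(\<Sum>j<N. Phi i j * (Y a j - c * Y' a j)) = cross var3 (\<lambda>b. v b i - c * v' b i) a" if "i < n" for i a
  proof -
    have "(\<Sum>j<N. Phi i j * (Y a j - c * Y' a j)) = (\<Sum>j<N. Phi i j * Y a j) - c * (\<Sum>j<N. Phi i j * Y' a j)"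
      by (simp add: right_diff_distrib sum_subtractf sum_distrib_left mult.left_commute)
    then show ?thesis by (simp only: 1(2)[OF that] 2(2)[OF that] cross_diff cross_scale)
  qed
  have c: "(\<Sum>i<n. f i * (v a i - c * v' a i)) = var3 a * (s - c * s')" for a
  proof -
    have "(\<Sum>i<n. f i * (v a i - c * v' a i)) = (\<Sum>i<n. f i * v a i) - c * (\<Sum>i<n. f i * v' a i)"
      by (simp add: right_diff_distrib sum_subtractf sum_distrib_left mult.left_commute)
    then show ?thesis by (simp add: 1(3) 2(3) right_diff_distrib mult.left_commute)
  qed
  show ?thesis unfolding lift_def
    by (rule exI[of _ "\<lambda>a j. Y a j - c * Y' a j"], rule exI[of _ "\<lambda>a i. v a i - c * v' a i"])
      (intro conjI allI impI a b c)
qed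

text \<open>The chase runs backwards: an expansion of \<open>s\<close> in \<open>f\<close> turns
  \<open>v\<close> into a syzygy up to multiples of the variables, and the resulting
  \<open>\<eta>\<close> corrects \<open>Y\<close> to kernel vectors without changing
  \<open>x\<close>.\<close>

lemma lift_in_ideal:
  assumes "lift x s" "s \<in> I"
  shows "\<exists>\<xi>. (\<forall>a. kr (\<xi> a)) \<and> (\<forall>j<N. x j = (\<Sum>a\<in>UNIV. var3 a * \<xi> a j))"
proof -
  from assms(1) obtain Y v where 1: "\<And>j. j < N \<Longrightarrow> x j = (\<Sum>a\<in>UNIV. var3 a * Y a j)"
    "\<And>a i. i < n \<Longrightarrow> (\<Sum>j<N. Phi i j * Y a j) = cross var3 (\<lambda>b. v b i) a"
    "\<And>a. (\<Sum>i<n. f i * v a i) = var3 a * s" unfolding lift_def by blast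
  obtain r where r: "s = (\<Sum>i<n. r i * f i)" using f_gen[OF assms(2)] by (rule exE)
  have "\<exists>\<eta>. \<forall>i<n. v a i - var3 a * r i = (\<Sum>j<N. Phi i j * \<eta> j)" for a
  proof (rule Phi_gen)
    have "(\<Sum>i<n. f i * (v a i - var3 a * r i)) = (\<Sum>i<n. f i * v a i) - var3 a * (\<Sum>i<n. r i * f i)"
      by (simp add: right_diff_distrib sum_subtractf sum_distrib_left mult_ac)
    then show "(\<Sum>i<n. f i * (v a i - var3 a * r i)) = 0" by (simp add: 1(3) r)
  qed
  then have "\<forall>a. \<exists>\<eta>. \<forall>i<n. v a i - var3 a * r i = (\<Sum>j<N. Phi i j * \<eta> j)" by (rule allI)
  from choice[OF this] obtain \<eta> where \<eta>: "\<And>a i. i < n \<Longrightarrow> v a i - var3 a * r i = (\<Sum>j<N. Phi i j * \<eta> a j)" by auto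
  define \<xi> where "\<xi> a j = Y a j - cross var3 (\<lambda>b. \<eta> b j) a" for a j
  have "kr (\<xi> a)" for a unfolding kr_def
  proof (intro allI impI)
    fix i assume i: "i < n"
    have "(\<Sum>j<N. Phi i j * \<xi> a j) = cross var3 (\<lambda>b. v b i) a - (\<Sum>j<N. Phi i j * cross var3 (\<lambda>b. \<eta> b j) a)"
      by (simp add: \<xi>_def right_diff_distrib sum_subtractf 1(2)[OF i])
    also have "(\<Sum>j<N. Phi i j * cross var3 (\<lambda>b. \<eta> b j) a) = cross var3 (\<lambda>b. \<Sum>j<N. Phi i j * \<eta> b j) a"
      by (rule cross_sum[symmetric])
    also have "(\<lambda>b. \<Sum>j<N. Phi i j * \<eta> b j) = (\<lambda>b. v b i - var3 b * r i)" by (simp add: \<eta>[OF i])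
    also have "cross var3 (\<lambda>b. v b i - var3 b * r i) a = cross var3 (\<lambda>b. v b i) a"
      by (simp only: cross_diff cross_self diff_zero)
    finally show "(\<Sum>j<N. Phi i j * \<xi> a j) = 0" by simp
  qed
  moreover have "x j = (\<Sum>a\<in>UNIV. var3 a * \<xi> a j)" if "j < N" for j
    by (simp add: \<xi>_def right_diff_distrib sum_subtractf cross_orthogonal 1(1)[OF that])
  ultimately show ?thesis by (intro exI[of _ \<xi>]) simp
qed

definition khom :: "int \<Rightarrow> (nat \<Rightarrow> 'k poly3) \<Rightarrow> bool" where
  "khom \<epsilon> x \<longleftrightarrow> (\<forall>j<N. homz (\<epsilon> - e j) (x j))"

text \<open>A kernel vector with a lift in \<open>I\<close> lies in the maximal ideal times the
  kernel, and modulo \<open>I\<close> lifts range over a line. So one vector with a lift outside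
  \<open>I\<close> accounts for the rest; if no homogeneous vector has such a lift,
  \<open>g = 0\<close> serves.\<close>

lemma kernel_modulo_maximal:
  "\<exists>g \<gamma>. kr g \<and> khom \<gamma> g \<and> (\<forall>x \<epsilon>. kr x \<and> khom \<epsilon> x \<longrightarrow>
     (\<exists>c \<xi>. (\<forall>a. kr (\<xi> a)) \<and> (\<forall>j<N. x j = const3 c * g j + (\<Sum>a\<in>UNIV. var3 a * \<xi> a j))))"
proof (cases "\<exists>g \<gamma> s. kr g \<and> khom \<gamma> g \<and> lift g s \<and> s \<notin> I")
  case True
  then obtain g \<gamma> sg where g: "kr g" "khom \<gamma> g" "lift g sg" "sg \<notin> I" by blast
  obtain \<kappa> where \<kappa>: "sg - const3 \<kappa> * s0 \<in> I" using lift_socle[OF g(3)] by (rule exE)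
  have \<kappa>0: "\<kappa> \<noteq> 0" using \<kappa> g(4) by auto
  have "\<exists>c \<xi>. (\<forall>a. kr (\<xi> a)) \<and> (\<forall>j<N. x j = const3 c * g j + (\<Sum>a\<in>UNIV. var3 a * \<xi> a j))" if x: "kr x" for x
  proof -
    obtain s where s: "lift x s" using lift_exists[OF x] by (rule exE)
    obtain c where c: "s - const3 c * s0 \<in> I" using lift_socle[OF s] by (rule exE)
    let ?t = "c / \<kappa>"
    have "const3 c = const3 ?t * const3 \<kappa>" using \<kappa>0 by (simp add: const3_mult[symmetric])
    then have "s - const3 ?t * sg = (s - const3 c * s0) - const3 ?t * (sg - const3 \<kappa> * s0)"
      by (simp add: algebra_simps)
    also have "\<dots> \<in> I" by (intro I_diff c I_mult \<kappa>)
    finally have sI: "s - const3 ?t * sg \<in> I" .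
    obtain \<xi> where \<xi>: "\<And>a. kr (\<xi> a)"
      "\<And>j. j < N \<Longrightarrow> x j - const3 ?t * g j = (\<Sum>a\<in>UNIV. var3 a * \<xi> a j)"
      using lift_in_ideal[OF lift_linear[OF s g(3)] sI] by auto
    have "x j = const3 ?t * g j + (\<Sum>a\<in>UNIV. var3 a * \<xi> a j)" if "j < N" for j
      using \<xi>(2)[OF that] by (simp add: algebra_simps)
    then show ?thesis using \<xi>(1) by (intro exI[of _ ?t] exI[of _ \<xi>]) simp
  qed
  then show ?thesis using g(1,2) by (intro exI[of _ g] exI[of _ \<gamma>]) simp
next
  case False
  have "\<exists>c \<xi>. (\<forall>a. kr (\<xi> a)) \<and> (\<forall>j<N. x j = const3 c * 0 + (\<Sum>a\<in>UNIV. var3 a * \<xi> a j))"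
    if x: "kr x" "khom \<epsilon> x" for x \<epsilon>
  proof -
    obtain s where s: "lift x s" using lift_exists[OF x(1)] by (rule exE)
    then have "s \<in> I" using False x by blast
    from lift_in_ideal[OF s this] obtain \<xi> where "(\<forall>a. kr (\<xi> a)) \<and> (\<forall>j<N. x j = (\<Sum>a\<in>UNIV. var3 a * \<xi> a j))"
      by (rule exE)
    then show ?thesis by (intro exI[of _ 0] exI[of _ \<xi>]) simp
  qed
  note 0 = this
  show ?thesis
  proof (rule exI[of _ "\<lambda>_. 0"], rule exI[of _ 0], intro conjI allI impI)
    show "kr (\<lambda>_. 0)" "khom 0 (\<lambda>_. 0)" by (simp_all add: kr_def khom_def)
    fix x \<epsilon> assume "kr x \<and> khom \<epsilon> x"
    then show "\<exists>c \<xi>. (\<forall>a. kr (\<xi> a)) \<and> (\<forall>j<N. x j = const3 c * 0 + (\<Sum>a\<in>UNIV. var3 a * \<xi> a j))"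
      by (elim conjE) (rule 0)
  qed
qed

lemma kr_vcomp: "kr x \<Longrightarrow> kr (vcomp e \<epsilon> x)"
  unfolding kr_def
proof (intro allI impI)
  fix i assume x: "\<forall>i<n. (\<Sum>j<N. Phi i j * x j) = 0" "i < n"
  have "(\<Sum>j<N. Phi i j * vcomp e \<epsilon> x j) = hc (\<epsilon> - d i) (\<Sum>j<N. Phi i j * x j)"
    unfolding hc_sum vcomp_def
    by (intro sum.cong refl) (subst hc_mult'[OF Phi_hom], simp_all add: algebra_simps)
  then show "(\<Sum>j<N. Phi i j * vcomp e \<epsilon> x j) = 0" using x by simp
qed

text \<open>Nakayama by induction on the degree: what remains after subtracting a multiple of
  \<open>g\<close> is a sum of variables times kernel vectors of lower degree.\<close>

lemma kernel_cyclic: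
  "\<exists>g \<gamma>. kr g \<and> khom \<gamma> g \<and> (\<forall>x. kr x \<longrightarrow> (\<exists>r. \<forall>j<N. x j = r * g j))"
proof -
  obtain g \<gamma> where g: "kr g" "khom \<gamma> g" and all: "\<forall>x \<epsilon>. kr x \<and> khom \<epsilon> x \<longrightarrow>
     (\<exists>c \<xi>. (\<forall>a. kr (\<xi> a)) \<and> (\<forall>j<N. x j = const3 c * g j + (\<Sum>a\<in>UNIV. var3 a * \<xi> a j)))"
    using kernel_modulo_maximal by (elim exE conjE) (rule that)
  have step: "\<exists>c \<xi>. (\<forall>a. kr (\<xi> a)) \<and> (\<forall>j<N. x j = const3 c * g j + (\<Sum>a\<in>UNIV. var3 a * \<xi> a j))"
    if "kr x" "khom \<epsilon> x" for x \<epsilon>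
    using all[rule_format, OF conjI[OF that]] .
  \<comment> \<open>A lower bound for all generator degrees: homogeneous kernel vectors of degree
    below \<open>m\<close> vanish, which starts the induction.\<close>
  define m where "m = (\<Sum>j<N. - \<bar>e j\<bar>)"
  have m: "m \<le> e j" if "j < N" for j
  proof -
    have "\<bar>e j\<bar> \<le> (\<Sum>j<N. \<bar>e j\<bar>)" by (rule member_le_sum) (use that in auto)
    then show ?thesis unfolding m_def sum_negf by linarith
  qed
  have hom: "\<exists>r. \<forall>j<N. x j = r * g j" if "kr x" "khom \<epsilon> x" "\<epsilon> < m + int t" for x \<epsilon> t
    using that
  proof (induction t arbitrary: x \<epsilon>)
    case 0
    have "x j = 0" if "j < N" for j
      using 0(2,3) m[OF that] that by (intro homz_neg[of "\<epsilon> - e j"]) (auto simp: khom_def)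
    then show ?case by (intro exI[of _ 0]) simp
  next
    case (Suc t)
    from step[OF Suc.prems(1,2)] obtain c \<xi> where \<xi>: "\<And>a. kr (\<xi> a)"
      "\<And>j. j < N \<Longrightarrow> x j = const3 c * g j + (\<Sum>a\<in>UNIV. var3 a * \<xi> a j)" by auto
    have "\<exists>r. \<forall>j<N. vcomp e (\<epsilon> - 1) (\<xi> a) j = r * g j" for a
      using Suc.prems(3) by (intro Suc.IH[OF kr_vcomp[OF \<xi>(1)], of "\<epsilon> - 1"]) (auto simp: khom_def vcomp_def)
    then have "\<forall>a. \<exists>r. \<forall>j<N. vcomp e (\<epsilon> - 1) (\<xi> a) j = r * g j" by (rule allI)
    from choice[OF this] obtain r where r: "\<And>a j. j < N \<Longrightarrow> vcomp e (\<epsilon> - 1) (\<xi> a) j = r a * g j" by auto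
    \<comment> \<open>In the component of degree \<epsilon> the vector \<open>g\<close> contributes
      only if \<epsilon> is its own degree \<gamma>.\<close>
    define c' where "c' = (if \<epsilon> = \<gamma> then const3 c else 0)"
    have "x j = (c' + (\<Sum>a\<in>UNIV. var3 a * r a)) * g j" if j: "j < N" for j
    proof -
      have "x j = hc (\<epsilon> - e j) (x j)" using Suc.prems(2) j by (simp add: khom_def hc_self)
      also have "\<dots> = const3 c * hc (\<epsilon> - e j) (g j) + (\<Sum>a\<in>UNIV. var3 a * hc (\<epsilon> - e j - 1) (\<xi> a j))"
        unfolding \<xi>(2)[OF j] by (simp only: hc_add hc_const3_mult hc_sum hc_mult'[OF homz_var3])
      also have "const3 c * hc (\<epsilon> - e j) (g j) = c' * g j"
        using g(2) j hc_homz[of "\<gamma> - e j" "g j" "\<epsilon> - e j"] by (auto simp: khom_def c'_def)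
      also have "(\<Sum>a\<in>UNIV. var3 a * hc (\<epsilon> - e j - 1) (\<xi> a j)) = (\<Sum>a\<in>UNIV. var3 a * (r a * g j))"
        by (intro sum.cong refl) (simp only: r[OF j, symmetric] vcomp_def diff_diff_eq add.commute[of _ 1])
      finally show ?thesis by (simp add: distrib_right sum_distrib_right mult.assoc)
    qed
    then show ?case by (intro exI[of _ "c' + (\<Sum>a\<in>UNIV. var3 a * r a)"]) simp
  qed
  have "\<exists>r. \<forall>j<N. x j = r * g j" if x: "kr x" for x
  proof -
    obtain T where T: "finite T" "\<And>i. i < N \<Longrightarrow> x i = (\<Sum>t\<in>T. vcomp e t x i)"
      using vcomp_decomp[where m = N and z = x and \<delta> = e] by metis
    have "\<exists>r. \<forall>j<N. vcomp e t x j = r * g j" for t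
      using hom[OF kr_vcomp[OF x], of t t "nat (t - m + 1)"] by (simp add: khom_def vcomp_def)
    then have "\<forall>t. \<exists>r. \<forall>j<N. vcomp e t x j = r * g j" by (rule allI)
    from choice[OF this] obtain r where r: "\<And>t j. j < N \<Longrightarrow> vcomp e t x j = r t * g j" by auto
    have "x j = (\<Sum>t\<in>T. r t) * g j" if "j < N" for j
      using T(2)[OF that] by (simp add: r[OF that] sum_distrib_right)
    then show ?thesis by (intro exI[of _ "\<Sum>t\<in>T. r t"]) simp
  qed
  then show ?thesis using g by (intro exI[of _ g] exI[of _ \<gamma>]) simp
qed

end

section \<open>Duality of the resolution\<close>

lemma det_eq_0_of_kernel:
  fixes A :: "'a::idom mat"
  assumes A: "A \<in> carrier_mat n n" and v: "\<And>i. i < n \<Longrightarrow> (\<Sum>j<n. A $$ (i, j) * v j) = 0" and "j < n" "v j \<noteq> 0"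
  shows "det A = 0"
proof -
  have "(\<Sum>i<n. adj_mat A $$ (j, i) * (\<Sum>l<n. A $$ (i, l) * v l)) = (\<Sum>l<n. (adj_mat A * A) $$ (j, l) * v l)"
    using A \<open>j < n\<close> adj_mat(1)[OF A] unfolding sum_distrib_left
    by (subst sum.swap) (simp add: scalar_prod_def sum_distrib_right mult.assoc atLeast0LessThan)
  also have "\<dots> = (\<Sum>l<n. (if l = j then det A * v j else 0))"
    unfolding adj_mat(3)[OF A] using \<open>j < n\<close> by (intro sum.cong) auto
  finally show ?thesis using assms by simp
qed

context gorenstein_resolution
begin

lemma generator_radical: "\<exists>r. var3 a ^ Suc k = (\<Sum>i<n. r i * f i)"
  by (rule f_gen[OF var3_power_in])

lemma Phi_in_maximal:
  assumes "j < N" "i < n"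
  shows "c0 (Phi i j) = 0"
  using Phi_syz[OF assms(1)] assms(2) f_min[of "\<lambda>i. Phi i j" i] by (simp add: mult.commute)

lemma koszul_syzygy:
  assumes "i < n" "l < n"
  shows "\<exists>x. \<forall>m<n. (if m = l then f i else 0) - (if m = i then f l else 0) = (\<Sum>j<N. Phi m j * x j)"
proof (rule Phi_gen)
  show "(\<Sum>m<n. f m * ((if m = l then f i else 0) - (if m = i then f l else 0))) = 0"
    using assms by (simp add: right_diff_distrib sum_subtractf if_distrib[of "\<lambda>x. _ * x"] mult.commute cong: if_cong)
qed

text \<open>Koszul syzygies are combinations of the columns of \<open>Phi\<close>, so \<sigma> is
  orthogonal to them: \<open>f i * \<sigma> l = f l * \<sigma> i\<close>. Since powers of all
  variables lie in the ideal, such a vector is a multiple of \<open>f\<close>.\<close>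

lemma kernel_transpose:
  assumes "\<And>j. j < N \<Longrightarrow> (\<Sum>i<n. Phi i j * \<sigma> i) = 0"
  shows "\<exists>r. \<forall>i<n. \<sigma> i = r * f i"
proof (rule proportional_multiple)
  show "\<exists>r. var3 a ^ Suc k = (\<Sum>i<n. r i * f i)" for a by (rule generator_radical)
  fix i l assume il: "i < n" "l < n"
  obtain x where x: "\<And>m. m < n \<Longrightarrow> (if m = l then f i else 0) - (if m = i then f l else 0) = (\<Sum>j<N. Phi m j * x j)"
    using koszul_syzygy[OF il] by auto
  have "(\<Sum>m<n. ((if m = l then f i else 0) - (if m = i then f l else 0)) * \<sigma> m) =
      (\<Sum>m<n. \<Sum>j<N. Phi m j * x j * \<sigma> m)"
    by (intro sum.cong refl) (simp only: x lessThan_iff sum_distrib_right)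
  also have "\<dots> = (\<Sum>j<N. \<Sum>m<n. Phi m j * x j * \<sigma> m)" by (rule sum.swap)
  also have "\<dots> = (\<Sum>j<N. (\<Sum>m<n. Phi m j * \<sigma> m) * x j)"
    by (simp add: sum_distrib_left sum_distrib_right mult_ac)
  also have "\<dots> = 0" by (simp add: assms)
  finally have "f i * \<sigma> l - f l * \<sigma> i = 0"
    using il by (simp add: left_diff_distrib sum_subtractf if_distrib[of "\<lambda>x. x * _"] cong: if_cong)
  then show "f i * \<sigma> l = f l * \<sigma> i" by simp
qed

text \<open>The multiplicative structure of Buchsbaum and Eisenbud: \<open>P i l\<close> lifts the Koszul syzygy of \<open>f i\<close>
  and \<open>f l\<close> alternatingly, and \<open>T\<close> is the resulting pairing of the first two free modules.\<close>

lemma exists_pairing: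
  assumes g: "kr g" "khom \<gamma> g" "\<forall>x. kr x \<longrightarrow> (\<exists>r. \<forall>j<N. x j = r * g j)" "\<exists>j<N. g j \<noteq> 0"
  shows "\<exists>T P. (\<forall>i<n. \<forall>j<N. homz (d i + e j - \<gamma>) (T i j)) \<and>
    (\<forall>i<n. \<forall>j<N. \<forall>m<N. (if m = j then f i else 0) = g m * T i j + (\<Sum>l<n. Phi l j * P i l m)) \<and>
    (\<forall>i<n. \<forall>l<n. \<forall>m<N. P i l m = - P l i m) \<and>
    (\<forall>i<n. (\<Sum>m<N. g m * T i m) = of_int (int N - int n + 1) * f i)"
proof -
  define Q where "Q i l x \<longleftrightarrow> (\<forall>j<N. homz (d i + d l - e j) (x j)) \<and>
      (\<forall>m<n. (if m = l then f i else 0) - (if m = i then f l else 0) = (\<Sum>j<N. Phi m j * x j))" for i l x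
  have "\<exists>x. Q i l x" if il: "i < n" "l < n" for i l
  proof -
      obtain x where x: "\<And>m. m < n \<Longrightarrow> (if m = l then f i else 0) - (if m = i then f l else 0) = (\<Sum>j<N. Phi m j * x j)"
        using koszul_syzygy[OF il] by auto
      have "(if m = l then f i else 0) - (if m = i then f l else 0) = (\<Sum>j<N. Phi m j * hc (d i + d l - e j) (x j))"
        if m: "m < n" for m
      proof -
        let ?L = "(if m = l then f i else 0) - (if m = i then f l else 0)"
        have "homz (d i + d l - d m) ?L" using il f_hom[of i] f_hom[of l] by (auto intro: homz_diff)
        then have "?L = hc (d i + d l - d m) (\<Sum>j<N. Phi m j * x j)" using x[OF m] by (simp add: hc_self)
        also have "\<dots> = (\<Sum>j<N. Phi m j * hc (d i + d l - e j) (x j))"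
          unfolding hc_sum by (intro sum.cong refl, subst hc_mult'[OF Phi_hom]) (simp_all add: algebra_simps)
        finally show ?thesis .
      qed
      then show ?thesis unfolding Q_def by (intro exI[of _ "\<lambda>j. hc (d i + d l - e j) (x j)"]) simp
  qed
  then obtain \<pi> where Q: "\<And>i l. i < n \<Longrightarrow> l < n \<Longrightarrow> Q i l (\<pi> i l)" by metis
  have \<pi>: "homz (d i + d l - e j) (\<pi> i l j)" if "i < n" "l < n" "j < N" for i l j
    using Q[OF that(1,2)] that(3) by (simp add: Q_def)
  have \<pi>': "(if m = l then f i else 0) - (if m = i then f l else 0) = (\<Sum>j<N. Phi m j * \<pi> i l j)"
    if "i < n" "l < n" "m < n" for i l m
    using Q[OF that(1,2)] that(3) unfolding Q_def by blast
  \<comment> \<open>The lifts \<open>\<pi>\<close> are arbitrary; alternation is imposed by using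
    them for i < l only. The skew symmetry of the final matrix originates here.\<close>
  define P where "P i l j = (if i < l then \<pi> i l j else if l < i then - \<pi> l i j else 0)" for i l j
  have P_skew: "P i l m = - P l i m" for i l m by (auto simp: P_def)
  have P_hom: "homz (d i + d l - e j) (P i l j)" if "i < n" "l < n" "j < N" for i l j
    using \<pi>[OF that] \<pi>[OF that(2,1,3)] by (auto simp: P_def add.commute)
  have P_prop: "(\<Sum>j<N. Phi m j * P i l j) = (if m = l then f i else 0) - (if m = i then f l else 0)"
    if "i < n" "l < n" "m < n" for i l m
  proof -
    consider "i < l" | "l < i" | "i = l" by linarith
    then show ?thesis
    proof cases
      case 1
      then show ?thesis using \<pi>'[OF that] by (simp add: P_def)
    next
      case 2
      then show ?thesis using \<pi>'[OF that(2,1,3), symmetric] by (simp add: P_def sum_negf)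
    qed (simp add: P_def)
  qed
  \<comment> \<open>\<open>P\<close> is a homotopy for multiplication by \<open>f i\<close> up to
    the second free module. The defect there is killed by \<open>Phi\<close>, hence a multiple of
    \<open>g\<close>, and the multiplier becomes \<open>T i j\<close>.\<close>
  have "\<exists>t. \<forall>m<N. (if m = j then f i else 0) - (\<Sum>l<n. Phi l j * P i l m) = t * g m" if ij: "i < n" "j < N" for i j
  proof (rule g(3)[rule_format], unfold kr_def, intro allI impI)
    fix p assume p: "p < n"
    have "(\<Sum>m<N. Phi p m * (\<Sum>l<n. Phi l j * P i l m)) = (\<Sum>l<n. Phi l j * (\<Sum>m<N. Phi p m * P i l m))"
      unfolding sum_distrib_left by (subst sum.swap) (simp add: mult.left_commute)
    also have "\<dots> = (\<Sum>l<n. Phi l j * ((if p = l then f i else 0) - (if p = i then f l else 0)))"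
      by (intro sum.cong refl) (simp add: P_prop ij p)
    also have "\<dots> = Phi p j * f i - (if p = i then (\<Sum>l<n. f l * Phi l j) else 0)"
      using p by (simp add: right_diff_distrib sum_subtractf if_distrib[of "\<lambda>x. _ * x"] mult.commute cong: if_cong)
    finally have *: "(\<Sum>m<N. Phi p m * (\<Sum>l<n. Phi l j * P i l m)) = Phi p j * f i"
      by (simp add: Phi_syz[OF ij(2)])
    have "(\<Sum>m<N. Phi p m * (if m = j then f i else 0)) = Phi p j * f i"
      using ij(2) by (simp add: if_distrib[of "\<lambda>x. _ * x"] cong: if_cong)
    then show "(\<Sum>m<N. Phi p m * ((if m = j then f i else 0) - (\<Sum>l<n. Phi l j * P i l m))) = 0"
      unfolding right_diff_distrib sum_subtractf * by simp
  qed
  note ex_t = this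
  define T where "T i j = (SOME t. \<forall>m<N. (if m = j then f i else 0) - (\<Sum>l<n. Phi l j * P i l m) = t * g m)" for i j
  have T: "(if m = j then f i else 0) - (\<Sum>l<n. Phi l j * P i l m) = T i j * g m"
    if "i < n" "j < N" "m < N" for i j m
    using someI_ex[OF ex_t[OF that(1,2)]] that(3) unfolding T_def by (elim allE impE)
  have T_eq: "(if m = j then f i else 0) = g m * T i j + (\<Sum>l<n. Phi l j * P i l m)"
    if "i < n" "j < N" "m < N" for i j m
  proof -
    have "(if m = j then f i else 0) = ((if m = j then f i else 0) - (\<Sum>l<n. Phi l j * P i l m)) + (\<Sum>l<n. Phi l j * P i l m)"
      by simp
    then show ?thesis unfolding T[OF that] by (simp add: mult.commute)
  qed
  have T_hom: "homz (d i + e j - \<gamma>) (T i j)" if ij: "i < n" "j < N" for i j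
  proof -
    obtain m where m: "m < N" "g m \<noteq> 0" using g(4) by blast
    have "homz (d i + e j - e m) ((if m = j then f i else 0) - (\<Sum>l<n. Phi l j * P i l m))"
    proof (intro homz_diff homz_sum)
      show "homz (d i + e j - e m) (if m = j then f i else 0)" using f_hom[OF ij(1)] by auto
      show "homz (d i + e j - e m) (Phi l j * P i l m)" if "l \<in> {..<n}" for l
        using homz_mult[OF Phi_hom[OF ij(2)] P_hom[OF ij(1) _ m(1)], of l l] that by (simp add: algebra_simps)
    qed
    then have "homz (d i + e j - e m) (T i j * g m)" using T[OF ij m(1)] by simp
    from homz_cancel[OF this _ m(2), of "\<gamma> - e m"] show ?thesis
      using g(2) m(1) by (simp add: khom_def algebra_simps)
  qed
  \<comment> \<open>The diagonal case m = j is summed: the identity contributes N and the Koszul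
    syzygies n - 1 copies of \<open>f i\<close>.\<close>
  have "(\<Sum>m<N. g m * T i m) = of_int (int N - int n + 1) * f i" if i: "i < n" for i
  proof -
    have "g m * T i m = f i - (\<Sum>l<n. Phi l m * P i l m)" if "m < N" for m
      using T[OF i that that] by (simp add: mult.commute)
    then have "(\<Sum>m<N. g m * T i m) = (\<Sum>m<N. f i - (\<Sum>l<n. Phi l m * P i l m))" by simp
    also have "\<dots> = of_nat N * f i - (\<Sum>l<n. \<Sum>m<N. Phi l m * P i l m)"
      by (simp add: sum_subtractf) (rule sum.swap)
    also have "(\<Sum>l<n. \<Sum>m<N. Phi l m * P i l m) = (\<Sum>l<n. f i - (if l = i then f l else 0))"
      by (intro sum.cong refl) (simp add: P_prop i)
    also have "\<dots> = of_nat n * f i - f i" using i by (simp add: sum_subtractf)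
    finally show ?thesis by (simp add: algebra_simps)
  qed
  then show ?thesis
    by (intro exI[of _ T] exI[of _ P] conjI allI impI T_hom T_eq P_skew)
qed

text \<open>Keeps the scalar N - n + 1 away from zero. For N = n - 1 the first N rows of
  \<open>Phi\<close> form a square matrix: the kernel vector \<open>g\<close> makes it singular,
  while lifts of the Koszul syzygies with the last generator invert it up to the factor
  \<open>f N\<close>.\<close>

lemma rank_bound:
  assumes g: "kr g" "\<exists>j<N. g j \<noteq> 0"
  shows "Suc N \<noteq> n"
proof
  assume n: "Suc N = n"
  have "\<exists>x. \<forall>m<n. (if m = l then f N else 0) - (if m = N then f l else 0) = (\<Sum>j<N. Phi m j * x j)" if "l < n" for l
    using koszul_syzygy[of N l] n that by auto
  note ex_x = this
  define x where "x l = (SOME x. \<forall>m<n. (if m = l then f N else 0) - (if m = N then f l else 0) = (\<Sum>j<N. Phi m j * x j))" for l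
  have x: "(if m = l then f N else 0) - (if m = N then f l else 0) = (\<Sum>j<N. Phi m j * x l j)"
    if "l < n" "m < n" for l m
    using someI_ex[OF ex_x[OF that(1)]] that(2) unfolding x_def by (elim allE impE)
  define A where "A = mat N N (\<lambda>(i, j). Phi i j)"
  define B where "B = mat N N (\<lambda>(j, l). x l j)"
  have car: "A \<in> carrier_mat N N" "B \<in> carrier_mat N N" by (simp_all add: A_def B_def)
  obtain j where j: "j < N" "g j \<noteq> 0" using g(2) by blast
  have "det A = 0"
  proof (rule det_eq_0_of_kernel[where v = g, OF car(1) _ j(1) j(2)])
    show "(\<Sum>j<N. A $$ (i, j) * g j) = 0" if "i < N" for i
      using g(1) that n by (simp add: kr_def A_def)
  qed
  moreover have "A * B = f N \<cdot>\<^sub>m 1\<^sub>m N"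
  proof (rule eq_matI)
    fix i l assume "i < dim_row (f N \<cdot>\<^sub>m 1\<^sub>m N)" "l < dim_col (f N \<cdot>\<^sub>m 1\<^sub>m N)"
    then have il: "i < N" "l < N" by auto
    have "(A * B) $$ (i, l) = (\<Sum>j<N. Phi i j * x l j)"
      using il by (simp add: A_def B_def scalar_prod_def atLeast0LessThan)
    also have "\<dots> = (if i = l then f N else 0)" using x[of l i] il n by (simp split: if_splits)
    finally show "(A * B) $$ (i, l) = (f N \<cdot>\<^sub>m 1\<^sub>m N) $$ (i, l)" using il by simp
  qed (simp_all add: A_def B_def)
  then have "det A * det B = f N ^ N" using det_mult[OF car] by (simp add: det_smult)
  ultimately show False using f_nonzero[of N] n by simp
qed

text \<open>Applied to a vector orthogonal to \<open>g\<close>, the homotopy \<open>TP\<close>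
  writes \<open>f i * \<rho>\<close> as a combination of the rows of \<open>Phi\<close>, so
  multiples by high powers of the variables are in the row space. Saturation, available by
  \<open>kernel_transpose\<close>, removes the powers.\<close>

lemma dual_exact:
  assumes g: "kr g" "\<exists>j<N. g j \<noteq> 0"
    and TP: "\<And>i j m. i < n \<Longrightarrow> j < N \<Longrightarrow> m < N \<Longrightarrow>
      (if m = j then f i else 0) = g m * T i j + (\<Sum>l<n. Phi l j * P i l m)"
    and \<rho>: "(\<Sum>m<N. \<rho> m * g m) = 0"
  shows "\<exists>\<sigma>. \<forall>m<N. \<rho> m = (\<Sum>i<n. Phi i m * \<sigma> i)"
proof -
  define Im where "Im z \<longleftrightarrow> (\<exists>\<sigma>. \<forall>m<N. z m = (\<Sum>i<n. Phi i m * \<sigma> i))" for z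
  have mult: "Im (\<lambda>m. r * z m)" if "Im z" for r z
  proof -
    from that obtain \<sigma> where "\<And>m. m < N \<Longrightarrow> z m = (\<Sum>i<n. Phi i m * \<sigma> i)" unfolding Im_def by auto
    then show ?thesis unfolding Im_def
      by (intro exI[of _ "\<lambda>i. r * \<sigma> i"]) (simp add: sum_distrib_left mult.left_commute)
  qed
  have fIm: "\<exists>\<sigma>. \<forall>m<N. f i * \<rho> m = (\<Sum>l<n. Phi l m * \<sigma> l)" if i: "i < n" for i
  proof (intro exI[of _ "\<lambda>l. \<Sum>m<N. \<rho> m * P i l m"] allI impI)
    fix j assume j: "j < N"
    have "f i * \<rho> j = (\<Sum>m<N. \<rho> m * (if m = j then f i else 0))"
      using j by (simp add: if_distrib[of "\<lambda>x. _ * x"] mult.commute cong: if_cong)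
    also have "\<dots> = (\<Sum>m<N. \<rho> m * (g m * T i j + (\<Sum>l<n. Phi l j * P i l m)))"
      by (intro sum.cong refl) (simp only: TP[OF i j] lessThan_iff)
    also have "\<dots> = (\<Sum>m<N. \<rho> m * g m) * T i j + (\<Sum>m<N. \<Sum>l<n. Phi l j * (\<rho> m * P i l m))"
      by (simp add: distrib_left sum.distrib sum_distrib_left sum_distrib_right mult_ac)
    also have "\<dots> = (\<Sum>l<n. Phi l j * (\<Sum>m<N. \<rho> m * P i l m))"
      unfolding \<rho> sum_distrib_left by (simp, rule sum.swap)
    finally show "f i * \<rho> j = (\<Sum>l<n. Phi l j * (\<Sum>m<N. \<rho> m * P i l m))" .
  qed
  define \<sigma> where "\<sigma> i = (SOME \<sigma>. \<forall>m<N. f i * \<rho> m = (\<Sum>l<n. Phi l m * \<sigma> l))" for i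
  have \<sigma>: "f i * \<rho> m = (\<Sum>l<n. Phi l m * \<sigma> i l)" if "i < n" "m < N" for i m
    using someI_ex[OF fIm[OF that(1)]] that(2) unfolding \<sigma>_def by (elim allE impE)
  have "Im \<rho>"
  proof (rule saturated_power[where K = "Suc k" and P = Im])
    show "Im z" if z: "\<And>a. Im (\<lambda>i. var3 a * z i)" for z
    proof -
      have "\<forall>a. \<exists>\<sigma>. \<forall>m<N. var3 a * z m = (\<Sum>i<n. Phi i m * \<sigma> i)" using z unfolding Im_def by (rule allI)
      from choice[OF this] obtain w where w: "\<And>a m. m < N \<Longrightarrow> var3 a * z m = (\<Sum>i<n. Phi i m * w a i)" by auto
      show ?thesis unfolding Im_def
      proof (rule image_saturated[where A = "\<lambda>m i. Phi i m" and g = f])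
        show "\<exists>r. \<forall>j<n. x j = r * f j" if "\<And>i. i < N \<Longrightarrow> (\<Sum>j<n. Phi j i * x j) = 0" for x
          using that by (rule kernel_transpose)
        show "(\<Sum>j<n. Phi j i * f j) = 0" if "i < N" for i
          using Phi_syz[OF that] by (simp add: mult.commute)
      qed (rule w)
    qed
    show "Im (\<lambda>i. r * z i)" if "Im z" for r z by (rule mult[OF that])
    fix a
    obtain r where r: "var3 a ^ Suc k = (\<Sum>i<n. r i * f i)" using generator_radical by (rule exE)
    have "var3 a ^ Suc k * \<rho> m = (\<Sum>l<n. Phi l m * (\<Sum>i<n. r i * \<sigma> i l))" if m: "m < N" for m
    proof -
      have "var3 a ^ Suc k * \<rho> m = (\<Sum>i<n. r i * (f i * \<rho> m))"
        unfolding r by (simp add: sum_distrib_right mult.assoc)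
      also have "\<dots> = (\<Sum>i<n. \<Sum>l<n. Phi l m * (r i * \<sigma> i l))"
        by (intro sum.cong refl) (simp add: \<sigma> m sum_distrib_left mult.left_commute)
      finally show ?thesis unfolding sum_distrib_left by (subst (asm) sum.swap)
    qed
    then show "Im (\<lambda>i. var3 a ^ Suc k * \<rho> i)" unfolding Im_def
      by (intro exI[of _ "\<lambda>l. \<Sum>i<n. r i * \<sigma> i l"]) simp
  qed
  then show ?thesis unfolding Im_def .
qed

text \<open>By \<open>Tg\<close> the entries of \<open>g\<close> generate an ideal containing
  \<open>I\<close>; if it were larger, it would contain \<open>s0\<close> by essentiality of the
  socle. Then multiplication by \<open>s0\<close> is null-homotopic on the dual complex, and
  following the homotopy \<open>b\<close>, \<open>\<beta>\<close>, \<open>t\<close> back to the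
  generators expresses \<open>s0\<close> in \<open>f\<close>.\<close>

lemma dual_generators_in_ideal:
  assumes g: "kr g" "\<exists>j<N. g j \<noteq> 0"
    and TP: "\<And>i j m. i < n \<Longrightarrow> j < N \<Longrightarrow> m < N \<Longrightarrow>
      (if m = j then f i else 0) = g m * T i j + (\<Sum>l<n. Phi l j * P i l m)"
    and Tg: "\<And>i. i < n \<Longrightarrow> (\<Sum>m<N. g m * T i m) = const3 c * f i" and c: "c \<noteq> 0"
    and m: "m < N"
  shows "g m \<in> I"
proof (rule ccontr)
  assume "g m \<notin> I"
  from socle_essential[OF this] obtain E where E: "E * g m - s0 \<in> I" by (rule exE)
  obtain r where r: "E * g m - s0 = (\<Sum>i<n. r i * f i)" using f_gen[OF E] by (rule exE)
  have fT: "f i = (\<Sum>j<N. const3 (1 / c) * T i j * g j)" if "i < n" for i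
  proof -
    have "f i = const3 (1 / c) * (const3 c * f i)" using c by (simp add: mult.assoc[symmetric] const3_mult[symmetric])
    then show ?thesis unfolding Tg[OF that, symmetric] by (simp add: sum_distrib_left mult_ac)
  qed
  define b where "b j = (if j = m then E else 0) - (\<Sum>i<n. r i * (const3 (1 / c) * T i j))" for j
  have sb: "s0 = (\<Sum>j<N. b j * g j)"
  proof -
    have "(\<Sum>i<n. r i * f i) = (\<Sum>i<n. \<Sum>j<N. r i * (const3 (1 / c) * T i j) * g j)"
      by (intro sum.cong refl) (simp add: fT sum_distrib_left mult.assoc)
    also have "\<dots> = (\<Sum>j<N. (\<Sum>i<n. r i * (const3 (1 / c) * T i j)) * g j)"
      unfolding sum_distrib_right by (rule sum.swap)
    finally have "(\<Sum>j<N. b j * g j) = E * g m - (\<Sum>i<n. r i * f i)"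
      using m by (simp add: b_def left_diff_distrib sum_subtractf if_distrib[of "\<lambda>x. x * _"] cong: if_cong)
    then show ?thesis by (simp add: r[symmetric])
  qed
  have "\<exists>\<beta>. \<forall>m<N. (if m = j then s0 else 0) - g j * b m = (\<Sum>i<n. Phi i m * \<beta> i)" if j: "j < N" for j
  proof (rule dual_exact[OF g TP])
    have "(\<Sum>m<N. ((if m = j then s0 else 0) - g j * b m) * g m) = s0 * g j - g j * (\<Sum>m<N. b m * g m)"
      using j by (simp add: left_diff_distrib sum_subtractf if_distrib[of "\<lambda>x. x * _"] sum_distrib_left mult.assoc cong: if_cong)
    then show "(\<Sum>m<N. ((if m = j then s0 else 0) - g j * b m) * g m) = 0" by (simp add: sb[symmetric])
  qed
  note ex_b = this
  define \<beta> where "\<beta> j = (SOME \<beta>. \<forall>m<N. (if m = j then s0 else 0) - g j * b m = (\<Sum>i<n. Phi i m * \<beta> i))" for j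
  have \<beta>: "(if m = j then s0 else 0) - g j * b m = (\<Sum>i<n. Phi i m * \<beta> j i)" if "j < N" "m < N" for j m
    using someI_ex[OF ex_b[OF that(1)]] that(2) unfolding \<beta>_def by (elim allE impE)
  define \<sigma> where "\<sigma> p i = (if i = p then s0 else 0) - (\<Sum>j<N. Phi p j * \<beta> j i)" for p i
  have "\<exists>t. \<forall>i<n. \<sigma> p i = t * f i" if p: "p < n" for p
  proof (rule kernel_transpose)
    fix q assume q: "q < N"
    have "(\<Sum>i<n. Phi i q * (\<Sum>j<N. Phi p j * \<beta> j i)) = (\<Sum>j<N. Phi p j * (\<Sum>i<n. Phi i q * \<beta> j i))"
      unfolding sum_distrib_left by (subst sum.swap) (simp add: mult.left_commute)
    also have "\<dots> = (\<Sum>j<N. Phi p j * ((if q = j then s0 else 0) - g j * b q))"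
      by (intro sum.cong refl) (simp add: \<beta>[OF _ q, symmetric])
    also have "\<dots> = Phi p q * s0 - (\<Sum>j<N. Phi p j * g j) * b q"
      using q by (simp add: right_diff_distrib sum_subtractf if_distrib[of "\<lambda>x. _ * x"] sum_distrib_right mult.assoc cong: if_cong)
    also have "(\<Sum>j<N. Phi p j * g j) = 0" using g(1) p by (simp add: kr_def)
    finally show "(\<Sum>i<n. Phi i q * \<sigma> p i) = 0"
      using p by (simp add: \<sigma>_def right_diff_distrib sum_subtractf if_distrib[of "\<lambda>x. _ * x"] cong: if_cong)
  qed
  then obtain t where t: "\<And>p i. p < n \<Longrightarrow> i < n \<Longrightarrow> \<sigma> p i = t p * f i" by metis
  have "(\<Sum>p<n. f p * \<sigma> p 0) = f 0 * s0 - (\<Sum>j<N. (\<Sum>p<n. f p * Phi p j) * \<beta> j 0)"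
  proof -
    have "(\<Sum>p<n. f p * (\<Sum>j<N. Phi p j * \<beta> j 0)) = (\<Sum>j<N. (\<Sum>p<n. f p * Phi p j) * \<beta> j 0)"
      unfolding sum_distrib_left sum_distrib_right by (subst sum.swap) (simp add: mult.assoc)
    then show ?thesis using n_pos
      by (simp add: \<sigma>_def right_diff_distrib sum_subtractf if_distrib[of "\<lambda>x. _ * x"] cong: if_cong)
  qed
  then have "f 0 * s0 = (\<Sum>p<n. f p * \<sigma> p 0)" by (simp add: Phi_syz)
  also have "\<dots> = f 0 * (\<Sum>p<n. t p * f p)"
    by (simp add: t n_pos sum_distrib_left mult_ac)
  finally have "s0 = (\<Sum>p<n. t p * f p)" using f_nonzero[OF n_pos] by simp
  then show False using s0_notin f_in by (auto intro: I_sum I_mult)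
qed

end

section \<open>The skew-symmetric syzygy matrix\<close>

lemma sum_matrix_assoc:
  fixes a :: "nat \<Rightarrow> 'a::comm_ring_1"
  shows "(\<Sum>j<p. a j * (\<Sum>l<q. B j l * x l)) = (\<Sum>l<q. (\<Sum>j<p. a j * B j l) * x l)"
  unfolding sum_distrib_left sum_distrib_right by (subst sum.swap) (simp add: mult.assoc)

lemma sum_delta_mult:
  fixes x :: "nat \<Rightarrow> 'a::comm_ring_1"
  shows
  "i < n \<Longrightarrow> (\<Sum>j<n. (if j = i then c else 0) * x j) = c * x i"
  "i < n \<Longrightarrow> (\<Sum>j<n. (if i = j then c else 0) * x j) = c * x i"
  by (simp_all add: if_distrib[of "\<lambda>x. x * _"] cong: if_cong)

lemma c0_det:
  assumes A: "A \<in> carrier_mat n n"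
  shows "c0 (det A) = det (mat n n (\<lambda>(i, j). c0 (A $$ (i, j) :: 'k::field poly3)))"
proof -
  interpret c: comm_ring_hom "\<lambda>p :: 'k poly3. c0 p"
    by unfold_locales (simp_all add: lookup_add)
  have "mat n n (\<lambda>(i, j). c0 (A $$ (i, j))) = map_mat (\<lambda>p. c0 p) A" using A by auto
  then show ?thesis by (simp add: c.hom_det)
qed

lemma homz_of_int: "homz 0 (of_int m :: 'k::field poly3)"
  using homz_const3[of "of_int m :: 'k"] by (simp add: const3_def)

text \<open>Entries graded by row and column weights give all terms of the Leibniz expansion the
  same degree.\<close>

lemma homz_det:
  fixes A :: "'k::field poly3 mat"
  assumes A: "A \<in> carrier_mat n n"
    and h: "\<And>i j. i < n \<Longrightarrow> j < n \<Longrightarrow> homz (a i + b j) (A $$ (i, j))"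
  shows "homz ((\<Sum>i<n. a i) + (\<Sum>j<n. b j)) (det A)"
  unfolding det_def'[OF A]
proof (rule homz_sum)
  fix p assume "p \<in> {p. p permutes {0..<n}}"
  then have p: "p permutes {..<n}" by (simp add: atLeast0LessThan)
  have "homz (\<Sum>i\<in>{0..<n}. a i + b (p i)) (\<Prod>i = 0..<n. A $$ (i, p i))"
    using permutes_in_image[OF p] by (intro homz_prod h) auto
  moreover have "(\<Sum>i\<in>{0..<n}. a i + b (p i)) = (\<Sum>i<n. a i) + (\<Sum>j<n. b j)"
    using sum.permute[OF p, of b] by (simp add: sum.distrib atLeast0LessThan)
  ultimately have "homz ((\<Sum>i<n. a i) + (\<Sum>j<n. b j)) (\<Prod>i = 0..<n. A $$ (i, p i))" by simp
  from homz_mult[OF homz_of_int[of "sign p"] this]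
  show "homz ((\<Sum>i<n. a i) + (\<Sum>j<n. b j)) (signof p * (\<Prod>i = 0..<n. A $$ (i, p i)))" by simp
qed

context gorenstein_resolution
begin

text \<open>\<open>T\<close> identifies the second free module with the dual of the first up to a
  degree shift; composing \<open>Phi\<close> with its inverse gives a matrix between a module and
  its dual, for which skew symmetry makes sense.\<close>

theorem skew_presentation:
  "\<exists>M. (\<forall>i<n. \<forall>l<n. M i l = - M l i \<and> homz (int k + 3 - d i - d l) (M i l) \<and> c0 (M i l) = 0) \<and>
    (\<forall>i<n. (\<Sum>l<n. M i l * f l) = 0) \<and>
    (\<forall>x. (\<forall>i<n. (\<Sum>l<n. M i l * x l) = 0) \<longrightarrow> (\<exists>r. \<forall>l<n. x l = r * f l)) \<and>
    (\<forall>z. (\<Sum>i<n. f i * z i) = 0 \<longrightarrow> (\<exists>x. \<forall>i<n. z i = (\<Sum>l<n. M i l * x l)))"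
proof -
  obtain g \<gamma> where g: "kr g" "khom \<gamma> g" and gall: "\<forall>x. kr x \<longrightarrow> (\<exists>r. \<forall>j<N. x j = r * g j)"
    using kernel_cyclic by (elim exE conjE) (rule that)
  have ggen: "\<exists>r. \<forall>j<N. x j = r * g j" if "kr x" for x using gall that by simp
  have sd: "(\<exists>j<N. g j \<noteq> 0) \<and> \<gamma> = int k + 3"
  proof (rule socle_degree[where f = f and Phi = Phi and d = d and e = e])
    show "(\<Sum>j<N. Phi i j * g j) = 0" if "i < n" for i using g(1) that by (simp add: kr_def)
    show "homz (\<gamma> - e j) (g j)" if "j < N" for j using g(2) that by (simp add: khom_def)
    show "\<exists>r. \<forall>j<N. x j = r * g j" if "\<forall>i<n. (\<Sum>j<N. Phi i j * x j) = 0" for x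
      using that by (intro ggen) (simp add: kr_def)
  qed (rule f_in f_hom f_gen Phi_hom Phi_syz Phi_gen; assumption)+
  then have gnz: "\<exists>j<N. g j \<noteq> 0" and \<gamma>: "\<gamma> = int k + 3" by auto
  obtain T P where T_hom0: "\<forall>i<n. \<forall>j<N. homz (d i + e j - \<gamma>) (T i j)"
    and TP0: "\<forall>i<n. \<forall>j<N. \<forall>m<N. (if m = j then f i else 0) = g m * T i j + (\<Sum>l<n. Phi l j * P i l m)"
    and P_skew0: "\<forall>i<n. \<forall>l<n. \<forall>m<N. P i l m = - P l i m"
    and Tg0: "\<forall>i<n. (\<Sum>m<N. g m * T i m) = of_int (int N - int n + 1) * f i"
    using exists_pairing[OF g gall gnz] by (elim exE conjE) (rule that)
  have TP: "(if m = j then f i else 0) = g m * T i j + (\<Sum>l<n. Phi l j * P i l m)"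
    if "i < n" "j < N" "m < N" for i j m using TP0 that by (elim allE impE)
  define c where "c = (of_int (int N - int n + 1) :: 'k)"
  have "Suc N \<noteq> n" using rank_bound[OF g(1) gnz] .
  then have c: "c \<noteq> 0" by (simp only: c_def of_int_eq_0_iff)
  have "(of_int (int N - int n + 1) :: 'k poly3) = const3 c"
    unfolding c_def const3_def by (rule single_of_int[symmetric])
  then have Tg: "(\<Sum>m<N. g m * T i m) = const3 c * f i" if "i < n" for i using Tg0 that by simp
  have "g m \<in> I" if "m < N" for m
    by (rule dual_generators_in_ideal[OF g(1) gnz TP Tg c that])
  then have ex_U: "\<exists>r. g m = (\<Sum>i<n. r i * f i)" if "m < N" for m using f_gen that by simp
  define U where "U m = (SOME r. g m = (\<Sum>i<n. r i * f i))" for m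
  have U: "g m = (\<Sum>i<n. U m i * f i)" if "m < N" for m
    unfolding U_def by (rule someI_ex[OF ex_U[OF that]])
  \<comment> \<open>T U f = T g = c f, so the rows of T U - c are relations among minimal generators
    and vanish modulo the maximal ideal.\<close>
  have TU: "(\<Sum>m<N. c0 (T i m) * c0 (U m l)) = (if l = i then c else 0)" if il: "i < n" "l < n" for i l
  proof -
    have "(\<Sum>l<n. ((\<Sum>m<N. T i m * U m l) - (if l = i then const3 c else 0)) * f l) =
        (\<Sum>m<N. T i m * (\<Sum>l<n. U m l * f l)) - const3 c * f i"
      by (simp only: left_diff_distrib sum_subtractf sum_matrix_assoc sum_delta_mult[OF il(1)])
    also have "(\<Sum>m<N. T i m * (\<Sum>l<n. U m l * f l)) = (\<Sum>m<N. T i m * g m)"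
      by (intro sum.cong refl) (simp only: U lessThan_iff)
    also have "\<dots> = (\<Sum>m<N. g m * T i m)" by (simp only: mult.commute)
    finally have "(\<Sum>l<n. ((\<Sum>m<N. T i m * U m l) - (if l = i then const3 c else 0)) * f l) = 0"
      using Tg[OF il(1)] by simp
    from f_min[OF this il(2)] show ?thesis by (auto simp: lookup_minus lookup_sum split: if_splits)
  qed
  \<comment> \<open>The rows of U T - c are orthogonal to \<open>g\<close>, hence combinations of
    rows of \<open>Phi\<close>, whose entries lie in the maximal ideal.\<close>
  have UT: "(\<Sum>i<n. c0 (U m i) * c0 (T i m')) = (if m' = m then c else 0)" if mm: "m < N" "m' < N" for m m'
  proof -
    have "\<exists>\<sigma>. \<forall>m'<N. (\<Sum>i<n. U m i * T i m') - (if m' = m then const3 c else 0) = (\<Sum>i<n. Phi i m' * \<sigma> i)"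
    proof (rule dual_exact[OF g(1) gnz TP])
      have "(\<Sum>m'<N. ((\<Sum>i<n. U m i * T i m') - (if m' = m then const3 c else 0)) * g m') =
          (\<Sum>i<n. U m i * (\<Sum>m'<N. T i m' * g m')) - const3 c * g m"
        by (simp only: left_diff_distrib sum_subtractf sum_matrix_assoc sum_delta_mult[OF mm(1)])
      also have "(\<Sum>i<n. U m i * (\<Sum>m'<N. T i m' * g m')) = (\<Sum>i<n. U m i * (const3 c * f i))"
        by (intro sum.cong refl) (simp add: Tg[symmetric] mult.commute)
      also have "\<dots> = const3 c * g m" by (simp add: U[OF mm(1)] sum_distrib_left mult_ac)
      finally show "(\<Sum>m'<N. ((\<Sum>i<n. U m i * T i m') - (if m' = m then const3 c else 0)) * g m') = 0" by simp
    qed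
    then obtain \<sigma> where "(\<Sum>i<n. U m i * T i m') - (if m' = m then const3 c else 0) = (\<Sum>i<n. Phi i m' * \<sigma> i)"
      using mm(2) by auto
    then have "c0 ((\<Sum>i<n. U m i * T i m') - (if m' = m then const3 c else 0)) = 0"
      using mm(2) by (simp add: lookup_sum Phi_in_maximal)
    then show ?thesis by (auto simp: lookup_minus lookup_sum split: if_splits)
  qed
  \<comment> \<open>The products in both orders have the same trace; in characteristic zero this
    forces n = N, and then c = 1.\<close>
  have "of_nat n * c = (\<Sum>i<n. \<Sum>m<N. c0 (T i m) * c0 (U m i))" by (simp add: TU)
  also have "\<dots> = (\<Sum>m<N. \<Sum>i<n. c0 (U m i) * c0 (T i m))" by (subst sum.swap) (simp add: mult.commute)
  also have "\<dots> = of_nat N * c" by (simp add: UT)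
  finally have "n = N" using c by simp
  then have Nn: "N = n" by simp
  then have c1: "c = 1" by (simp add: c_def)
  define Tm where "Tm = mat n n (\<lambda>(i, j). T i j)"
  define Um where "Um = mat n n (\<lambda>(i, j). U i j)"
  have car: "Tm \<in> carrier_mat n n" "Um \<in> carrier_mat n n" by (simp_all add: Tm_def Um_def)
  have "mat n n (\<lambda>(i, j). c0 ((Tm * Um) $$ (i, j))) = 1\<^sub>m n"
    by (rule eq_matI) (auto simp: Tm_def Um_def scalar_prod_def atLeast0LessThan lookup_sum TU[unfolded Nn] c1)
  then have "c0 (det Tm) * c0 (det Um) = 1"
    using c0_det[of "Tm * Um" n] car by (simp add: det_mult[OF car])
  then have cT: "c0 (det Tm) \<noteq> 0" by auto
  \<comment> \<open>A homogeneous determinant with nonzero constant term is a constant, so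
    \<open>T\<close> is invertible over the polynomial ring itself and not merely modulo the maximal
    ideal.\<close>
  have "homz ((\<Sum>i<n. d i) + (\<Sum>j<n. e j - \<gamma>)) (det Tm)"
    using T_hom0 by (intro homz_det car) (simp add: Tm_def Nn add_diff_eq)
  moreover from c0_homz[OF this] have "(\<Sum>i<n. d i) + (\<Sum>j<n. e j - \<gamma>) = 0" using cT by blast
  ultimately have "homz 0 (det Tm)" by simp
  define \<delta> where "\<delta> = c0 (det Tm)"
  have \<delta>: "det Tm = const3 \<delta>" "\<delta> \<noteq> 0"
    using homz_0_const3[OF \<open>homz 0 (det Tm)\<close>] cT by (simp_all add: \<delta>_def)
  define V where "V j l = const3 (1 / \<delta>) * adj_mat Tm $$ (j, l)" for j l
  have d1: "const3 (1 / \<delta>) * det Tm = 1" using \<delta> by (simp add: const3_mult[symmetric])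
  have TV: "(\<Sum>j<n. T i j * V j l) = (if i = l then 1 else 0)" if "i < n" "l < n" for i l
  proof -
    have "(\<Sum>j<n. T i j * V j l) = const3 (1 / \<delta>) * (Tm * adj_mat Tm) $$ (i, l)"
      using that adj_mat(1)[OF car(1)]
      by (simp add: V_def Tm_def scalar_prod_def atLeast0LessThan sum_distrib_left mult.left_commute)
    then show ?thesis using that d1 by (simp add: adj_mat(2)[OF car(1)])
  qed
  have VT: "(\<Sum>i<n. V j i * T i l) = (if j = l then 1 else 0)" if "j < n" "l < n" for j l
  proof -
    have "(\<Sum>i<n. V j i * T i l) = const3 (1 / \<delta>) * (adj_mat Tm * Tm) $$ (j, l)"
      using that adj_mat(1)[OF car(1)]
      by (simp add: V_def Tm_def scalar_prod_def atLeast0LessThan sum_distrib_left mult.assoc)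
    then show ?thesis using that d1 by (simp add: adj_mat(3)[OF car(1)])
  qed
  have TVx: "(\<Sum>j<n. T i j * (\<Sum>l<n. V j l * x l)) = x i" if "i < n" for i x
    by (simp add: sum_matrix_assoc TV that sum_delta_mult cong: sum.cong_simp)
  have VTx: "(\<Sum>i<n. V j i * (\<Sum>l<n. T i l * x l)) = x j" if "j < n" for j x
    by (simp add: sum_matrix_assoc VT that sum_delta_mult cong: sum.cong_simp)
  have hcT: "hc D (T i j * p) = T i j * hc (D - (d i + e j - \<gamma>)) p" if "i < n" "j < n" for D i j p
    by (rule hc_mult') (use T_hom0 that Nn in simp)
  have V_hom: "homz (\<gamma> - e j - d l) (V j l)" if j: "j < n" and l: "l < n" for j l
  proof -
    have "(\<Sum>j'<n. T i j' * hc (\<gamma> - e j' - d l) (V j' l)) = (if i = l then 1 else 0)" if i: "i < n" for i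
    proof -
      have "(\<Sum>j'<n. T i j' * hc (\<gamma> - e j' - d l) (V j' l)) = hc (d i - d l) (\<Sum>j'<n. T i j' * V j' l)"
        unfolding hc_sum
        by (intro sum.cong refl) (simp add: hcT i algebra_simps)
      then show ?thesis by (auto simp: TV[OF i l] hc_self)
    qed
    then have "(\<Sum>i<n. V j i * (\<Sum>j'<n. T i j' * hc (\<gamma> - e j' - d l) (V j' l))) = (\<Sum>i<n. V j i * (if i = l then 1 else 0))"
      by (intro sum.cong refl) (simp only: lessThan_iff)
    then have "hc (\<gamma> - e j - d l) (V j l) = V j l"
      using l by (simp add: VTx[OF j] if_distrib[of "\<lambda>x. _ * x"] cong: if_cong)
    then show ?thesis using homz_hc[of "\<gamma> - e j - d l" "V j l"] by simp
  qed
  define A where "A a b = (\<Sum>i<n. Phi i a * T i b)" for a b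
  \<comment> \<open>The relation between \<open>T\<close> and \<open>P\<close> expresses
    \<open>A\<close> through \<open>P\<close> only after multiplication by an entry of
    \<open>g\<close>; a nonzero entry is cancelled at the end.\<close>
  have A_skew: "A a b = - A b a" if ab: "a < n" "b < n" for a b
  proof -
    obtain m where m: "m < N" "g m \<noteq> 0" using gnz by blast
    have gA: "g m * A a b = - (\<Sum>i<n. \<Sum>l<n. Phi i a * (Phi l b * P i l m))" if ab: "a < n" "b < n" for a b
    proof -
      have "g m * A a b = (\<Sum>i<n. Phi i a * (g m * T i b))" by (simp add: A_def sum_distrib_left mult.left_commute)
      also have "\<dots> = (\<Sum>i<n. Phi i a * ((if m = b then f i else 0) - (\<Sum>l<n. Phi l b * P i l m)))"
      proof (intro sum.cong refl)
        fix i assume "i \<in> {..<n}"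
        then have "(if m = b then f i else 0) = g m * T i b + (\<Sum>l<n. Phi l b * P i l m)"
          using TP[of i b m] ab m(1) Nn by simp
        then show "Phi i a * (g m * T i b) = Phi i a * ((if m = b then f i else 0) - (\<Sum>l<n. Phi l b * P i l m))" by simp
      qed
      also have "\<dots> = (if m = b then (\<Sum>i<n. f i * Phi i a) else 0) - (\<Sum>i<n. \<Sum>l<n. Phi i a * (Phi l b * P i l m))"
        by (simp add: right_diff_distrib sum_subtractf sum_distrib_left mult.commute)
      finally show ?thesis using Phi_syz[of a] ab Nn by simp
    qed
    have "(\<Sum>i<n. \<Sum>l<n. Phi i a * (Phi l b * P i l m)) = (\<Sum>l<n. \<Sum>i<n. Phi i a * (Phi l b * P i l m))"
      by (rule sum.swap)
    also have "\<dots> = (\<Sum>l<n. \<Sum>i<n. - (Phi l b * (Phi i a * P l i m)))"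
    proof (intro sum.cong refl)
      fix i l assume "i \<in> {..<n}" "l \<in> {..<n}"
      then have "P i l m = - P l i m" by (intro P_skew0[rule_format] m(1)) simp_all
      then show "Phi i a * (Phi l b * P i l m) = - (Phi l b * (Phi i a * P l i m))" by (simp add: mult.left_commute)
    qed
    finally have "g m * A a b = - (g m * A b a)" using gA[OF ab] gA[OF ab(2,1)] by (simp add: sum_negf)
    then have "g m * A a b = g m * (- A b a)" by simp
    then show ?thesis by (rule mult_left_cancel[OF m(2), THEN iffD1])
  qed
  have PhiA: "Phi l a = (\<Sum>b<n. A a b * V b l)" if "l < n" for l a
  proof -
    have "(\<Sum>b<n. A a b * V b l) = (\<Sum>i<n. Phi i a * (\<Sum>b<n. T i b * V b l))"
      unfolding A_def by (rule sum_matrix_assoc[symmetric])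
    also have "\<dots> = (\<Sum>i<n. Phi i a * (if i = l then 1 else 0))"
      by (intro sum.cong refl) (simp add: TV that)
    finally show ?thesis using that by (simp add: if_distrib[of "\<lambda>x. _ * x"] cong: if_cong)
  qed
  \<comment> \<open>With \<open>V\<close> the inverse of \<open>T\<close>, this is the transpose of
    V^T A V, so it inherits skew symmetry by congruence, while its kernel and image are those of
    \<open>Phi\<close> transported along \<open>V\<close>.\<close>
  define M where "M p l = (\<Sum>j<n. Phi p j * V j l)" for p l
  have M_skew: "M p l = - M l p" if pl: "p < n" "l < n" for p l
  proof -
    have ex: "M p l = (\<Sum>j<n. \<Sum>b<n. A j b * (V b p * V j l))" if "p < n" for p l
      by (simp add: M_def PhiA[OF that] sum_distrib_right mult.assoc)
    have "M p l = (\<Sum>b<n. \<Sum>j<n. A j b * (V b p * V j l))" unfolding ex[OF pl(1)] by (rule sum.swap)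
    also have "\<dots> = (\<Sum>b<n. \<Sum>j<n. - (A b j * (V j l * V b p)))"
    proof (intro sum.cong refl)
      fix b j assume "b \<in> {..<n}" "j \<in> {..<n}"
      then have "A j b = - A b j" by (intro A_skew) auto
      then show "A j b * (V b p * V j l) = - (A b j * (V j l * V b p))" by (simp add: mult.commute)
    qed
    finally show ?thesis unfolding ex[OF pl(2)] by (simp add: sum_negf)
  qed
  have M_hom: "homz (int k + 3 - d i - d l) (M i l)" if "i < n" "l < n" for i l
    unfolding M_def
  proof (rule homz_sum)
    fix j assume "j \<in> {..<n}"
    then show "homz (int k + 3 - d i - d l) (Phi i j * V j l)"
      using homz_mult[OF Phi_hom[of j i] V_hom[of j l]] that Nn \<gamma> by (simp add: algebra_simps)
  qed
  have Mx: "(\<Sum>l<n. M i l * x l) = (\<Sum>j<n. Phi i j * (\<Sum>l<n. V j l * x l))" for i x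
    unfolding M_def by (rule sum_matrix_assoc[symmetric])
  have fT: "f l = (\<Sum>m<n. T l m * g m)" if "l < n" for l
    using Tg[OF that] c1 Nn by (simp add: mult.commute)
  have Mf: "(\<Sum>l<n. M i l * f l) = 0" if "i < n" for i
  proof -
    have "(\<Sum>l<n. V j l * f l) = g j" if "j < n" for j
      using VTx[OF that, of g] by (simp add: fT cong: sum.cong_simp)
    moreover have "(\<Sum>j<n. Phi i j * g j) = 0" using g(1) that unfolding kr_def unfolding Nn by simp
    ultimately show ?thesis by (simp add: Mx cong: sum.cong_simp)
  qed
  have c0M: "c0 (M i l) = 0" if il: "i < n" "l < n" for i l
  proof -
    have "(\<Sum>i<n. M i l * f i) = (\<Sum>i<n. - (M l i * f i))"
      by (intro sum.cong refl) (use M_skew[OF _ il(2)] in simp)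
    then have "(\<Sum>i<n. M i l * f i) = 0" using Mf[OF il(2)] by (simp add: sum_negf)
    from f_min[OF this il(1)] show ?thesis .
  qed
  have ker: "\<exists>r. \<forall>l<n. x l = r * f l" if "\<forall>i<n. (\<Sum>l<n. M i l * x l) = 0" for x
  proof -
    have "kr (\<lambda>j. \<Sum>l<n. V j l * x l)" using that unfolding kr_def unfolding Nn by (simp add: Mx)
    from ggen[OF this] obtain r where r: "\<forall>j<N. (\<Sum>l<n. V j l * x l) = r * g j" by (rule exE)
    have "x i = r * f i" if i: "i < n" for i
    proof -
      have "x i = (\<Sum>j<n. T i j * (\<Sum>l<n. V j l * x l))" by (simp add: TVx[OF i])
      also have "\<dots> = (\<Sum>j<n. T i j * (r * g j))" by (intro sum.cong refl) (use r Nn in simp)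
      finally show ?thesis by (simp add: fT[OF i] sum_distrib_left mult.left_commute)
    qed
    then show ?thesis by (intro exI[of _ r]) simp
  qed
  have gen: "\<exists>x. \<forall>i<n. z i = (\<Sum>l<n. M i l * x l)" if z: "(\<Sum>i<n. f i * z i) = 0" for z
  proof -
    from Phi_gen[OF z] obtain x where x: "\<forall>i<n. z i = (\<Sum>j<N. Phi i j * x j)" by (rule exE)
    have "z i = (\<Sum>l<n. M i l * (\<Sum>j<n. T l j * x j))" if "i < n" for i
      using x that Nn by (simp add: Mx VTx cong: sum.cong_simp)
    then show ?thesis by (intro exI[of _ "\<lambda>l. \<Sum>j<n. T l j * x j"]) simp
  qed
  show ?thesis
  proof (rule exI[of _ M], intro conjI allI impI)
    show "M i l = - M l i" "homz (int k + 3 - d i - d l) (M i l)" "c0 (M i l) = 0" if "i < n" "l < n" for i l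
      by (rule M_skew[OF that] M_hom[OF that] c0M[OF that])+
    show "(\<Sum>l<n. M i l * f l) = 0" if "i < n" for i by (rule Mf[OF that])
    show "\<exists>r. \<forall>l<n. x l = r * f l" if "\<forall>i<n. (\<Sum>l<n. M i l * x l) = 0" for x by (rule ker[OF that])
    show "\<exists>x. \<forall>i<n. z i = (\<Sum>l<n. M i l * x l)" if "(\<Sum>i<n. f i * z i) = 0" for z by (rule gen[OF that])
  qed
qed

end

section \<open>Pfaffians and determinants\<close>

definition perms :: "nat \<Rightarrow> (nat \<Rightarrow> nat) set" where
  "perms N = {\<sigma>. \<sigma> permutes {..<N}}"

definition pweight :: "(nat \<Rightarrow> nat \<Rightarrow> 'a::comm_ring_1) \<Rightarrow> nat \<Rightarrow> (nat \<Rightarrow> nat) \<Rightarrow> 'a" where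
  "pweight A m \<sigma> = of_int (sign \<sigma>) * (\<Prod>i<m. A (\<sigma> (2 * i)) (\<sigma> (2 * i + 1)))"

definition pf :: "nat \<Rightarrow> (nat \<Rightarrow> nat \<Rightarrow> 'a::comm_ring_1) \<Rightarrow> 'a" where
  "pf m A = (\<Sum>\<sigma>\<in>matching_perms m. pweight A m \<sigma>)"

text \<open>Each perfect matching is listed by 2^m m! permutations, of equal weight if
  \<open>A\<close> is skew. The sum over all permutations is not tied to an ordering, so a change of
  basis in it is a determinant expansion.\<close>

definition full_pf :: "nat \<Rightarrow> (nat \<Rightarrow> nat \<Rightarrow> 'a::comm_ring_1) \<Rightarrow> 'a" where
  "full_pf m A = (\<Sum>\<sigma>\<in>perms (2 * m). pweight A m \<sigma>)"

section \<open>From matchings to all permutations\<close>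

lemma pfaffian_eq_pf: "pfaffian M = pf (dim_row M div 2) (\<lambda>i j. M $$ (i, j))"
  by (simp add: pfaffian_def pf_def pweight_def)

lemma finite_perms [simp]: "finite (perms N)"
  by (simp add: perms_def finite_permutations)

lemma perms_permutation: "\<sigma> \<in> perms N \<Longrightarrow> permutation \<sigma>"
  unfolding perms_def permutation_permutes by blast

lemma perms_less: "\<sigma> \<in> perms N \<Longrightarrow> \<sigma> x < N \<longleftrightarrow> x < N"
  using permutes_in_image[of \<sigma> "{..<N}" x] by (simp add: perms_def)

lemma perms_inj: "\<sigma> \<in> perms N \<Longrightarrow> \<sigma> x = \<sigma> y \<longleftrightarrow> x = y"
  using permutes_inj[of \<sigma> "{..<N}"] by (auto simp: perms_def inj_def)

lemma perms_comp: "\<sigma> \<in> perms N \<Longrightarrow> \<tau> \<in> perms N \<Longrightarrow> \<sigma> \<circ> \<tau> \<in> perms N"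
  by (simp add: perms_def permutes_compose)

lemma perms_transpose: "a < N \<Longrightarrow> b < N \<Longrightarrow> transpose a b \<in> perms N"
  by (simp add: perms_def permutes_swap_id)

text \<open>The sign of the transposition cancels the sign from exchanging the two indices of the
  skew matrix.\<close>

lemma pweight_flip:
  assumes \<sigma>: "\<sigma> \<in> perms (2 * m)" and j: "j < m"
    and A: "\<And>x y. x < 2 * m \<Longrightarrow> y < 2 * m \<Longrightarrow> A x y = - A y x"
  shows "pweight A m (\<sigma> \<circ> transpose (2 * j) (2 * j + 1)) = pweight A m \<sigma>"
proof -
  let ?t = "transpose (2 * j) (2 * j + 1)"
  have t: "?t \<in> perms (2 * m)" using j by (intro perms_transpose) auto
  have s: "sign (\<sigma> \<circ> ?t) = - sign \<sigma>"
    using sign_compose[OF perms_permutation[OF \<sigma>] perms_permutation[OF t]] by (simp add: sign_swap_id)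
  have o: "?t (2 * i) = 2 * i" "?t (2 * i + 1) = 2 * i + 1" if "i \<noteq> j" for i
    using that by (auto simp: transpose_def)
  have jj: "?t (2 * j) = 2 * j + 1" "?t (2 * j + 1) = 2 * j" by simp_all
  have "(\<Prod>i<m. A ((\<sigma> \<circ> ?t) (2 * i)) ((\<sigma> \<circ> ?t) (2 * i + 1))) =
      A (\<sigma> (2 * j + 1)) (\<sigma> (2 * j)) * (\<Prod>i\<in>{..<m} - {j}. A ((\<sigma> \<circ> ?t) (2 * i)) ((\<sigma> \<circ> ?t) (2 * i + 1)))"
    using j by (subst prod.remove[of _ j]) (simp_all only: comp_apply jj finite_lessThan lessThan_iff)
  also have "(\<Prod>i\<in>{..<m} - {j}. A ((\<sigma> \<circ> ?t) (2 * i)) ((\<sigma> \<circ> ?t) (2 * i + 1))) =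
      (\<Prod>i\<in>{..<m} - {j}. A (\<sigma> (2 * i)) (\<sigma> (2 * i + 1)))"
    by (intro prod.cong refl) (simp only: comp_apply o Diff_iff insert_iff empty_iff, simp)
  also have "A (\<sigma> (2 * j + 1)) (\<sigma> (2 * j)) = - A (\<sigma> (2 * j)) (\<sigma> (2 * j + 1))"
    using j by (intro A) (simp_all add: perms_less[OF \<sigma>])
  also have "- A (\<sigma> (2 * j)) (\<sigma> (2 * j + 1)) * (\<Prod>i\<in>{..<m} - {j}. A (\<sigma> (2 * i)) (\<sigma> (2 * i + 1))) =
      - (\<Prod>i<m. A (\<sigma> (2 * i)) (\<sigma> (2 * i + 1)))"
    using j by (subst prod.remove[of "{..<m}" j]) simp_all
  finally have e: "(\<Prod>i<m. A ((\<sigma> \<circ> ?t) (2 * i)) ((\<sigma> \<circ> ?t) (2 * i + 1))) =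
      - (\<Prod>i<m. A (\<sigma> (2 * i)) (\<sigma> (2 * i + 1)))" .
  show ?thesis unfolding pweight_def s e by simp
qed

definition swap2 :: "nat \<Rightarrow> nat \<Rightarrow> nat \<Rightarrow> nat" where
  "swap2 a b = transpose (2 * a) (2 * b) \<circ> transpose (2 * a + 1) (2 * b + 1)"

lemma swap2_apply: "swap2 a b (2 * i) = 2 * transpose a b i" "swap2 a b (2 * i + 1) = 2 * transpose a b i + 1"
  by (auto simp: swap2_def transpose_def)

lemma swap2_perms: "a < m \<Longrightarrow> b < m \<Longrightarrow> swap2 a b \<in> perms (2 * m)"
  unfolding swap2_def by (intro perms_comp perms_transpose) auto

lemma swap2_swap2: "swap2 a b \<circ> swap2 a b = id"
proof
  fix x show "(swap2 a b \<circ> swap2 a b) x = id x"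
  proof (cases "even x")
    case True
    then obtain i where "x = 2 * i" by blast
    then show ?thesis by (simp add: swap2_apply)
  next
    case False
    then obtain i where "x = 2 * i + 1" by (blast elim: oddE)
    then show ?thesis by (simp only: comp_apply swap2_apply) simp
  qed
qed

text \<open>Exchanging two whole pairs is a product of two transpositions and only permutes the
  factors of the weight.\<close>

lemma pweight_swap2:
  assumes \<sigma>: "\<sigma> \<in> perms (2 * m)" and ab: "a < m" "b < m"
  shows "pweight A m (\<sigma> \<circ> swap2 a b) = pweight A m \<sigma>"
proof -
  have p: "permutation (transpose (2 * a) (2 * b))" "permutation (transpose (2 * a + 1) (2 * b + 1))"
    by (rule permutation_swap_id)+
  have "sign (swap2 a b) = 1"
    unfolding swap2_def sign_compose[OF p] by (auto simp: sign_swap_id)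
  then have s: "sign (\<sigma> \<circ> swap2 a b) = sign \<sigma>"
    using sign_compose[OF perms_permutation[OF \<sigma>] perms_permutation[OF swap2_perms[OF ab]]] by simp
  have "transpose a b permutes {..<m}" using ab by (simp add: permutes_swap_id)
  from prod.permute[OF this, of "\<lambda>i. A (\<sigma> (2 * i)) (\<sigma> (2 * i + 1))"]
  have "(\<Prod>i<m. A ((\<sigma> \<circ> swap2 a b) (2 * i)) ((\<sigma> \<circ> swap2 a b) (2 * i + 1))) = (\<Prod>i<m. A (\<sigma> (2 * i)) (\<sigma> (2 * i + 1)))"
    by (simp only: comp_def swap2_apply)
  then show ?thesis by (simp only: pweight_def s)
qed

text \<open>Interpolates between all permutations at j = 0 and those listing each pair in increasing
  order at j = m; every step halves the sum.\<close>

definition flipped :: "nat \<Rightarrow> nat \<Rightarrow> (nat \<Rightarrow> nat) set" where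
  "flipped m j = {\<sigma> \<in> perms (2 * m). \<forall>i<j. \<sigma> (2 * i) < \<sigma> (2 * i + 1)}"

lemma sum_flipped:
  assumes j: "j < m" and A: "\<And>x y. x < 2 * m \<Longrightarrow> y < 2 * m \<Longrightarrow> A x y = - A y x"
  shows "(\<Sum>\<sigma>\<in>flipped m j. pweight A m \<sigma>) = 2 * (\<Sum>\<sigma>\<in>flipped m (Suc j). pweight A m \<sigma>)"
proof -
  let ?t = "transpose (2 * j) (2 * j + 1)"
  let ?G = "flipped m j - flipped m (Suc j)"
  have o: "?t (2 * i) = 2 * i" "?t (2 * i + 1) = 2 * i + 1" if "i \<noteq> j" for i
    using that by (auto simp: transpose_def)
  have jj: "?t (2 * j) = 2 * j + 1" "?t (2 * j + 1) = 2 * j" by simp_all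
  have t: "?t \<in> perms (2 * m)" using j by (intro perms_transpose) auto
  have fin: "finite (flipped m i)" for i by (simp add: flipped_def)
  have sub: "flipped m (Suc j) \<subseteq> flipped m j" by (auto simp: flipped_def)
  have bij: "bij_betw (\<lambda>\<sigma>. \<sigma> \<circ> ?t) (flipped m (Suc j)) ?G"
  proof (rule bij_betw_byWitness[where f' = "\<lambda>\<sigma>. \<sigma> \<circ> ?t"])
    have id: "(\<sigma> \<circ> ?t) \<circ> ?t = \<sigma>" for \<sigma> :: "nat \<Rightarrow> nat" by (simp add: comp_assoc)
    then show "\<forall>\<sigma>\<in>flipped m (Suc j). (\<sigma> \<circ> ?t) \<circ> ?t = \<sigma>" "\<forall>\<sigma>\<in>?G. (\<sigma> \<circ> ?t) \<circ> ?t = \<sigma>" by simp_all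
    show "(\<lambda>\<sigma>. \<sigma> \<circ> ?t) ` flipped m (Suc j) \<subseteq> ?G"
    proof (intro image_subsetI)
      fix \<sigma> assume \<sigma>: "\<sigma> \<in> flipped m (Suc j)"
      then have "\<sigma> \<circ> ?t \<in> perms (2 * m)" using t by (auto simp: flipped_def intro: perms_comp)
      moreover have "(\<sigma> \<circ> ?t) (2 * i) < (\<sigma> \<circ> ?t) (2 * i + 1)" if "i < j" for i
      proof -
        have ij: "i \<noteq> j" using that by simp
        show ?thesis unfolding comp_apply o[OF ij] using \<sigma> that by (auto simp: flipped_def)
      qed
      moreover have "\<not> (\<sigma> \<circ> ?t) (2 * j) < (\<sigma> \<circ> ?t) (2 * j + 1)"
        using \<sigma> unfolding comp_apply jj by (auto simp: flipped_def less_Suc_eq)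
      ultimately show "\<sigma> \<circ> ?t \<in> ?G" unfolding flipped_def by blast
    qed
    show "(\<lambda>\<sigma>. \<sigma> \<circ> ?t) ` ?G \<subseteq> flipped m (Suc j)"
    proof (intro image_subsetI)
      fix \<sigma> assume \<sigma>: "\<sigma> \<in> ?G"
      then have p: "\<sigma> \<in> perms (2 * m)" by (simp add: flipped_def)
      then have "\<sigma> \<circ> ?t \<in> perms (2 * m)" using t by (intro perms_comp)
      moreover have "(\<sigma> \<circ> ?t) (2 * i) < (\<sigma> \<circ> ?t) (2 * i + 1)" if "i < j" for i
      proof -
        have ij: "i \<noteq> j" using that by simp
        show ?thesis unfolding comp_apply o[OF ij] using \<sigma> that by (auto simp: flipped_def)
      qed
      moreover have "(\<sigma> \<circ> ?t) (2 * j) < (\<sigma> \<circ> ?t) (2 * j + 1)"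
      proof -
        have "\<not> \<sigma> (2 * j) < \<sigma> (2 * j + 1)" using \<sigma> by (auto simp: flipped_def less_Suc_eq)
        moreover have "\<sigma> (2 * j) \<noteq> \<sigma> (2 * j + 1)" by (simp add: perms_inj[OF p])
        ultimately show ?thesis unfolding comp_apply jj by simp
      qed
      ultimately show "\<sigma> \<circ> ?t \<in> flipped m (Suc j)" unfolding flipped_def by (auto simp: less_Suc_eq)
    qed
  qed
  have "(\<Sum>\<sigma>\<in>?G. pweight A m \<sigma>) = (\<Sum>\<sigma>\<in>flipped m (Suc j). pweight A m (\<sigma> \<circ> ?t))"
    by (rule sum.reindex_bij_betw[OF bij, symmetric])
  also have "\<dots> = (\<Sum>\<sigma>\<in>flipped m (Suc j). pweight A m \<sigma>)"
    by (intro sum.cong refl pweight_flip j A) (simp_all add: flipped_def)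
  finally show ?thesis using sum.subset_diff[OF sub fin, of "pweight A m"] by simp
qed

definition sorted_to :: "nat \<Rightarrow> nat \<Rightarrow> (nat \<Rightarrow> nat) set" where
  "sorted_to m j = {\<sigma> \<in> flipped m m. \<forall>i<j. \<forall>l<m. i < l \<longrightarrow> \<sigma> (2 * i) < \<sigma> (2 * l)}"

lemma swap2_sorted_to:
  assumes \<sigma>: "\<sigma> \<in> sorted_to m j" and ab: "j \<le> a" "a < m" "j \<le> b" "b < m"
  shows "\<sigma> \<circ> swap2 a b \<in> sorted_to m j"
proof -
  have tm: "transpose a b i < m" if "i < m" for i using ab that by (auto simp: transpose_def)
  have "\<sigma> \<circ> swap2 a b \<in> perms (2 * m)"
    using \<sigma> ab by (intro perms_comp swap2_perms) (auto simp: sorted_to_def flipped_def)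
  moreover have "(\<sigma> \<circ> swap2 a b) (2 * i) < (\<sigma> \<circ> swap2 a b) (2 * i + 1)" if "i < m" for i
    using \<sigma> tm[OF that] unfolding comp_apply swap2_apply by (auto simp: sorted_to_def flipped_def)
  moreover have "(\<sigma> \<circ> swap2 a b) (2 * i) < (\<sigma> \<circ> swap2 a b) (2 * l)" if "i < j" "l < m" "i < l" for i l
  proof -
    have "transpose a b i = i" using that ab by (auto simp: transpose_def)
    moreover have "i < transpose a b l" using that ab by (auto simp: transpose_def)
    ultimately show ?thesis
      using \<sigma> that tm[OF that(2)] unfolding comp_apply swap2_apply by (auto simp: sorted_to_def)
  qed
  ultimately show ?thesis by (auto simp: sorted_to_def flipped_def)
qed

text \<open>Among the pairs from \<open>j\<close> on, the one with the least first entry is moved to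
  place \<open>j\<close>. Its former place \<open>l\<close> is the only information lost, which
  accounts for the factor m - j.\<close>

lemma sum_sorted_to:
  assumes j: "j < m"
  shows "(\<Sum>\<sigma>\<in>sorted_to m j. pweight A m \<sigma>) = of_nat (m - j) * (\<Sum>\<sigma>\<in>sorted_to m (Suc j). pweight A m \<sigma>)"
proof -
  let ?F = "\<lambda>(l, \<sigma>). \<sigma> \<circ> swap2 j l"
  have fin: "finite (sorted_to m i)" for i by (simp add: sorted_to_def flipped_def)
  have sub: "sorted_to m (Suc j) \<subseteq> sorted_to m j" by (auto simp: sorted_to_def)
  have cancel: "(\<sigma> \<circ> swap2 j l) \<circ> swap2 j l = \<sigma>" for \<sigma> :: "nat \<Rightarrow> nat" and l
    by (simp add: comp_assoc swap2_swap2)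
  have min: "(\<sigma> \<circ> swap2 j l) (2 * l) < (\<sigma> \<circ> swap2 j l) (2 * i)"
    if "\<sigma> \<in> sorted_to m (Suc j)" "l \<in> {j..<m}" "i \<in> {j..<m}" "i \<noteq> l" for \<sigma> l i
  proof -
    have "transpose j l i < m" "transpose j l i > j" using that by (auto simp: transpose_def)
    then show ?thesis using that(1) unfolding comp_apply swap2_apply by (auto simp: sorted_to_def)
  qed
  have inj: "inj_on ?F ({j..<m} \<times> sorted_to m (Suc j))"
  proof (rule inj_onI, clarify)
    fix l \<sigma> l' \<sigma>' assume l: "l \<in> {j..<m}" "l' \<in> {j..<m}"
      and s: "\<sigma> \<in> sorted_to m (Suc j)" "\<sigma>' \<in> sorted_to m (Suc j)"
      and eq: "\<sigma> \<circ> swap2 j l = \<sigma>' \<circ> swap2 j l'"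
    have "l = l'"
    proof (rule ccontr)
      assume ne: "l \<noteq> l'"
      from min[OF s(1) l ne[symmetric]] min[OF s(2) l(2,1) ne] show False unfolding eq by simp
    qed
    moreover then have "\<sigma> = \<sigma>'" using eq cancel by metis
    ultimately show "l = l' \<and> \<sigma> = \<sigma>'" by blast
  qed
  have img: "?F ` ({j..<m} \<times> sorted_to m (Suc j)) = sorted_to m j"
  proof
    show "?F ` ({j..<m} \<times> sorted_to m (Suc j)) \<subseteq> sorted_to m j"
      using sub j by (auto intro!: swap2_sorted_to)
    show "sorted_to m j \<subseteq> ?F ` ({j..<m} \<times> sorted_to m (Suc j))"
    proof
      fix \<sigma> assume \<sigma>: "\<sigma> \<in> sorted_to m j"
      then have p: "\<sigma> \<in> perms (2 * m)" by (simp add: sorted_to_def flipped_def)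
      let ?S = "(\<lambda>i. \<sigma> (2 * i)) ` {j..<m}"
      have "Min ?S \<in> ?S" using j by (intro Min_in) auto
      then obtain l where l1: "l \<in> {j..<m}" "Min ?S = \<sigma> (2 * l)" by (rule imageE)
      have "\<sigma> (2 * l) \<le> \<sigma> (2 * i)" if "i \<in> {j..<m}" for i
        unfolding l1(2)[symmetric] using that by (intro Min_le) auto
      note l = l1(1) this
      have "\<sigma> \<circ> swap2 j l \<in> sorted_to m j" using l(1) j by (intro swap2_sorted_to[OF \<sigma>]) auto
      moreover have "(\<sigma> \<circ> swap2 j l) (2 * j) < (\<sigma> \<circ> swap2 j l) (2 * i)" if "j < i" "i < m" for i
      proof -
        have t: "transpose j l i \<in> {j..<m}" "transpose j l i \<noteq> l" using that l(1) by (auto simp: transpose_def)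
        have "\<sigma> (2 * l) \<le> \<sigma> (2 * transpose j l i)" by (rule l(2)[OF t(1)])
        moreover have "\<sigma> (2 * l) \<noteq> \<sigma> (2 * transpose j l i)" using t(2) by (simp add: perms_inj[OF p])
        ultimately show ?thesis unfolding comp_apply swap2_apply by simp
      qed
      ultimately have "\<sigma> \<circ> swap2 j l \<in> sorted_to m (Suc j)" by (auto simp: sorted_to_def less_Suc_eq)
      with l(1) have "(l, \<sigma> \<circ> swap2 j l) \<in> {j..<m} \<times> sorted_to m (Suc j)" by (rule SigmaI)
      moreover have "\<sigma> = ?F (l, \<sigma> \<circ> swap2 j l)" by (simp only: case_prod_conv cancel)
      ultimately show "\<sigma> \<in> ?F ` ({j..<m} \<times> sorted_to m (Suc j))" by (rule image_eqI[rotated])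
    qed
  qed
  have "(\<Sum>\<sigma>\<in>sorted_to m j. pweight A m \<sigma>) = (\<Sum>x\<in>{j..<m} \<times> sorted_to m (Suc j). pweight A m (?F x))"
    unfolding img[symmetric] by (subst sum.reindex[OF inj]) simp
  also have "\<dots> = (\<Sum>(l, \<sigma>)\<in>{j..<m} \<times> sorted_to m (Suc j). pweight A m \<sigma>)"
    by (intro sum.cong refl) (auto intro!: pweight_swap2 simp: sorted_to_def flipped_def)
  also have "\<dots> = of_nat (m - j) * (\<Sum>\<sigma>\<in>sorted_to m (Suc j). pweight A m \<sigma>)"
    by (simp add: sum.cartesian_product[symmetric])
  finally show ?thesis .
qed

lemma full_pf_eq:
  assumes A: "\<And>x y. x < 2 * m \<Longrightarrow> y < 2 * m \<Longrightarrow> A x y = - A y x"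
  shows "full_pf m A = of_nat (2 ^ m * (\<Prod>i<m. m - i)) * pf m A"
proof -
  have 1: "full_pf m A = 2 ^ j * (\<Sum>\<sigma>\<in>flipped m j. pweight A m \<sigma>)" if "j \<le> m" for j
    using that
  proof (induction j)
    case 0
    then show ?case by (simp add: full_pf_def flipped_def)
  next
    case (Suc j)
    then show ?case using sum_flipped[of j m A, OF _ A] by simp
  qed
  have 2: "(\<Sum>\<sigma>\<in>flipped m m. pweight A m \<sigma>) = of_nat (\<Prod>i<j. m - i) * (\<Sum>\<sigma>\<in>sorted_to m j. pweight A m \<sigma>)"
    if "j \<le> m" for j
    using that
  proof (induction j)
    case 0
    have "sorted_to m 0 = flipped m m" by (simp add: sorted_to_def)
    then show ?case by simp
  next
    case (Suc j)
    then show ?case using sum_sorted_to[of j m A] by (simp add: mult.assoc)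
  qed
  have "sorted_to m m = matching_perms m"
    unfolding sorted_to_def flipped_def matching_perms_def perms_def by (auto intro: less_trans)
  then show ?thesis using 1[of m] 2[of m] by (simp add: pf_def mult.assoc)
qed

lemma less_double_cases:
  fixes x m :: nat
  assumes "x < 2 * m"
  obtains i where "i < m" "x = 2 * i" | i where "i < m" "x = 2 * i + 1"
proof -
  have "x div 2 < m" using assms by auto
  moreover have "x = 2 * (x div 2) \<or> x = 2 * (x div 2) + 1" by presburger
  ultimately show ?thesis using that by blast
qed

lemma prod_lessThan_double: "(\<Prod>j<2 * m. g j) = (\<Prod>i<m. g (2 * i) * g (2 * i + 1 :: nat))"
  for g :: "nat \<Rightarrow> 'a::comm_monoid_mult"
  by (induction m) (simp_all add: mult.assoc)

lemma signed_sum_columns: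
  fixes B :: "nat \<Rightarrow> nat \<Rightarrow> 'a::comm_ring_1"
  shows "(\<Sum>\<sigma>\<in>perms N. of_int (sign \<sigma>) * (\<Prod>j<N. B (\<sigma> j) (\<tau> j))) = det (mat N N (\<lambda>(i, j). B j (\<tau> i)))"
  by (subst det_def'[of _ N]) (simp_all add: perms_def atLeast0LessThan permutes_in_image[of _ "{..<N}", simplified])

text \<open>Expanding all entries gives a sum over choices of column indices, in which the sum over
  \<sigma> is a determinant with those indices. A repeated index makes two rows equal, so only the
  permutations survive, each contributing det B up to its sign.\<close>

lemma full_pf_congruence:
  fixes A B :: "nat \<Rightarrow> nat \<Rightarrow> 'a::comm_ring_1"
  assumes N: "N = 2 * m"
  shows "full_pf m (\<lambda>p q. \<Sum>a<N. \<Sum>b<N. B p a * A a b * B q b) = det (mat N N (\<lambda>(i, j). B i j)) * full_pf m A"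
proof -
  let ?P = "{..<N} \<times> {..<N}" and ?dB = "det (mat N N (\<lambda>(i, j). B i j))"
  let ?Fn = "Pi\<^sub>E {..<m} (\<lambda>_. ?P)"
  define T where "T f j = (if even j then fst (f (j div 2)) else snd (f (j div 2)))" for f :: "nat \<Rightarrow> nat \<times> nat" and j
  have T2: "T f (2 * i) = fst (f i)" "T f (2 * i + 1) = snd (f i)" for f i by (simp_all add: T_def)
  have Tlt: "T f j < N" if "f \<in> ?Fn" "j < N" for f j
  proof -
    have "j div 2 < m" using that(2) N by auto
    then have "f (j div 2) \<in> ?P" using that(1) by (rule PiE_mem[rotated, OF lessThan_iff[THEN iffD2]])
    then show ?thesis by (auto simp: T_def)
  qed
  define W where "W f = (\<Prod>i<m. A (fst (f i)) (snd (f i)))" for f :: "nat \<Rightarrow> nat \<times> nat"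
  have expand: "pweight (\<lambda>p q. \<Sum>a<N. \<Sum>b<N. B p a * A a b * B q b) m \<sigma> =
      (\<Sum>f\<in>?Fn. W f * (of_int (sign \<sigma>) * (\<Prod>j<N. B (\<sigma> j) (T f j))))" for \<sigma>
  proof -
    have "(\<Prod>i<m. \<Sum>a<N. \<Sum>b<N. B (\<sigma> (2 * i)) a * A a b * B (\<sigma> (2 * i + 1)) b) =
        (\<Prod>i<m. \<Sum>x\<in>?P. B (\<sigma> (2 * i)) (fst x) * A (fst x) (snd x) * B (\<sigma> (2 * i + 1)) (snd x))"
      by (simp add: sum.cartesian_product case_prod_unfold)
    also have "\<dots> = (\<Sum>f\<in>?Fn. \<Prod>i<m. B (\<sigma> (2 * i)) (fst (f i)) * A (fst (f i)) (snd (f i)) * B (\<sigma> (2 * i + 1)) (snd (f i)))"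
      by (rule prod_sum_PiE) auto
    also have "\<dots> = (\<Sum>f\<in>?Fn. W f * (\<Prod>j<N. B (\<sigma> j) (T f j)))"
      unfolding N prod_lessThan_double W_def prod.distrib[symmetric] T2 by (intro sum.cong prod.cong refl) (simp add: mult_ac)
    finally show ?thesis by (simp add: pweight_def sum_distrib_left mult.left_commute)
  qed
  have "full_pf m (\<lambda>p q. \<Sum>a<N. \<Sum>b<N. B p a * A a b * B q b) =
      (\<Sum>f\<in>?Fn. W f * (\<Sum>\<sigma>\<in>perms N. of_int (sign \<sigma>) * (\<Prod>j<N. B (\<sigma> j) (T f j))))"
    unfolding full_pf_def expand N[symmetric] sum_distrib_left by (rule sum.swap)
  also have "\<dots> = (\<Sum>f\<in>?Fn. W f * det (mat N N (\<lambda>(i, j). B j (T f i))))"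
    by (simp only: signed_sum_columns)
  also have "\<dots> = (\<Sum>f\<in>(\<lambda>p. restrict (\<lambda>i. (p (2 * i), p (2 * i + 1))) {..<m}) ` perms N. W f * det (mat N N (\<lambda>(i, j). B j (T f i))))"
  proof (rule sum.mono_neutral_right)
    show "finite ?Fn" by (intro finite_PiE) auto
    show "(\<lambda>p. restrict (\<lambda>i. (p (2 * i), p (2 * i + 1))) {..<m}) ` perms N \<subseteq> ?Fn"
      using N by (auto simp: restrict_PiE_iff perms_less split: if_splits)
    show "\<forall>f\<in>?Fn - (\<lambda>p. restrict (\<lambda>i. (p (2 * i), p (2 * i + 1))) {..<m}) ` perms N.
        W f * det (mat N N (\<lambda>(i, j). B j (T f i))) = 0"
    proof
      fix f assume f: "f \<in> ?Fn - (\<lambda>p. restrict (\<lambda>i. (p (2 * i), p (2 * i + 1))) {..<m}) ` perms N"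
      have "\<not> inj_on (T f) {..<N}"
      proof
        assume inj: "inj_on (T f) {..<N}"
        define p where "p j = (if j < N then T f j else j)" for j
        have "T f ` {..<N} = {..<N}" using inj Tlt f by (intro endo_inj_surj) auto
        with inj have "bij_betw (T f) {..<N} {..<N}" unfolding bij_betw_def by blast
        moreover have "bij_betw p {..<N} {..<N} \<longleftrightarrow> bij_betw (T f) {..<N} {..<N}"
          by (rule bij_betw_cong) (simp add: p_def)
        ultimately have "bij_betw p {..<N} {..<N}" by simp
        then have "p permutes {..<N}" by (rule bij_imp_permutes) (simp add: p_def)
        then have "p \<in> perms N" unfolding perms_def by simp
        moreover have "f = restrict (\<lambda>i. (p (2 * i), p (2 * i + 1))) {..<m}"
        proof
          fix i show "f i = restrict (\<lambda>i. (p (2 * i), p (2 * i + 1))) {..<m} i"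
          proof (cases "i < m")
            case True
            then have lt: "2 * i < N" "2 * i + 1 < N" using N by auto
            show ?thesis by (simp only: restrict_apply lessThan_iff True if_True p_def lt T2 prod.collapse)
          next
            case False
            from f have "f \<in> ?Fn" by blast
            then have "f i = undefined" by (rule PiE_arb) (use False in simp)
            then show ?thesis using False by simp
          qed
        qed
        ultimately show False using f by blast
      qed
      then obtain i j where ij: "i < N" "j < N" "i \<noteq> j" "T f i = T f j" by (auto simp: inj_on_def)
      have "det (mat N N (\<lambda>(i, j). B j (T f i))) = 0"
        by (rule det_identical_rows[of _ N i j]) (use ij in auto)
      then show "W f * det (mat N N (\<lambda>(i, j). B j (T f i))) = 0" by simp
    qed
  qed
  also have "\<dots> = (\<Sum>p\<in>perms N. ?dB * pweight A m p)"
  proof (subst sum.reindex)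
    show "inj_on (\<lambda>p. restrict (\<lambda>i. (p (2 * i), p (2 * i + 1))) {..<m}) (perms N)"
    proof (rule inj_onI)
      fix p q assume pq: "p \<in> perms N" "q \<in> perms N"
        "restrict (\<lambda>i. (p (2 * i), p (2 * i + 1))) {..<m} = restrict (\<lambda>i. (q (2 * i), q (2 * i + 1))) {..<m}"
      have eq: "p (2 * i) = q (2 * i)" "p (2 * i + 1) = q (2 * i + 1)" if "i < m" for i
        using fun_cong[OF pq(3), of i] that by auto
      show "p = q"
      proof
        fix x show "p x = q x"
        proof (cases "x < N")
          case True
          then show ?thesis unfolding N by (rule less_double_cases) (simp_all only: eq)
        next
          case False
          then show ?thesis using pq(1,2) by (auto simp: perms_def permutes_not_in)
        qed
      qed
    qed
    have "W (restrict (\<lambda>i. (p (2 * i), p (2 * i + 1))) {..<m}) * det (mat N N (\<lambda>(i, j). B j (T (restrict (\<lambda>i. (p (2 * i), p (2 * i + 1))) {..<m}) i))) = ?dB * pweight A m p"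
      if p: "p \<in> perms N" for p
    proof -
      define f where "f = restrict (\<lambda>i. (p (2 * i), p (2 * i + 1))) {..<m}"
      have Tp: "T f j = p j" if "j < N" for j
        using that unfolding N by (rule less_double_cases) (simp_all add: T_def f_def)
      have "mat N N (\<lambda>(i, j). B j (T f i)) = mat N N (\<lambda>(i, j). (mat N N (\<lambda>(i, j). B j i)) $$ (p i, j))"
        by (rule eq_matI) (auto simp: Tp perms_less[OF p])
      also have "det \<dots> = of_int (sign p) * det (mat N N (\<lambda>(i, j). B j i))"
        using p by (subst det_permute_rows) (auto simp: perms_def atLeast0LessThan)
      also have "mat N N (\<lambda>(i, j). B j i) = transpose_mat (mat N N (\<lambda>(i, j). B i j))"
        by (rule eq_matI) auto
      also have "det \<dots> = ?dB" by (rule det_transpose[of _ N]) simp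
      finally have "det (mat N N (\<lambda>(i, j). B j (T f i))) = of_int (sign p) * ?dB" .
      moreover have "W f = (\<Prod>i<m. A (p (2 * i)) (p (2 * i + 1)))" by (simp add: W_def f_def)
      ultimately show ?thesis unfolding f_def[symmetric] by (simp add: pweight_def mult_ac)
    qed
    then show "sum ((\<lambda>f. W f * det (mat N N (\<lambda>(i, j). B j (T f i)))) \<circ> (\<lambda>p. restrict (\<lambda>i. (p (2 * i), p (2 * i + 1))) {..<m})) (perms N) =
        (\<Sum>p\<in>perms N. ?dB * pweight A m p)"
      unfolding comp_def by (intro sum.cong refl)
  qed
  finally show ?thesis by (simp add: full_pf_def N sum_distrib_left)
qed

section \<open>Pfaffians of block matrices\<close>

definition shift_perm :: "nat \<Rightarrow> nat \<Rightarrow> (nat \<Rightarrow> nat) \<Rightarrow> nat \<Rightarrow> nat" where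
  "shift_perm s n \<tau> x = (if s \<le> x \<and> x < s + n then s + \<tau> (x - s) else x)"

lemma shift_perm:
  assumes "\<tau> \<in> perms n"
  shows "shift_perm s n \<tau> \<in> perms (s + n)" "sign (shift_perm s n \<tau>) = sign \<tau>"
proof -
  let ?f = "\<lambda>x. s + x"
  have \<tau>: "\<tau> permutes {..<n}" using assms by (simp add: perms_def)
  have img: "?f ` {..<n} = {s..<s + n}"
    using image_add_atLeastLessThan[of s 0 n] by (simp add: atLeast0LessThan add.commute)
  have eq: "shift_perm s n \<tau> = map_permutation {..<n} ?f \<tau>"
  proof
    fix x show "shift_perm s n \<tau> x = map_permutation {..<n} ?f \<tau> x"
    proof (cases "s \<le> x \<and> x < s + n")
      case True
      then have "x - s < n" by auto
      then have "inv_into {..<n} ?f x = x - s"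
        using inv_into_f_f[of ?f "{..<n}" "x - s"] True by simp
      then show ?thesis using True by (simp add: map_permutation_def img shift_perm_def)
    next
      case False
      then show ?thesis by (auto simp: map_permutation_def img shift_perm_def)
    qed
  qed
  have "map_permutation {..<n} ?f \<tau> permutes {s..<s + n}"
    by (rule map_permutation_permutes[OF _ \<tau>]) (simp add: bij_betw_def img)
  then have "map_permutation {..<n} ?f \<tau> permutes {..<s + n}" by (rule permutes_subset) auto
  then show "shift_perm s n \<tau> \<in> perms (s + n)" by (simp add: eq perms_def)
  show "sign (shift_perm s n \<tau>) = sign \<tau>"
    unfolding eq by (rule sign_map_permutation[OF _ \<tau>]) simp_all
qed

lemma perms_mono: "n \<le> m \<Longrightarrow> \<sigma> \<in> perms n \<Longrightarrow> \<sigma> \<in> perms m"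
  unfolding perms_def using permutes_subset[of \<sigma> "{..<n}" "{..<m}"] by auto

lemma perms_outside: "\<sigma> \<in> perms n \<Longrightarrow> n \<le> x \<Longrightarrow> \<sigma> x = x"
  unfolding perms_def by (auto simp: permutes_def)

lemma permsI:
  assumes "inj_on \<sigma> {..<n}" "\<And>x. x < n \<Longrightarrow> \<sigma> x < n" "\<And>x. x \<ge> n \<Longrightarrow> \<sigma> x = x"
  shows "\<sigma> \<in> perms n"
proof -
  have "\<sigma> ` {..<n} = {..<n}" using assms by (intro endo_inj_surj) auto
  then have "bij_betw \<sigma> {..<n} {..<n}" using assms(1) by (simp add: bij_betw_def)
  then have "\<sigma> permutes {..<n}" by (rule bij_imp_permutes) (use assms(3) in auto)
  then show ?thesis by (simp add: perms_def)
qed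

lemma matching_perms_iff:
  "\<sigma> \<in> matching_perms m \<longleftrightarrow> \<sigma> \<in> perms (2 * m) \<and> (\<forall>i<m. \<sigma> (2 * i) < \<sigma> (2 * i + 1)) \<and>
    (\<forall>i j. i < j \<longrightarrow> j < m \<longrightarrow> \<sigma> (2 * i) < \<sigma> (2 * j))"
  by (auto simp: matching_perms_def perms_def)

lemma matching_perms_pair: "\<sigma> \<in> matching_perms m \<Longrightarrow> i < m \<Longrightarrow> \<sigma> (2 * i) < \<sigma> (2 * i + 1)"
  and matching_perms_first: "\<sigma> \<in> matching_perms m \<Longrightarrow> i < j \<Longrightarrow> j < m \<Longrightarrow> \<sigma> (2 * i) < \<sigma> (2 * j)"
  by (simp_all add: matching_perms_iff)

lemma finite_matching_perms [simp]: "finite (matching_perms m)"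
  by (rule finite_subset[of _ "perms (2 * m)"]) (auto simp: matching_perms_iff)

lemma prod_lessThan_add: "(\<Prod>i<a + b. g i) = (\<Prod>i<a. g i) * (\<Prod>i<b. g (a + i :: nat))"
  for g :: "nat \<Rightarrow> 'a::comm_monoid_mult"
  by (induction b) (simp_all add: mult.assoc)

lemma prod_nonzero_factor:
  fixes h :: "nat \<Rightarrow> 'a::comm_ring_1"
  assumes "(\<Prod>i<n. h i) \<noteq> 0" "i < n"
  shows "h i \<noteq> 0"
proof
  assume "h i = 0"
  with assms(2) have "\<exists>i\<in>{..<n}. h i = 0" by auto
  from prod_zero[OF finite_lessThan this] assms(1) show False by simp
qed

text \<open>A matching with nonzero weight pairs each block within itself. As first entries
  increase, the pairs of the first block come first, so such a matching is a matching of each block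
  placed one after the other.\<close>

lemma pf_block_diagonal:
  fixes A D :: "nat \<Rightarrow> nat \<Rightarrow> 'a::comm_ring_1"
  defines "C \<equiv> \<lambda>a i j. if i < 2 * a \<and> j < 2 * a then A i j
    else if 2 * a \<le> i \<and> 2 * a \<le> j then D (i - 2 * a) (j - 2 * a) else 0"
  shows "pf (a + b) (C a) = pf a A * pf b D"
proof -
  let ?J = "\<lambda>(\<sigma>, \<tau>). \<sigma> \<circ> shift_perm (2 * a) (2 * b) \<tau>"
  have J: "(\<sigma> \<circ> shift_perm (2 * a) (2 * b) \<tau>) x = (if x < 2 * a then \<sigma> x else if x < 2 * (a + b) then 2 * a + \<tau> (x - 2 * a) else x)"
    if "\<sigma> \<in> matching_perms a" for \<sigma> \<tau> x
    using that perms_outside[of \<sigma> "2 * a"] by (auto simp: shift_perm_def matching_perms_iff)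
  have Jm: "\<sigma> \<circ> shift_perm (2 * a) (2 * b) \<tau> \<in> matching_perms (a + b)"
    and Jw: "pweight (C a) (a + b) (\<sigma> \<circ> shift_perm (2 * a) (2 * b) \<tau>) = pweight A a \<sigma> * pweight D b \<tau>"
    if s: "\<sigma> \<in> matching_perms a" "\<tau> \<in> matching_perms b" for \<sigma> \<tau>
  proof -
    let ?r = "\<sigma> \<circ> shift_perm (2 * a) (2 * b) \<tau>"
    have p: "\<sigma> \<in> perms (2 * a)" "\<tau> \<in> perms (2 * b)" using s by (auto simp: matching_perms_iff)
    have p2: "\<sigma> \<in> perms (2 * a + 2 * b)" "shift_perm (2 * a) (2 * b) \<tau> \<in> perms (2 * a + 2 * b)"
      using perms_mono[OF _ p(1)] shift_perm(1)[OF p(2)] by auto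
    have lo: "?r x = \<sigma> x" "\<sigma> x < 2 * a" if "x < 2 * a" for x
      unfolding J[OF s(1)] using that by (simp_all add: perms_less[OF p(1)])
    have hi: "?r (2 * a + x) = 2 * a + \<tau> x" if "x < 2 * b" for x
      unfolding J[OF s(1)] using that by simp
    have hi': "?r (2 * (a + i)) = 2 * a + \<tau> (2 * i)" "?r (2 * (a + i) + 1) = 2 * a + \<tau> (2 * i + 1)" if "i < b" for i
      using hi[of "2 * i"] hi[of "2 * i + 1"] that by (simp_all only: distrib_left add.assoc)
    have lo': "?r (2 * i) = \<sigma> (2 * i)" "?r (2 * i + 1) = \<sigma> (2 * i + 1)" "\<sigma> (2 * i) < 2 * a" "\<sigma> (2 * i + 1) < 2 * a" if "i < a" for i
      using lo[of "2 * i"] lo[of "2 * i + 1"] that by auto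
    show "?r \<in> matching_perms (a + b)" unfolding matching_perms_iff
    proof (intro conjI allI impI)
      show "?r \<in> perms (2 * (a + b))" using perms_comp[OF p2] by simp
      show "?r (2 * i) < ?r (2 * i + 1)" if "i < a + b" for i
      proof (cases "i < a")
        case True
        then show ?thesis unfolding lo'[OF True] using s(1) by (simp add: matching_perms_iff)
      next
        case False
        then obtain i' where i: "i = a + i'" using le_Suc_ex not_less by blast
        then have "i' < b" using that by simp
        then show ?thesis unfolding i hi'[OF \<open>i' < b\<close>] using s(2) by (simp add: matching_perms_iff)
      qed
      show "?r (2 * i) < ?r (2 * j)" if "i < j" "j < a + b" for i j
      proof (cases "j < a")
        case True
        then have "i < a" using that by simp
        then show ?thesis unfolding lo'[OF True] lo'[OF \<open>i < a\<close>] using s(1) True that by (simp add: matching_perms_iff)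
      next
        case False
        then obtain j' where j: "j = a + j'" using le_Suc_ex not_less by blast
        then have j': "j' < b" using that by simp
        show ?thesis
        proof (cases "i < a")
          case True
          then show ?thesis unfolding j hi'[OF j'] lo'[OF True] using lo'(3)[OF True] by simp
        next
          case False
          then obtain i' where i: "i = a + i'" using le_Suc_ex not_less by blast
          then have "i' < b" "i' < j'" using that j j' by auto
          then show ?thesis unfolding i j hi'[OF j'] hi'[OF \<open>i' < b\<close>] using s(2) j' by (simp add: matching_perms_iff)
        qed
      qed
    qed
    have sg: "sign ?r = sign \<sigma> * sign \<tau>"
      using sign_compose[OF perms_permutation[OF p2(1)] perms_permutation[OF p2(2)]] by (simp add: shift_perm(2)[OF p(2)])
    have "(\<Prod>i<a + b. C a (?r (2 * i)) (?r (2 * i + 1))) =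
        (\<Prod>i<a. A (\<sigma> (2 * i)) (\<sigma> (2 * i + 1))) * (\<Prod>i<b. D (\<tau> (2 * i)) (\<tau> (2 * i + 1)))"
      unfolding prod_lessThan_add
    proof (intro arg_cong2[where f = "(*)"] prod.cong refl)
      show "C a (?r (2 * i)) (?r (2 * i + 1)) = A (\<sigma> (2 * i)) (\<sigma> (2 * i + 1))" if "i \<in> {..<a}" for i
        using that lo'(3,4)[of i] unfolding lo'(1,2)[OF that[unfolded lessThan_iff]] by (simp add: C_def)
      show "C a (?r (2 * (a + i))) (?r (2 * (a + i) + 1)) = D (\<tau> (2 * i)) (\<tau> (2 * i + 1))" if "i \<in> {..<b}" for i
        unfolding hi'[OF that[unfolded lessThan_iff]] by (simp add: C_def)
    qed
    note e = this
    show "pweight (C a) (a + b) ?r = pweight A a \<sigma> * pweight D b \<tau>"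
      unfolding pweight_def sg e by (simp add: mult_ac)
  qed
  have onto: "\<sigma> \<in> ?J ` (matching_perms a \<times> matching_perms b)"
    if \<sigma>: "\<sigma> \<in> matching_perms (a + b)" and nz: "pweight (C a) (a + b) \<sigma> \<noteq> 0" for \<sigma>
  proof -
    have p: "\<sigma> \<in> perms (2 * (a + b))" using \<sigma> by (simp add: matching_perms_iff)
    have side: "\<sigma> (2 * i) < 2 * a \<longleftrightarrow> \<sigma> (2 * i + 1) < 2 * a" if "i < a + b" for i
    proof -
      have "(\<Prod>i<a + b. C a (\<sigma> (2 * i)) (\<sigma> (2 * i + 1))) \<noteq> 0" using nz by (auto simp: pweight_def)
      then have "C a (\<sigma> (2 * i)) (\<sigma> (2 * i + 1)) \<noteq> 0" using that by (rule prod_nonzero_factor)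
      then show ?thesis by (auto simp: C_def split: if_splits)
    qed
    define K where "K = {i. i < a + b \<and> \<sigma> (2 * i) < 2 * a}"
    define S where "S = {x. x < 2 * (a + b) \<and> \<sigma> x < 2 * a}"
    have fK: "finite K" by (simp add: K_def)
    have "\<sigma> ` S = {..<2 * a}"
    proof
      show "\<sigma> ` S \<subseteq> {..<2 * a}" by (auto simp: S_def)
      show "{..<2 * a} \<subseteq> \<sigma> ` S"
      proof
        fix y assume y: "y \<in> {..<2 * a}"
        have "\<sigma> ` {..<2 * (a + b)} = {..<2 * (a + b)}" using p by (simp add: perms_def permutes_image)
        moreover have "y \<in> {..<2 * (a + b)}" using y by auto
        ultimately obtain x where "x \<in> {..<2 * (a + b)}" "y = \<sigma> x" by blast
        then show "y \<in> \<sigma> ` S" using y by (auto simp: S_def)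
      qed
    qed
    moreover have "inj_on \<sigma> S" using perms_inj[OF p] by (auto simp: inj_on_def)
    ultimately have cS: "card S = 2 * a" using card_image[of \<sigma> S] by simp
    have S_eq: "S = (\<lambda>i. 2 * i) ` K \<union> (\<lambda>i. 2 * i + 1) ` K"
    proof (intro equalityI subsetI)
      fix x assume x: "x \<in> S"
      show "x \<in> (\<lambda>i. 2 * i) ` K \<union> (\<lambda>i. 2 * i + 1) ` K"
      proof (cases "even x")
        case True
        then obtain i where "x = 2 * i" by blast
        then show ?thesis using x by (auto simp: S_def K_def)
      next
        case False
        then obtain i where i: "x = 2 * i + 1" by (blast elim: oddE)
        then have "i \<in> K" using x side[of i] by (auto simp: S_def K_def)
        then show ?thesis using i by blast
      qed
    next
      fix x assume "x \<in> (\<lambda>i. 2 * i) ` K \<union> (\<lambda>i. 2 * i + 1) ` K"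
      then obtain i where i: "i \<in> K" "x = 2 * i \<or> x = 2 * i + 1" by blast
      then show "x \<in> S" using side[of i] by (auto simp: S_def K_def)
    qed
    have "(\<lambda>i. 2 * i) ` K \<inter> (\<lambda>i. 2 * i + 1) ` K = {}" by (auto; presburger)
    then have "card S = card ((\<lambda>i. 2 * i) ` K) + card ((\<lambda>i. 2 * i + 1) ` K)"
      unfolding S_eq by (intro card_Un_disjoint) (simp_all add: fK)
    then have cK: "card K = a" using cS by (simp add: card_image inj_on_def)
    \<comment> \<open>\<open>K\<close> is closed downwards because first entries increase, and it
      has \<open>a\<close> elements by counting the preimages of the first block; so it is an
      initial segment.\<close>
    have "i < a" if "i \<in> K" for i
    proof -
      have "j \<in> K" if "j < i" for j
      proof -
        have "\<sigma> (2 * j) < \<sigma> (2 * i)" using \<sigma> that \<open>i \<in> K\<close> by (simp add: matching_perms_iff K_def)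
        then show ?thesis using that \<open>i \<in> K\<close> by (simp add: K_def)
      qed
      then have "{..i} \<subseteq> K" using that by (auto simp: le_less)
      from card_mono[OF fK this] show ?thesis by (simp add: cK)
    qed
    then have "K \<subseteq> {..<a}" by blast
    then have K: "K = {..<a}" by (rule card_subset_eq[rotated]) (simp_all add: cK)
    have low: "\<sigma> x < 2 * a \<longleftrightarrow> x < 2 * a" if x: "x < 2 * (a + b)" for x
    proof -
      have "\<sigma> x < 2 * a \<longleftrightarrow> x \<in> S" using x by (simp add: S_def)
      also have "\<dots> \<longleftrightarrow> x < 2 * a" unfolding S_eq K
      proof
        show "x < 2 * a" if "x \<in> (\<lambda>i. 2 * i) ` {..<a} \<union> (\<lambda>i. 2 * i + 1) ` {..<a}" using that by auto
        assume "x < 2 * a"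
        then have "x div 2 < a" by auto
        moreover have "x = 2 * (x div 2) \<or> x = 2 * (x div 2) + 1" by presburger
        ultimately show "x \<in> (\<lambda>i. 2 * i) ` {..<a} \<union> (\<lambda>i. 2 * i + 1) ` {..<a}" by blast
      qed
      finally show ?thesis .
    qed
    define \<sigma>1 where "\<sigma>1 x = (if x < 2 * a then \<sigma> x else x)" for x
    define \<tau> where "\<tau> x = (if x < 2 * b then \<sigma> (2 * a + x) - 2 * a else x)" for x
    have up: "2 * a \<le> \<sigma> (2 * a + x) \<and> \<sigma> (2 * a + x) < 2 * a + 2 * b" if "x < 2 * b" for x
      using low[of "2 * a + x"] perms_less[OF p, of "2 * a + x"] that by auto
    have "\<sigma>1 \<in> perms (2 * a)"
      using perms_inj[OF p] low by (intro permsI) (auto simp: \<sigma>1_def inj_on_def)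
    then have m1: "\<sigma>1 \<in> matching_perms a"
      using \<sigma> by (auto simp: matching_perms_iff \<sigma>1_def)
    have "\<tau> \<in> perms (2 * b)"
    proof (rule permsI)
      show "inj_on \<tau> {..<2 * b}"
      proof (rule inj_onI)
        fix x y assume xy: "x \<in> {..<2 * b}" "y \<in> {..<2 * b}" "\<tau> x = \<tau> y"
        then have "\<sigma> (2 * a + x) = \<sigma> (2 * a + y)" using up[of x] up[of y] by (auto simp: \<tau>_def)
        then show "x = y" by (simp add: perms_inj[OF p])
      qed
      show "\<tau> x < 2 * b" if "x < 2 * b" for x using up[OF that] that by (auto simp: \<tau>_def)
    qed (simp add: \<tau>_def)
    moreover have "\<tau> (2 * i) < \<tau> (2 * i + 1)" if "i < b" for i
    proof -
      have "\<sigma> (2 * (a + i)) < \<sigma> (2 * (a + i) + 1)" by (rule matching_perms_pair[OF \<sigma>]) (use that in simp)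
      then show ?thesis using up[of "2 * i"] up[of "2 * i + 1"] that by (auto simp: \<tau>_def add.assoc)
    qed
    moreover have "\<tau> (2 * i) < \<tau> (2 * j)" if "i < j" "j < b" for i j
    proof -
      have "\<sigma> (2 * (a + i)) < \<sigma> (2 * (a + j))" by (rule matching_perms_first[OF \<sigma>]) (use that in simp_all)
      then show ?thesis using up[of "2 * i"] up[of "2 * j"] that by (auto simp: \<tau>_def)
    qed
    ultimately have m2: "\<tau> \<in> matching_perms b" by (auto simp: matching_perms_iff)
    have "\<sigma> = \<sigma>1 \<circ> shift_perm (2 * a) (2 * b) \<tau>"
    proof
      fix x
      consider "x < 2 * a" | y where "x = 2 * a + y" "y < 2 * b" | "2 * (a + b) \<le> x"
        by (metis add_mult_distrib2 le_Suc_ex linorder_not_le nat_add_left_cancel_less)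
      then show "\<sigma> x = (\<sigma>1 \<circ> shift_perm (2 * a) (2 * b) \<tau>) x"
      proof cases
        case 1
        then show ?thesis unfolding J[OF m1] by (simp add: \<sigma>1_def)
      next
        case 2
        then show ?thesis using up[of y] unfolding J[OF m1] by (auto simp: \<tau>_def)
      next
        case 3
        then show ?thesis unfolding J[OF m1] by (simp add: perms_outside[OF p])
      qed
    qed
    then show ?thesis using m1 m2 by (intro image_eqI[of _ _ "(\<sigma>1, \<tau>)"]) auto
  qed
  have inj: "inj_on ?J (matching_perms a \<times> matching_perms b)"
  proof (rule inj_onI, clarify)
    fix \<sigma> \<tau> \<sigma>' \<tau>' assume s: "\<sigma> \<in> matching_perms a" "\<tau> \<in> matching_perms b" "\<sigma>' \<in> matching_perms a" "\<tau>' \<in> matching_perms b"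
      and eq: "\<sigma> \<circ> shift_perm (2 * a) (2 * b) \<tau> = \<sigma>' \<circ> shift_perm (2 * a) (2 * b) \<tau>'"
    have "\<sigma> x = \<sigma>' x" for x
    proof (cases "x < 2 * a")
      case True
      then show ?thesis using fun_cong[OF eq, of x] unfolding J[OF s(1)] J[OF s(3)] by simp
    next
      case False
      then show ?thesis using s(1,3) by (simp add: matching_perms_iff perms_outside[of _ "2 * a"])
    qed
    moreover have "\<tau> x = \<tau>' x" for x
    proof (cases "x < 2 * b")
      case True
      then show ?thesis using fun_cong[OF eq, of "2 * a + x"] unfolding J[OF s(1)] J[OF s(3)] by simp
    next
      case False
      then show ?thesis using s(2,4) by (simp add: matching_perms_iff perms_outside[of _ "2 * b"])
    qed
    ultimately show "\<sigma> = \<sigma>' \<and> \<tau> = \<tau>'" by blast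
  qed
  have "pf (a + b) (C a) = (\<Sum>\<sigma>\<in>?J ` (matching_perms a \<times> matching_perms b). pweight (C a) (a + b) \<sigma>)"
    unfolding pf_def
  proof (rule sum.mono_neutral_right)
    show "?J ` (matching_perms a \<times> matching_perms b) \<subseteq> matching_perms (a + b)"
    proof
      fix y assume "y \<in> ?J ` (matching_perms a \<times> matching_perms b)"
      then obtain x where x: "y = ?J x" "x \<in> matching_perms a \<times> matching_perms b" by (rule imageE)
      show "y \<in> matching_perms (a + b)"
        using x(2) unfolding x(1) by (cases x) (simp only: mem_Sigma_iff case_prod_conv Jm)
    qed
    show "\<forall>\<sigma>\<in>matching_perms (a + b) - ?J ` (matching_perms a \<times> matching_perms b). pweight (C a) (a + b) \<sigma> = 0"
    proof (rule ballI, rule ccontr)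
      fix \<sigma> assume \<sigma>: "\<sigma> \<in> matching_perms (a + b) - ?J ` (matching_perms a \<times> matching_perms b)"
        "pweight (C a) (a + b) \<sigma> \<noteq> 0"
      show False by (rule DiffD2[OF \<sigma>(1) onto[OF DiffD1[OF \<sigma>(1)] \<sigma>(2)]])
    qed
  qed simp
  also have "\<dots> = (\<Sum>(\<sigma>, \<tau>)\<in>matching_perms a \<times> matching_perms b. pweight A a \<sigma> * pweight D b \<tau>)"
    by (subst sum.reindex[OF inj], intro sum.cong refl) (simp only: comp_apply case_prod_unfold mem_Times_iff Jw)
  also have "\<dots> = pf a A * pf b D"
    unfolding pf_def sum_product by (simp add: sum.cartesian_product)
  finally show ?thesis .
qed

lemma strict_mono_self_map:
  fixes h :: "nat \<Rightarrow> nat"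
  assumes mono: "\<And>i j. i < j \<Longrightarrow> j < n \<Longrightarrow> h i < h j" and lt: "\<And>i. i < n \<Longrightarrow> h i < n" and i: "i < n"
  shows "h i = i"
proof -
  have inj: "inj_on h {..<n}"
  proof (rule inj_onI)
    fix x y assume "x \<in> {..<n}" "y \<in> {..<n}" "h x = h y"
    then show "x = y" using mono[of x y] mono[of y x] by (cases x y rule: linorder_cases) auto
  qed
  have surj: "h ` {..<n} = {..<n}" using inj lt by (intro endo_inj_surj) auto
  show ?thesis using i
  proof (induction i rule: less_induct)
    case (less i)
    have "i \<in> h ` {..<n}" using surj less.prems by simp
    then obtain l where l: "l < n" "i = h l" by auto
    have "\<not> l < i" using less.IH[of l] l by auto
    moreover have "\<not> i < l"
    proof
      assume "i < l"
      then have "h i < i" using mono[of i l] l by simp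
      then have "h (h i) = h i" using less.IH[of "h i"] less.prems by simp
      moreover have "h (h i) < h i" using mono[of "h i" i] \<open>h i < i\<close> less.prems by simp
      ultimately show False by simp
    qed
    ultimately show ?case using l by (cases i l rule: linorder_cases) auto
  qed
qed

lemma det_function:
  fixes A :: "nat \<Rightarrow> nat \<Rightarrow> 'a::comm_ring_1"
  shows "det (mat n n (\<lambda>(i, j). A i j)) = (\<Sum>\<pi>\<in>perms n. of_int (sign \<pi>) * (\<Prod>i<n. A i (\<pi> i)))"
  by (subst det_def'[of _ n]) (simp_all add: perms_def atLeast0LessThan permutes_in_image[of _ "{..<n}", simplified])

text \<open>Nonzero weight forces each pair to join the two halves. Increasing order then makes the
  first entries 0, ..., n - 1, and the second entries form a permutation \<pi>. The common
  interleaving \<open>E id\<close> contributes the fixed sign.\<close>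

lemma pf_antidiagonal:
  fixes A :: "nat \<Rightarrow> nat \<Rightarrow> 'a::comm_ring_1"
  defines "C \<equiv> \<lambda>n i j. if i < n \<and> n \<le> j then A i (j - n) else if n \<le> i \<and> j < n then - A j (i - n) else 0"
  shows "\<exists>s\<in>{1, -1}. pf n (C n) = s * det (mat n n (\<lambda>(i, j). A i j))"
proof -
  define E where "E \<pi> y = (if y < 2 * n then if even y then y div 2 else n + \<pi> (y div 2) else y)" for \<pi> :: "nat \<Rightarrow> nat" and y
  have E2: "E \<pi> (2 * i) = i" "E \<pi> (2 * i + 1) = n + \<pi> i" if "i < n" for \<pi> i using that by (simp_all add: E_def)
  have Ep: "E \<pi> \<in> perms (2 * n)" if \<pi>: "\<pi> \<in> perms n" for \<pi>
  proof (rule permsI)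
    show "inj_on (E \<pi>) {..<2 * n}"
    proof (rule inj_onI)
      fix x y assume xy: "x \<in> {..<2 * n}" "y \<in> {..<2 * n}" "E \<pi> x = E \<pi> y"
      then have d: "x div 2 < n" "y div 2 < n" by auto
      have "x div 2 = y div 2 \<and> (even x \<longleftrightarrow> even y)"
        using xy d by (auto simp: E_def perms_inj[OF \<pi>] split: if_splits)
      then show "x = y" by presburger
    qed
    show "E \<pi> x < 2 * n" if "x < 2 * n" for x
    proof -
      have "x div 2 < n" using that by auto
      then show ?thesis using that perms_less[OF \<pi>, of "x div 2"] by (auto simp: E_def)
    qed
  qed (simp add: E_def)
  have Em: "E \<pi> \<in> matching_perms n" if \<pi>: "\<pi> \<in> perms n" for \<pi>
    unfolding matching_perms_iff using Ep[OF \<pi>] E2[of _ \<pi>] by auto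
  have "id \<in> perms n" by (simp add: perms_def permutes_id)
  then have Eid: "E id \<in> perms (2 * n)" by (rule Ep)
  define s where "s = (of_int (sign (E id)) :: 'a)"
  have Ew: "pweight (C n) n (E \<pi>) = s * (of_int (sign \<pi>) * (\<Prod>i<n. A i (\<pi> i)))" if \<pi>: "\<pi> \<in> perms n" for \<pi>
  proof -
    have sp: "shift_perm n n \<pi> \<in> perms (2 * n)" using shift_perm(1)[OF \<pi>, of n] by (simp add: mult_2)
    have "E \<pi> = shift_perm n n \<pi> \<circ> E id"
    proof
      fix y show "E \<pi> y = (shift_perm n n \<pi> \<circ> E id) y"
      proof (cases "y < 2 * n")
        case True
        then have "y div 2 < n" by auto
        then show ?thesis using True by (auto simp: E_def shift_perm_def)
      qed (auto simp: E_def shift_perm_def)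
    qed
    then have "sign (E \<pi>) = sign \<pi> * sign (E id)"
      using sign_compose[OF perms_permutation[OF sp] perms_permutation[OF Eid]] by (simp add: shift_perm(2)[OF \<pi>])
    moreover have "(\<Prod>i<n. C n (E \<pi> (2 * i)) (E \<pi> (2 * i + 1))) = (\<Prod>i<n. A i (\<pi> i))"
    proof (intro prod.cong refl)
      fix i assume "i \<in> {..<n}"
      then have i: "i < n" by simp
      show "C n (E \<pi> (2 * i)) (E \<pi> (2 * i + 1)) = A i (\<pi> i)" unfolding E2[OF i] using i by (simp add: C_def)
    qed
    ultimately show ?thesis by (simp add: pweight_def s_def mult_ac)
  qed
  have onto: "\<sigma> \<in> E ` perms n" if \<sigma>: "\<sigma> \<in> matching_perms n" and nz: "pweight (C n) n \<sigma> \<noteq> 0" for \<sigma>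
  proof -
    have p: "\<sigma> \<in> perms (2 * n)" using \<sigma> by (simp add: matching_perms_iff)
    have side: "\<sigma> (2 * i) < n" "n \<le> \<sigma> (2 * i + 1)" "\<sigma> (2 * i + 1) < 2 * n" if "i < n" for i
    proof -
      have "(\<Prod>i<n. C n (\<sigma> (2 * i)) (\<sigma> (2 * i + 1))) \<noteq> 0" using nz by (auto simp: pweight_def)
      then have "C n (\<sigma> (2 * i)) (\<sigma> (2 * i + 1)) \<noteq> 0" using that by (rule prod_nonzero_factor)
      moreover have "\<sigma> (2 * i) < \<sigma> (2 * i + 1)" using \<sigma> that by (simp add: matching_perms_iff)
      ultimately show "\<sigma> (2 * i) < n" "n \<le> \<sigma> (2 * i + 1)" by (auto simp: C_def split: if_splits)
      show "\<sigma> (2 * i + 1) < 2 * n" using that by (simp add: perms_less[OF p])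
    qed
    have ev: "\<sigma> (2 * i) = i" if "i < n" for i
      by (rule strict_mono_self_map[of n "\<lambda>i. \<sigma> (2 * i)"]) (use \<sigma> side that in \<open>auto simp: matching_perms_iff\<close>)
    define \<pi> where "\<pi> x = (if x < n then \<sigma> (2 * x + 1) - n else x)" for x
    have "\<pi> \<in> perms n"
    proof (rule permsI)
      show "inj_on \<pi> {..<n}"
      proof (rule inj_onI)
        fix x y assume xy: "x \<in> {..<n}" "y \<in> {..<n}" "\<pi> x = \<pi> y"
        then have "\<sigma> (2 * x + 1) = \<sigma> (2 * y + 1)" using side(2)[of x] side(2)[of y] by (auto simp: \<pi>_def)
        then show "x = y" by (simp add: perms_inj[OF p])
      qed
      show "\<pi> x < n" if "x < n" for x using side(2,3)[OF that] that by (auto simp: \<pi>_def)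
    qed (simp add: \<pi>_def)
    moreover have "\<sigma> = E \<pi>"
    proof
      fix y show "\<sigma> y = E \<pi> y"
      proof (cases "y < 2 * n")
        case True
        then have d: "y div 2 < n" by auto
        show ?thesis
        proof (cases "even y")
          case even: True
          then have "y = 2 * (y div 2)" by simp
          then show ?thesis using True even ev[OF d] by (simp add: E_def)
        next
          case False
          then have "2 * (y div 2) + 1 = y" by presburger
          then show ?thesis using True False d side(2)[OF d] by (simp add: E_def \<pi>_def)
        qed
      qed (simp add: E_def perms_outside[OF p])
    qed
    ultimately show ?thesis by blast
  qed
  have inj: "inj_on E (perms n)"
  proof (rule inj_onI)
    fix \<pi> \<pi>' assume pp: "\<pi> \<in> perms n" "\<pi>' \<in> perms n" "E \<pi> = E \<pi>'"
    show "\<pi> = \<pi>'"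
    proof
      fix x show "\<pi> x = \<pi>' x"
      proof (cases "x < n")
        case True
        then show ?thesis using fun_cong[OF pp(3), of "2 * x + 1"] unfolding E2[OF True] by simp
      qed (use pp in \<open>simp add: perms_outside\<close>)
    qed
  qed
  have "pf n (C n) = (\<Sum>\<sigma>\<in>E ` perms n. pweight (C n) n \<sigma>)"
    unfolding pf_def
  proof (rule sum.mono_neutral_right)
    show "E ` perms n \<subseteq> matching_perms n" by (rule image_subsetI) (rule Em)
    show "\<forall>\<sigma>\<in>matching_perms n - E ` perms n. pweight (C n) n \<sigma> = 0"
    proof (rule ballI, rule ccontr)
      fix \<sigma> assume \<sigma>: "\<sigma> \<in> matching_perms n - E ` perms n" "pweight (C n) n \<sigma> \<noteq> 0"
      show False by (rule DiffD2[OF \<sigma>(1) onto[OF DiffD1[OF \<sigma>(1)] \<sigma>(2)]])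
    qed
  qed simp
  also have "\<dots> = (\<Sum>\<pi>\<in>perms n. s * (of_int (sign \<pi>) * (\<Prod>i<n. A i (\<pi> i))))"
    by (subst sum.reindex[OF inj], intro sum.cong refl) (simp only: comp_apply Ew)
  also have "\<dots> = s * det (mat n n (\<lambda>(i, j). A i j))"
    unfolding sum_distrib_left[symmetric] det_function ..
  finally have "pf n (C n) = s * det (mat n n (\<lambda>(i, j). A i j))" .
  moreover have "s \<in> {1, -1}" unfolding s_def by (cases "E id" rule: sign_cases) auto
  ultimately show ?thesis by blast
qed

lemma prod_uminus_lessThan: "(\<Prod>i<m. - h i) = (- 1) ^ m * (\<Prod>i<m. h i :: 'a::comm_ring_1)"
  by (induction m) simp_all

lemma pf_scale: "pf m (\<lambda>i j. - A i j) = (- 1) ^ m * pf m A"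
  unfolding pf_def sum_distrib_left pweight_def
  by (intro sum.cong refl) (simp add: prod_uminus_lessThan mult_ac)

lemma det_scalar_function:
  "det (mat n n (\<lambda>(i, j). if i = j then c else 0)) = (c :: 'a::comm_ring_1) ^ n"
proof -
  have "mat n n (\<lambda>(i, j). if i = j then c else 0) = c \<cdot>\<^sub>m 1\<^sub>m n" by (rule eq_matI) auto
  then show ?thesis by simp
qed

lemma sign_algebra:
  fixes s D P b u E :: "'a::idom"
  assumes s: "s \<in> {1, -1}" and b: "b = E \<or> b = - E" and u: "u = 1 \<or> u = - 1"
    and eq: "s * (E * D) = b * (u * P)" and "E \<noteq> 0"
  shows "\<exists>s\<in>{1, -1}. D = s * P"
proof -
  have "E * D = s * (s * (E * D))" using s by (elim insertE emptyE) simp_all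
  then have e: "E * D = s * (b * (u * P))" by (simp only: eq)
  have "E * D = E * P \<or> E * D = E * (- P)"
    unfolding e using s b u by (elim disjE insertE emptyE) simp_all
  then have "D = P \<or> D = - P" using mult_left_cancel[OF \<open>E \<noteq> 0\<close>, of D] by blast
  then show ?thesis by auto
qed

text \<open>The matrices \<open>A \<oplus> -A\<close> and \<open>[[0, 2A], [2A, 0]]\<close> are congruent by \<open>[[1, 1], [1, -1]]\<close>, and the
  Pfaffian of the second one is a determinant.\<close>

theorem det_eq_pf_square:
  fixes A :: "nat \<Rightarrow> nat \<Rightarrow> 'a::{idom, ring_char_0}"
  assumes skew: "\<And>x y. x < 2 * m \<Longrightarrow> y < 2 * m \<Longrightarrow> A x y = - A y x"
  shows "\<exists>s\<in>{1, -1}. det (mat (2 * m) (2 * m) (\<lambda>(i, j). A i j)) = s * pf m A ^ 2"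
proof -
  define n where "n = 2 * m"
  define B where "B p a = (if p < n then (if a = p then 1 else 0) + (if a = p + n then 1 else 0)
      else (if a + n = p then 1 else 0) - (if a = p then 1 else 0) :: 'a)" for p a
  define C0 where "C0 i j = (if i < n \<and> j < n then A i j else if n \<le> i \<and> n \<le> j then - A (i - n) (j - n) else 0)" for i j
  \<comment> \<open>By skew symmetry of \<open>A\<close> the lower block is again twice
    \<open>A\<close>; it is written with a minus sign and exchanged indices to fit
    \<open>pf_antidiagonal\<close>.\<close>
  define C1 where "C1 i j = (if i < n \<and> n \<le> j then 2 * A i (j - n) else if n \<le> i \<and> j < n then - (2 * A j (i - n)) else 0)" for i j
  let ?BCB = "\<lambda>p q. \<Sum>a<2 * n. \<Sum>b<2 * n. B p a * C0 a b * B q b"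
  have row: "(\<Sum>a<2 * n. B p a * x a) = (if p < n then x p + x (p + n) else x (p - n) - x p)" if "p < 2 * n" for p x
  proof (cases "p < n")
    case True
    have "(\<Sum>a<2 * n. B p a * x a) = (\<Sum>a<2 * n. (if a = p then x a else 0) + (if a = p + n then x a else 0))"
      by (intro sum.cong refl) (simp add: B_def True)
    then show ?thesis using True that by (simp add: sum.distrib)
  next
    case False
    have "(\<Sum>a<2 * n. B p a * x a) = (\<Sum>a<2 * n. (if a = p - n then x a else 0) - (if a = p then x a else 0))"
      by (intro sum.cong refl) (use False in \<open>auto simp: B_def\<close>)
    then show ?thesis using False that by (simp add: sum_subtractf)
  qed
  have sk: "A x y = - A y x" if "x < n" "y < n" for x y by (rule skew; use that in \<open>simp add: n_def\<close>)
  have BCB: "?BCB p q = C1 p q" if pq: "p < 2 * n" "q < 2 * n" for p q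
  proof -
    have "?BCB p q = (\<Sum>a<2 * n. B p a * (\<Sum>b<2 * n. B q b * C0 a b))"
      unfolding sum_distrib_left by (intro sum.cong refl) (simp add: mult_ac)
    also have "\<dots> = (if p < n then (\<Sum>b<2 * n. B q b * C0 p b) + (\<Sum>b<2 * n. B q b * C0 (p + n) b)
        else (\<Sum>b<2 * n. B q b * C0 (p - n) b) - (\<Sum>b<2 * n. B q b * C0 p b))" by (rule row[OF pq(1)])
    also have "\<dots> = C1 p q"
    proof -
      consider "p < n" "q < n" | "p < n" "\<not> q < n" | "\<not> p < n" "q < n" | "\<not> p < n" "\<not> q < n" by blast
      then show ?thesis
      proof cases
        case 3
        then have "A (p - n) q = - A q (p - n)" using pq by (intro sk) auto
        then show ?thesis using 3 pq unfolding row[OF pq(2)] by (simp add: C0_def C1_def)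
      qed (use pq in \<open>auto simp: row C0_def C1_def\<close>)
    qed
    finally show ?thesis .
  qed
  have full_cong: "full_pf n ?BCB = full_pf n C1"
    unfolding full_pf_def pweight_def
    by (intro sum.cong arg_cong2[where f = "(*)"] prod.cong refl) (auto intro!: BCB simp: perms_less)
  have C1_skew: "C1 x y = - C1 y x" for x y by (simp add: C1_def)
  have C0_skew: "C0 x y = - C0 y x" if "x < 2 * n" "y < 2 * n" for x y
  proof -
    have "A x y = - A y x" if "x < n" "y < n" using sk[OF that] .
    moreover have "A (x - n) (y - n) = - A (y - n) (x - n)" if "n \<le> x" "n \<le> y"
      using that \<open>x < 2 * n\<close> \<open>y < 2 * n\<close> by (intro sk) auto
    ultimately show ?thesis by (simp add: C0_def)
  qed
  let ?dB = "det (mat (2 * n) (2 * n) (\<lambda>(i, j). B i j))"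
  \<comment> \<open>The number of permutations listing one matching, nonzero in characteristic zero,
    so that it can be cancelled when passing from the full sums to the Pfaffians.\<close>
  have k: "of_nat (2 ^ n * (\<Prod>i<n. n - i)) \<noteq> (0 :: 'a)"
    unfolding of_nat_eq_0_iff by (simp add: prod_zero_iff)
  have "full_pf n C1 = ?dB * full_pf n C0"
    unfolding full_cong[symmetric] by (rule full_pf_congruence) simp
  then have "of_nat (2 ^ n * (\<Prod>i<n. n - i)) * pf n C1 = of_nat (2 ^ n * (\<Prod>i<n. n - i)) * (?dB * pf n C0)"
    by (simp only: full_pf_eq[OF C1_skew] full_pf_eq[OF C0_skew] mult.left_commute)
  then have main: "pf n C1 = ?dB * pf n C0" by (rule mult_left_cancel[OF k, THEN iffD1])
  have C0_eq: "C0 = (\<lambda>i j. if i < 2 * m \<and> j < 2 * m then A i j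
      else if 2 * m \<le> i \<and> 2 * m \<le> j then - A (i - 2 * m) (j - 2 * m) else 0)"
    unfolding C0_def n_def ..
  have "n = m + m" by (simp add: n_def)
  then have "pf n C0 = pf m A * pf m (\<lambda>i j. - A i j)"
    using pf_block_diagonal[of m m A "\<lambda>i j. - A i j"] unfolding C0_eq by simp
  then have C0: "pf n C0 = (- 1) ^ m * pf m A ^ 2" by (simp add: pf_scale power2_eq_square mult_ac)
  obtain s where s: "s \<in> {1, -1}" "pf n C1 = s * det (mat n n (\<lambda>(i, j). 2 * A i j))"
    using pf_antidiagonal[of n "\<lambda>i j. 2 * A i j"] unfolding C1_def by blast
  have "mat n n (\<lambda>(i, j). 2 * A i j) = 2 \<cdot>\<^sub>m mat n n (\<lambda>(i, j). A i j)" by (rule eq_matI) auto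
  then have s': "pf n C1 = s * (2 ^ n * det (mat n n (\<lambda>(i, j). A i j)))" using s(2) by simp
  have "mat (2 * n) (2 * n) (\<lambda>(i, j). B i j) * mat (2 * n) (2 * n) (\<lambda>(i, j). B i j) = mat (2 * n) (2 * n) (\<lambda>(i, j). if i = j then 2 else 0)"
  proof (rule eq_matI)
    fix i j assume "i < dim_row (mat (2 * n) (2 * n) (\<lambda>(i, j). if i = j then (2::'a) else 0))"
      "j < dim_col (mat (2 * n) (2 * n) (\<lambda>(i, j). if i = j then (2::'a) else 0))"
    then have ij: "i < 2 * n" "j < 2 * n" by auto
    have "(mat (2 * n) (2 * n) (\<lambda>(i, j). B i j) * mat (2 * n) (2 * n) (\<lambda>(i, j). B i j)) $$ (i, j) = (\<Sum>a<2 * n. B i a * B a j)"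
      using ij by (simp add: scalar_prod_def atLeast0LessThan)
    also have "\<dots> = (if i < n then B i j + B (i + n) j else B (i - n) j - B i j)" by (rule row[OF ij(1)])
    also have "\<dots> = (if i = j then 2 else 0)" using ij by (auto simp: B_def)
    finally show "(mat (2 * n) (2 * n) (\<lambda>(i, j). B i j) * mat (2 * n) (2 * n) (\<lambda>(i, j). B i j)) $$ (i, j) =
        mat (2 * n) (2 * n) (\<lambda>(i, j). if i = j then 2 else 0) $$ (i, j)" using ij by simp
  qed auto
  \<comment> \<open>Up to sign, det B is 2^n, which cancels against the power of two from the
    doubled entries of \<open>C1\<close>.\<close>
  then have "?dB * ?dB = 2 ^ (2 * n)"
    using det_mult[of "mat (2 * n) (2 * n) (\<lambda>(i, j). B i j)" "2 * n" "mat (2 * n) (2 * n) (\<lambda>(i, j). B i j)"]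
    by (simp add: det_scalar_function)
  then have "?dB ^ 2 = (2 ^ n) ^ 2" by (simp add: power2_eq_square power_add[symmetric] mult_2)
  then have dB: "?dB = 2 ^ n \<or> ?dB = - (2 ^ n)" by (simp only: power2_eq_iff)
  have u: "(- 1 :: 'a) ^ m = 1 \<or> (- 1 :: 'a) ^ m = - 1" by (cases "even m") simp_all
  have "s * (2 ^ n * det (mat n n (\<lambda>(i, j). A i j))) = ?dB * ((- 1) ^ m * pf m A ^ 2)"
    using main unfolding s' C0 .
  moreover have "(2 :: 'a) ^ n \<noteq> 0" by simp
  ultimately have "\<exists>s\<in>{1, -1}. det (mat n n (\<lambda>(i, j). A i j)) = s * pf m A ^ 2"
    by (rule sign_algebra[OF s(1) dB u])
  then show ?thesis unfolding n_def .
qed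

section \<open>Codimension\<close>

definition degree_le :: "nat \<Rightarrow> 'k::field poly3 \<Rightarrow> bool" where
  "degree_le E p \<longleftrightarrow> (\<forall>\<alpha>\<in>Poly_Mapping.keys p. mdeg \<alpha> \<le> E)"

lemma degree_le_mult: "degree_le a p \<Longrightarrow> degree_le b q \<Longrightarrow> degree_le (a + b) (p * q)"
  unfolding degree_le_def using keys_mult[of p q] by (fastforce simp: mdeg_add intro: add_mono)

lemma degree_le_mono: "degree_le a p \<Longrightarrow> a \<le> b \<Longrightarrow> degree_le b p"
  by (auto simp: degree_le_def intro: le_trans)

lemma degree_le_1: "degree_le 0 1"
  by (simp add: degree_le_def)

lemma degree_le_power: "degree_le a p \<Longrightarrow> degree_le (n * a) (p ^ n)"
  by (induction n) (auto simp: degree_le_1 intro: degree_le_mult)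

lemma degree_le_exists: "\<exists>E. degree_le E p"
  unfolding degree_le_def
  by (rule exI[of _ "\<Sum>\<alpha>\<in>Poly_Mapping.keys p. mdeg \<alpha>"]) (auto intro: member_le_sum)

lemma card_mdeg_le: "finite {\<alpha>. mdeg \<alpha> \<le> E}" "card {\<alpha>. mdeg \<alpha> \<le> E} \<le> (E + 1) ^ 3"
proof -
  let ?S = "{\<alpha>. mdeg \<alpha> \<le> E}"
  have sub: "Poly_Mapping.lookup ` ?S \<subseteq> Pi\<^sub>E UNIV (\<lambda>_. {..E})"
  proof (intro image_subsetI PiE_I)
    fix \<alpha> :: monomial3 and i assume "\<alpha> \<in> ?S"
    moreover have "Poly_Mapping.lookup \<alpha> i \<le> mdeg \<alpha>" unfolding mdeg_def by (rule member_le_sum) auto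
    ultimately show "Poly_Mapping.lookup \<alpha> i \<in> {..E}" by simp
  qed simp
  have fin: "finite (Pi\<^sub>E (UNIV :: 3 set) (\<lambda>_. {..E}))" by (intro finite_PiE) auto
  have inj: "inj_on Poly_Mapping.lookup ?S" by (auto simp: inj_on_def poly_mapping_eqI)
  show "finite ?S" by (rule finite_imageD[OF finite_subset[OF sub fin] inj])
  have "card ?S = card (Poly_Mapping.lookup ` ?S)" by (rule card_image[OF inj, symmetric])
  also have "\<dots> \<le> card (Pi\<^sub>E (UNIV :: 3 set) (\<lambda>_. {..E}))" by (rule card_mono[OF fin sub])
  also have "\<dots> = (E + 1) ^ 3" by (simp add: card_PiE)
  finally show "card ?S \<le> (E + 1) ^ 3" .
qed

lemma vector_space_poly3: "vector_space (\<lambda>(c :: 'k::field) (p :: 'k poly3). const3 c * p)"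
  by unfold_locales (auto simp: const3_add const3_mult algebra_simps)

lemma degree_le_in_span:
  assumes "degree_le E p"
  shows "p \<in> module.span (\<lambda>(c :: 'k::field) (p :: 'k poly3). const3 c * p) ((\<lambda>\<alpha>. Poly_Mapping.single \<alpha> 1) ` {\<alpha>. mdeg \<alpha> \<le> E})"
proof -
  interpret vs: vector_space "\<lambda>(c :: 'k) (p :: 'k poly3). const3 c * p" by (rule vector_space_poly3)
  have "(\<Sum>\<alpha>\<in>Poly_Mapping.keys p. const3 (Poly_Mapping.lookup p \<alpha>) * Poly_Mapping.single \<alpha> 1) \<in>
      vs.span ((\<lambda>\<alpha>. Poly_Mapping.single \<alpha> 1) ` {\<alpha>. mdeg \<alpha> \<le> E})"
    by (intro vs.span_sum vs.span_scale vs.span_base imageI) (use assms in \<open>auto simp: degree_le_def\<close>)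
  then show ?thesis using poly3_sum_single[of p] by (simp add: single_eq_const3_mult[symmetric])
qed

lemma linear_dependence_bounded_degree:
  fixes v :: "'l \<Rightarrow> 'k::field poly3"
  assumes L: "finite L" and deg: "\<And>l. l \<in> L \<Longrightarrow> degree_le E (v l)" and card: "card L > (E + 1) ^ 3"
  shows "\<exists>c. (\<exists>l\<in>L. c l \<noteq> 0) \<and> (\<Sum>l\<in>L. const3 (c l) * v l) = 0"
proof (cases "inj_on v L")
  case False
  then obtain l l' where l: "l \<in> L" "l' \<in> L" "l \<noteq> l'" "v l = v l'" by (auto simp: inj_on_def)
  define c where "c m = (if m = l then 1 else if m = l' then - 1 else (0 :: 'k))" for m
  have "(\<Sum>m\<in>L. const3 (c m) * v m) = (\<Sum>m\<in>L. (if m = l then v m else 0) - (if m = l' then v m else 0))"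
    by (intro sum.cong refl) (use l(3) in \<open>auto simp: c_def const3_uminus\<close>)
  also have "\<dots> = 0" using L l by (simp add: sum_subtractf)
  finally show ?thesis using l(1) by (intro exI[of _ c]) (auto simp: c_def)
next
  case True
  interpret vs: vector_space "\<lambda>(c :: 'k) (p :: 'k poly3). const3 c * p" by (rule vector_space_poly3)
  let ?T = "(\<lambda>\<alpha>. Poly_Mapping.single \<alpha> (1 :: 'k)) ` {\<alpha>. mdeg \<alpha> \<le> E}"
  have "v ` L \<subseteq> vs.span ?T" using degree_le_in_span deg by blast
  moreover have "card ?T < card (v ` L)"
    using card_image_le[OF card_mdeg_le(1), of "\<lambda>\<alpha>. Poly_Mapping.single \<alpha> (1 :: 'k)" E] card_mdeg_le(2)[of E] card card_image[OF True] by simp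
  moreover have "finite ?T" by (intro finite_imageI card_mdeg_le)
  ultimately have "vs.dependent (v ` L)" using vs.independent_span_bound[of ?T "v ` L"] by force
  then obtain u where u: "\<exists>w\<in>v ` L. u w \<noteq> 0" "(\<Sum>w\<in>v ` L. const3 (u w) * w) = 0"
    using vs.dependent_finite[OF finite_imageI[OF L]] by blast
  show ?thesis using u by (intro exI[of _ "\<lambda>l. u (v l)"]) (simp add: sum.reindex[OF True])
qed

text \<open>\<open>meval B fs c\<close> is the polynomial in \<open>fs\<close> with coefficients \<open>c\<close>, indexed by exponent lists, in
  which every exponent is less than \<open>B\<close>.\<close>

fun meval :: "nat \<Rightarrow> 'k::field poly3 list \<Rightarrow> (nat list \<Rightarrow> 'k) \<Rightarrow> 'k poly3" where
  "meval B [] c = const3 (c [])"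
| "meval B (f # fs) c = (\<Sum>a<B. f ^ a * meval B fs (\<lambda>l. c (a # l)))"

fun mpower :: "'k::field poly3 list \<Rightarrow> nat list \<Rightarrow> 'k poly3" where
  "mpower (f # fs) (a # l) = f ^ a * mpower fs l"
| "mpower _ _ = 1"

definition exponents :: "nat \<Rightarrow> nat \<Rightarrow> nat list set" where
  "exponents B n = {l. set l \<subseteq> {..<B} \<and> length l = n}"

lemma exponents_Suc: "(\<Sum>l\<in>exponents B (Suc n). h l) = (\<Sum>a<B. \<Sum>l\<in>exponents B n. h (a # l))"
  for h :: "nat list \<Rightarrow> 'a::comm_monoid_add"
proof -
  have "exponents B (Suc n) = (\<lambda>(a, l). a # l) ` ({..<B} \<times> exponents B n)"
    by (auto simp: exponents_def length_Suc_conv image_iff)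
  moreover have "inj_on (\<lambda>(a, l). a # l) ({..<B} \<times> exponents B n)" by (auto simp: inj_on_def)
  ultimately show ?thesis by (simp add: sum.reindex sum.cartesian_product case_prod_unfold)
qed

lemma meval_eq: "meval B fs c = (\<Sum>l\<in>exponents B (length fs). const3 (c l) * mpower fs l)"
proof (induction fs arbitrary: c)
  case Nil
  have "exponents B 0 = {[]}" by (auto simp: exponents_def)
  then show ?case by simp
next
  case (Cons f fs)
  show ?case by (simp add: exponents_Suc Cons.IH sum_distrib_left mult.left_commute)
qed

text \<open>Algebraic independence modulo \<open>P\<close>, tested only on exponents below
  \<open>B\<close>; the bound keeps the later dimension count within finite linear algebra.\<close>

definition algebraically_free :: "nat \<Rightarrow> 'k::field poly3 set \<Rightarrow> 'k poly3 list \<Rightarrow> bool" where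
  "algebraically_free B P fs \<longleftrightarrow> (\<forall>c. meval B fs c \<in> P \<longrightarrow> (\<forall>l\<in>exponents B (length fs). c l = 0))"

lemma primeideal_ring3D:
  assumes "primeideal P (ring3 :: 'k::field poly3 ring)"
  shows "ideal P ring3" "1 \<notin> P" "x * y \<in> P \<Longrightarrow> x \<in> P \<or> y \<in> P"
proof -
  interpret primeideal P "ring3 :: 'k poly3 ring" by (rule assms)
  show "ideal P ring3" by (rule ideal_axioms)
  show "1 \<notin> P" using one_imp_carrier I_notcarr by auto
  show "x * y \<in> P \<Longrightarrow> x \<in> P \<or> y \<in> P" using I_prime[of x y] by simp
qed

text \<open>Modulo \<open>Q\<close> the new element vanishes and only the part free of
  \<open>f\<close> remains, which is zero by freeness of \<open>fs\<close>. The rest is divisible by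
  \<open>f\<close>, and primality of \<open>P\<close> cancels it since \<open>f\<close> is not in
  \<open>P\<close>; iterating clears all powers.\<close>

lemma algebraically_free_Cons:
  assumes P: "primeideal P (ring3 :: 'k::field poly3 ring)" and Q: "ideal Q (ring3 :: 'k poly3 ring)"
    and PQ: "P \<subseteq> Q" and f: "f \<in> Q" "f \<notin> P" and free: "algebraically_free B Q fs"
  shows "algebraically_free B P (f # fs)"
proof -
  note P' = primeideal_ring3D[OF P]
  have *: "\<forall>a<n. \<forall>l\<in>exponents B (length fs). G a l = 0" if "(\<Sum>a<n. f ^ a * meval B fs (G a)) \<in> P" for n G
    using that
  proof (induction n arbitrary: G)
    case (Suc n)
    let ?S = "\<Sum>a<n. f ^ a * meval B fs (G (Suc a))"
    have split: "(\<Sum>a<Suc n. f ^ a * meval B fs (G a)) = meval B fs (G 0) + f * ?S"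
      unfolding sum.lessThan_Suc_shift by (simp add: sum_distrib_left mult.assoc del: sum.lessThan_Suc)
    have "meval B fs (G 0) + f * ?S \<in> Q" using Suc.prems PQ unfolding split by blast
    from ideal3_diff[OF Q this ideal3_mult'[OF Q f(1), of ?S]] have "meval B fs (G 0) \<in> Q" by simp
    then have z: "\<forall>l\<in>exponents B (length fs). G 0 l = 0" using free by (simp add: algebraically_free_def)
    then have "meval B fs (G 0) = 0" by (simp add: meval_eq)
    then have "f * ?S \<in> P" using Suc.prems unfolding split by simp
    then have "?S \<in> P" using P'(3)[of f ?S] f(2) by blast
    from Suc.IH[OF this] z show ?case by (auto simp: less_Suc_eq_0_disj)
  qed simp
  show ?thesis unfolding algebraically_free_def
  proof (intro allI impI ballI)
    fix c l assume c: "meval B (f # fs) c \<in> P" and l: "l \<in> exponents B (length (f # fs))"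
    from l obtain a l' where "l = a # l'" "a < B" "l' \<in> exponents B (length fs)"
      by (auto simp: exponents_def length_Suc_conv)
    then show "c l = 0" using *[where n = B and G = "\<lambda>a l. c (a # l)"] c by simp
  qed
qed

text \<open>Picking an element in each step of a chain of length four gives four algebraically free
  polynomials. Their monomials with exponents below \<open>B\<close> are about B^4 in number and
  live in a space of dimension of order B^3, which is impossible for large \<open>B\<close>.\<close>

lemma prime_chain_length:
  assumes C: "\<And>i. i \<le> l \<Longrightarrow> primeideal (C i) (ring3 :: 'k::field poly3 ring)"
    and strict: "\<And>i. i < l \<Longrightarrow> C i \<subset> C (Suc i)"
  shows "l \<le> 3"
proof (rule ccontr)
  assume "\<not> l \<le> 3"
  then have l: "l \<ge> 4" by simp
  have "\<exists>f. f \<in> C (Suc i) \<and> f \<notin> C i" if "i < l" for i using strict[OF that] by blast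
  then obtain f where f: "\<And>i. i < l \<Longrightarrow> f i \<in> C (Suc i) \<and> f i \<notin> C i" by metis
  let ?fs = "[f 0, f 1, f 2, f 3]"
  obtain E0 E1 E2 E3 where E: "degree_le E0 (f 0)" "degree_le E1 (f 1)" "degree_le E2 (f 2)" "degree_le E3 (f 3)"
    using degree_le_exists by metis
  define e where "e = E0 + E1 + E2 + E3"
  have deg: "degree_le e (f 0)" "degree_le e (f 1)" "degree_le e (f 2)" "degree_le e (f 3)"
    by (rule degree_le_mono[OF E(1)] degree_le_mono[OF E(2)] degree_le_mono[OF E(3)] degree_le_mono[OF E(4)]; simp add: e_def)+
  \<comment> \<open>With this choice B^4 exceeds (B (4 e + 1))^3, which is at least (4 B e + 1)^3,
    the bound for the number of monomials of degree at most 4 B e.\<close>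
  define B where "B = Suc ((4 * e + 1) ^ 3)"
  have prime: "primeideal (C 0) ring3" "primeideal (C 1) ring3" "primeideal (C 2) ring3" "primeideal (C 3) ring3" "primeideal (C 4) ring3"
    using C l by simp_all
  note ids = primeideal_ring3D(1)[OF prime(2)] primeideal_ring3D(1)[OF prime(3)] primeideal_ring3D(1)[OF prime(4)] primeideal_ring3D(1)[OF prime(5)]
  have num: "Suc 0 = 1" "Suc 1 = 2" "Suc 2 = 3" "Suc 3 = 4" by simp_all
  have "c [] = 0" if "const3 (c []) \<in> C 4" for c :: "nat list \<Rightarrow> 'k"
  proof (rule ccontr)
    assume "c [] \<noteq> 0"
    then have "const3 (1 / c []) * const3 (c []) = 1" by (simp add: const3_mult[symmetric])
    then show False using ideal3_mult[OF ids(4) that, of "const3 (1 / c [])"] primeideal_ring3D(2)[OF prime(5)] by simp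
  qed
  then have "algebraically_free B (C 4) []" by (auto simp: algebraically_free_def exponents_def)
  note free4 = this
  have step: "algebraically_free B (C i) (f i # fs)" if i: "i < l" and fs: "algebraically_free B (C (Suc i)) fs" for i fs
  proof (rule algebraically_free_Cons[OF _ _ _ _ _ fs])
    show "primeideal (C i) ring3" using C i by simp
    show "ideal (C (Suc i)) ring3" using C[of "Suc i"] i by (intro primeideal_ring3D(1)) simp
    show "C i \<subseteq> C (Suc i)" using strict[OF i] by blast
    show "f i \<in> C (Suc i)" "f i \<notin> C i" using f[OF i] by blast+
  qed
  have lt: "0 < l" "1 < l" "2 < l" "3 < l" using l by linarith+
  have free: "algebraically_free B (C 0) ?fs"
    by (intro step lt, unfold num One_nat_def[symmetric], intro step lt, unfold num, intro step lt, unfold num, intro step lt, unfold num, rule free4)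
  let ?L = "exponents B 4"
  have fin: "finite ?L" and cardL: "card ?L = B ^ 4"
    using finite_lists_length_eq[of "{..<B}" 4] card_lists_length_eq[of "{..<B}" 4] by (simp_all add: exponents_def)
  have degL: "degree_le (4 * B * e) (mpower ?fs x)" if "x \<in> ?L" for x
  proof -
    from that obtain a b c d where x: "x = [a, b, c, d]" "a < B" "b < B" "c < B" "d < B"
      by (auto simp: exponents_def eval_nat_numeral length_Suc_conv)
    have "degree_le (a * e + (b * e + (c * e + (d * e + 0)))) (f 0 ^ a * (f 1 ^ b * (f 2 ^ c * (f 3 ^ d * 1))))"
      by (intro degree_le_mult degree_le_power deg degree_le_1)
    moreover have "a * e + (b * e + (c * e + (d * e + 0))) \<le> 4 * B * e"
    proof -
      have "a * e \<le> B * e" "b * e \<le> B * e" "c * e \<le> B * e" "d * e \<le> B * e" by (rule mult_right_mono; use x in simp)+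
      moreover have "4 * B * e = B * e + B * e + B * e + B * e" by simp
      ultimately show ?thesis by linarith
    qed
    ultimately show ?thesis unfolding x(1) by (auto intro: degree_le_mono)
  qed
  have "1 \<le> B" by (simp add: B_def)
  then have "4 * B * e + 1 \<le> B * (4 * e + 1)" by (simp add: algebra_simps)
  then have "(4 * B * e + 1) ^ 3 \<le> (B * (4 * e + 1)) ^ 3" by (rule power_mono) simp
  also have "\<dots> = B ^ 3 * (4 * e + 1) ^ 3" by (rule power_mult_distrib)
  also have "\<dots> < B ^ 3 * B" by (simp add: B_def)
  also have "\<dots> = B ^ 4" by (simp add: eval_nat_numeral)
  finally have "card ?L > (4 * B * e + 1) ^ 3" by (simp add: cardL)
  then have "\<exists>c. (\<exists>l\<in>?L. c l \<noteq> 0) \<and> (\<Sum>l\<in>?L. const3 (c l) * mpower ?fs l) = 0"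
    by (rule linear_dependence_bounded_degree[OF fin, rotated]) (rule degL)
  then obtain c where c: "\<exists>l\<in>?L. c l \<noteq> 0" "(\<Sum>l\<in>?L. const3 (c l) * mpower ?fs l) = 0" by blast
  have len: "length ?fs = 4" by simp
  have "meval B ?fs c = 0" unfolding meval_eq len using c(2) .
  then have "meval B ?fs c \<in> C 0" using ideal3_0[OF primeideal_ring3D(1)[OF prime(1)]] by simp
  then have "\<forall>l\<in>exponents B (length ?fs). c l = 0" using free unfolding algebraically_free_def by blast
  then show False using c(1) unfolding len by blast
qed

section \<open>Height of the maximal ideal and codimension of a Gorenstein ideal\<close>

definition coordinate_ideal :: "3 set \<Rightarrow> 'k::field poly3 set" where
  "coordinate_ideal S = {p. mfilter (\<lambda>\<alpha>. \<forall>i\<in>S. Poly_Mapping.lookup \<alpha> i = 0) p = 0}"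

lemma primeideal_coordinate_ideal: "primeideal (coordinate_ideal S) (ring3 :: 'k::field poly3 ring)"
proof (rule primeidealI[OF _ cring_ring3])
  let ?m = "mfilter (\<lambda>\<alpha>. \<forall>i\<in>S. Poly_Mapping.lookup \<alpha> i = 0) :: 'k poly3 \<Rightarrow> 'k poly3"
  have hom: "?m (p * q) = ?m p * ?m q" for p q by (rule mfilter_hom) (auto simp: lookup_add)
  show "ideal (coordinate_ideal S) (ring3 :: 'k poly3 ring)"
    by (simp add: ideal_ring3_iff coordinate_ideal_def mfilter_add hom)
  have "?m 1 = 1" using mfilter_single[of _ 0 "1 :: 'k"] by simp
  then have "(1 :: 'k poly3) \<notin> coordinate_ideal S" by (simp add: coordinate_ideal_def)
  then show "carrier (ring3 :: 'k poly3 ring) \<noteq> coordinate_ideal S" by auto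
  show "a \<in> coordinate_ideal S \<or> b \<in> coordinate_ideal S" if "a \<otimes>\<^bsub>ring3\<^esub> b \<in> coordinate_ideal S" for a b :: "'k poly3"
    using that by (simp add: coordinate_ideal_def hom)
qed

lemma var3_in_coordinate_ideal: "var3 i \<in> (coordinate_ideal S :: 'k::field poly3 set) \<longleftrightarrow> i \<in> S"
proof -
  have "mfilter (\<lambda>\<alpha>. \<forall>j\<in>S. Poly_Mapping.lookup \<alpha> j = 0) (var3 i) = (if i \<in> S then 0 else var3 i :: 'k poly3)"
    unfolding var3_def mfilter_single by (auto simp: lookup_single when_def)
  then show ?thesis by (simp add: coordinate_ideal_def)
qed

lemma coordinate_ideal_mono: "S \<subseteq> T \<Longrightarrow> coordinate_ideal S \<subseteq> (coordinate_ideal T :: 'k::field poly3 set)"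
proof
  fix p :: "'k poly3" assume ST: "S \<subseteq> T" and "p \<in> coordinate_ideal S"
  then have z: "mfilter (\<lambda>\<alpha>. \<forall>i\<in>S. Poly_Mapping.lookup \<alpha> i = 0) p = 0" by (simp add: coordinate_ideal_def)
  have "Poly_Mapping.lookup p \<alpha> = 0" if "\<forall>i\<in>T. Poly_Mapping.lookup \<alpha> i = 0" for \<alpha>
    using arg_cong[OF z, of "\<lambda>q. Poly_Mapping.lookup q \<alpha>"] that ST by (auto split: if_splits)
  then show "p \<in> coordinate_ideal T" by (auto simp: coordinate_ideal_def intro!: poly_mapping_eqI)
qed

lemma coordinate_ideal_UNIV: "coordinate_ideal UNIV = {p. c0 p = (0 :: 'k::field)}"
proof -
  have "(\<forall>i\<in>UNIV. Poly_Mapping.lookup \<alpha> i = 0) \<longleftrightarrow> \<alpha> = 0" for \<alpha> :: monomial3 by (auto intro: poly_mapping_eqI)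
  then have "mfilter (\<lambda>\<alpha>. \<forall>i\<in>UNIV. Poly_Mapping.lookup \<alpha> i = 0) p = const3 (c0 p)" for p :: "'k poly3"
    by (intro poly_mapping_eqI) (auto simp: const3_def lookup_single when_def)
  then show ?thesis by (simp add: coordinate_ideal_def)
qed

lemma prime_height_maximal: "prime_height ring3 (coordinate_ideal UNIV :: 'k::field poly3 set) = 3"
proof -
  let ?H = "{enat l | l. \<exists>C :: nat \<Rightarrow> 'k poly3 set. (\<forall>i\<le>l. primeideal (C i) ring3) \<and>
    (\<forall>i<l. C i \<subset> C (Suc i)) \<and> C l = coordinate_ideal UNIV}"
  have "Sup ?H \<le> 3"
  proof (rule Sup_least)
    fix x assume "x \<in> ?H"
    then obtain l and C :: "nat \<Rightarrow> 'k poly3 set" where x: "x = enat l" "\<forall>i\<le>l. primeideal (C i) ring3" "\<forall>i<l. C i \<subset> C (Suc i)"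
      by blast
    have "l \<le> 3" by (rule prime_chain_length[of l C]) (use x in auto)
    then show "x \<le> 3" unfolding x(1) numeral_eq_enat by simp
  qed
  moreover have "enat 3 \<in> ?H"
  proof -
    define S where "S i = (if i = 0 then {} else if i = Suc 0 then {0} else if i = 2 then {0, 1} else (UNIV :: 3 set))" for i :: nat
    have str: "coordinate_ideal (S i) \<subset> (coordinate_ideal (S (Suc i)) :: 'k poly3 set)" if "i < 3" for i
    proof -
      have "(2 :: 3) \<notin> {0, 1}" using three_distinct by auto
      then have "{0, 1} \<noteq> (UNIV :: 3 set)" by blast
      then have sub: "S i \<subset> S (Suc i)" using that three_distinct
        by (auto simp: S_def less_Suc_eq eval_nat_numeral)
      then obtain j where "j \<in> S (Suc i)" "j \<notin> S i" by blast
      then have "coordinate_ideal (S i) \<noteq> (coordinate_ideal (S (Suc i)) :: 'k poly3 set)"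
        using var3_in_coordinate_ideal[of j] by blast
      then show ?thesis using coordinate_ideal_mono[of "S i" "S (Suc i)"] sub by blast
    qed
    have "\<exists>C :: nat \<Rightarrow> 'k poly3 set. (\<forall>i\<le>3. primeideal (C i) ring3) \<and> (\<forall>i<3. C i \<subset> C (Suc i)) \<and> C 3 = coordinate_ideal UNIV"
      by (intro exI[of _ "\<lambda>i. coordinate_ideal (S i)"] conjI allI impI primeideal_coordinate_ideal str) (simp_all add: S_def)
    then show ?thesis by blast
  qed
  then have "enat 3 \<le> Sup ?H" by (rule Sup_upper)
  ultimately show ?thesis unfolding prime_height_def by (simp add: numeral_eq_enat)
qed

context gorenstein_ideal
begin

text \<open>Powers of all variables lie in the ideal, so a prime above it contains the maximal ideal
  of the origin and equals it. The infimum is thus the height of that single prime.\<close>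

lemma codimension_eq: "codimension ring3 I = 3"
proof -
  have IM: "I \<subseteq> coordinate_ideal UNIV"
  proof
    fix p assume p: "p \<in> I"
    have "c0 p = 0"
    proof (rule ccontr)
      assume "c0 p \<noteq> 0"
      have "hc 0 p = const3 (c0 p)" using homz_0_const3[OF homz_hc[of 0 p]] by simp
      then have "const3 (1 / c0 p) * const3 (c0 p) \<in> I" using I_mult[OF hcI[OF p, of 0], of "const3 (1 / c0 p)"] by simp
      then have "1 \<in> I" using \<open>c0 p \<noteq> 0\<close> by (simp add: const3_mult[symmetric])
      from I_mult[OF this, of s0] show False using s0_notin by simp
    qed
    then show "p \<in> coordinate_ideal UNIV" by (simp add: coordinate_ideal_UNIV)
  qed
  have only: "P = coordinate_ideal UNIV" if P: "primeideal P (ring3 :: 'k poly3 ring)" "I \<subseteq> P" for P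
  proof -
    note P' = primeideal_ring3D[OF P(1)]
    have pw: "var3 a ^ m \<in> P \<Longrightarrow> var3 a \<in> P" for a m
    proof (induction m)
      case (Suc m)
      then show ?case using P'(3)[of "var3 a" "var3 a ^ m"] unfolding power_Suc by blast
    qed (simp add: P'(2))
    have v: "var3 a \<in> P" for a by (rule pw[of a "Suc k"]) (use var3_power_in P(2) in blast)
    have sub: "p \<in> P" if c0p: "c0 p = 0" for p
    proof -
      obtain q where "p = (\<Sum>a\<in>UNIV. var3 a * q a)" using c0p unfolding c0_eq_0_iff by (rule exE)
      then show ?thesis by (auto intro!: ideal3_sum[OF P'(1)] ideal3_mult'[OF P'(1)] v)
    qed
    have "c0 p = 0" if "p \<in> P" for p
    proof (rule ccontr)
      assume "c0 p \<noteq> 0"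
      have "p - const3 (c0 p) \<in> P" by (rule sub) (simp add: lookup_minus)
      from ideal3_diff[OF P'(1) that this] have "const3 (c0 p) \<in> P" by simp
      from ideal3_mult[OF P'(1) this, of "const3 (1 / c0 p)"] show False
        using P'(2) \<open>c0 p \<noteq> 0\<close> by (simp add: const3_mult[symmetric])
    qed
    then show ?thesis using sub by (auto simp: coordinate_ideal_UNIV)
  qed
  have "{prime_height ring3 P | P. primeideal P ring3 \<and> I \<subseteq> P} = {prime_height ring3 (coordinate_ideal UNIV :: 'k poly3 set)}"
  proof (intro equalityI subsetI)
    fix h assume "h \<in> {prime_height ring3 P | P. primeideal P ring3 \<and> I \<subseteq> P}"
    then obtain P where P: "h = prime_height ring3 P" "primeideal P ring3" "I \<subseteq> P" by blast
    show "h \<in> {prime_height ring3 (coordinate_ideal UNIV :: 'k poly3 set)}" unfolding P(1) only[OF P(2,3)] by (rule singletonI)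
  next
    fix h assume "h \<in> {prime_height ring3 (coordinate_ideal UNIV :: 'k poly3 set)}"
    then have "h = prime_height ring3 (coordinate_ideal UNIV :: 'k poly3 set)" by (rule singletonD)
    then show "h \<in> {prime_height ring3 P | P. primeideal P ring3 \<and> I \<subseteq> P}"
      using IM primeideal_coordinate_ideal[of UNIV, where 'k = 'k] by blast
  qed
  then show ?thesis by (simp add: codimension_def prime_height_maximal)
qed

end

section \<open>Artinian graded Gorenstein ideals\<close>

context
  fixes I :: "'k::field poly3 set"
  assumes I: "ideal I (ring3 :: 'k poly3 ring)"
begin

lemma mem_coset3: "y \<in> I +>\<^bsub>ring3\<^esub> x \<longleftrightarrow> y - x \<in> I"
proof -
  have "I +>\<^bsub>ring3\<^esub> x = {h + x | h. h \<in> I}" by (auto simp: a_r_coset_def')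
  then show ?thesis by (auto intro: exI[of _ "y - x"])
qed

lemma coset3_eq_iff: "I +>\<^bsub>ring3\<^esub> x = I +>\<^bsub>ring3\<^esub> y \<longleftrightarrow> x - y \<in> I"
proof
  assume eq: "I +>\<^bsub>ring3\<^esub> x = I +>\<^bsub>ring3\<^esub> y"
  have "x \<in> I +>\<^bsub>ring3\<^esub> x" using ideal3_0[OF I] by (simp add: mem_coset3)
  then show "x - y \<in> I" unfolding eq mem_coset3 .
next
  assume xy: "x - y \<in> I"
  have "z - x \<in> I \<longleftrightarrow> z - y \<in> I" for z
    using ideal3_add[OF I _ xy, of "z - x"] ideal3_diff[OF I _ xy, of "z - y"] by auto
  then show "I +>\<^bsub>ring3\<^esub> x = I +>\<^bsub>ring3\<^esub> y" by (auto simp: mem_coset3)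
qed

lemma coset3_zero: "I +>\<^bsub>ring3\<^esub> 0 = I"
  by (rule Set.set_eqI) (simp add: mem_coset3)

lemma quot_ring3:
  "carrier (ring3 Quot I) = range (\<lambda>x. I +>\<^bsub>ring3\<^esub> x)" "\<zero>\<^bsub>ring3 Quot I\<^esub> = I +>\<^bsub>ring3\<^esub> 0"
  "(I +>\<^bsub>ring3\<^esub> x) \<oplus>\<^bsub>ring3 Quot I\<^esub> (I +>\<^bsub>ring3\<^esub> y) = I +>\<^bsub>ring3\<^esub> (x + y)"
  "(I +>\<^bsub>ring3\<^esub> x) \<otimes>\<^bsub>ring3 Quot I\<^esub> (I +>\<^bsub>ring3\<^esub> y) = I +>\<^bsub>ring3\<^esub> (x * y)"
proof -
  interpret ideal I "ring3 :: 'k poly3 ring" by (rule I)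
  show "carrier (ring3 Quot I) = range (\<lambda>x. I +>\<^bsub>ring3\<^esub> x)" by (auto simp: FactRing_def A_RCOSETS_def')
  show "\<zero>\<^bsub>ring3 Quot I\<^esub> = I +>\<^bsub>ring3\<^esub> 0" by (simp add: FactRing_def coset3_zero)
  show "(I +>\<^bsub>ring3\<^esub> x) \<oplus>\<^bsub>ring3 Quot I\<^esub> (I +>\<^bsub>ring3\<^esub> y) = I +>\<^bsub>ring3\<^esub> (x + y)"
    using a_rcos_sum[of x y] by (simp add: FactRing_def)
  show "(I +>\<^bsub>ring3\<^esub> x) \<otimes>\<^bsub>ring3 Quot I\<^esub> (I +>\<^bsub>ring3\<^esub> y) = I +>\<^bsub>ring3\<^esub> (x * y)"
    using rcoset_mult_add[of x y] by (simp add: FactRing_def)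
qed

lemma quot_ideal_preimage:
  assumes "ideal J (ring3 Quot I)"
  shows "ideal {r. I +>\<^bsub>ring3\<^esub> r \<in> J} (ring3 :: 'k poly3 ring)"
    "J = (\<lambda>r. I +>\<^bsub>ring3\<^esub> r) ` {r. I +>\<^bsub>ring3\<^esub> r \<in> J}"
proof -
  interpret J: ideal J "ring3 Quot I" by (rule assms)
  have "I +>\<^bsub>ring3\<^esub> 0 \<in> J" using additive_subgroup.zero_closed[OF ideal.axioms(1)[OF assms]] by (simp add: quot_ring3)
  moreover have "I +>\<^bsub>ring3\<^esub> (x + y) \<in> J" if "I +>\<^bsub>ring3\<^esub> x \<in> J" "I +>\<^bsub>ring3\<^esub> y \<in> J" for x y
    using additive_subgroup.a_closed[OF ideal.axioms(1)[OF assms] that] by (simp add: quot_ring3)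
  moreover have "I +>\<^bsub>ring3\<^esub> (r * x) \<in> J" if "I +>\<^bsub>ring3\<^esub> x \<in> J" for r x
    using J.I_l_closed[OF that, of "I +>\<^bsub>ring3\<^esub> r"] by (simp add: quot_ring3)
  ultimately show "ideal {r. I +>\<^bsub>ring3\<^esub> r \<in> J} (ring3 :: 'k poly3 ring)" by (simp add: ideal_ring3_iff)
  have "J \<subseteq> range (\<lambda>r. I +>\<^bsub>ring3\<^esub> r)" using J.Icarr by (auto simp: quot_ring3)
  then show "J = (\<lambda>r. I +>\<^bsub>ring3\<^esub> r) ` {r. I +>\<^bsub>ring3\<^esub> r \<in> J}" by blast
qed

lemma socle_eq: "socle I = (\<lambda>r. I +>\<^bsub>ring3\<^esub> r) ` {r. \<forall>a. var3 a * r \<in> I}"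
proof -
  have gen: "(\<forall>D\<in>Idl\<^bsub>ring3\<^esub> (range var3). D * r \<in> I) \<longleftrightarrow> (\<forall>a. var3 a * r \<in> I)" for r
  proof
    assume "\<forall>D\<in>Idl\<^bsub>ring3\<^esub> (range var3). D * r \<in> I"
    then show "\<forall>a. var3 a * r \<in> I" using genideal_mono[of "range var3"] by blast
  next
    assume a: "\<forall>a. var3 a * r \<in> I"
    have "ideal {D. D * r \<in> I} (ring3 :: 'k poly3 ring)"
      by (simp add: ideal_ring3_iff ideal3_0[OF I] ideal3_add[OF I] ideal3_mult[OF I] distrib_right mult.assoc)
    from genideal_min[OF this, of "range var3"] a
    show "\<forall>D\<in>Idl\<^bsub>ring3\<^esub> (range var3). D * r \<in> I" by blast
  qed
  have ann: "(I +>\<^bsub>ring3\<^esub> D) \<otimes>\<^bsub>ring3 Quot I\<^esub> (I +>\<^bsub>ring3\<^esub> r) = \<zero>\<^bsub>ring3 Quot I\<^esub> \<longleftrightarrow> D * r \<in> I" for D r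
    by (simp only: quot_ring3 coset3_eq_iff diff_zero)
  have image: "{x \<in> range c. P x} = c ` {r. P (c r)}" for P and c :: "'k poly3 \<Rightarrow> 'k poly3 set" by blast
  show ?thesis unfolding socle_def quot_ring3(1) image ann gen by (rule refl)
qed

end

text \<open>The ideals \<open>J j\<close> of elements whose components of degree below
  \<open>j\<close> lie in \<open>I\<close> have a descending chain of images in the quotient. Once
  it is stationary, a form of degree \<open>j\<close> agrees modulo \<open>I\<close> with an element
  of \<open>J (Suc j)\<close>, whose component of degree \<open>j\<close> is in
  \<open>I\<close>.\<close>

lemma artinian_high_degree:
  fixes I :: "'k::field poly3 set"
  assumes I: "ideal I ring3" and hcI: "\<And>D d. D \<in> I \<Longrightarrow> hc d D \<in> I" and art: "artinian_ring (ring3 Quot I)"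
  shows "\<exists>m. \<forall>j\<ge>m. \<forall>p. homz (int j) p \<longrightarrow> p \<in> I"
proof -
  define J where "J j = {r. \<forall>d<int j. hc d r \<in> I}" for j
  have J: "ideal (J j) ring3" for j
    unfolding ideal_ring3_iff
  proof (intro conjI ballI allI)
    show "0 \<in> J j" using ideal3_0[OF I] by (simp add: J_def)
  next
    fix x y assume "x \<in> J j" "y \<in> J j"
    then show "x + y \<in> J j" by (simp add: J_def hc_add ideal3_add[OF I])
  next
    fix r x assume x: "x \<in> J j"
    have "hc d (r * x) \<in> I" if d: "d < int j" for d
    proof (induction r rule: poly3_induct)
      case zero
      then show ?case using ideal3_0[OF I] by simp
    next
      case (add \<alpha> c p)
      have "hc (d - int (mdeg \<alpha>)) x \<in> I" using x d by (simp add: J_def)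
      then have "hc d (Poly_Mapping.single \<alpha> c * x) \<in> I"
        by (simp add: hc_mult'[OF homz_single] ideal3_mult[OF I])
      then show ?case using add.IH by (simp add: distrib_right hc_add ideal3_add[OF I])
    qed
    then show "r * x \<in> J j" by (simp add: J_def)
  qed
  define Q where "Q j = (\<lambda>r. I +>\<^bsub>ring3\<^esub> r) ` J j" for j
  have Q: "ideal (Q j) (ring3 Quot I)" for j
    unfolding Q_def by (rule ring.ring_ideal_imp_quot_ideal[OF ring_ring3 I J])
  have wf: "wf {(J, K). ideal J (ring3 Quot I) \<and> ideal K (ring3 Quot I) \<and> J \<subset> K}"
    using art by (simp add: artinian_ring_def)
  obtain z where z: "z \<in> range Q" "\<And>y. (y, z) \<in> {(J, K). ideal J (ring3 Quot I) \<and> ideal K (ring3 Quot I) \<and> J \<subset> K} \<Longrightarrow> y \<notin> range Q"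
    using wfE_min[OF wf, of "Q 0" "range Q"] by blast
  then obtain m where m: "z = Q m" by blast
  have dec: "Q i \<subseteq> Q j" if "j \<le> i" for i j
    using that by (auto simp: Q_def J_def)
  have const: "Q j = Q m" if "m \<le> j" for j
    using z(2)[of "Q j"] dec[OF that] Q unfolding m by blast
  have "p \<in> I" if "m \<le> j" "homz (int j) p" for j p
  proof -
    have "p \<in> J j" using that(2) ideal3_0[OF I] by (simp add: J_def hc_homz)
    then have "I +>\<^bsub>ring3\<^esub> p \<in> Q (Suc j)" using const[of j] const[of "Suc j"] that(1) by (auto simp: Q_def)
    then obtain q where q: "q \<in> J (Suc j)" "I +>\<^bsub>ring3\<^esub> p = I +>\<^bsub>ring3\<^esub> q" by (auto simp: Q_def)
    have "p - q \<in> I" using q(2) unfolding coset3_eq_iff[OF I] .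
    from hcI[OF this, of "int j"] have "p - hc (int j) q \<in> I" by (simp add: hc_diff hc_self[OF that(2)])
    moreover have "hc (int j) q \<in> I" using q(1) by (simp add: J_def)
    ultimately show "p \<in> I" using ideal3_add[OF I] by fastforce
  qed
  then show ?thesis by blast
qed

text \<open>Vanishing above the socle degree comes by descent from the Artinian bound: if all forms
  of degree j + 1 > k + 1 lie in \<open>I\<close>, a form of degree \<open>j\<close> represents a
  socle element, hence a multiple of \<open>s\<close>, and comparing components in degree
  \<open>j\<close> leaves zero.\<close>

lemma gorenstein_ideal_of_agg:
  fixes I :: "'k::field_char_0 poly3 set"
  assumes "artinian_graded_gorenstein k I"
  shows "\<exists>s0. gorenstein_ideal I k s0"
proof -
  have I: "ideal I ring3" and hcI: "\<And>D d. D \<in> I \<Longrightarrow> hc d D \<in> I" and art: "artinian_ring (ring3 Quot I)"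
    using assms by (auto simp: artinian_graded_gorenstein_def homogeneous_ideal_iff)
  obtain s where s: "homz (int k) s" "s \<notin> I" "socle I = {I +>\<^bsub>ring3\<^esub> (const3 c * s) | c. True}"
    using assms by (auto simp: artinian_graded_gorenstein_def homogeneous_iff_homz)
  have "I +>\<^bsub>ring3\<^esub> (const3 1 * s) \<in> socle I" unfolding s(3) by blast
  then obtain r where r: "\<forall>a. var3 a * r \<in> I" "I +>\<^bsub>ring3\<^esub> s = I +>\<^bsub>ring3\<^esub> r"
    unfolding socle_eq[OF I] by auto
  have sr: "s - r \<in> I" using r(2) unfolding coset3_eq_iff[OF I] .
  have var_s: "var3 a * s \<in> I" for a
    using ideal3_add[OF I ideal3_mult[OF I sr, of "var3 a"], of "var3 a * r"] r(1) by (simp add: right_diff_distrib)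
  have socle_span: "\<exists>c. r - const3 c * s \<in> I" if v: "\<And>a. var3 a * r \<in> I" for r
  proof -
    have "I +>\<^bsub>ring3\<^esub> r \<in> socle I" unfolding socle_eq[OF I] using v by blast
    then obtain c where "I +>\<^bsub>ring3\<^esub> r = I +>\<^bsub>ring3\<^esub> (const3 c * s)" unfolding s(3) by blast
    then show ?thesis unfolding coset3_eq_iff[OF I] by blast
  qed
  obtain m where m: "\<And>j p. j \<ge> m \<Longrightarrow> homz (int j) p \<Longrightarrow> p \<in> I" using artinian_high_degree[OF I hcI art] by blast
  have down: "p \<in> I" if "homz (int j) p" "j > k" "j + t \<ge> m" for t j p
    using that
  proof (induction t arbitrary: j p)
    case 0
    then show ?case using m by simp
  next
    case (Suc t)
    have "var3 a * p \<in> I" for a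
    proof (rule Suc.IH)
      show "homz (int (Suc j)) (var3 a * p)" using homz_mult[OF homz_var3 Suc.prems(1), of a] by simp
    qed (use Suc.prems in auto)
    then obtain c where c: "p - const3 c * s \<in> I" using socle_span by blast
    have "hc (int j) (p - const3 c * s) = p"
      using Suc.prems(1,2) s(1) by (simp add: hc_diff hc_self hc_const3_mult hc_homz[OF s(1)])
    then show ?case using hcI[OF c, of "int j"] by simp
  qed
  have "gorenstein_ideal I k s"
  proof (rule gorenstein_ideal.intro)
    show "p \<in> I" if "homz d p" "int k < d" for d p
      using down[of "nat d" p m] that by simp
  qed (use I hcI s var_s socle_span in auto)
  then show ?thesis by blast
qed

lemma (in vector_space) dim_less_of_subspace:
  assumes "subspace U" "U \<subset> W" "W \<subseteq> span T" "finite T"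
  shows "dim U < dim W"
proof -
  obtain B where B: "B \<subseteq> U" "independent B" "U \<subseteq> span B" "card B = dim U" by (rule basis_exists)
  obtain C where C: "C \<subseteq> W" "independent C" "W \<subseteq> span C" "card C = dim W" by (rule basis_exists)
  have finC: "finite C" using independent_span_bound[OF assms(4) C(2)] C(1) assms(3) by blast
  have finB: "finite B" using independent_span_bound[OF assms(4) B(2)] B(1) assms(2,3) by blast
  obtain w where w: "w \<in> W" "w \<notin> U" using assms(2) by blast
  have "span B \<subseteq> U" by (rule span_minimal[OF B(1) assms(1)])
  then have "w \<notin> span B" using w by blast
  then have ind: "independent (insert w B)" using B(2) by (rule independent_insertI)
  have "insert w B \<subseteq> span C" using w(1) B(1) assms(2) C(3) by blast
  from independent_span_bound[OF finC ind this] have "card (insert w B) \<le> card C" by blast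
  moreover have "w \<notin> B" using w B(1) by blast
  ultimately show ?thesis using finB B(4) C(4) by simp
qed

context gorenstein_ideal
begin

lemma truncate_degree: "\<exists>q. degree_le k q \<and> r - q \<in> I"
proof (induction r rule: poly3_induct)
  case zero
  show ?case by (rule exI[of _ 0]) (simp add: degree_le_def I_0)
next
  case (add \<alpha> c p)
  then obtain q where q: "degree_le k q" "p - q \<in> I" by blast
  show ?case
  proof (cases "mdeg \<alpha> \<le> k")
    case True
    have "degree_le k (Poly_Mapping.single \<alpha> c + q)"
      using q(1) True keys_add[of "Poly_Mapping.single \<alpha> c" q] by (auto simp: degree_le_def split: if_splits)
    then show ?thesis using q(2) by (intro exI[of _ "Poly_Mapping.single \<alpha> c + q"]) simp
  next
    case False
    then have "Poly_Mapping.single \<alpha> c \<in> I" by (intro high_degree[OF homz_single]) simp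
    from I_add[OF this q(2)] show ?thesis using q(1) by (intro exI[of _ q]) (simp add: add_diff_eq)
  qed
qed

text \<open>Ideals of the quotient are measured by the dimension of the space of polynomials of
  degree at most \<open>k\<close> lying over them. Every class has such a representative, so a
  strict inclusion raises the dimension.\<close>

lemma artinian_quotient: "artinian_ring (ring3 Quot I)"
proof -
  interpret vs: vector_space "\<lambda>(c :: 'k) (p :: 'k poly3). const3 c * p" by (rule vector_space_poly3)
  define W where "W J = {r. degree_le k r \<and> I +>\<^bsub>ring3\<^esub> r \<in> J}" for J
  let ?T = "(\<lambda>\<alpha>. Poly_Mapping.single \<alpha> (1 :: 'k)) ` {\<alpha>. mdeg \<alpha> \<le> k}"
  have sub: "vs.subspace (W J)" if "ideal J (ring3 Quot I)" for J
  proof -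
    note J = quot_ideal_preimage(1)[OF I that]
    have "degree_le k (p + q)" if "degree_le k p" "degree_le k q" for p q :: "'k poly3"
      using that keys_add[of p q] by (auto simp: degree_le_def)
    moreover have "degree_le k (const3 c * p)" if "degree_le k p" for c and p :: "'k poly3"
      using that by (auto simp: degree_le_def in_keys_iff)
    moreover have "degree_le k (0 :: 'k poly3)" by (simp add: degree_le_def)
    ultimately show ?thesis
      using ideal3_0[OF J] ideal3_add[OF J] ideal3_mult[OF J] by (simp add: vs.subspace_def W_def)
  qed
  have strict: "W J \<subset> W K" if JK: "ideal J (ring3 Quot I)" "ideal K (ring3 Quot I)" "J \<subset> K" for J K
  proof -
    obtain x where x: "x \<in> K" "x \<notin> J" using JK(3) by blast
    obtain r where r: "x = I +>\<^bsub>ring3\<^esub> r" using x(1) quot_ideal_preimage(2)[OF I JK(2)] by blast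
    obtain q where q: "degree_le k q" "r - q \<in> I" using truncate_degree by blast
    have "x = I +>\<^bsub>ring3\<^esub> q" using q(2) unfolding r coset3_eq_iff[OF I] .
    then have "q \<in> W K" "q \<notin> W J" using x q(1) by (simp_all add: W_def)
    moreover have "W J \<subseteq> W K" using JK(3) by (auto simp: W_def)
    ultimately show ?thesis by blast
  qed
  have "W K \<subseteq> vs.span ?T" for K using degree_le_in_span by (auto simp: W_def)
  then have less: "vs.dim (W J) < vs.dim (W K)"
    if "ideal J (ring3 Quot I)" "ideal K (ring3 Quot I)" "J \<subset> K" for J K
    by (intro vs.dim_less_of_subspace[of _ _ ?T] sub strict that finite_imageI card_mdeg_le)
  have "wf {(J, K). ideal J (ring3 Quot I) \<and> ideal K (ring3 Quot I) \<and> J \<subset> K}"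
  proof (intro wf_subset[OF wf_measure[of "\<lambda>J. vs.dim (W J)"]] subsetI)
    fix p assume "p \<in> {(J, K). ideal J (ring3 Quot I) \<and> ideal K (ring3 Quot I) \<and> J \<subset> K}"
    then obtain J K where "p = (J, K)" "ideal J (ring3 Quot I)" "ideal K (ring3 Quot I)" "J \<subset> K" by blast
    then show "p \<in> measure (\<lambda>J. vs.dim (W J))" using less by simp
  qed
  then show ?thesis unfolding artinian_ring_def using ideal.quotient_is_ring[OF I] by blast
qed

lemma agg: "artinian_graded_gorenstein k I"
  unfolding artinian_graded_gorenstein_def
proof (intro conjI exI[of _ s0])
  show "homogeneous_ideal I" using I hcI by (simp add: homogeneous_ideal_iff)
  show "artinian_ring (ring3 Quot I)" by (rule artinian_quotient)
  show "homogeneous k s0" using s0_hom by (simp add: homogeneous_iff_homz)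
  show "s0 \<notin> I" by (rule s0_notin)
  show "socle I = {I +>\<^bsub>ring3\<^esub> (const3 c * s0) | c. True}" unfolding socle_eq[OF I]
  proof (intro equalityI subsetI)
    fix x assume "x \<in> (\<lambda>r. I +>\<^bsub>ring3\<^esub> r) ` {r. \<forall>a. var3 a * r \<in> I}"
    then obtain r where r: "x = I +>\<^bsub>ring3\<^esub> r" "\<And>a. var3 a * r \<in> I" by blast
    obtain c where "r - const3 c * s0 \<in> I" using socle_span[OF r(2)] by blast
    then have "x = I +>\<^bsub>ring3\<^esub> (const3 c * s0)" unfolding r(1) coset3_eq_iff[OF I] .
    then show "x \<in> {I +>\<^bsub>ring3\<^esub> (const3 c * s0) | c. True}" by blast
  next
    fix x assume "x \<in> {I +>\<^bsub>ring3\<^esub> (const3 c * s0) | c. True}"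
    then obtain c where c: "x = I +>\<^bsub>ring3\<^esub> (const3 c * s0)" by blast
    have "var3 a * (const3 c * s0) \<in> I" for a
      using I_mult[OF var_s0[of a], of "const3 c"] by (simp add: mult.left_commute)
    then show "x \<in> (\<lambda>r. I +>\<^bsub>ring3\<^esub> r) ` {r. \<forall>a. var3 a * r \<in> I}" unfolding c by blast
  qed
qed

lemma const3_s0_in_iff: "const3 c * s0 \<in> I \<longleftrightarrow> c = 0"
proof
  assume c: "const3 c * s0 \<in> I"
  show "c = 0"
  proof (rule ccontr)
    assume "c \<noteq> 0"
    then have eq: "const3 (1 / c) * (const3 c * s0) = s0" by (simp add: mult.assoc[symmetric] const3_mult[symmetric])
    show False using I_mult[OF c, of "const3 (1 / c)"] s0_notin unfolding eq by blast
  qed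
qed (simp add: I_0)

text \<open>Macaulay: \<open>I\<close> is recovered from the functional that sends a polynomial to the coefficient of its
  degree \<open>k\<close> part along the socle.\<close>

lemma exists_dual_form: "\<exists>F. F \<in> forms k \<and> perp F = I"
proof -
  \<comment> \<open>Multiplication by a variable pushes the degree \<open>k\<close> component above
    the socle degree, so this component represents a socle element.\<close>
  have "\<exists>c. hc (int k) D - const3 c * s0 \<in> I" for D
  proof (rule socle_span)
    show "var3 a * hc (int k) D \<in> I" for a
      by (rule high_degree[OF homz_mult[OF homz_var3 homz_hc]]) simp
  qed
  then have "\<forall>D. \<exists>c. hc (int k) D - const3 c * s0 \<in> I" by blast
  from choice[OF this] obtain f where f: "\<And>D. hc (int k) D - const3 (f D) * s0 \<in> I" by blast
  have uniq: "f D = c" if c: "hc (int k) D - const3 c * s0 \<in> I" for D c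
  proof -
    have "const3 (f D - c) * s0 = (hc (int k) D - const3 c * s0) - (hc (int k) D - const3 (f D) * s0)"
      by (simp add: const3_diff left_diff_distrib)
    then have "const3 (f D - c) * s0 \<in> I" using I_diff[OF c f[of D]] by simp
    then show ?thesis by (simp add: const3_s0_in_iff)
  qed
  have add: "f (p + q) = f p + f q" for p q
  proof (rule uniq)
    show "hc (int k) (p + q) - const3 (f p + f q) * s0 \<in> I"
      using I_add[OF f[of p] f[of q]] by (simp add: hc_add const3_add algebra_simps)
  qed
  have scale: "f (const3 c * p) = c * f p" for c p
  proof (rule uniq)
    show "hc (int k) (const3 c * p) - const3 (c * f p) * s0 \<in> I"
      using I_mult[OF f[of p], of "const3 c"] by (simp add: hc_const3_mult const3_mult right_diff_distrib mult.assoc)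
  qed
  have deg: "f (hc (int k) p) = f p" for p
    by (rule uniq) (use f[of p] in \<open>simp add: hc_self\<close>)
  have zero: "f D = 0 \<longleftrightarrow> hc (int k) D \<in> I" for D
    using f[of D] uniq[of D 0] by auto
  obtain F where F: "homz (int k) F" "\<And>D. phi F D = f D"
    by (rule phi_represent[of f k, OF add scale deg], rule that)
  have "F \<noteq> 0"
  proof
    assume "F = 0"
    then have "f s0 = 0" using F(2)[of s0] by (simp add: phi_def)
    then show False using s0_notin by (simp add: zero hc_self[OF s0_hom])
  qed
  moreover have "D \<in> perp F \<longleftrightarrow> D \<in> I" for D
  proof
    assume D: "D \<in> perp F"
    show "D \<in> I"
    proof (rule ccontr)
      assume "D \<notin> I"
      then obtain E where "E * D - s0 \<in> I" using socle_essential by blast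
      from hcI[OF this, of "int k"] have "hc (int k) (E * D) - s0 \<in> I" by (simp add: hc_diff hc_self[OF s0_hom])
      moreover have "hc (int k) (E * D) \<in> I" using D by (simp add: perp_eq F(2) zero)
      ultimately show False using I_diff[of "hc (int k) (E * D)" "hc (int k) (E * D) - s0"] s0_notin by simp
    qed
  next
    assume "D \<in> I"
    then have "hc (int k) (E * D) \<in> I" for E by (intro hcI I_mult)
    then show "D \<in> perp F" by (simp add: perp_eq F(2) zero)
  qed
  ultimately show ?thesis using F(1) by (auto simp: forms_def homogeneous_iff_homz intro!: exI[of _ F])
qed

end

section \<open>Annihilators of forms\<close>

lemma phi_mult_homz: "homz k F \<Longrightarrow> homz d p \<Longrightarrow> phi F (E * p) = phi F (hc (k - d) E * p)"
  using phi_hc[of k F "E * p"] by (simp add: hc_mult)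

text \<open>In the top degree only constant multiples can pair nontrivially with F.\<close>

lemma form_in_perp_iff:
  fixes F :: "'k::field_char_0 poly3"
  assumes "homz k F" "homz k D"
  shows "D \<in> perp F \<longleftrightarrow> phi F D = 0"
proof -
  have "phi F (E * D) = c0 E * phi F D" for E
    using phi_mult_homz[OF assms, of E] homz_0_const3[OF homz_hc[of 0 E]]
    by (simp add: phi_const3_mult c0_hc)
  then show ?thesis by (auto simp: perp_eq intro: exI[of _ 1] dest: spec[of _ 1])
qed

lemma ideal_perp: "ideal (perp F) (ring3 :: 'k::field_char_0 poly3 ring)"
  by (simp add: ideal_ring3_iff perp_eq distrib_left phi_add mult.assoc[symmetric])

lemma gorenstein_ideal_perp:
  fixes F :: "'k::field_char_0 poly3"
  assumes F: "homz (int k) F" and s: "homz (int k) s" "phi F s = 1"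
  shows "gorenstein_ideal (perp F) k s"
proof (rule gorenstein_ideal.intro)
  show "ideal (perp F) ring3" by (rule ideal_perp)
  show "hc d D \<in> perp F" if D: "D \<in> perp F" for D d
  proof -
    have "phi F (E * hc d D) = phi F (hc (int k - d) E * D)" for E
    proof -
      have "phi F (hc (int k - d) E * D) = phi F (hc (int k) (hc (int k - d) E * D))" by (rule phi_hc[OF F, symmetric])
      also have "hc (int k) (hc (int k - d) E * D) = hc (int k - d) E * hc d D"
        by (simp add: hc_mult'[OF homz_hc])
      finally show ?thesis using phi_mult_homz[OF F homz_hc, of E d D] by simp
    qed
    then show ?thesis using D by (simp add: perp_eq)
  qed
  show "homz (int k) s" by (rule s)
  show "s \<notin> perp F" using s by (simp add: form_in_perp_iff[OF F])
  show high: "p \<in> perp F" if "homz d p" "int k < d" for d p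
  proof -
    have "phi F (E * p) = 0" for E
      using phi_mult_homz[OF F that(1), of E] homz_neg[OF homz_hc, of "int k - d" E] that(2) by simp
    then show ?thesis by (simp add: perp_eq)
  qed
  show "var3 a * s \<in> perp F" for a
    by (rule high[OF homz_mult[OF homz_var3 s(1)]]) simp
  show "\<exists>c. r - const3 c * s \<in> perp F" if r: "\<And>a. var3 a * r \<in> perp F" for r
  proof (rule exI)
    \<comment> \<open>The coefficient is chosen so that \<open>?w\<close> pairs to zero with F. A
      multiplier E splits into its constant term, which gives zero by this choice, and a combination
      of the variables, which send \<open>?w\<close> into the annihilator.\<close>
    let ?w = "r - const3 (phi F r) * s"
    have vw: "var3 a * ?w \<in> perp F" for a
      using ideal3_diff[OF ideal_perp r[of a] ideal3_mult[OF ideal_perp \<open>\<And>a. var3 a * s \<in> perp F\<close>[of a], of "const3 (phi F r)"]]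
      by (simp add: right_diff_distrib mult.left_commute)
    have "phi F (E * ?w) = 0" for E
    proof -
      have "c0 (E - const3 (c0 E)) = 0" by (simp add: lookup_minus)
      then obtain q where q: "E - const3 (c0 E) = (\<Sum>a\<in>UNIV. var3 a * q a)" unfolding c0_eq_0_iff by (rule exE)
      have "E * ?w = const3 (c0 E) * ?w + (E - const3 (c0 E)) * ?w" by (simp add: left_diff_distrib)
      also have "(E - const3 (c0 E)) * ?w = (\<Sum>a\<in>UNIV. q a * (var3 a * ?w))"
        unfolding q sum_distrib_right by (intro sum.cong refl) (simp add: mult_ac)
      finally have "phi F (E * ?w) = c0 E * phi F ?w + (\<Sum>a\<in>UNIV. phi F (q a * (var3 a * ?w)))"
        by (simp only: phi_add phi_const3_mult phi_sum)
      moreover have "phi F ?w = 0" by (simp add: phi_diff phi_const3_mult s(2))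
      moreover have "phi F (q a * (var3 a * ?w)) = 0" for a using vw[of a] by (simp add: perp_eq)
      ultimately show ?thesis by simp
    qed
    then show "?w \<in> perp F" by (simp add: perp_eq)
  qed
qed

lemma phi_single: "phi F (Poly_Mapping.single \<alpha> 1) = Poly_Mapping.lookup F \<alpha> * of_nat (mfact \<alpha>)"
  by (simp add: phi_def lookup_single when_def in_keys_iff if_distrib[of "\<lambda>x. x * _"] cong: if_cong)

lemma perp_proportional:
  fixes F :: "'k::field_char_0 poly3"
  assumes "c \<noteq> 0"
  shows "perp (const3 c * F) = perp F"
proof -
  have "phi (const3 c * F) D = c * phi F D" for D
  proof -
    have "Poly_Mapping.keys (const3 c * F) = Poly_Mapping.keys F" using assms by (auto simp: in_keys_iff)
    then show ?thesis by (simp add: phi_def sum_distrib_left mult.assoc mult.left_commute)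
  qed
  then show ?thesis using assms by (simp add: perp_eq)
qed

text \<open>In degree \<open>k\<close> the annihilator is the kernel of the functional, and two
  functionals on that space with the same kernel are proportional; the factor is the value on a form
  normalised for F.\<close>

lemma perp_eq_imp_proportional:
  fixes F G :: "'k::field_char_0 poly3"
  assumes F: "F \<in> forms k" and G: "G \<in> forms k" and eq: "perp F = perp G"
  shows "(F, G) \<in> proportional"
proof -
  have hF: "homz (int k) F" and hG: "homz (int k) G" and "F \<noteq> 0" "G \<noteq> 0"
    using F G by (simp_all add: forms_def homogeneous_iff_homz)
  obtain s where s: "homz (int k) s" "phi F s = 1" by (rule phi_nonzero[OF hF \<open>F \<noteq> 0\<close>])
  have "phi G D = phi G s * phi F D" if D: "homz (int k) D" for D
  proof -
    let ?D = "D - const3 (phi F D) * s"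
    have h: "homz (int k) ?D" by (intro homz_diff D homz_const3_mult s)
    have "phi F ?D = 0" by (simp add: phi_diff phi_const3_mult s)
    then have "phi G ?D = 0" using form_in_perp_iff[OF hF h] form_in_perp_iff[OF hG h] eq by simp
    then have "phi G D = phi F D * phi G s" by (simp add: phi_diff phi_const3_mult)
    then show ?thesis by (simp only: mult.commute)
  qed
  then have "phi G D = phi G s * phi F D" for D
    using phi_hc[OF hG, of D] phi_hc[OF hF, of D] homz_hc[of "int k" D] by metis
  from this[of "Poly_Mapping.single _ 1"] have "G = const3 (phi G s) * F"
    by (intro poly_mapping_eqI) (simp add: phi_single mult.assoc[symmetric])
  moreover from this have "phi G s \<noteq> 0" using \<open>G \<noteq> 0\<close> by auto
  ultimately show ?thesis unfolding proportional_def by blast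
qed

text \<open>A linear combination of the derivatives of F is the action of the form with the same
  coefficients, so independence means that no nonzero form of half the degree annihilates F.\<close>

lemma nondegenerate_iff:
  fixes F :: "'k::field_char_0 poly3"
  assumes "even k" and F: "homz (int k) F"
  shows "nondegenerate k F \<longleftrightarrow> (\<forall>D. homz (int (k div 2)) D \<longrightarrow> D \<in> perp F \<longrightarrow> D = 0)"
proof -
  let ?r = "k div 2"
  let ?D = "\<lambda>c. \<Sum>\<alpha> | mdeg \<alpha> = ?r. Poly_Mapping.single \<alpha> (c \<alpha> :: 'k)"
  have sum: "(\<Sum>\<alpha> | mdeg \<alpha> = ?r. const3 (c \<alpha>) * act (Poly_Mapping.single \<alpha> 1) F) = act (?D c) F" for c
  proof (rule poly_mapping_eqI)
    fix \<gamma>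
    have "Poly_Mapping.lookup (\<Sum>\<alpha> | mdeg \<alpha> = ?r. const3 (c \<alpha>) * act (Poly_Mapping.single \<alpha> 1) F) \<gamma> * of_nat (mfact \<gamma>)
        = (\<Sum>\<alpha> | mdeg \<alpha> = ?r. c \<alpha> * phi F (Poly_Mapping.single \<gamma> 1 * Poly_Mapping.single \<alpha> 1))"
      by (simp add: lookup_sum sum_distrib_right mult.assoc lookup_act)
    also have "\<dots> = (\<Sum>\<alpha> | mdeg \<alpha> = ?r. phi F (Poly_Mapping.single \<gamma> 1 * Poly_Mapping.single \<alpha> (c \<alpha>)))"
      by (intro sum.cong refl, subst (3) single_eq_const3_mult) (simp add: mult.left_commute phi_const3_mult)
    also have "\<dots> = phi F (Poly_Mapping.single \<gamma> 1 * ?D c)" by (simp only: sum_distrib_left phi_sum)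
    finally show "Poly_Mapping.lookup (\<Sum>\<alpha> | mdeg \<alpha> = ?r. const3 (c \<alpha>) * act (Poly_Mapping.single \<alpha> 1) F) \<gamma> =
        Poly_Mapping.lookup (act (?D c) F) \<gamma>" by (simp add: lookup_act[symmetric])
  qed
  have lookup_D: "Poly_Mapping.lookup (?D c) \<alpha> = (if mdeg \<alpha> = ?r then c \<alpha> else 0)" for c \<alpha>
    by (simp add: lookup_sum lookup_single when_def finite_mdeg)
  have hD: "homz (int ?r) (?D c)" for c by (auto simp: homz_iff_lookup lookup_D split: if_splits)
  have *: "nondegenerate k F \<longleftrightarrow> (\<forall>c. ?D c \<in> perp F \<longrightarrow> (\<forall>\<alpha>. mdeg \<alpha> = ?r \<longrightarrow> c \<alpha> = 0))"
    unfolding nondegenerate_def sum using assms by (simp add: homogeneous_iff_homz perp_def)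
  show ?thesis unfolding *
  proof (intro iffI allI impI)
    fix D assume A: "\<forall>c. ?D c \<in> perp F \<longrightarrow> (\<forall>\<alpha>. mdeg \<alpha> = ?r \<longrightarrow> c \<alpha> = 0)" and D: "homz (int ?r) D" "D \<in> perp F"
    have eq: "D = ?D (Poly_Mapping.lookup D)"
      by (rule poly_mapping_eqI) (use D(1) in \<open>auto simp: lookup_D homz_iff_lookup\<close>)
    have "\<forall>\<alpha>. mdeg \<alpha> = ?r \<longrightarrow> Poly_Mapping.lookup D \<alpha> = 0" using A[rule_format, of "Poly_Mapping.lookup D"] D(2) eq by simp
    then show "D = 0" by (intro poly_mapping_eqI) (use D(1) in \<open>auto simp: homz_iff_lookup\<close>)
  next
    fix c \<alpha> assume A: "\<forall>D. homz (int ?r) D \<longrightarrow> D \<in> perp F \<longrightarrow> D = 0" and c: "?D c \<in> perp F" and \<alpha>: "mdeg \<alpha> = ?r"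
    have "?D c = 0" using A hD c by blast
    then show "c \<alpha> = 0" using lookup_D[of c \<alpha>] \<alpha> by simp
  qed
qed

section \<open>Adjugates of skew-symmetric matrices\<close>

text \<open>The rank-one change A + e_i e_i^T. For singular \<open>A\<close> its determinant is the
  i-th diagonal entry of the adjugate, so a singular system becomes one to which Cramer's rule
  applies.\<close>

definition bump :: "'a::comm_ring_1 mat \<Rightarrow> nat \<Rightarrow> 'a mat" where
  "bump A i = mat (dim_row A) (dim_col A) (\<lambda>(a, b). A $$ (a, b) + (if a = i \<and> b = i then 1 else 0))"

context
  fixes A :: "'a::comm_ring_1 mat" and n :: nat
  assumes A: "A \<in> carrier_mat n n"
begin

lemma adj_mat_mult:
  assumes "i < n" "j < n"
  shows "(\<Sum>l<n. A $$ (i, l) * adj_mat A $$ (l, j)) = (if i = j then det A else 0)"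
    "(\<Sum>l<n. adj_mat A $$ (i, l) * A $$ (l, j)) = (if i = j then det A else 0)"
proof -
  note adj = adj_mat[OF A]
  have "(\<Sum>l<n. A $$ (i, l) * adj_mat A $$ (l, j)) = (A * adj_mat A) $$ (i, j)"
    using A adj(1) assms by (simp add: scalar_prod_def atLeast0LessThan)
  also have "\<dots> = (if i = j then det A else 0)" unfolding adj(2) using assms by simp
  finally show "(\<Sum>l<n. A $$ (i, l) * adj_mat A $$ (l, j)) = (if i = j then det A else 0)" .
  have "(\<Sum>l<n. adj_mat A $$ (i, l) * A $$ (l, j)) = (adj_mat A * A) $$ (i, j)"
    using A adj(1) assms by (simp add: scalar_prod_def atLeast0LessThan)
  also have "\<dots> = (if i = j then det A else 0)" unfolding adj(3) using assms by simp
  finally show "(\<Sum>l<n. adj_mat A $$ (i, l) * A $$ (l, j)) = (if i = j then det A else 0)" .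
qed

lemma bump_carrier: "bump A i \<in> carrier_mat n n"
  using A by (simp add: bump_def)

lemma adj_mat_diagonal: "i < n \<Longrightarrow> adj_mat A $$ (i, i) = det (mat_delete A i i)"
  using A by (simp add: adj_mat_def cofactor_def)

lemma det_bump:
  assumes i: "i < n"
  shows "det (bump A i) = det A + adj_mat A $$ (i, i)"
proof -
  have cof: "cofactor (bump A i) i j = cofactor A i j" if "j < n" for j
  proof -
    have "mat_delete (bump A i) i j = mat_delete A i j"
      by (rule eq_matI) (use A i that in \<open>auto simp: mat_delete_def bump_def\<close>)
    then show ?thesis by (simp add: cofactor_def)
  qed
  have idx: "bump A i $$ (i, j) = A $$ (i, j) + (if j = i then 1 else 0)" if "j < n" for j
    using A i that by (simp add: bump_def)
  have "det (bump A i) = (\<Sum>j<n. bump A i $$ (i, j) * cofactor (bump A i) i j)"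
    by (rule laplace_expansion_row[OF bump_carrier i])
  also have "\<dots> = (\<Sum>j<n. A $$ (i, j) * cofactor A i j + (if j = i then cofactor A i i else 0))"
    by (intro sum.cong refl) (auto simp: cof idx distrib_right)
  also have "\<dots> = det A + cofactor A i i"
    using i by (simp add: sum.distrib laplace_expansion_row[OF A i])
  finally show ?thesis using A i by (simp add: adj_mat_def)
qed

lemma bump_mult:
  assumes "a < n" "i < n"
  shows "(\<Sum>b<n. bump A i $$ (a, b) * x b) = (\<Sum>b<n. A $$ (a, b) * x b) + (if a = i then x i else 0)"
proof -
  have "(\<Sum>b<n. bump A i $$ (a, b) * x b) = (\<Sum>b<n. A $$ (a, b) * x b + (if b = i then (if a = i then x i else 0) else 0))"
    by (intro sum.cong refl) (use A assms in \<open>auto simp: bump_def distrib_right\<close>)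
  then show ?thesis using assms by (simp add: sum.distrib)
qed

end

lemma skew_symmetric_iff:
  "skew_symmetric n A \<longleftrightarrow> A \<in> carrier_mat n n \<and> (\<forall>i<n. \<forall>j<n. A $$ (i, j) = - A $$ (j, i))"
proof
  assume *: "skew_symmetric n A"
  then have A: "A \<in> carrier_mat n n" by (simp add: skew_symmetric_def)
  have "A $$ (i, j) = - A $$ (j, i)" if "i < n" "j < n" for i j
  proof -
    have "transpose_mat A $$ (j, i) = (- A) $$ (j, i)" using * by (simp add: skew_symmetric_def)
    then show ?thesis using A that by simp
  qed
  with A show "A \<in> carrier_mat n n \<and> (\<forall>i<n. \<forall>j<n. A $$ (i, j) = - A $$ (j, i))" by blast
next
  assume *: "A \<in> carrier_mat n n \<and> (\<forall>i<n. \<forall>j<n. A $$ (i, j) = - A $$ (j, i))"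
  then have C: "A \<in> carrier_mat n n" by blast
  have "transpose_mat A = - A"
  proof (rule eq_matI)
    fix i j assume "i < dim_row (- A)" "j < dim_col (- A)"
    then have ij: "i < n" "j < n" using C by auto
    have "A $$ (j, i) = - A $$ (i, j)" using * ij by blast
    then show "transpose_mat A $$ (i, j) = (- A) $$ (i, j)" using C ij by simp
  qed (use C in auto)
  then show "skew_symmetric n A" using C by (simp add: skew_symmetric_def)
qed

lemma skew_symmetricD: "skew_symmetric n A \<Longrightarrow> i < n \<Longrightarrow> j < n \<Longrightarrow> A $$ (i, j) = - A $$ (j, i)"
  unfolding skew_symmetric_iff by blast

lemma det_skew_odd:
  fixes A :: "'a::{idom, ring_char_0} mat"
  assumes A: "skew_symmetric n A" and "odd n"
  shows "det A = 0"
proof -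
  have C: "A \<in> carrier_mat n n" and T: "transpose_mat A = - A" using A by (simp_all add: skew_symmetric_def)
  have neg: "- A = (- 1) \<cdot>\<^sub>m A" by (rule eq_matI) auto
  have "det A = det (- A)" using det_transpose[OF C] unfolding T by (rule sym)
  also have "\<dots> = (- 1) ^ n * det A" unfolding neg using C by simp
  also have "\<dots> = - det A" using \<open>odd n\<close> by simp
  finally have "2 * det A = 0" unfolding eq_neg_iff_add_eq_0 by (simp only: mult_2)
  then show ?thesis by simp
qed

lemma skew_symmetric_mat_delete:
  assumes A: "skew_symmetric n A"
  shows "skew_symmetric (n - 1) (mat_delete A i i)"
proof -
  have C: "A \<in> carrier_mat n n" using A by (simp add: skew_symmetric_def)
  have "mat_delete A i i $$ (a, b) = - mat_delete A i i $$ (b, a)" if "a < n - 1" "b < n - 1" for a b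
    using that C unfolding mat_delete_def by (simp, intro conjI impI; intro skew_symmetricD[OF A]; simp)
  then show ?thesis using mat_delete_carrier[OF C] unfolding skew_symmetric_iff by blast
qed

lemma adj_mat_diagonal_pfaffian:
  fixes A :: "'a::{idom, ring_char_0} mat"
  assumes A: "skew_symmetric n A" and "odd n" "i < n"
  shows "\<exists>s\<in>{1, -1}. adj_mat A $$ (i, i) = s * sub_pfaffian A i ^ 2"
proof -
  let ?D = "mat_delete A i i"
  have C: "A \<in> carrier_mat n n" using A by (simp add: skew_symmetric_def)
  obtain m where m: "n = Suc (2 * m)" using \<open>odd n\<close> by (auto elim: oddE)
  have D: "?D \<in> carrier_mat (2 * m) (2 * m)" using mat_delete_carrier[OF C, of i i] by (simp add: m)
  have skD: "?D $$ (x, y) = - ?D $$ (y, x)" if "x < 2 * m" "y < 2 * m" for x y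
    using skew_symmetricD[OF skew_symmetric_mat_delete[OF A], of x y i] that by (simp add: m)
  have "mat (2 * m) (2 * m) (\<lambda>(i', j'). ?D $$ (i', j')) = ?D" by (rule eq_matI) (use C m in auto)
  moreover have "sub_pfaffian A i = pf m (\<lambda>a b. ?D $$ (a, b))"
    using C m unfolding sub_pfaffian_def pfaffian_eq_pf by simp
  moreover have "\<exists>s\<in>{1, -1}. det (mat (2 * m) (2 * m) (\<lambda>(i', j'). ?D $$ (i', j'))) = s * pf m (\<lambda>a b. ?D $$ (a, b)) ^ 2"
    by (rule det_eq_pf_square) (rule skD)
  ultimately show ?thesis by (simp only: adj_mat_diagonal[OF C \<open>i < n\<close>])
qed

lemma sum_skip_index:
  fixes g :: "nat \<Rightarrow> int"
  assumes "i < n"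
  shows "(\<Sum>a<n - 1. g (if a < i then a else Suc a)) = (\<Sum>l<n. g l) - g i"
proof -
  let ?h = "\<lambda>a. if a < i then a else Suc a"
  have "inj_on ?h {..<n - 1}" by (auto simp: inj_on_def split: if_splits)
  moreover have "?h ` {..<n - 1} = {..<n} - {i}"
  proof (intro equalityI subsetI)
    fix x assume x: "x \<in> {..<n} - {i}"
    show "x \<in> ?h ` {..<n - 1}"
      by (rule image_eqI[of _ _ "if x < i then x else x - 1"]) (use x assms in auto)
  qed (use assms in auto)
  ultimately have "(\<Sum>a<n - 1. g (?h a)) = (\<Sum>l\<in>{..<n} - {i}. g l)"
    using sum.reindex[of ?h "{..<n - 1}" g] by simp
  then show ?thesis using assms by (simp add: sum_diff1)
qed

text \<open>Lets powers of the generators of an ideal be traded for powers of the variables.\<close>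

lemma ideal_radical:
  assumes I: "ideal I (ring3 :: 'k::field poly3 ring)"
  shows "ideal {q. \<exists>N. q ^ N \<in> I} (ring3 :: 'k poly3 ring)"
  unfolding ideal_ring3_iff
proof (intro conjI ballI allI)
  show "0 \<in> {q. \<exists>N. q ^ N \<in> I}" using ideal3_0[OF I] by (auto intro: exI[of _ 1])
next
  fix x y assume "x \<in> {q. \<exists>N. q ^ N \<in> I}" "y \<in> {q. \<exists>N. q ^ N \<in> I}"
  then obtain N M where N: "x ^ N \<in> I" and M: "y ^ M \<in> I" by blast
  have "of_nat (N + M choose j) * x ^ j * y ^ (N + M - j) \<in> I" for j
  proof (cases "N \<le> j")
    case True
    then have "x ^ j = x ^ N * x ^ (j - N)" by (simp add: power_add[symmetric])
    then have "x ^ j \<in> I" using ideal3_mult'[OF I N] by simp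
    then show ?thesis by (intro ideal3_mult'[OF I] ideal3_mult[OF I])
  next
    case False
    then have "N + M - j = M + (N - j)" by simp
    then have "y ^ (N + M - j) = y ^ M * y ^ (N - j)" by (simp only: power_add)
    then have "y ^ (N + M - j) \<in> I" using ideal3_mult'[OF I M] by simp
    then show ?thesis by (intro ideal3_mult[OF I])
  qed
  then have "(x + y) ^ (N + M) \<in> I" unfolding binomial_ring by (intro ideal3_sum[OF I])
  then show "x + y \<in> {q. \<exists>N. q ^ N \<in> I}" by blast
next
  fix r x assume "x \<in> {q. \<exists>N. q ^ N \<in> I}"
  then obtain N where "x ^ N \<in> I" by blast
  then have "(r * x) ^ N \<in> I" unfolding power_mult_distrib by (rule ideal3_mult[OF I])
  then show "r * x \<in> {q. \<exists>N. q ^ N \<in> I}" by blast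
qed

lemma var3_powers_coprime:
  fixes c :: "'k::field poly3"
  assumes "c dvd var3 0 ^ N" "c dvd var3 1 ^ M"
  shows "c dvd 1"
proof -
  obtain q q' where q: "var3 0 ^ N = c * q" "var3 1 ^ M = c * q'" using assms by (auto elim!: dvdE)
  have "var3 1 ^ M * q = var3 0 ^ N * q'" unfolding q by (simp only: mult_ac)
  then have "var3 0 ^ N dvd var3 1 ^ M * q" by (rule dvdI)
  then have "var3 0 ^ N dvd q" by (rule var3_power_dvd_var3_mult[OF three_distinct(1)])
  then obtain w where "q = var3 0 ^ N * w" by (rule dvdE)
  then have "var3 0 ^ N * (c * w) = var3 0 ^ N * 1" using q(1) by (simp only: mult.left_commute mult_1_right)
  moreover have nz: "var3 0 ^ N \<noteq> (0 :: 'k poly3)" by simp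
  ultimately have "c * w = 1" unfolding mult_left_cancel[OF nz] by blast
  then show ?thesis by (rule dvdI[OF sym])
qed

section \<open>The structure theorem\<close>

text \<open>A skew-symmetric matrix with kernel spanned by \<open>f\<close> has adjugate \<open>c f f\<^sup>T\<close>. Exactness makes
  \<open>c\<close> divide a power of each generator, and the generators have no common factor, so \<open>c\<close> is constant.\<close>

theorem (in gorenstein_generators) structure_theorem:
  "\<exists>A \<gamma>. skew_symmetric n A \<and>
    (\<forall>i<n. \<forall>l<n. homz (int k + 3 - d i - d l) (A $$ (i, l)) \<and> c0 (A $$ (i, l)) = 0) \<and>
    (\<forall>x. (\<forall>i<n. (\<Sum>l<n. A $$ (i, l) * x l) = 0) \<longrightarrow> (\<exists>r. \<forall>l<n. x l = r * f l)) \<and>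
    odd n \<and> \<gamma> \<noteq> 0 \<and> (\<forall>i<n. adj_mat A $$ (i, i) = const3 \<gamma> * f i ^ 2) \<and>
    (int n - 1) * (int k + 3) = 2 * (\<Sum>i<n. d i)"
proof -
  obtain N Phi e where R: "\<forall>j<N. (\<Sum>i<n. f i * Phi i j) = 0 \<and> (\<forall>i. homz (e j - d i) (Phi i j))"
      "\<forall>z. (\<Sum>i<n. f i * z i) = 0 \<longrightarrow> (\<exists>x. \<forall>i<n. z i = (\<Sum>j<(N :: nat). Phi i j * x j))"
      "\<forall>x. (\<forall>i<n. (\<Sum>j<N. Phi i j * x j) = 0) \<longrightarrow> (\<forall>j<N. c0 (x j) = 0)"
    using syzygy_minimal_generators by (elim exE conjE) (rule that)
  interpret R: gorenstein_resolution I k s0 n f d N Phi e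
  proof (intro gorenstein_resolution.intro gorenstein_generators_axioms gorenstein_resolution_axioms.intro)
    show "(\<Sum>i<n. f i * Phi i j) = 0" "homz (e j - d i) (Phi i j)" if "j < N" for i j using R(1) that by simp_all
    show "\<exists>x. \<forall>i<n. z i = (\<Sum>j<N. Phi i j * x j)" if "(\<Sum>i<n. f i * z i) = 0" for z using R(2) that by simp
    show "c0 (x j) = 0" if "\<forall>i<n. (\<Sum>j<N. Phi i j * x j) = 0" "j < N" for x j using R(3) that by simp
  qed
  obtain M where M: "\<forall>i<n. \<forall>l<n. M i l = - M l i \<and> homz (int k + 3 - d i - d l) (M i l) \<and> c0 (M i l) = 0"
      "\<forall>i<n. (\<Sum>l<n. M i l * f l) = 0"
      "\<forall>x. (\<forall>i<n. (\<Sum>l<n. M i l * x l) = 0) \<longrightarrow> (\<exists>r. \<forall>l<n. x l = r * f l)"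
      "\<forall>z. (\<Sum>i<n. f i * z i) = 0 \<longrightarrow> (\<exists>x. \<forall>i<n. z i = (\<Sum>l<n. M i l * x l))"
    using R.skew_presentation by (elim exE conjE) (rule that)
  define A where "A = mat n n (\<lambda>(i, j). M i j)"
  have A: "A \<in> carrier_mat n n" and ent: "\<And>i j. i < n \<Longrightarrow> j < n \<Longrightarrow> A $$ (i, j) = M i j" by (simp_all add: A_def)
  have rowsum: "(\<Sum>l<n. A $$ (i, l) * x l) = (\<Sum>l<n. M i l * x l)" if "i < n" for i x
    by (intro sum.cong refl) (simp add: ent that)
  have skew: "skew_symmetric n A" unfolding skew_symmetric_iff
  proof (intro conjI allI impI A)
    fix i j assume ij: "i < n" "j < n"
    show "A $$ (i, j) = - A $$ (j, i)" unfolding ent[OF ij] ent[OF ij(2,1)] using M(1) ij by blast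
  qed
  have hom: "homz (int k + 3 - d i - d l) (A $$ (i, l)) \<and> c0 (A $$ (i, l)) = 0" if "i < n" "l < n" for i l
    unfolding ent[OF that] using M(1) that by blast
  have Af: "(\<Sum>l<n. A $$ (i, l) * f l) = 0" if "i < n" for i
    unfolding rowsum[OF that] using M(2) that by blast
  have ker: "\<exists>r. \<forall>l<n. x l = r * f l" if x: "\<And>i. i < n \<Longrightarrow> (\<Sum>l<n. A $$ (i, l) * x l) = 0" for x
  proof -
    have "\<forall>i<n. (\<Sum>l<n. M i l * x l) = 0" using x rowsum by simp
    then show ?thesis using M(3) by blast
  qed
  have det0: "det A = 0" by (rule det_eq_0_of_kernel[OF A Af n_pos f_nonzero[OF n_pos]])
  let ?a = "\<lambda>i j. adj_mat A $$ (i, j)"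
  \<comment> \<open>As det A = 0, the columns of the adjugate lie in the kernel of \<open>A\<close>;
    by skew symmetry so do its rows. Comparing the two descriptions shows that the adjugate is a
    multiple of f f^T.\<close>
  have "\<forall>j. \<exists>r. j < n \<longrightarrow> (\<forall>l<n. ?a l j = r * f l)"
  proof
    fix j show "\<exists>r. j < n \<longrightarrow> (\<forall>l<n. ?a l j = r * f l)"
    proof (cases "j < n")
      case True
      have "\<exists>r. \<forall>l<n. ?a l j = r * f l" by (rule ker) (simp add: adj_mat_mult(1)[OF A _ True] det0)
      then show ?thesis by blast
    qed blast
  qed
  from choice[OF this] obtain r where r: "\<And>j l. j < n \<Longrightarrow> l < n \<Longrightarrow> ?a l j = r j * f l" by blast
  have "\<forall>i. \<exists>t. i < n \<longrightarrow> (\<forall>l<n. ?a i l = t * f l)"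
  proof
    fix i show "\<exists>t. i < n \<longrightarrow> (\<forall>l<n. ?a i l = t * f l)"
    proof (cases "i < n")
      case True
      have "\<exists>t. \<forall>l<n. ?a i l = t * f l"
      proof (rule ker)
        fix j assume j: "j < n"
        have "(\<Sum>l<n. A $$ (j, l) * ?a i l) = (\<Sum>l<n. - (?a i l * A $$ (l, j)))"
          by (intro sum.cong refl) (use skew_symmetricD[OF skew j] in \<open>simp add: mult.commute\<close>)
        also have "\<dots> = 0" using adj_mat_mult(2)[OF A True j] det0 by (simp add: sum_negf)
        finally show "(\<Sum>l<n. A $$ (j, l) * ?a i l) = 0" .
      qed
      then show ?thesis by blast
    qed blast
  qed
  from choice[OF this] obtain t where t: "\<And>i l. i < n \<Longrightarrow> l < n \<Longrightarrow> ?a i l = t i * f l" by blast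
  have rt: "r i = t i" if i: "i < n" for i
  proof -
    have "r i * f i = t i * f i" using r[OF i i] t[OF i i] by (rule trans[OF sym])
    then show ?thesis using f_nonzero[OF i] by simp
  qed
  have "\<exists>c. \<forall>j<n. r j = c * f j"
  proof (rule proportional_multiple[where K = "Suc k"])
    fix i j assume ij: "i < n" "j < n"
    have "r j * f i = t i * f j" using r[OF ij(2,1)] t[OF ij] by (rule trans[OF sym])
    then show "f i * r j = f j * r i" unfolding rt[OF ij(1)] by (simp only: mult.commute)
  next
    show "\<exists>q. var3 a ^ Suc k = (\<Sum>i<n. q i * f i)" for a by (rule f_gen[OF var3_power_in])
  qed
  then obtain c where c: "\<And>j. j < n \<Longrightarrow> r j = c * f j" by blast
  have diag: "?a i i = c * f i ^ 2" if "i < n" for i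
    unfolding r[OF that that] c[OF that] power2_eq_square by (rule mult.assoc)
  have c_dvd: "c dvd (f i ^ 2) ^ n" if i: "i < n" for i
  proof -
    have "\<forall>j. \<exists>x. j < n \<longrightarrow> (\<forall>a<n. (if a = j then f i else 0) - (if a = i then f j else 0) = (\<Sum>l<n. M a l * x l))"
    proof
      fix j show "\<exists>x. j < n \<longrightarrow> (\<forall>a<n. (if a = j then f i else 0) - (if a = i then f j else 0) = (\<Sum>l<n. M a l * x l))"
      proof (cases "j < n")
        case True
        have "(\<Sum>a<n. f a * ((if a = j then f i else 0) - (if a = i then f j else 0))) =
            (\<Sum>a<n. (if a = j then f j * f i else 0) - (if a = i then f i * f j else 0))"
          by (intro sum.cong refl) auto
        also have "\<dots> = 0" using True i by (simp add: sum_subtractf)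
        finally show ?thesis using M(4)[rule_format, of "\<lambda>a. (if a = j then f i else 0) - (if a = i then f j else 0)"] by blast
      qed blast
    qed
    from choice[OF this] obtain x where x: "\<And>j a. j < n \<Longrightarrow> a < n \<Longrightarrow>
        (if a = j then f i else 0) - (if a = i then f j else 0) = (\<Sum>l<n. M a l * x j l)" by blast
    \<comment> \<open>\<open>x j\<close> solves A x = f_i e_j - f_j e_i. It is scaled by
      \<open>f i\<close> and moved along the kernel vector \<open>f\<close> until its i-th entry is
      \<open>f j * f i\<close>; the extra entry of \<open>bump A i\<close> then cancels the e_i
      term, leaving f_i^2 e_j.\<close>
    define u where "u l j = f i * x j l - (x j i - f j) * f l" for l j
    define U where "U = mat n n (\<lambda>(l, j). u l j)"
    have U: "U \<in> carrier_mat n n" by (simp add: U_def)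
    have entry: "(\<Sum>b<n. bump A i $$ (a, b) * u b j) = (if a = j then f i ^ 2 else 0)" if aj: "a < n" "j < n" for a j
    proof -
      have "(\<Sum>b<n. A $$ (a, b) * u b j) = (\<Sum>b<n. f i * (A $$ (a, b) * x j b) - (x j i - f j) * (A $$ (a, b) * f b))"
        by (intro sum.cong refl) (simp add: u_def algebra_simps)
      also have "\<dots> = f i * (\<Sum>b<n. A $$ (a, b) * x j b) - (x j i - f j) * (\<Sum>b<n. A $$ (a, b) * f b)"
        by (simp only: sum_subtractf sum_distrib_left)
      also have "\<dots> = f i * ((if a = j then f i else 0) - (if a = i then f j else 0))"
        unfolding Af[OF aj(1)] rowsum[OF aj(1)] x[OF aj(2,1), symmetric] by simp
      finally have 1: "(\<Sum>b<n. A $$ (a, b) * u b j) = f i * ((if a = j then f i else 0) - (if a = i then f j else 0))" .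
      have 2: "u i j = f j * f i" by (simp add: u_def algebra_simps)
      show ?thesis unfolding bump_mult[OF A aj(1) i] 1 2
        by (simp add: power2_eq_square right_diff_distrib mult.commute)
    qed
    have "bump A i * U = mat n n (\<lambda>(a, j). if a = j then f i ^ 2 else 0)"
    proof (rule eq_matI)
      fix a j assume "a < dim_row (mat n n (\<lambda>(a, j). if a = j then f i ^ 2 else 0))"
        "j < dim_col (mat n n (\<lambda>(a, j). if a = j then f i ^ 2 else 0))"
      then have aj: "a < n" "j < n" by simp_all
      have "(bump A i * U) $$ (a, j) = (\<Sum>b<n. bump A i $$ (a, b) * u b j)"
        using aj bump_carrier[OF A, of i] by (simp add: scalar_prod_def atLeast0LessThan U_def)
      then show "(bump A i * U) $$ (a, j) = mat n n (\<lambda>(a, j). if a = j then f i ^ 2 else 0) $$ (a, j)"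
        using aj by (simp add: entry)
    qed (use bump_carrier[OF A, of i] U in auto)
    then have "det (bump A i) * det U = (f i ^ 2) ^ n"
      using det_mult[OF bump_carrier[OF A, of i] U] det_scalar_function[of n "f i ^ 2"] by simp
    then have "(f i ^ 2) ^ n = c * (f i ^ 2 * det U)" by (simp add: det_bump[OF A i] det0 diag[OF i] mult.assoc)
    then show ?thesis by (rule dvdI)
  qed
  have idc: "ideal {p. c dvd p} (ring3 :: 'k poly3 ring)" by (simp add: ideal_ring3_iff dvd_mult)
  note rad = ideal_radical[OF idc]
  \<comment> \<open>The radical of the ideal of multiples of \<open>c\<close> contains all
    generators, hence all variables, and two coprime variables make \<open>c\<close> a unit.\<close>
  have "f i \<in> {q. \<exists>N. q ^ N \<in> {p. c dvd p}}" if "i < n" for i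
    using c_dvd[OF that] unfolding power_mult[symmetric] by blast
  then have "\<exists>N. c dvd var3 a ^ N" for a
  proof -
    obtain q where q: "var3 a ^ Suc k = (\<Sum>i<n. q i * f i)" using f_gen[OF var3_power_in] by blast
    have "var3 a ^ Suc k \<in> {q. \<exists>N. q ^ N \<in> {p. c dvd p}}" unfolding q
      by (intro ideal3_sum[OF rad] ideal3_mult[OF rad]) (use \<open>\<And>i. i < n \<Longrightarrow> f i \<in> _\<close> in simp)
    then obtain N where "c dvd (var3 a ^ Suc k) ^ N" by blast
    then show ?thesis unfolding power_mult[symmetric] by blast
  qed
  then have "c dvd 1" using var3_powers_coprime by blast
  then obtain w where w: "1 = c * w" by (rule dvdE)
  then have c0': "c \<noteq> 0" by auto
  \<comment> \<open>The degree forced on \<open>c\<close> by the equation between a diagonal minor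
    of \<open>A\<close> and \<open>c * f 0 ^ 2\<close>.\<close>
  define E where "E = (int n - 1) * (int k + 3) - 2 * (\<Sum>i<n. d i)"
  have "homz E c"
  proof -
    let ?h = "\<lambda>a. if a < 0 then a else Suc a"
    have "homz ((\<Sum>a<n - 1. int k + 3 - d (?h a)) + (\<Sum>b<n - 1. - d (?h b))) (det (mat_delete A 0 0))"
    proof (rule homz_det[OF mat_delete_carrier[OF A]])
      fix a b assume ab: "a < n - 1" "b < n - 1"
      have "mat_delete A 0 0 $$ (a, b) = A $$ (Suc a, Suc b)" using ab A by (simp add: mat_delete_def)
      then show "homz (int k + 3 - d (?h a) + - d (?h b)) (mat_delete A 0 0 $$ (a, b))"
        using hom[of "Suc a" "Suc b"] ab by simp
    qed
    moreover have sums: "(\<Sum>a<n - 1. int k + 3 - d (?h a)) = (\<Sum>l<n. int k + 3 - d l) - (int k + 3 - d 0)"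
      "(\<Sum>b<n - 1. - d (?h b)) = (\<Sum>l<n. - d l) - (- d 0)"
      by (rule sum_skip_index[OF n_pos])+
    moreover have "E + 2 * d 0 = ((\<Sum>l<n. int k + 3 - d l) - (int k + 3 - d 0)) + ((\<Sum>l<n. - d l) - (- d 0))"
      by (simp add: E_def sum_subtractf sum_negf algebra_simps)
    ultimately have "homz (E + 2 * d 0) (det (mat_delete A 0 0))" by (simp only: sums)
    then have "homz (E + 2 * d 0) (c * f 0 ^ 2)"
      using adj_mat_diagonal[OF A n_pos] diag[OF n_pos] by simp
    moreover have "homz (2 * d 0) (f 0 ^ 2)" using homz_power[OF f_hom[OF n_pos], of 2] by simp
    ultimately have "homz (E + 2 * d 0 - 2 * d 0) c" by (rule homz_cancel) (simp add: f_nonzero[OF n_pos])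
    then show ?thesis by simp
  qed
  \<comment> \<open>\<open>c\<close> has degree \<open>E\<close>, and the component of its inverse
    in degree -E is nonzero; neither degree can be negative.\<close>
  have "E = 0"
  proof -
    have "E \<ge> 0" using homz_neg[OF \<open>homz E c\<close>] c0' by linarith
    moreover have "hc 0 (c * w) = c * hc (0 - E) w" by (rule hc_mult'[OF \<open>homz E c\<close>])
    then have "c * hc (0 - E) w = 1" unfolding w[symmetric] hc_self[OF homz_1] by (rule sym)
    then have "\<not> 0 - E < 0" using homz_neg[OF homz_hc, of "0 - E" w] by auto
    ultimately show ?thesis by linarith
  qed
  then have cc: "c = const3 (c0 c)" using \<open>homz E c\<close> homz_0_const3 by simp
  \<comment> \<open>For even \<open>n\<close> the diagonal minors would be determinants of skew
    matrices of odd order and vanish, while they equal \<open>c * f i ^ 2\<close>.\<close>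
  have "odd n"
  proof (rule ccontr)
    assume "\<not> odd n"
    then have "odd (n - 1)" using n_pos by simp
    from det_skew_odd[OF skew_symmetric_mat_delete[OF skew, of 0] this]
    have "c * f 0 ^ 2 = 0" using adj_mat_diagonal[OF A n_pos] diag[OF n_pos] by simp
    then show False using c0' f_nonzero[OF n_pos] by simp
  qed
  moreover have "c0 c \<noteq> 0" using cc c0' by auto
  moreover have "\<forall>i<n. ?a i i = const3 (c0 c) * f i ^ 2" using diag cc by simp
  moreover have "(int n - 1) * (int k + 3) = 2 * (\<Sum>i<n. d i)" using \<open>E = 0\<close> by (simp add: E_def)
  ultimately show ?thesis using skew hom ker by (intro exI[of _ A] exI[of _ "c0 c"]) blast
qed

section \<open>From minors to Pfaffian ideals\<close>

lemma square_root_multiple: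
  fixes w u :: "'k::{alg_closed_field, field_char_0} poly3"
  assumes "c \<noteq> 0" "w ^ 2 = const3 c * u ^ 2"
  shows "\<exists>\<mu>. \<mu> \<noteq> 0 \<and> w = const3 \<mu> * u"
proof -
  \<comment> \<open>The root exists because the field is algebraically closed; the sign ambiguity of
    square roots in a domain is absorbed into the scalar.\<close>
  obtain \<mu> where \<mu>: "\<mu> ^ 2 = c" using nth_root_exists[of 2 c] by auto
  have "const3 \<mu> ^ 2 = const3 c" unfolding \<mu>[symmetric] by (simp only: power2_eq_square const3_mult)
  then have "w ^ 2 = (const3 \<mu> * u) ^ 2" using assms(2) by (simp only: power_mult_distrib)
  then have "w = const3 \<mu> * u \<or> w = const3 (- \<mu>) * u"
    unfolding power2_eq_iff const3_uminus mult_minus_left .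
  moreover have "\<mu> \<noteq> 0" "- \<mu> \<noteq> 0" using \<mu> assms(1) by auto
  ultimately show ?thesis by blast
qed

lemma sign_const3: "s \<in> {1, -1} \<Longrightarrow> \<exists>\<sigma>. s = const3 \<sigma> \<and> \<sigma> * \<sigma> = 1"
  for s :: "'k::field poly3"
  by (elim insertE emptyE; rule exI[of _ 1] exI[of _ "- 1"]; simp add: const3_uminus)+

lemma (in gorenstein_ideal) exists_generators: "\<exists>n f d. gorenstein_generators I k s0 n f d"
proof -
  obtain n :: nat and f d where g: "\<forall>i<n. f i \<in> I \<and> homz (d i) (f i)" "\<forall>p\<in>I. \<exists>r. p = (\<Sum>i<n. r i * f i)"
      "\<forall>r. (\<Sum>i<n. r i * f i) = 0 \<longrightarrow> (\<forall>i<n. c0 (r i) = 0)"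
    using ideal_minimal_generators by (elim exE conjE) (rule that)
  have "gorenstein_generators I k s0 n f d"
  proof (intro gorenstein_generators.intro gorenstein_ideal_axioms gorenstein_generators_axioms.intro)
    show "f i \<in> I" "homz (d i) (f i)" if "i < n" for i using g(1) that by simp_all
    show "\<exists>r. p = (\<Sum>i<n. r i * f i)" if "p \<in> I" for p using g(2) that by blast
    show "c0 (r i) = 0" if "(\<Sum>i<n. r i * f i) = 0" "i < n" for r i using g(3) that by blast
  qed
  then show ?thesis by blast
qed

lemma pfaffian_structure:
  fixes I :: "'k::{alg_closed_field, field_char_0} poly3 set"
  assumes "gorenstein_generators I k s0 n f d"
  shows "\<exists>A. skew_symmetric n A \<and>
    (\<forall>i<n. \<forall>l<n. homz (int k + 3 - d i - d l) (A $$ (i, l)) \<and> c0 (A $$ (i, l)) = 0) \<and>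
    (\<forall>x. (\<forall>i<n. (\<Sum>l<n. A $$ (i, l) * x l) = 0) \<longrightarrow> (\<exists>r. \<forall>l<n. x l = r * f l)) \<and>
    odd n \<and> (int n - 1) * (int k + 3) = 2 * (\<Sum>i<n. d i) \<and>
    (\<forall>i<n. \<exists>\<mu>. \<mu> \<noteq> 0 \<and> sub_pfaffian A i = const3 \<mu> * f i) \<and> I = pfaffian_ideal A"
proof -
  interpret gorenstein_generators I k s0 n f d by (rule assms)
  obtain A \<gamma> where A: "skew_symmetric n A"
    "\<forall>i<n. \<forall>l<n. homz (int k + 3 - d i - d l) (A $$ (i, l)) \<and> c0 (A $$ (i, l)) = 0"
    "\<forall>x. (\<forall>i<n. (\<Sum>l<n. A $$ (i, l) * x l) = 0) \<longrightarrow> (\<exists>r. \<forall>l<n. x l = r * f l)"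
    "odd n" "\<gamma> \<noteq> 0" "\<forall>i<n. adj_mat A $$ (i, i) = const3 \<gamma> * f i ^ 2"
    "(int n - 1) * (int k + 3) = 2 * (\<Sum>i<n. d i)"
    using structure_theorem by (elim exE conjE) (rule that)
  have pf: "\<exists>\<mu>. \<mu> \<noteq> 0 \<and> sub_pfaffian A i = const3 \<mu> * f i" if i: "i < n" for i
  proof -
    obtain s where s: "s \<in> {1, -1}" "adj_mat A $$ (i, i) = s * sub_pfaffian A i ^ 2"
      using adj_mat_diagonal_pfaffian[OF A(1,4) i] by blast
    obtain \<sigma> where \<sigma>: "s = const3 \<sigma>" "\<sigma> * \<sigma> = 1" using sign_const3[OF s(1)] by blast
    have "const3 \<sigma> * sub_pfaffian A i ^ 2 = const3 \<gamma> * f i ^ 2"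
      using s(2) A(6)[rule_format, OF i] \<sigma>(1) by simp
    then have "const3 (\<sigma> * \<sigma>) * sub_pfaffian A i ^ 2 = const3 (\<sigma> * \<gamma>) * f i ^ 2"
      by (simp only: const3_mult mult.assoc)
    then have "sub_pfaffian A i ^ 2 = const3 (\<sigma> * \<gamma>) * f i ^ 2" unfolding \<sigma>(2) by simp
    moreover have "\<sigma> * \<gamma> \<noteq> 0" using \<sigma>(2) A(5) by auto
    ultimately show ?thesis by (intro square_root_multiple)
  qed
  have dim: "dim_row A = n" using A(1) by (auto simp: skew_symmetric_def)
  have "I = pfaffian_ideal A"
  proof
    have fG: "f i \<in> pfaffian_ideal A" if i: "i < n" for i
    proof -
      obtain \<mu> where \<mu>: "\<mu> \<noteq> 0" "sub_pfaffian A i = const3 \<mu> * f i" using pf[OF i] by blast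
      have "sub_pfaffian A i \<in> pfaffian_ideal A" unfolding pfaffian_ideal_def dim
        using genideal_mono[of "sub_pfaffian A ` {..<n}"] i by blast
      then have "const3 (1 / \<mu>) * sub_pfaffian A i \<in> pfaffian_ideal A"
        unfolding pfaffian_ideal_def by (rule ideal3_mult[OF genideal_ideal])
      also have "const3 (1 / \<mu>) * sub_pfaffian A i = f i"
        unfolding \<mu>(2) mult.assoc[symmetric] const3_mult[symmetric] using \<mu>(1) by simp
      finally show ?thesis .
    qed
    show "I \<subseteq> pfaffian_ideal A"
    proof
      fix p assume "p \<in> I"
      then obtain r where r: "p = (\<Sum>i<n. r i * f i)" using f_gen by blast
      show "p \<in> pfaffian_ideal A" unfolding r pfaffian_ideal_def
        by (intro ideal3_sum[OF genideal_ideal] ideal3_mult[OF genideal_ideal])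
          (use fG in \<open>simp add: pfaffian_ideal_def\<close>)
    qed
    show "pfaffian_ideal A \<subseteq> I" unfolding pfaffian_ideal_def dim
    proof (rule genideal_min[OF I], rule image_subsetI)
      fix i assume "i \<in> {..<n}"
      then have i: "i < n" by simp
      obtain \<mu> where \<mu>: "sub_pfaffian A i = const3 \<mu> * f i" using pf[OF i] by blast
      show "sub_pfaffian A i \<in> I" unfolding \<mu> by (rule I_mult[OF f_in[OF i]])
    qed
  qed
  then show ?thesis using A pf by (intro exI[of _ A]) blast
qed

lemma pfaffian_gorenstein_ideals_eq:
  "pfaffian_gorenstein_ideals k = {I :: 'k::{alg_closed_field, field_char_0} poly3 set. artinian_graded_gorenstein k I}"
proof (intro equalityI subsetI CollectI)
  fix I :: "'k poly3 set" assume "I \<in> {I. artinian_graded_gorenstein k I}"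
  then have agg: "artinian_graded_gorenstein k I" by simp
  obtain s0 where G: "gorenstein_ideal I k s0" using gorenstein_ideal_of_agg[OF agg] by blast
  obtain n f d where "gorenstein_generators I k s0 n f d" using gorenstein_ideal.exists_generators[OF G] by blast
  from pfaffian_structure[OF this] obtain A where A: "skew_symmetric n A"
    "\<forall>i<n. \<forall>l<n. homz (int k + 3 - d i - d l) (A $$ (i, l)) \<and> c0 (A $$ (i, l)) = 0" "odd n" "I = pfaffian_ideal A"
    by blast
  \<comment> \<open>Minimality gives the entries zero constant term, so a nonzero entry has positive
    degree; a zero entry may be assigned degree 1.\<close>
  have "\<exists>e>0. homogeneous e (A $$ (i, j))" if "i < n" "j < n" for i j
  proof (cases "A $$ (i, j) = 0")
    case False
    define e where "e = int k + 3 - d i - d j"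
    have h: "homz e (A $$ (i, j))" "c0 (A $$ (i, j)) = 0" using A(2) that by (simp_all add: e_def)
    have "\<not> e < 0" using homz_neg[OF h(1)] False by blast
    moreover have "e \<noteq> 0" using homz_0_const3[of "A $$ (i, j)"] h False by auto
    ultimately show ?thesis using h(1) by (intro exI[of _ "nat e"]) (simp add: homogeneous_iff_homz)
  qed (auto simp: homogeneous_def intro: exI[of _ 1])
  then show "I \<in> pfaffian_gorenstein_ideals k"
    unfolding pfaffian_gorenstein_ideals_def using agg gorenstein_ideal.codimension_eq[OF G] A(1,3,4) by blast
qed (simp add: pfaffian_gorenstein_ideals_def)

lemma perp_forms:
  "perp ` forms k = {I :: 'k::field_char_0 poly3 set. artinian_graded_gorenstein k I}"
proof (intro equalityI subsetI)
  fix I :: "'k poly3 set" assume "I \<in> perp ` forms k"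
  then obtain F where F: "I = perp F" "homz (int k) F" "F \<noteq> 0" by (auto simp: forms_def homogeneous_iff_homz)
  obtain s where "homz (int k) s" "phi F s = 1" by (rule phi_nonzero[OF F(2,3)])
  from gorenstein_ideal.agg[OF gorenstein_ideal_perp[OF F(2) this]] show "I \<in> {I. artinian_graded_gorenstein k I}"
    by (simp add: F(1))
next
  fix I :: "'k poly3 set" assume "I \<in> {I. artinian_graded_gorenstein k I}"
  then obtain s0 where "gorenstein_ideal I k s0" using gorenstein_ideal_of_agg by blast
  from gorenstein_ideal.exists_dual_form[OF this] show "I \<in> perp ` forms k" by blast
qed

section \<open>Linear presentations\<close>

lemma perp_nondegenerate_linear:
  fixes F :: "'k::{alg_closed_field, field_char_0} poly3"
  assumes n: "n \<ge> 5" "odd n" and F: "F \<in> nondegenerate_forms (n - 3)"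
  shows "perp F \<in> linear_pfaffian_gorenstein_ideals n"
proof -
  obtain q where q: "n = 2 * q + 1" using n(2) by (rule oddE)
  have q2: "q \<ge> 2" using n(1) q by simp
  define k where "k = n - 3"
  have k: "int k + 3 = 2 * int q + 1" "even k" "int (k div 2) = int q - 1" using q q2 by (auto simp: k_def)
  have hF: "homz (int k) F" and "F \<noteq> 0" and nd: "nondegenerate k F"
    using F by (simp_all add: nondegenerate_forms_def forms_def homogeneous_iff_homz k_def)
  have small: "D = 0" if "homz (int q - 1) D" "D \<in> perp F" for D
    using nd that unfolding nondegenerate_iff[OF k(2) hF] k(3) by blast
  obtain s where s: "homz (int k) s" "phi F s = 1" by (rule phi_nonzero[OF hF \<open>F \<noteq> 0\<close>])
  have G: "gorenstein_ideal (perp F) k s" by (rule gorenstein_ideal_perp[OF hF s])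
  obtain N f d where GG: "gorenstein_generators (perp F) k s N f d" using gorenstein_ideal.exists_generators[OF G] by blast
  interpret gorenstein_generators "perp F" k s N f d by (rule GG)
  from pfaffian_structure[OF GG] obtain A where A: "skew_symmetric N A"
    "\<forall>i<N. \<forall>l<N. homz (int k + 3 - d i - d l) (A $$ (i, l)) \<and> c0 (A $$ (i, l)) = 0"
    "\<forall>x. (\<forall>i<N. (\<Sum>l<N. A $$ (i, l) * x l) = 0) \<longrightarrow> (\<exists>r. \<forall>l<N. x l = r * f l)"
    "odd N" "(int N - 1) * (int k + 3) = 2 * (\<Sum>i<N. d i)"
    "\<forall>i<N. \<exists>\<mu>. \<mu> \<noteq> 0 \<and> sub_pfaffian A i = const3 \<mu> * f i" "perp F = pfaffian_ideal A"
    by (elim exE conjE) (rule that)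
  \<comment> \<open>A generator of smaller degree, multiplied by a power of a variable, would be a
    nonzero form of degree q - 1, half the degree of F, annihilating F.\<close>
  have d_ge: "d i \<ge> int q" if i: "i < N" for i
  proof (rule ccontr)
    assume lt: "\<not> d i \<ge> int q"
    let ?m = "nat (int q - 1 - d i)"
    have "homz (int ?m * 1 + d i) (var3 0 ^ ?m * f i)" by (intro homz_mult homz_power homz_var3 f_hom i)
    then have "homz (int q - 1) (var3 0 ^ ?m * f i)" using lt by simp
    from small[OF this I_mult[OF f_in[OF i]]] show False using f_nonzero[OF i] by simp
  qed
  have "N \<noteq> 1"
  proof
    assume "N = 1"
    then have "d 0 = 0" using A(5) by simp
    then show False using d_ge[OF n_pos] q2 by simp
  qed
  then have N2: "2 \<le> N" using n_pos by simp
  have d_eq: "d i = int q" if i: "i < N" for i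
  proof (rule ccontr)
    assume "d i \<noteq> int q"
    then have gt: "d i > int q" using d_ge[OF i] by simp
    \<comment> \<open>A generator of degree above \<open>q\<close> leaves only entries of degree at
      most 0 in its column, and these vanish by minimality. The unit vector at \<open>i\<close> is
      then in the kernel, hence a multiple of \<open>f\<close>; a second generator, available since
      N is at least 2, contradicts this.\<close>
    have z: "A $$ (l, i) = 0" if l: "l < N" for l
    proof -
      define e where "e = int k + 3 - d l - d i"
      have h: "homz e (A $$ (l, i))" "c0 (A $$ (l, i)) = 0" using A(2) l i by (simp_all add: e_def)
      have "e \<le> 0" using gt d_ge[OF l] k(1) by (simp add: e_def)
      then consider "e < 0" | "e = 0" by linarith
      then show ?thesis
      proof cases
        case 2
        then show ?thesis using homz_0_const3[of "A $$ (l, i)"] h by simp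
      qed (rule homz_neg[OF h(1)])
    qed
    define x where "x l = (if l = i then 1 else 0 :: 'k poly3)" for l
    have "(\<Sum>l<N. A $$ (a, l) * x l) = 0" if "a < N" for a
      by (rule sum.neutral) (use z[OF that] in \<open>auto simp: x_def\<close>)
    then obtain \<rho> where \<rho>: "\<And>l. l < N \<Longrightarrow> x l = \<rho> * f l" using A(3) by blast
    obtain j where j: "j < N" "j \<noteq> i" using N2 by (cases "i = 0") (auto intro: that[of 1] that[of 0])
    have "\<rho> * f j = 0" using \<rho>[OF j(1)] j(2) by (simp add: x_def)
    then have "\<rho> = 0" using f_nonzero[OF j(1)] by simp
    then show False using \<rho>[OF i] by (simp add: x_def)
  qed
  \<comment> \<open>With all degrees equal to \<open>q\<close>, the degree identity becomes an
    equation for the number of generators.\<close>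
  have "(\<Sum>i<N. d i) = int N * int q" by (simp add: d_eq)
  then have "(int N - 1) * (2 * int q + 1) = 2 * (int N * int q)" using A(5) unfolding k(1) by simp
  then have "int N = 2 * int q + 1" by (simp add: algebra_simps)
  then have Nn: "N = n" using q by linarith
  have "homogeneous 1 (A $$ (i, j))" if "i < n" "j < n" for i j
  proof -
    have "int k + 3 - d i - d j = 1" using that k(1) by (simp add: d_eq Nn)
    then show ?thesis using A(2) that unfolding Nn homogeneous_iff_homz by (metis of_nat_1)
  qed
  moreover have "homogeneous ((n - 1) div 2) (sub_pfaffian A i)" if i: "i < n" for i
  proof -
    obtain \<mu> where \<mu>: "sub_pfaffian A i = const3 \<mu> * f i" using A(6) i unfolding Nn by blast
    have "homz (int q) (f i)" using f_hom[of i] d_eq[of i] i Nn by simp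
    then show ?thesis unfolding \<mu> homogeneous_iff_homz by (simp add: q)
  qed
  ultimately show ?thesis unfolding linear_pfaffian_gorenstein_ideals_def
    using agg codimension_eq A(1,7) Nn by blast
qed

text \<open>The adjugate of a skew-symmetric matrix of odd order has rank one, with diagonal the squares of
  the Pfaffians up to sign; hence the Pfaffians, with suitable scalars, span the kernel.\<close>

lemma skew_kernel_pfaffians:
  fixes A :: "'k::{alg_closed_field, field_char_0} poly3 mat"
  assumes A: "skew_symmetric n A" "odd n"
    and pow: "\<And>a. \<exists>q. var3 a ^ K = (\<Sum>i<n. q i * sub_pfaffian A i)"
  shows "\<exists>\<iota>. (\<forall>i<n. \<iota> i \<noteq> 0) \<and>
    (\<forall>i<n. (\<Sum>l<n. A $$ (i, l) * (const3 (\<iota> l) * sub_pfaffian A l)) = 0) \<and>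
    (\<forall>x. (\<forall>i<n. (\<Sum>l<n. A $$ (i, l) * x l) = 0) \<longrightarrow> (\<exists>r. \<forall>l<n. x l = r * (const3 (\<iota> l) * sub_pfaffian A l)))"
proof -
  let ?p = "sub_pfaffian A"
  let ?a = "\<lambda>i j. adj_mat A $$ (i, j)"
  have C: "A \<in> carrier_mat n n" using A(1) by (simp add: skew_symmetric_def)
  have det0: "det A = 0" by (rule det_skew_odd[OF A])
  have "\<exists>i<n. ?p i \<noteq> 0"
  proof (rule ccontr)
    assume none: "\<not> (\<exists>i<n. ?p i \<noteq> 0)"
    obtain q where "var3 0 ^ K = (\<Sum>i<n. q i * ?p i)" using pow by blast
    also have "\<dots> = 0" by (rule sum.neutral) (use none in auto)
    finally show False by simp
  qed
  then obtain m where m: "m < n" "?p m \<noteq> 0" by blast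
  let ?D = "?a m m"
  have diag: "\<exists>\<sigma>. \<sigma> * \<sigma> = 1 \<and> ?a i i = const3 \<sigma> * ?p i ^ 2" if i: "i < n" for i
  proof -
    obtain s where s: "s \<in> {1, -1}" "?a i i = s * ?p i ^ 2" using adj_mat_diagonal_pfaffian[OF A i] by blast
    obtain \<sigma> where \<sigma>: "s = const3 \<sigma>" "\<sigma> * \<sigma> = 1" using sign_const3[OF s(1)] by blast
    show ?thesis using s(2) \<sigma>(2) unfolding \<sigma>(1) by blast
  qed
  obtain \<sigma> where \<sigma>: "\<sigma> * \<sigma> = 1" "?D = const3 \<sigma> * ?p m ^ 2" using diag[OF m(1)] by blast
  have D0: "?D \<noteq> 0" using \<sigma> m(2) by auto
  \<comment> \<open>The difference of the two sides is a kernel vector of \<open>A\<close> vanishing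
    at place \<open>m\<close>, so \<open>bump A m\<close> kills it too; but the determinant of that
    matrix is \<open>?D\<close>, which is nonzero.\<close>
  have scale: "?D * x j = x m * ?a j m" if x: "\<And>i. i < n \<Longrightarrow> (\<Sum>l<n. A $$ (i, l) * x l) = 0" and j: "j < n" for x j
  proof (rule ccontr)
    assume ne: "?D * x j \<noteq> x m * ?a j m"
    define y where "y l = ?D * x l - x m * ?a l m" for l
    have "(\<Sum>b<n. bump A m $$ (a, b) * y b) = 0" if a: "a < n" for a
    proof -
      have "(\<Sum>b<n. A $$ (a, b) * y b) = (\<Sum>b<n. ?D * (A $$ (a, b) * x b) - x m * (A $$ (a, b) * ?a b m))"
        by (intro sum.cong refl) (simp add: y_def algebra_simps)
      also have "\<dots> = ?D * (\<Sum>b<n. A $$ (a, b) * x b) - x m * (\<Sum>b<n. A $$ (a, b) * ?a b m)"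
        by (simp only: sum_subtractf sum_distrib_left)
      also have "\<dots> = 0" by (simp add: x[OF a] adj_mat_mult(1)[OF C a m(1)] det0)
      moreover have "y m = 0" by (simp add: y_def)
      ultimately show ?thesis by (simp add: bump_mult[OF C a m(1)])
    qed
    from det_eq_0_of_kernel[OF bump_carrier[OF C] this j] ne have "det (bump A m) = 0" by (simp add: y_def)
    then show False using D0 by (simp add: det_bump[OF C m(1)] det0)
  qed
  \<comment> \<open>Rows of the adjugate are kernel vectors by skew symmetry, so
    \<open>scale\<close> compares row \<open>m\<close> with column \<open>m\<close>.\<close>
  have row: "?a m j = ?a j m" if j: "j < n" for j
  proof -
    have "(\<Sum>l<n. A $$ (i, l) * ?a m l) = 0" if i: "i < n" for i
    proof -
      have "(\<Sum>l<n. A $$ (i, l) * ?a m l) = (\<Sum>l<n. - (?a m l * A $$ (l, i)))"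
        by (intro sum.cong refl) (use skew_symmetricD[OF A(1) i] in \<open>simp add: mult.commute\<close>)
      also have "\<dots> = 0" using adj_mat_mult(2)[OF C m(1) i] det0 by (simp add: sum_negf)
      finally show ?thesis .
    qed
    from scale[OF this j] show ?thesis using D0 by simp
  qed
  have "\<forall>j. \<exists>c. j < n \<longrightarrow> c \<noteq> 0 \<and> ?a j m = const3 c * (?p m * ?p j)"
  proof
    fix j
    show "\<exists>c. j < n \<longrightarrow> c \<noteq> 0 \<and> ?a j m = const3 c * (?p m * ?p j)"
    proof (cases "j < n")
      case True
      have "(\<Sum>l<n. A $$ (i, l) * ?a l j) = 0" if "i < n" for i
        using adj_mat_mult(1)[OF C that True] det0 by simp
      \<comment> \<open>The entry \<open>?a j m\<close> squares to the product of two diagonal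
        entries, each a Pfaffian square up to sign; a square root gives the entry as a scalar times
        the product of the two Pfaffians.\<close>
      from scale[OF this True] have eq: "?D * ?a j j = ?a j m ^ 2" by (simp only: row[OF True] power2_eq_square)
      obtain \<tau> where \<tau>: "\<tau> * \<tau> = 1" "?a j j = const3 \<tau> * ?p j ^ 2" using diag[OF True] by blast
      have "?a j m ^ 2 = const3 (\<sigma> * \<tau>) * (?p m * ?p j) ^ 2"
        unfolding eq[symmetric] \<sigma>(2) \<tau>(2) const3_mult by (simp only: power_mult_distrib mult_ac)
      moreover have "\<sigma> * \<tau> \<noteq> 0" using \<sigma>(1) \<tau>(1) by auto
      ultimately show ?thesis using square_root_multiple by blast
    qed blast
  qed
  from choice[OF this] obtain \<iota> where \<iota>: "\<And>j. j < n \<Longrightarrow> \<iota> j \<noteq> 0"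
    "\<And>j. j < n \<Longrightarrow> ?a j m = const3 (\<iota> j) * (?p m * ?p j)" by blast
  define P where "P l = const3 (\<iota> l) * ?p l" for l
  have aP: "?a j m = ?p m * P j" if "j < n" for j unfolding \<iota>(2)[OF that] P_def by (simp only: mult.left_commute)
  have AP: "(\<Sum>l<n. A $$ (i, l) * P l) = 0" if i: "i < n" for i
  proof -
    have "?p m * (\<Sum>l<n. A $$ (i, l) * P l) = (\<Sum>l<n. A $$ (i, l) * ?a l m)"
      unfolding sum_distrib_left by (intro sum.cong refl) (simp add: aP mult.left_commute)
    also have "\<dots> = 0" by (simp add: adj_mat_mult(1)[OF C i m(1)] det0)
    finally show ?thesis using m(2) by simp
  qed
  have ker: "\<exists>r. \<forall>l<n. x l = r * P l" if x: "\<And>i. i < n \<Longrightarrow> (\<Sum>l<n. A $$ (i, l) * x l) = 0" for x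
  proof (rule proportional_multiple[where K = K])
    fix l j assume lj: "l < n" "j < n"
    have Dx: "?D * x i = x m * (?p m * P i)" if i: "i < n" for i
    proof -
      have "?D * x i = x m * ?a i m" by (rule scale[OF x i])
      also have "?a i m = ?p m * P i" by (rule aP[OF i])
      finally show ?thesis .
    qed
    have "?D * (P l * x j) = P l * (?D * x j)" by (rule mult.left_commute)
    also have "\<dots> = P j * (?D * x l)" unfolding Dx[OF lj(1)] Dx[OF lj(2)] by (simp only: mult_ac)
    also have "\<dots> = ?D * (P j * x l)" by (rule mult.left_commute)
    finally show "P l * x j = P j * x l" using D0 by simp
  next
    fix a
    obtain q where q: "var3 a ^ K = (\<Sum>i<n. q i * ?p i)" using pow by blast
    have "q i * ?p i = q i * const3 (1 / \<iota> i) * P i" if "i < n" for i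
    proof -
      have "const3 (1 / \<iota> i) * P i = ?p i" using \<iota>(1)[OF that]
        unfolding P_def mult.assoc[symmetric] const3_mult[symmetric] by simp
      then show ?thesis by (simp only: mult.assoc)
    qed
    then have "var3 a ^ K = (\<Sum>i<n. q i * const3 (1 / \<iota> i) * P i)" unfolding q by (intro sum.cong) auto
    then show "\<exists>r. var3 a ^ K = (\<Sum>i<n. r i * P i)" by (rule exI[of _ "\<lambda>i. q i * const3 (1 / \<iota> i)"])
  qed
  show ?thesis using \<iota>(1) AP ker unfolding P_def by (intro exI[of _ \<iota>]) blast
qed

text \<open>Exactness at the generators: the image of \<open>A\<close> contains the syzygies multiplied by a power of
  each variable, and it is saturated since the kernel of \<open>A\<close> is generated by one vector.\<close>

lemma skew_syzygies:
  fixes A :: "'k::{alg_closed_field, field_char_0} poly3 mat" and P :: "nat \<Rightarrow> 'k poly3"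
  assumes A: "skew_symmetric n A" "odd n"
    and P: "\<And>i. i < n \<Longrightarrow> \<iota> i \<noteq> 0" "\<And>i. i < n \<Longrightarrow> P i = const3 (\<iota> i) * sub_pfaffian A i"
    and AP: "\<And>i. i < n \<Longrightarrow> (\<Sum>l<n. A $$ (i, l) * P l) = 0"
    and ker: "\<And>x. (\<And>i. i < n \<Longrightarrow> (\<Sum>l<n. A $$ (i, l) * x l) = 0) \<Longrightarrow> \<exists>r. \<forall>l<n. x l = r * P l"
    and pow: "\<And>a. \<exists>q. var3 a ^ K = (\<Sum>i<n. q i * sub_pfaffian A i)"
    and z: "(\<Sum>i<n. P i * z i) = 0"
  shows "\<exists>u. \<forall>i<n. z i = (\<Sum>l<n. A $$ (i, l) * u l)"
proof -
  let ?p = "sub_pfaffian A"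
  have C: "A \<in> carrier_mat n n" using A(1) by (simp add: skew_symmetric_def)
  have det0: "det A = 0" by (rule det_skew_odd[OF A])
  define B where "B y \<longleftrightarrow> (\<exists>u. \<forall>i<n. y i = (\<Sum>l<n. A $$ (i, l) * u l))" for y
  have BI: "B y" if "\<And>i. i < n \<Longrightarrow> y i = (\<Sum>l<n. A $$ (i, l) * u l)" for y u using that unfolding B_def by blast
  have B_mult: "B (\<lambda>i. r * y i)" if By: "B y" for r y
  proof -
    obtain u where u: "\<And>i. i < n \<Longrightarrow> y i = (\<Sum>l<n. A $$ (i, l) * u l)" using By unfolding B_def by blast
    show ?thesis by (rule BI[where u = "\<lambda>l. r * u l"]) (simp add: u sum_distrib_left mult.left_commute)
  qed
  have B_add: "B (\<lambda>i. y i + y' i)" if By: "B y" "B y'" for y y'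
  proof -
    obtain u u' where u: "\<And>i. i < n \<Longrightarrow> y i = (\<Sum>l<n. A $$ (i, l) * u l)" "\<And>i. i < n \<Longrightarrow> y' i = (\<Sum>l<n. A $$ (i, l) * u' l)"
      using By unfolding B_def by blast
    show ?thesis by (rule BI[where u = "\<lambda>l. u l + u' l"]) (simp add: u sum.distrib distrib_left)
  qed
  have PA: "(\<Sum>i<n. P i * A $$ (i, j)) = 0" if j: "j < n" for j
  proof -
    have "(\<Sum>i<n. P i * A $$ (i, j)) = (\<Sum>i<n. - (A $$ (j, i) * P i))"
      by (intro sum.cong refl) (use skew_symmetricD[OF A(1) j] in \<open>simp add: mult.commute\<close>)
    also have "\<dots> = 0" using AP[OF j] by (simp add: sum_negf)
    finally show ?thesis .
  qed
  \<comment> \<open>Cramer's rule for \<open>bump A i\<close> gives \<open>w\<close> with A w + w_i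
    e_i = D z. Pairing with \<open>P\<close> kills \<open>A w\<close> and \<open>z\<close>, so P_i
    w_i = 0 and the correction disappears.\<close>
  have square: "B (\<lambda>j. ?p i ^ 2 * z j)" if i: "i < n" for i
  proof (cases "?p i = 0")
    case True
    show ?thesis by (rule BI[where u = "\<lambda>_. 0"]) (simp add: True)
  next
    case False
    let ?E = "bump A i"
    note E = bump_carrier[OF C, of i]
    define w where "w l = (\<Sum>b<n. adj_mat ?E $$ (l, b) * z b)" for l
    let ?D = "adj_mat A $$ (i, i)"
    have Ew: "(\<Sum>l<n. A $$ (a, l) * w l) + (if a = i then w i else 0) = ?D * z a" if a: "a < n" for a
    proof -
      have "(\<Sum>l<n. ?E $$ (a, l) * w l) = (\<Sum>b<n. (\<Sum>l<n. ?E $$ (a, l) * adj_mat ?E $$ (l, b)) * z b)"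
        unfolding w_def by (rule sum_matrix_assoc)
      also have "\<dots> = (\<Sum>b<n. (if a = b then ?D else 0) * z b)"
        by (intro sum.cong refl) (use a in \<open>simp add: adj_mat_mult(1)[OF E] det_bump[OF C i] det0\<close>)
      also have "\<dots> = ?D * z a" by (rule sum_delta_mult(2)[OF a])
      finally show ?thesis unfolding bump_mult[OF C a i] .
    qed
    have "(\<Sum>a<n. P a * (?D * z a)) = (\<Sum>a<n. P a * (\<Sum>l<n. A $$ (a, l) * w l)) + (\<Sum>a<n. if a = i then P i * w i else 0)"
      unfolding sum.distrib[symmetric] by (intro sum.cong refl) (auto simp: Ew[symmetric] distrib_left)
    moreover have "(\<Sum>a<n. P a * (?D * z a)) = ?D * (\<Sum>a<n. P a * z a)"
      unfolding sum_distrib_left by (intro sum.cong refl mult.left_commute)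
    moreover have "(\<Sum>a<n. P a * (\<Sum>l<n. A $$ (a, l) * w l)) = 0"
      unfolding sum_matrix_assoc by (rule sum.neutral) (simp add: PA)
    ultimately have "P i * w i = 0" using z i by simp
    moreover have "P i \<noteq> 0" using P[OF i] False by simp
    ultimately have wi: "w i = 0" by simp
    have "?D * z a = (\<Sum>l<n. A $$ (a, l) * w l)" if a: "a < n" for a
    proof -
      have "?D * z a = (\<Sum>l<n. A $$ (a, l) * w l) + (if a = i then w i else 0)" by (rule Ew[OF a, symmetric])
      also have "\<dots> = (\<Sum>l<n. A $$ (a, l) * w l)" unfolding wi by (simp only: if_cancel add_0_right)
      finally show ?thesis .
    qed
    then have BD: "B (\<lambda>a. ?D * z a)" by (rule BI)
    obtain s where s: "s \<in> {1, -1}" "?D = s * ?p i ^ 2" using adj_mat_diagonal_pfaffian[OF A i] by blast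
    have "s * s = 1" using s(1) by auto
    then have sD: "s * (?D * z a) = ?p i ^ 2 * z a" for a unfolding s(2) mult.assoc[symmetric] by simp
    show ?thesis using B_mult[OF BD, of s] unfolding sD .
  qed
  \<comment> \<open>The multipliers taking \<open>z\<close> into the image form an ideal. It
    contains the squares of the Pfaffians, so through its radical it contains powers of the
    variables.\<close>
  have J: "ideal {q. B (\<lambda>i. q * z i)} (ring3 :: 'k poly3 ring)"
    unfolding ideal_ring3_iff
  proof (intro conjI ballI allI)
    show "0 \<in> {q. B (\<lambda>i. q * z i)}" using BI[of "\<lambda>i. 0 * z i" "\<lambda>_. 0"] by simp
  next
    fix x y assume "x \<in> {q. B (\<lambda>i. q * z i)}" "y \<in> {q. B (\<lambda>i. q * z i)}"
    then show "x + y \<in> {q. B (\<lambda>i. q * z i)}" using B_add[of "\<lambda>i. x * z i" "\<lambda>i. y * z i"] by (simp add: distrib_right)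
  next
    fix r x assume "x \<in> {q. B (\<lambda>i. q * z i)}"
    then show "r * x \<in> {q. B (\<lambda>i. q * z i)}" using B_mult[of "\<lambda>i. x * z i" r] by (simp add: mult.assoc)
  qed
  note rad = ideal_radical[OF J]
  have pR: "?p i \<in> {q. \<exists>N. q ^ N \<in> {q. B (\<lambda>i. q * z i)}}" if "i < n" for i
    using square[OF that] by blast
  have "\<exists>N. B (\<lambda>i. var3 a ^ N * z i)" for a
  proof -
    obtain q where q: "var3 a ^ K = (\<Sum>i<n. q i * ?p i)" using pow by blast
    have "var3 a ^ K \<in> {q. \<exists>N. q ^ N \<in> {q. B (\<lambda>i. q * z i)}}" unfolding q
      by (intro ideal3_sum[OF rad] ideal3_mult[OF rad] pR) simp
    then obtain N where "B (\<lambda>i. (var3 a ^ K) ^ N * z i)" by blast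
    then show ?thesis unfolding power_mult[symmetric] by blast
  qed
  then have "\<forall>a. \<exists>N. B (\<lambda>i. var3 a ^ N * z i)" by blast
  from choice[OF this] obtain N where N: "\<And>a. B (\<lambda>i. var3 a ^ N a * z i)" by blast
  define L where "L = N 0 + N 1 + N 2"
  have NL: "N a \<le> L" for a
  proof -
    have "\<forall>a. N a \<le> L" unfolding all_three by (simp add: L_def)
    then show ?thesis by blast
  qed
  have "B z"
  proof (rule saturated_power[where P = B and z = z and K = L])
    fix y assume y: "\<And>a. B (\<lambda>i. var3 a * y i)"
    then have "\<forall>a. \<exists>u. \<forall>i<n. var3 a * y i = (\<Sum>l<n. A $$ (i, l) * u l)" unfolding B_def by blast
    from choice[OF this] obtain v where v: "\<And>a i. i < n \<Longrightarrow> var3 a * y i = (\<Sum>l<n. A $$ (i, l) * v a l)" by blast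
    show "B y" unfolding B_def
    proof (rule image_saturated[where p = n and q = n and A = "\<lambda>i l. A $$ (i, l)" and g = P and z = y and w = v], goal_cases)
      case (1 x)
      then show ?case by (rule ker)
    next
      case (2 i)
      then show ?case by (rule AP)
    next
      case (3 a i)
      then show ?case by (rule v)
    qed
  next
    show "B (\<lambda>i. r * y i)" if "B y" for r y by (rule B_mult[OF that])
  next
    fix a
    have L: "var3 a ^ L = var3 a ^ (L - N a) * var3 a ^ N a" using NL[of a] by (simp add: power_add[symmetric])
    show "B (\<lambda>i. var3 a ^ L * z i)" unfolding L mult.assoc by (rule B_mult[OF N])
  qed
  then show ?thesis unfolding B_def .
qed

lemma linear_imp_perp_nondegenerate:
  fixes I :: "'k::{alg_closed_field, field_char_0} poly3 set"
  assumes n: "n \<ge> 5" "odd n" and I: "I \<in> linear_pfaffian_gorenstein_ideals n"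
  shows "\<exists>F \<in> nondegenerate_forms (n - 3). perp F = I"
proof -
  obtain q where q: "n = 2 * q + 1" using n(2) by (rule oddE)
  have q2: "q \<ge> 2" using n(1) q by simp
  obtain k A where agg: "artinian_graded_gorenstein k I" and A: "skew_symmetric n A"
    "\<forall>i<n. \<forall>j<n. homogeneous 1 (A $$ (i, j))" "\<forall>i<n. homogeneous ((n - 1) div 2) (sub_pfaffian A i)"
    "I = pfaffian_ideal A"
    using I unfolding linear_pfaffian_gorenstein_ideals_def by blast
  obtain s0 where G: "gorenstein_ideal I k s0" using gorenstein_ideal_of_agg[OF agg] by blast
  interpret gorenstein_ideal I k s0 by (rule G)
  have dim: "dim_row A = n" using A(1) by (auto simp: skew_symmetric_def)
  have Ieq: "I = {\<Sum>i<n. r i * sub_pfaffian A i | r. True}"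
    unfolding A(4) pfaffian_ideal_def dim by (rule genideal_family)
  have pow: "\<exists>r. var3 a ^ Suc k = (\<Sum>i<n. r i * sub_pfaffian A i)" for a
    using var3_power_in[of a] unfolding Ieq by blast
  obtain \<iota> where \<iota>: "\<forall>i<n. \<iota> i \<noteq> 0"
    "\<forall>i<n. (\<Sum>l<n. A $$ (i, l) * (const3 (\<iota> l) * sub_pfaffian A l)) = 0"
    "\<forall>x. (\<forall>i<n. (\<Sum>l<n. A $$ (i, l) * x l) = 0) \<longrightarrow> (\<exists>r. \<forall>l<n. x l = r * (const3 (\<iota> l) * sub_pfaffian A l))"
    using skew_kernel_pfaffians[OF A(1) n(2) pow] by (elim exE conjE) (rule that)
  define P where "P l = const3 (\<iota> l) * sub_pfaffian A l" for l
  have P: "(\<Sum>l<n. A $$ (i, l) * P l) = 0" if "i < n" for i using \<iota>(2) that unfolding P_def by blast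
  have ker: "\<exists>r. \<forall>l<n. x l = r * P l" if "\<And>i. i < n \<Longrightarrow> (\<Sum>l<n. A $$ (i, l) * x l) = 0" for x
    using \<iota>(3) that unfolding P_def by blast
  have PI: "P i \<in> I" if "i < n" for i
  proof -
    have "sub_pfaffian A i \<in> I" unfolding A(4) pfaffian_ideal_def dim
      using genideal_mono[of "sub_pfaffian A ` {..<n}"] that by blast
    then show ?thesis unfolding P_def by (rule I_mult)
  qed
  have Phom: "homz (int q) (P i)" if "i < n" for i
    using A(3) that unfolding P_def homogeneous_iff_homz by (simp add: q)
  have gen: "\<exists>r. p = (\<Sum>i<n. r i * P i)" if p: "p \<in> I" for p
  proof -
    obtain r where r: "p = (\<Sum>i<n. r i * sub_pfaffian A i)" using p unfolding Ieq by blast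
    have "sub_pfaffian A i = const3 (1 / \<iota> i) * P i" if "i < n" for i
      using \<iota>(1) that unfolding P_def mult.assoc[symmetric] const3_mult[symmetric] by simp
    then have "p = (\<Sum>i<n. r i * const3 (1 / \<iota> i) * P i)"
      unfolding r by (intro sum.cong refl) (simp add: mult.assoc)
    then show ?thesis by (rule exI[of _ "\<lambda>i. r i * const3 (1 / \<iota> i)"])
  qed
  \<comment> \<open>The linear matrix gives a resolution with generators in degree q, syzygies in
    degree q + 1 and one last syzygy \<open>P\<close>, of degree (q + 1) + q; this must be k +
    3.\<close>
  have "(\<exists>j<n. P j \<noteq> 0) \<and> 2 * int q + 1 = int k + 3"
  proof (rule socle_degree[where f = P and Phi = "\<lambda>i j. A $$ (i, j)" and d = "\<lambda>_. int q" and e = "\<lambda>_. int q + 1"])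
    show "homz (int q + 1 - int q) (A $$ (i, j))" if "i < n" "j < n" for i j
      using A(2) that by (simp add: homogeneous_iff_homz)
    show "(\<Sum>i<n. P i * A $$ (i, j)) = 0" if j: "j < n" for j
    proof -
      have "(\<Sum>i<n. P i * A $$ (i, j)) = (\<Sum>i<n. - (A $$ (j, i) * P i))"
        by (intro sum.cong refl) (use skew_symmetricD[OF A(1) j] in \<open>simp add: mult.commute\<close>)
      also have "\<dots> = 0" using P[OF j] by (simp add: sum_negf)
      finally show ?thesis .
    qed
    show "\<exists>x. \<forall>i<n. z i = (\<Sum>j<n. A $$ (i, j) * x j)" if z: "(\<Sum>i<n. P i * z i) = 0" for z
    proof (rule skew_syzygies[OF A(1) n(2) _ _ P ker pow z])
      show "\<iota> i \<noteq> 0" if "i < n" for i using \<iota>(1) that by blast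
    qed (rule P_def)
    show "\<exists>r. \<forall>j<n. x j = r * P j" if "\<forall>i<n. (\<Sum>j<n. A $$ (i, j) * x j) = 0" for x
      by (rule ker) (use that in blast)
    show "homz (2 * int q + 1 - (int q + 1)) (P j)" if "j < n" for j using Phom[OF that] by simp
  qed (fact PI Phom gen P)+
  then have "k = 2 * (q - 1)" using q2 by linarith
  then have k: "k = n - 3" "even k" "int (k div 2) = int q - 1" using q q2 by auto
  obtain F where F: "F \<in> forms k" "perp F = I" using exists_dual_form by blast
  have hF: "homz (int k) F" using F(1) by (simp add: forms_def homogeneous_iff_homz)
  \<comment> \<open>The generators have degree \<open>q\<close>, one more than half the degree of F,
    so the ideal has no nonzero form of degree q - 1.\<close>
  have "nondegenerate k F" unfolding nondegenerate_iff[OF k(2) hF] k(3) F(2)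
  proof (intro allI impI)
    fix D assume D: "homz (int q - 1) D" "D \<in> I"
    obtain r where r: "D = (\<Sum>i<n. r i * P i)" using gen[OF D(2)] by blast
    have "D = hc (int q - 1) D" by (simp add: hc_self[OF D(1)])
    also have "\<dots> = (\<Sum>i<n. hc (int q - 1) (r i * P i))" unfolding r by (rule hc_sum)
    also have "\<dots> = (\<Sum>i<n. hc (int q - 1 - int q) (r i) * P i)"
      by (intro sum.cong refl hc_mult Phom) simp
    also have "\<dots> = 0"
    proof (rule sum.neutral, rule ballI)
      fix i
      have "hc (int q - 1 - int q) (r i) = 0" by (rule homz_neg[OF homz_hc]) simp
      then show "hc (int q - 1 - int q) (r i) * P i = 0" by (simp only: mult_zero_left)
    qed
    finally show "D = 0" .
  qed
  then have "F \<in> nondegenerate_forms (n - 3)" using F(1) k(1) by (simp add: nondegenerate_forms_def)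
  then show ?thesis using F(2) by blast
qed

section \<open>The correspondence\<close>

lemma perp_respects: "(perp :: 'k::field_char_0 poly3 \<Rightarrow> 'k poly3 set) respects proportional"
proof (rule congruentI)
  fix F G :: "'k poly3" assume "(F, G) \<in> proportional"
  then obtain c where "c \<noteq> 0" "G = const3 c * F" by (auto simp: proportional_def)
  then show "perp F = perp G" using perp_proportional by metis
qed

lemma perp_class_eq: "perp_class (proportional `` {F :: 'k::field_char_0 poly3}) = perp F"
  unfolding perp_class_def
proof (rule the_elem_image_unique)
  have "(F, F) \<in> proportional" by (auto simp: proportional_def intro: exI[of _ 1])
  then show "proportional `` {F} \<noteq> {}" by blast
  show "perp G = perp F" if "G \<in> proportional `` {F}" for G
    using congruentD[OF perp_respects, of F G] that by simp
qed

lemma proportional_class_eq: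
  fixes F G :: "'k::field poly3"
  assumes FG: "(F, G) \<in> proportional"
  shows "proportional `` {F} = proportional `` {G}"
proof -
  obtain c where c: "c \<noteq> 0" "G = const3 c * F" using FG by (auto simp: proportional_def)
  have F: "F = const3 (1 / c) * G"
    unfolding c(2) mult.assoc[symmetric] const3_mult[symmetric] using c(1) by simp
  have "(F, H) \<in> proportional \<longleftrightarrow> (G, H) \<in> proportional" for H
  proof
    assume "(F, H) \<in> proportional"
    then obtain e where e: "e \<noteq> 0" "H = const3 e * F" by (auto simp: proportional_def)
    have "H = const3 (e * (1 / c)) * G" unfolding e(2) const3_mult mult.assoc F[symmetric] ..
    then show "(G, H) \<in> proportional" using e(1) c(1) by (auto simp: proportional_def intro!: exI[of _ "e * (1 / c)"])
  next
    assume "(G, H) \<in> proportional"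
    then obtain e where e: "e \<noteq> 0" "H = const3 e * G" by (auto simp: proportional_def)
    have "H = const3 (e * c) * F" unfolding e(2) const3_mult mult.assoc c(2)[symmetric] ..
    then show "(F, H) \<in> proportional" using e(1) c(1) by (auto simp: proportional_def intro!: exI[of _ "e * c"])
  qed
  then show ?thesis by blast
qed

text \<open>Serves both correspondences: only the image of \<open>perp\<close> on the chosen set of
  forms differs, since equal annihilators already force proportionality among all forms of a
  degree.\<close>

lemma bij_betw_perp_class:
  fixes U :: "'k::field_char_0 poly3 set"
  assumes U: "U \<subseteq> forms k" and Y: "perp ` U = Y"
  shows "bij_betw perp_class (U // proportional) Y"
proof (rule bij_betw_imageI)
  show "inj_on perp_class (U // proportional)"
  proof (rule inj_onI)
    fix C D assume "C \<in> U // proportional" "D \<in> U // proportional" and eq: "perp_class C = perp_class D"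
    then obtain F G where FG: "F \<in> U" "G \<in> U" "C = proportional `` {F}" "D = proportional `` {G}"
      by (auto elim!: quotientE)
    have "perp F = perp G" using eq unfolding FG(3,4) perp_class_eq .
    then have "(F, G) \<in> proportional" using FG(1,2) U by (intro perp_eq_imp_proportional) auto
    then show "C = D" unfolding FG(3,4) by (rule proportional_class_eq)
  qed
  have "perp_class ` (U // proportional) = (\<lambda>F. perp_class (proportional `` {F})) ` U"
    by (auto simp: quotient_def)
  then show "perp_class ` (U // proportional) = Y" unfolding perp_class_eq Y .
qed

theorem proposition25:
  fixes n :: nat
  assumes "n \<ge> 5" and "odd n"
  shows "((perp :: 'k::{alg_closed_field, field_char_0} poly3 \<Rightarrow> 'k poly3 set) respects proportional) \<and>
    bij_betw perp_class
      (forms (n - 3) // (proportional :: ('k poly3 \<times> 'k poly3) set))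
      (pfaffian_gorenstein_ideals (n - 3)) \<and>
    bij_betw perp_class
      (nondegenerate_forms (n - 3) // (proportional :: ('k poly3 \<times> 'k poly3) set))
      (linear_pfaffian_gorenstein_ideals n)"
proof (intro conjI perp_respects)
  show "bij_betw perp_class (forms (n - 3) // (proportional :: ('k poly3 \<times> 'k poly3) set))
      (pfaffian_gorenstein_ideals (n - 3))"
    by (rule bij_betw_perp_class[OF subset_refl]) (simp only: perp_forms pfaffian_gorenstein_ideals_eq)
  have "perp ` (nondegenerate_forms (n - 3) :: 'k poly3 set) = linear_pfaffian_gorenstein_ideals n"
    using perp_nondegenerate_linear[OF assms] linear_imp_perp_nondegenerate[OF assms] by blast
  then show "bij_betw perp_class (nondegenerate_forms (n - 3) // (proportional :: ('k poly3 \<times> 'k poly3) set))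
      (linear_pfaffian_gorenstein_ideals n)"
    by (intro bij_betw_perp_class[of _ "n - 3"]) (auto simp: nondegenerate_forms_def)
qed

end
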